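(* Let $\Lambda\subset\mathbb R^2$ be compact with $\Lambda=-\Lambda$ and $0$ an interior point of $\Lambda$, and let $n\in\mathbb N\cup\{0\}$. (1) Let $p\ge1$ and $\alpha>0$. Then $\{\Phi_{n,N\Lambda};N\in\mathbb N\}$ is a Cauchy sequence in $L^p(\mu_0;H^{-\alpha}(\mathbb T^2))$, and hence it converges to a mapping $\Phi_n\in L^p(\mu_0;H^{-\alpha}(\mathbb T^2))$. Furthermore, the limit $\Phi_n$ is independent of the choice of $\Lambda$. (One writes $:z^n:\,=\Phi_n(z)$, $z\in E$, and calls it the Wick power of order $n$.) Moreover, for $p\ge2$, $n\in\mathbb N$ and $\varepsilon>0$, $$\|\Phi_n\|_{L^p(\mu_0;H^{-\alpha}(\mathbb T^2))}\le C(p-1)^{n/2}\sqrt{n!}\,\Big\{\alpha^{-2}\Big(\frac{1+\varepsilon}{4\pi\alpha}\Big)^{n-1}n!+C^n\Big(\frac{1+\varepsilon}{\varepsilon}\Big)^{n-1}\Big\}^{1/2},$$ where $C>0$ is independent of $\varepsilon>0$. (2) For each $g\in H=L^2(\mathbb T^2)$, the sequence $\{(\Phi_{n,N\Lambda}(\cdot),g)_H;N\in\mathbb N\}$ converges to a function $\Phi_n(\cdot)(g)$ in $L^p(\mu_0)$, $p\ge1$, as $N\to\infty$. Furthermore, the limit $\Phi_n(\cdot)(g)$ is independent of the choice of $\Lambda$ (it is also denoted $:z^n:(g)$). One has $\Phi_n(\cdot)(g)\in\mathcal C_n$, and, for $p\ge2$, $n\in\mathbb N$ and $\varepsilon>0$,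 $$\|\Phi_n(\cdot)(g)\|_{L^p(\mu_0)}\le C(p-1)^{n/2}\sqrt{n!}\,\Big\{\Big(\frac{1+\varepsilon}{4\pi}\Big)^{n-1}n!+C^n\Big(\frac{1+\varepsilon}{\varepsilon}\Big)^{n-1}\Big\}^{1/2}\|g\|_H,$$ where $C>0$ is independent of $\varepsilon>0$. Furthermore, for $\alpha>0$ and $g\in H^\alpha(\mathbb T^2)$, $\Phi_n(z)(g)={}_{H^{-\alpha}}\langle :z^n:,g\rangle_{H^\alpha}$ for $\mu_0$-a.e. $z\in E$.
   Context: $\mathbb T^2=(\mathbb R/2\pi\mathbb Z)^2$ with Lebesgue measure; $\{e_k\}_{k\in\mathbb Z^2}$ is the real orthonormal basis of $H=L^2(\mathbb T^2)$ (real-valued): $e_{(0,0)}=\frac1{2\pi}$, $e_k(x)=\frac1{\sqrt2\pi}\cos(k\cdot x)$ if $k\in\mathbb Z^2_+:=\{k_1>0\}\cup\{k_1=0,k_2>0\}$, $e_k(x)=\frac1{\sqrt2\pi}\sin(k\cdot x)$ if $k\in-\mathbb Z^2_+$. $H^s(\mathbb T^2)$ is the real Sobolev space with $\|u\|_{H^s}^2=\sum_k(1+|k|^2)^s\langle u,e_k\rangle^2$; ${}_{H^{-\alpha}}\langle\cdot,\cdot\rangle_{H^\alpha}$ is the dual pairing extending the $L^2$ inner product. Fix $\delta>0$ and $E=H^{-\delta}(\mathbb T^2)$. $\mu_0$ is the centered Gaussian probability measure on $E$ with $\int_E\langle z,l_1\rangle\langle z,l_2\rangle\mu_0(dz)=((1-\Delta)^{-1}l_1,l_2)_H$,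 $l_1,l_2\in E^*=H^\delta(\mathbb T^2)$. For a set $\Lambda$ as in the claim (and its dilates $N\Lambda=\{Nx;x\in\Lambda\}$) put $(\Pi_\Lambda z)(x)=\sum_{k\in\Lambda\cap\mathbb Z^2}\langle z,e_k\rangle e_k(x)$, $\rho_\Lambda=\mathbb E^{\mu_0}[(\Pi_\Lambda z)(x)^2]^{1/2}=\frac1{2\pi}\{\sum_{k\in\Lambda\cap\mathbb Z^2}(1+|k|^2)^{-1}\}^{1/2}$ (independent of $x$), and with the normalized Hermite polynomials $\mathbb H_n(\xi)=\frac{(-1)^n}{\sqrt{n!}}e^{\xi^2/2}(\frac d{d\xi})^ne^{-\xi^2/2}$ define $$\Phi_{n,\Lambda}(z)_x=\sqrt{n!}\,\rho_\Lambda^n\,\mathbb H_n\big(\rho_\Lambda^{-1}(\Pi_\Lambda z)(x)\big),\qquad z\in E,\ x\in\mathbb T^2,$$ and $(\Phi_{n,\Lambda}(z),g)_H=\int_{\mathbb T^2}\Phi_{n,\Lambda}(z)_x\,g(x)\,dx$ for $g\in H$. The map $f\mapsto W_f$, $W_f(z)=\langle z,f\rangle$ for $f\in E^*$, extends to an isometry $H^{-1}(\mathbb T^2)\to L^2(\mu_0)$; $\mathcal C_n$ (Wiener chaos of order $n$) is the closed linear span in $L^2(\mu_0)$ of $\{\mathbb H_n(W_f);\|f\|_{H^{-1}}=1\}$ for $n\ge1$, and $\mathcal C_0$ is the constants. *)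

theory Defs
  imports "HOL-Probability.Probability"
begin

section \<open>The torus, the trigonometric basis and Sobolev spaces\<close>

text \<open>Functions on the torus are functions on the plane, looked at only on the fundamental domain.\<close>

definition torus :: "(real \<times> real) measure" where
  "torus = restrict_space lborel ({0..<2 * pi} \<times> {0..<2 * pi})"

definition lat :: "int \<times> int \<Rightarrow> real \<times> real" where
  "lat k = (real_of_int (fst k), real_of_int (snd k))"

definition Z2_plus :: "(int \<times> int) set" where
  "Z2_plus = {k. fst k > 0} \<union> {k. fst k = 0 \<and> snd k > 0}"

definition e_basis :: "int \<times> int \<Rightarrow> real \<times> real \<Rightarrow> real" where
  "e_basis k x =
     (if k = (0, 0) then 1 / (2 * pi)
      else if k \<in> Z2_plus then 1 / (sqrt 2 * pi) * cos (lat k \<bullet> x)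
      else 1 / (sqrt 2 * pi) * sin (lat k \<bullet> x))"

text \<open>
  \<open>Lp_space M p\<close> consists of representatives; equality in it is equality almost everywhere.
  Finite exponents \<open>p \<ge> 1\<close> only.
\<close>

definition Lp_space :: "'a measure \<Rightarrow> real \<Rightarrow> ('a \<Rightarrow> real) set" where
  "Lp_space M p = {f \<in> borel_measurable M. integrable M (\<lambda>x. \<bar>f x\<bar> powr p)}"

definition Lp_norm :: "'a measure \<Rightarrow> real \<Rightarrow> ('a \<Rightarrow> real) \<Rightarrow> real" where
  "Lp_norm M p f = (LINT x|M. \<bar>f x\<bar> powr p) powr (1 / p)"

abbreviation H_space :: "(real \<times> real \<Rightarrow> real) set" where
  "H_space \<equiv> Lp_space torus 2"

abbreviation H_norm :: "(real \<times> real \<Rightarrow> real) \<Rightarrow> real" where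
  "H_norm \<equiv> Lp_norm torus 2"

definition H_inner :: "(real \<times> real \<Rightarrow> real) \<Rightarrow> (real \<times> real \<Rightarrow> real) \<Rightarrow> real" where
  "H_inner f g = (LINT x|torus. f x * g x)"

text \<open>
  A distribution \<open>u\<close> on the torus is represented by the family \<open>k \<mapsto> \<langle>u, e\<^sub>k\<rangle>\<close> of its coefficients.
  An element \<open>f\<close> of \<open>H\<close> (a function) becomes a distribution through \<open>fourier_coeffs f\<close>.
\<close>

type_synonym dist_coeffs = "int \<times> int \<Rightarrow> real"

definition fourier_coeffs :: "(real \<times> real \<Rightarrow> real) \<Rightarrow> dist_coeffs" where
  "fourier_coeffs f = (\<lambda>k. H_inner f (e_basis k))"

definition sobolev :: "real \<Rightarrow> dist_coeffs set" where
  "sobolev s = {u. (\<lambda>k. (1 + (norm (lat k))\<^sup>2) powr s * (u k)\<^sup>2) summable_on UNIV}"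

definition sobolev_norm :: "real \<Rightarrow> dist_coeffs \<Rightarrow> real" where
  "sobolev_norm s u = sqrt (\<Sum>\<^sub>\<infinity>k. (1 + (norm (lat k))\<^sup>2) powr s * (u k)\<^sup>2)"

definition sobolev_dist :: "real \<Rightarrow> dist_coeffs \<Rightarrow> dist_coeffs \<Rightarrow> real" where
  "sobolev_dist s u v = sobolev_norm s (\<lambda>k. u k - v k)"

definition dual_pairing :: "dist_coeffs \<Rightarrow> dist_coeffs \<Rightarrow> real" where
  "dual_pairing u v = (\<Sum>\<^sub>\<infinity>k. u k * v k)"

text \<open>\<open>mtopology\<close> below is meaningful only because the distance is a metric.\<close>

lemma sobolev_add:
  assumes "u \<in> sobolev s" "v \<in> sobolev s"
  shows "(\<lambda>k. u k + v k) \<in> sobolev s"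
    and "sobolev_norm s (\<lambda>k. u k + v k) \<le> sobolev_norm s u + sobolev_norm s v"
proof -
  define w where "w k = sqrt ((1 + (norm (lat k))\<^sup>2) powr s)" for k
  have w: "(1 + (norm (lat k))\<^sup>2) powr s * (f k)\<^sup>2 = (w k * f k)\<^sup>2" for f :: dist_coeffs and k
    by (simp add: w_def power_mult_distrib)
  have sm: "(\<lambda>k. (w k * f k)\<^sup>2) summable_on UNIV" if "f \<in> sobolev s" for f
    using that by (simp add: sobolev_def w)
  have nm: "sobolev_norm s f = sqrt (\<Sum>\<^sub>\<infinity>k. (w k * f k)\<^sup>2)" for f
    by (simp add: sobolev_norm_def w)
  have le: "L2_set (\<lambda>k. w k * f k) F \<le> sobolev_norm s f" if "f \<in> sobolev s" "finite F" for f F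
    unfolding L2_set_def nm
    by (intro real_sqrt_le_mono finite_sum_le_infsum sm that) auto
  define B where "B = sobolev_norm s u + sobolev_norm s v"
  have B: "B \<ge> 0"
    unfolding B_def nm by (intro add_nonneg_nonneg real_sqrt_ge_zero infsum_nonneg) auto
  have fin: "(\<Sum>k\<in>F. (w k * (u k + v k))\<^sup>2) \<le> B\<^sup>2" if F: "finite F" for F
  proof -
    have "L2_set (\<lambda>k. w k * u k + w k * v k) F \<le> B"
      using L2_set_triangle_ineq[of "\<lambda>k. w k * u k" "\<lambda>k. w k * v k" F]
        le[OF assms(1) F] le[OF assms(2) F] unfolding B_def by linarith
    then have "sqrt (\<Sum>k\<in>F. (w k * (u k + v k))\<^sup>2) \<le> B"
      by (simp add: L2_set_def distrib_left)
    then show ?thesis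
      using sqrt_le_D by blast
  qed
  have sum: "(\<lambda>k. (w k * (u k + v k))\<^sup>2) summable_on UNIV"
    by (rule nonneg_bdd_above_summable_on) (auto intro!: bdd_aboveI[where M = "B\<^sup>2"] fin)
  then show "(\<lambda>k. u k + v k) \<in> sobolev s"
    by (simp add: sobolev_def w)
  have "(\<Sum>\<^sub>\<infinity>k. (w k * (u k + v k))\<^sup>2) \<le> B\<^sup>2"
    by (rule infsum_le_finite_sums[OF sum]) (rule fin)
  then have "sqrt (\<Sum>\<^sub>\<infinity>k. (w k * (u k + v k))\<^sup>2) \<le> B"
    using B real_le_lsqrt by blast
  then show "sobolev_norm s (\<lambda>k. u k + v k) \<le> sobolev_norm s u + sobolev_norm s v"
    by (simp add: nm B_def)
qed

lemma sobolev_diff: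
  assumes "u \<in> sobolev s" "v \<in> sobolev s"
  shows "(\<lambda>k. u k - v k) \<in> sobolev s"
  using sobolev_add(1)[of u s "\<lambda>k. - v k"] assms by (simp add: sobolev_def)

lemma Metric_space_sobolev: "Metric_space (sobolev s) (sobolev_dist s)"
proof
  fix u v w :: dist_coeffs
  show "0 \<le> sobolev_dist s u v"
    by (simp add: sobolev_dist_def sobolev_norm_def infsum_nonneg)
  show "sobolev_dist s u v = sobolev_dist s v u"
    by (simp add: sobolev_dist_def sobolev_norm_def power2_commute)
  assume u: "u \<in> sobolev s" and v: "v \<in> sobolev s"
  show "sobolev_dist s u v = 0 \<longleftrightarrow> u = v"
  proof
    assume 0: "sobolev_dist s u v = 0"
    have "(1 + (norm (lat k))\<^sup>2) powr s * (u k - v k)\<^sup>2 = 0" for k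
    proof (rule nonneg_infsum_le_0D[where A = UNIV and
          f = "\<lambda>k. (1 + (norm (lat k))\<^sup>2) powr s * (u k - v k)\<^sup>2"])
      show "(\<Sum>\<^sub>\<infinity>k. (1 + (norm (lat k))\<^sup>2) powr s * (u k - v k)\<^sup>2) \<le> 0"
        using 0 by (simp add: sobolev_dist_def sobolev_norm_def)
      show "(\<lambda>k. (1 + (norm (lat k))\<^sup>2) powr s * (u k - v k)\<^sup>2) summable_on UNIV"
        using sobolev_diff[OF u v] by (simp add: sobolev_def)
    qed auto
    moreover have "1 + (norm (lat k))\<^sup>2 \<noteq> 0" for k
      by (smt (verit) zero_le_power2)
    ultimately show "u = v"
      by (auto simp: fun_eq_iff)
  qed (simp add: sobolev_dist_def sobolev_norm_def)
  assume w: "w \<in> sobolev s"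
  show "sobolev_dist s u w \<le> sobolev_dist s u v + sobolev_dist s v w"
    using sobolev_add(2)[OF sobolev_diff[OF u v] sobolev_diff[OF v w]]
    by (simp add: sobolev_dist_def)
qed

definition sobolev_borel :: "real \<Rightarrow> dist_coeffs measure" where
  "sobolev_borel s =
     sigma (sobolev s) {U. openin (Metric_space.mtopology (sobolev s) (sobolev_dist s)) U}"

text \<open>
  The Bochner space \<open>L\<^sup>p(M; H\<^sup>s)\<close>. As \<open>H\<^sup>s\<close> is separable, strong measurability is
  Borel measurability.
\<close>

definition LpS_space :: "'a measure \<Rightarrow> real \<Rightarrow> real \<Rightarrow> ('a \<Rightarrow> dist_coeffs) set" where
  "LpS_space M p s =
     {F \<in> measurable M (sobolev_borel s). integrable M (\<lambda>z. sobolev_norm s (F z) powr p)}"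

definition LpS_norm :: "'a measure \<Rightarrow> real \<Rightarrow> real \<Rightarrow> ('a \<Rightarrow> dist_coeffs) \<Rightarrow> real" where
  "LpS_norm M p s F = Lp_norm M p (\<lambda>z. sobolev_norm s (F z))"

definition LpS_dist ::
  "'a measure \<Rightarrow> real \<Rightarrow> real \<Rightarrow> ('a \<Rightarrow> dist_coeffs) \<Rightarrow> ('a \<Rightarrow> dist_coeffs) \<Rightarrow> real" where
  "LpS_dist M p s F G = LpS_norm M p s (\<lambda>z k. F z k - G z k)"


section \<open>The Gaussian measure\<close>

definition centered_gaussian_law :: "real measure \<Rightarrow> bool" where
  "centered_gaussian_law \<nu> \<longleftrightarrow>
     \<nu> = return borel 0 \<or> (\<exists>\<sigma>>0. \<nu> = density lborel (\<lambda>x. ennreal (normal_density 0 \<sigma> x)))"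

text \<open>The Fourier multiplier \<open>(1 - \<Delta>)\<^sup>-\<^sup>1\<close>.\<close>

definition inv_one_minus_laplacian :: "dist_coeffs \<Rightarrow> dist_coeffs" where
  "inv_one_minus_laplacian u = (\<lambda>k. u k / (1 + (norm (lat k))\<^sup>2))"

text \<open>
  \<open>free_field \<delta> M\<close>: \<open>M\<close> is the centered Gaussian probability measure on the Borel sets of
  \<open>E = H\<^sup>-\<^sup>\<delta>\<close> with covariance \<open>(1 - \<Delta>)\<^sup>-\<^sup>1\<close>. The dual of \<open>E\<close> is \<open>H\<^sup>\<delta>\<close>, contained in \<open>H\<close>, and
  on coefficients the inner product of \<open>H\<close> is the dual pairing.
\<close>

definition free_field :: "real \<Rightarrow> dist_coeffs measure \<Rightarrow> bool" where
  "free_field \<delta> M \<longleftrightarrow>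
     prob_space M \<and> space M = sobolev (- \<delta>) \<and> sets M = sets (sobolev_borel (- \<delta>)) \<and>
     (\<forall>l \<in> sobolev \<delta>. centered_gaussian_law (distr M borel (\<lambda>z. dual_pairing z l))) \<and>
     (\<forall>l\<^sub>1 \<in> sobolev \<delta>. \<forall>l\<^sub>2 \<in> sobolev \<delta>.
        (LINT z|M. dual_pairing z l\<^sub>1 * dual_pairing z l\<^sub>2)
          = dual_pairing (inv_one_minus_laplacian l\<^sub>1) l\<^sub>2)"


section \<open>Hermite polynomials and approximate Wick powers\<close>

definition hermite :: "nat \<Rightarrow> real \<Rightarrow> real" where
  "hermite n \<xi> =
     (- 1) ^ n / sqrt (fact n) * exp (\<xi>\<^sup>2 / 2) * (deriv ^^ n) (\<lambda>t. exp (- (t\<^sup>2) / 2)) \<xi>"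

definition proj :: "(real \<times> real) set \<Rightarrow> dist_coeffs \<Rightarrow> real \<times> real \<Rightarrow> real" where
  "proj \<Lambda> z x = (\<Sum>k | lat k \<in> \<Lambda>. z k * e_basis k x)"

definition rho :: "(real \<times> real) set \<Rightarrow> real" where
  "rho \<Lambda> = 1 / (2 * pi) * sqrt (\<Sum>k | lat k \<in> \<Lambda>. 1 / (1 + (norm (lat k))\<^sup>2))"

definition Phi_approx :: "nat \<Rightarrow> (real \<times> real) set \<Rightarrow> dist_coeffs \<Rightarrow> real \<times> real \<Rightarrow> real" where
  "Phi_approx n \<Lambda> z x = sqrt (fact n) * rho \<Lambda> ^ n * hermite n (proj \<Lambda> z x / rho \<Lambda>)"

definition admissible :: "(real \<times> real) set \<Rightarrow> bool" where
  "admissible \<Lambda> \<longleftrightarrow> compact \<Lambda> \<and> \<Lambda> = uminus ` \<Lambda> \<and> 0 \<in> interior \<Lambda>"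

definition dilate :: "nat \<Rightarrow> (real \<times> real) set \<Rightarrow> (real \<times> real) set" where
  "dilate N \<Lambda> = (\<lambda>x. real N *\<^sub>R x) ` \<Lambda>"


section \<open>Wiener chaos\<close>

text \<open>
  \<open>is_W \<delta> M f X\<close>: the random variable \<open>X\<close> is a version of \<open>W\<^sub>f\<close>, for \<open>f\<close> in \<open>H\<^sup>-\<^sup>1\<close>, i.e. of the
  value at \<open>f\<close> of the continuous extension of \<open>l \<mapsto> \<langle>\<cdot>, l\<rangle>\<close> from the dense subspace \<open>H\<^sup>\<delta>\<close>.
\<close>

definition is_W :: "real \<Rightarrow> dist_coeffs measure \<Rightarrow> dist_coeffs \<Rightarrow> (dist_coeffs \<Rightarrow> real) \<Rightarrow> bool" where
  "is_W \<delta> M f X \<longleftrightarrow>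
     f \<in> sobolev (- 1) \<and> X \<in> Lp_space M 2 \<and>
     (\<exists>l :: nat \<Rightarrow> dist_coeffs. (\<forall>j. l j \<in> sobolev \<delta>) \<and>
        (\<lambda>j. sobolev_dist (- 1) (l j) f) \<longlonglongrightarrow> 0 \<and>
        (\<lambda>j. Lp_norm M 2 (\<lambda>z. dual_pairing z (l j) - X z)) \<longlonglongrightarrow> 0)"

definition chaos_span :: "real \<Rightarrow> dist_coeffs measure \<Rightarrow> nat \<Rightarrow> (dist_coeffs \<Rightarrow> real) set" where
  "chaos_span \<delta> M n =
     {(\<lambda>z. \<Sum>i<m. c i * hermite n (X i z)) | (m :: nat) (c :: nat \<Rightarrow> real) X.
        \<forall>i<m. \<exists>f. sobolev_norm (- 1) f = 1 \<and> is_W \<delta> M f (X i)}"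

definition chaos :: "real \<Rightarrow> dist_coeffs measure \<Rightarrow> nat \<Rightarrow> (dist_coeffs \<Rightarrow> real) set" where
  "chaos \<delta> M n =
     (if n = 0 then {F \<in> borel_measurable M. \<exists>c. AE z in M. F z = c}
      else {F \<in> Lp_space M 2. \<forall>\<eta>>0. \<exists>G \<in> chaos_span \<delta> M n. Lp_norm M 2 (\<lambda>z. F z - G z) < \<eta>})"


section \<open>The right-hand sides of the estimates\<close>

definition wick_bound :: "real \<Rightarrow> nat \<Rightarrow> real \<Rightarrow> real \<Rightarrow> real \<Rightarrow> real" where
  "wick_bound C n p \<alpha> \<epsilon> =
     C * (p - 1) powr (real n / 2) * sqrt (fact n) *
     sqrt (1 / \<alpha>\<^sup>2 * ((1 + \<epsilon>) / (4 * pi * \<alpha>)) ^ (n - 1) * fact n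
           + C ^ n * ((1 + \<epsilon>) / \<epsilon>) ^ (n - 1))"

definition wick_pairing_bound :: "real \<Rightarrow> nat \<Rightarrow> real \<Rightarrow> real \<Rightarrow> real" where
  "wick_pairing_bound C n p \<epsilon> =
     C * (p - 1) powr (real n / 2) * sqrt (fact n) *
     sqrt (((1 + \<epsilon>) / (4 * pi)) ^ (n - 1) * fact n
           + C ^ n * ((1 + \<epsilon>) / \<epsilon>) ^ (n - 1))"

end

theory Submission
  imports Defs "HOL-Computational_Algebra.Formal_Power_Series"
begin

text \<open>
  Write \<open>a k = 1 / (1 + |k|\<^sup>2)\<close>. In terms of the independent standard normal variables
  \<open>\<xi>\<^sub>k = \<langle>z, e\<^sub>k\<rangle> / sqrt (a k)\<close>, the variable \<open>(\<Phi>\<^sub>n\<^sub>,\<^sub>\<Lambda>, g)\<close> is a homogeneous Hermite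
  polynomial of degree \<open>n\<close>. Since \<open>G\<^sub>\<Lambda>(x - y)\<^sup>n\<close> expands into exponentials, the sum of the squares of its
  coefficients is, up to the factor \<open>n! (4 \<pi>\<^sup>2)\<^sup>1\<^sup>-\<^sup>n\<close>, the sum of
  \<open>a k\<^sub>1 \<cdots> a k\<^sub>n * \<langle>g, e\<^sub>\<sigma>\<rangle>\<^sup>2\<close> over \<open>k\<^sub>1, \<dots>, k\<^sub>n \<in> \<Lambda>\<close>, where \<open>\<sigma> = k\<^sub>1 + \<dots> + k\<^sub>n\<close>.
  This quantity increases with \<open>\<Lambda>\<close>, so boundedness yields the Cauchy property, and the limit does not depend
  on \<open>\<Lambda>\<close>.

  The passage from \<open>L\<^sup>2\<close> to \<open>L\<^sup>p\<close> is Nelson's hypercontractivity with its sharp constant: the two-point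
  inequality tensorises by Minkowski's inequality, the central limit theorem carries it from coins to one Gaussian
  variable, and a second tensorisation to finitely many.

  The sharp constants come from summing over the largest \<open>k\<^sub>i\<close> first: if \<open>R\<close> is the largest of
  \<open>1 + |k\<^sub>j|\<^sup>2\<close>, \<open>j \<noteq> i\<close>, this sum is at most a constant times \<open>R\<^sup>-\<^sup>\<alpha> / \<alpha>\<close>, and the layer-cake formula for
  \<open>R\<^sup>-\<^sup>\<alpha>\<close> reduces the remaining sum to the integral of \<open>\<alpha> exp (- \<alpha> s) (\<pi> s + c)\<^sup>n\<^sup>-\<^sup>1\<close>, because
  the sum of \<open>a k\<close> over \<open>1 + |k|\<^sup>2 \<le> exp s\<close> is at most \<open>\<pi> s + c\<close>.
\<close>

section \<open>Quantitative Lp bounds\<close>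

text \<open>Boundedness gives the Cauchy property because the coefficient vectors of two symmetric
  sets \<open>F\<close> and \<open>F'\<close> have inner product q(F Int F'), where q(F) is the
  squared norm for \<open>F\<close>. The squared distance q(F) + q(F') - 2 q(F Int F') is then at
  most twice sup q - q(B) for any box B inside both sets. Symmetry enters through the real basis:
  e_k(x) e_k(y) is not a function of x - y, but its sum over k and -k is.

  The assumptions on the field describe the law of one linear functional at a time. The joint law of
  the coordinates has to be recovered from characteristic functions before any tensorised inequality
  applies.

  The 4 pi of the bounds is the factor 4 pi^2 per kernel divided by the slope pi of the logarithmic
  lattice sum. The additive constant c beside pi s does not spoil it: translating the integral
  absorbs c into exp(\<alpha> c / pi).

  The lattice estimate degenerates as \<alpha> tends to 1. Exponents above 1/2 are therefore
  compared with 1/2, and the price is a constant that depends on n.\<close>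

definition Lp_bounded :: "'a measure \<Rightarrow> real \<Rightarrow> ('a \<Rightarrow> real) \<Rightarrow> real \<Rightarrow> bool" where
  "Lp_bounded M p X B \<longleftrightarrow> X \<in> borel_measurable M \<and> 0 \<le> B \<and>
     (\<integral>\<^sup>+z. ennreal (\<bar>X z\<bar> powr p) \<partial>M) \<le> ennreal (B powr p)"

lemma Lp_bounded_measurable: "Lp_bounded M p X B \<Longrightarrow> X \<in> borel_measurable M"
  by (simp add: Lp_bounded_def)

text \<open>The way back from upper bounds to \<open>Lp_space\<close> and \<open>Lp_norm\<close>. A
  bound on the nonnegative integral carries integrability with it, so estimates made before this
  exit have no integrability side conditions.\<close>

lemma Lp_bounded_imp:
  assumes "Lp_bounded M p X B" "p > 0"
  shows "X \<in> Lp_space M p" and "Lp_norm M p X \<le> B"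
proof -
  have X[measurable]: "X \<in> borel_measurable M" and B: "0 \<le> B"
    and le: "(\<integral>\<^sup>+z. ennreal (\<bar>X z\<bar> powr p) \<partial>M) \<le> ennreal (B powr p)"
    using assms by (auto simp: Lp_bounded_def)
  have int: "integrable M (\<lambda>z. \<bar>X z\<bar> powr p)"
    proof (rule integrableI_bounded)
    show "(\<integral>\<^sup>+z. ennreal (norm (\<bar>X z\<bar> powr p)) \<partial>M) < \<infinity>"
      using le by (simp add: order.strict_trans1 ennreal_less_top)
  qed simp
  then show "X \<in> Lp_space M p" by (simp add: Lp_space_def)
  have "(LINT z|M. \<bar>X z\<bar> powr p) \<le> B powr p"
    using le int by (subst (asm) nn_integral_eq_integral) auto
  then have "Lp_norm M p X \<le> (B powr p) powr (1 / p)"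
    unfolding Lp_norm_def using assms by (intro powr_mono2) auto
  then show "Lp_norm M p X \<le> B" using assms B by (simp add: powr_powr)
qed

lemma Lp_bounded_cong_AE:
  assumes "Lp_bounded M p X B" "AE z in M. X z = Y z" "Y \<in> borel_measurable M"
  shows "Lp_bounded M p Y B"
proof -
  have "(\<integral>\<^sup>+z. ennreal (\<bar>Y z\<bar> powr p) \<partial>M) = (\<integral>\<^sup>+z. ennreal (\<bar>X z\<bar> powr p) \<partial>M)"
    by (rule nn_integral_cong_AE) (use assms(2) in auto)
  then show ?thesis using assms by (simp add: Lp_bounded_def)
qed

lemma Lp_bounded_mono:
  assumes "Lp_bounded M p X B" "B \<le> B'" "p > 0"
  shows "Lp_bounded M p X B'"
proof -
  have "ennreal (B powr p) \<le> ennreal (B' powr p)"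
    using assms by (intro ennreal_leI powr_mono2) (auto simp: Lp_bounded_def)
  moreover have "0 \<le> B'" using assms by (simp add: Lp_bounded_def)
  ultimately show ?thesis using assms(1) unfolding Lp_bounded_def by (blast intro: order_trans)
qed

text \<open>The bounds may vary with \<open>j\<close>. So one lemma serves approximations with
  converging bounds and, for a constant sequence \<open>X\<close>, the passage from bounds larger
  than \<open>b\<close> to \<open>b\<close> itself.\<close>

lemma Lp_bounded_Fatou:
  assumes "\<And>j. Lp_bounded M p (X j) (B j)" "B \<longlonglongrightarrow> b" "p > 0"
    and "AE z in M. (\<lambda>j. X j z) \<longlonglongrightarrow> Y z" and [measurable]: "Y \<in> borel_measurable M"
  shows "Lp_bounded M p Y b"
proof -
  have [measurable]: "X j \<in> borel_measurable M" for j
    using assms(1) by (simp add: Lp_bounded_def)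
  have B0: "B j \<ge> 0" for j using assms(1) by (simp add: Lp_bounded_def)
  then have b: "0 \<le> b" using assms(2) by (meson LIMSEQ_le_const)
  have "(\<integral>\<^sup>+z. ennreal (\<bar>Y z\<bar> powr p) \<partial>M)
      = (\<integral>\<^sup>+z. liminf (\<lambda>j. ennreal (\<bar>X j z\<bar> powr p)) \<partial>M)"
  proof (rule nn_integral_cong_AE, use assms(4) in eventually_elim)
    fix z assume "(\<lambda>j. X j z) \<longlonglongrightarrow> Y z"
    then have "(\<lambda>j. ennreal (\<bar>X j z\<bar> powr p)) \<longlonglongrightarrow> ennreal (\<bar>Y z\<bar> powr p)"
      using assms(3) by (intro tendsto_ennrealI tendsto_powr2 tendsto_rabs tendsto_const) auto
    then show "ennreal (\<bar>Y z\<bar> powr p) = liminf (\<lambda>j. ennreal (\<bar>X j z\<bar> powr p))"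
      by (intro lim_imp_Liminf[symmetric]) simp_all
  qed
  also have "\<dots> \<le> liminf (\<lambda>j. \<integral>\<^sup>+z. ennreal (\<bar>X j z\<bar> powr p) \<partial>M)"
    by (rule nn_integral_liminf) simp
  also have "\<dots> \<le> liminf (\<lambda>j. ennreal (B j powr p))"
    by (rule Liminf_mono) (use assms(1) in \<open>auto simp: Lp_bounded_def\<close>)
  also have "(\<lambda>j. ennreal (B j powr p)) \<longlonglongrightarrow> ennreal (b powr p)"
    using assms(3) by (intro tendsto_ennrealI tendsto_powr2 assms(2) tendsto_const) (auto simp: B0)
  then have "liminf (\<lambda>j. ennreal (B j powr p)) = ennreal (b powr p)"
    by (intro lim_imp_Liminf) simp_all
  finally show ?thesis using b by (simp add: Lp_bounded_def)
qed

text \<open>The concave power lies below its tangent at 1; the proof is the weighted inequality of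
  the means for \<open>u\<close> and 1.\<close>

lemma powr_le_Bernoulli:
  fixes u q :: real
  assumes "0 \<le> u" "0 < q" "q \<le> 1"
  shows "u powr q \<le> 1 + q * (u - 1)"
proof (cases "u = 0")
  case False
  have "u powr q * 1 powr (1 - q) \<le> q * u + (1 - q) * 1"
    by (rule Youngs_inequality_0) (use assms False in auto)
  then show ?thesis by (simp add: algebra_simps)
qed (use assms in auto)

lemma powr_Jensen:
  fixes w y :: "'i \<Rightarrow> real"
  assumes "finite J" "q \<ge> 1" "\<And>j. j \<in> J \<Longrightarrow> 0 \<le> w j" "\<And>j. j \<in> J \<Longrightarrow> 0 \<le> y j" "(\<Sum>j\<in>J. w j) = 1"
  shows "(\<Sum>j\<in>J. w j * y j) powr q \<le> (\<Sum>j\<in>J. w j * y j powr q)"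
proof -
  define m where "m = (\<Sum>j\<in>J. w j * y j)"
  have m0: "m \<ge> 0" unfolding m_def using assms by (intro sum_nonneg) auto
  show ?thesis
  proof (cases "m = 0")
    case True
    then show ?thesis using assms by (auto simp: m_def[symmetric] intro!: sum_nonneg)
  next
    case False
    then have m: "m > 0" using m0 by auto
    \<comment> \<open>The tangent of the convex power at the mean \<open>m\<close>, read off from
      the concave one: Bernoulli with exponent 1 / q, applied to (u / m)^q.\<close>
    have tangent: "m powr q + q * m powr q / m * (u - m) \<le> u powr q" if "u \<ge> 0" for u
    proof -
      have "((u / m) powr q) powr (1 / q) \<le> 1 + 1 / q * ((u / m) powr q - 1)"
        using assms(2) by (intro powr_le_Bernoulli) auto
      then have "q * (u / m) \<le> q + ((u / m) powr q - 1)"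
        using assms(2) that m by (simp add: powr_powr field_simps)
      then have "m powr q * (1 + q * (u / m - 1)) \<le> m powr q * (u / m) powr q"
        by (intro mult_left_mono) (auto simp: algebra_simps)
      also have "\<dots> = u powr q" using m that by (simp add: powr_divide)
      finally show ?thesis using m by (simp add: field_simps)
    qed
    have "m powr q = (\<Sum>j\<in>J. w j * (m powr q + q * m powr q / m * (y j - m)))"
    proof -
      have "(\<Sum>j\<in>J. w j * (m powr q + q * m powr q / m * (y j - m)))
          = (\<Sum>j\<in>J. w j * m powr q + q * m powr q / m * (w j * y j) - q * m powr q / m * (w j * m))"
        by (intro sum.cong refl) (use m in \<open>simp add: field_simps\<close>)
      also have "\<dots> = (\<Sum>j\<in>J. w j) * m powr q + q * m powr q / m * (\<Sum>j\<in>J. w j * y j) - q * m powr q / m * ((\<Sum>j\<in>J. w j) * m)"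
        by (simp only: sum_distrib_left sum_distrib_right sum.distrib sum_subtractf)
      finally show ?thesis using assms(5) by (simp add: m_def[symmetric])
    qed
    also have "\<dots> \<le> (\<Sum>j\<in>J. w j * y j powr q)"
      using assms tangent by (intro sum_mono mult_left_mono) auto
    finally show ?thesis by (simp add: m_def)
  qed
qed

text \<open>A pointwise argument: |X|^p lies below an affine function of X^2 whose expectation is at
  most C^p once that of X^2 is at most C^2.\<close>

lemma Lp_bounded_le2:
  assumes "prob_space M" "Lp_bounded M 2 X B" "0 < p" "p \<le> 2"
  shows "Lp_bounded M p X B"
proof -
  interpret prob_space M by fact
  have X[measurable]: "X \<in> borel_measurable M" and B: "0 \<le> B"
    and le: "(\<integral>\<^sup>+z. ennreal ((X z)\<^sup>2) \<partial>M) \<le> ennreal (B\<^sup>2)"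
    using assms by (auto simp: Lp_bounded_def)
  \<comment> \<open>Every C > B is positive, so dividing by C is legitimate even for B = 0; Fatou
    brings C down to B.\<close>
  have pos: "Lp_bounded M p X C" if "C > B" for C
  proof -
    have C: "C > 0" using that B by auto
    have le': "(\<integral>\<^sup>+z. ennreal ((X z)\<^sup>2) \<partial>M) \<le> ennreal (C\<^sup>2)"
      using le B that by (meson ennreal_leI less_imp_le order_trans power_mono)
    have "\<bar>X z\<bar> powr p \<le> C powr p * (1 - p / 2) + C powr p * (p / 2) / C\<^sup>2 * (X z)\<^sup>2" for z
    proof -
      have "((X z / C)\<^sup>2) powr (p / 2) \<le> 1 + p / 2 * ((X z / C)\<^sup>2 - 1)"
        by (rule powr_le_Bernoulli) (use assms in auto)
      moreover have "((X z / C)\<^sup>2) powr (p / 2) = \<bar>X z\<bar> powr p / C powr p"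
      proof -
        have "((X z / C)\<^sup>2) powr (p / 2) = (\<bar>X z / C\<bar> powr 2) powr (p / 2)"
          by (simp only: powr_numeral abs_ge_zero power2_abs)
        also have "\<dots> = \<bar>X z / C\<bar> powr p" unfolding powr_powr by simp
        also have "\<dots> = \<bar>X z\<bar> powr p / C powr p" using C by (simp add: powr_divide)
        finally show ?thesis .
      qed
      ultimately have "\<bar>X z\<bar> powr p \<le> C powr p * (1 + p / 2 * ((X z / C)\<^sup>2 - 1))"
        using C by (simp only: pos_divide_le_eq powr_gt_zero mult.commute)
      then show ?thesis by (simp add: algebra_simps power_divide)
    qed
    then have "(\<integral>\<^sup>+z. ennreal (\<bar>X z\<bar> powr p) \<partial>M) \<le>
       (\<integral>\<^sup>+z. ennreal (C powr p * (1 - p / 2)) + ennreal (C powr p * (p / 2) / C\<^sup>2) * ennreal ((X z)\<^sup>2) \<partial>M)"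
      using assms C by (intro nn_integral_mono) (simp flip: ennreal_plus ennreal_mult)
    also have "\<dots> = ennreal (C powr p * (1 - p / 2)) + ennreal (C powr p * (p / 2) / C\<^sup>2) * (\<integral>\<^sup>+z. ennreal ((X z)\<^sup>2) \<partial>M)"
      by (simp add: nn_integral_add nn_integral_cmult emeasure_space_1)
    also have "\<dots> \<le> ennreal (C powr p * (1 - p / 2)) + ennreal (C powr p * (p / 2) / C\<^sup>2) * ennreal (C\<^sup>2)"
      by (intro add_mono mult_left_mono le') auto
    also have "\<dots> = ennreal (C powr p)"
      using assms C by (simp flip: ennreal_plus ennreal_mult) (simp add: field_simps)
    finally show ?thesis using C by (auto simp: Lp_bounded_def)
  qed
  have lim: "(\<lambda>j. B + 1 / (real j + 1)) \<longlonglongrightarrow> B + 0"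
    by (intro tendsto_add tendsto_const) (use lim_inverse_n' LIMSEQ_inverse_real_of_nat in \<open>simp add: inverse_eq_divide add.commute\<close>)
  show ?thesis
    by (rule Lp_bounded_Fatou[where X = "\<lambda>_. X", OF pos])
       (use lim assms in auto)
qed

text \<open>Jensen's inequality for the weights t_j / S and the points f_j / t_j. The bounds
  \<open>t\<close> strictly exceed \<open>s\<close> in order to be positive; Fatou removes the
  excess.\<close>

lemma Lp_bounded_Minkowski:
  assumes "finite J" "q \<ge> 1" "\<And>j. j \<in> J \<Longrightarrow> Lp_bounded M q (f j) (s j)"
    and "\<And>j z. j \<in> J \<Longrightarrow> 0 \<le> f j z"
  shows "Lp_bounded M q (\<lambda>z. \<Sum>j\<in>J. f j z) (\<Sum>j\<in>J. s j)"
proof (cases "J = {}")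
  case True then show ?thesis by (simp add: Lp_bounded_def)
next
  case False
  have [measurable]: "j \<in> J \<Longrightarrow> f j \<in> borel_measurable M" for j
    using assms(3) by (simp add: Lp_bounded_def)
  have pos: "Lp_bounded M q (\<lambda>z. \<Sum>j\<in>J. f j z) (\<Sum>j\<in>J. t j)" if t: "\<And>j. j \<in> J \<Longrightarrow> t j > s j" for t
  proof -
    have t0: "j \<in> J \<Longrightarrow> t j > 0" for j
      using t[of j] assms(3)[of j] by (auto simp: Lp_bounded_def)
    have tb: "j \<in> J \<Longrightarrow> (\<integral>\<^sup>+z. ennreal (\<bar>f j z\<bar> powr q) \<partial>M) \<le> ennreal (t j powr q)" for j
      using Lp_bounded_mono[OF assms(3), of j "t j"] t[of j] assms(2) by (auto simp: Lp_bounded_def)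
    define S where "S = (\<Sum>j\<in>J. t j)"
    have S: "S > 0" unfolding S_def using t0 assms False by (intro sum_pos) auto
    have *: "(\<Sum>j\<in>J. f j z) powr q \<le> (\<Sum>j\<in>J. S powr q * (t j / S) / t j powr q * (f j z powr q))" for z
    proof -
      have "(\<Sum>j\<in>J. (t j / S) * (f j z / t j)) powr q \<le> (\<Sum>j\<in>J. (t j / S) * (f j z / t j) powr q)"
      proof (rule powr_Jensen)
        show "(\<Sum>j\<in>J. t j / S) = 1"
          using S by (simp add: S_def flip: sum_divide_distrib)
      qed (use assms S t0 in \<open>auto intro!: divide_nonneg_pos simp: less_imp_le\<close>)
      moreover have "(\<Sum>j\<in>J. (t j / S) * (f j z / t j)) = (\<Sum>j\<in>J. f j z) / S"
        unfolding sum_divide_distrib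
      proof (rule sum.cong[OF refl])
        fix j assume "j \<in> J"
        then show "t j / S * (f j z / t j) = f j z / S" using t0[of j] by simp
      qed
      moreover have "((\<Sum>j\<in>J. f j z) / S) powr q = (\<Sum>j\<in>J. f j z) powr q / S powr q"
        by (rule powr_divide)
      ultimately have "(\<Sum>j\<in>J. f j z) powr q / S powr q \<le> (\<Sum>j\<in>J. (t j / S) * (f j z / t j) powr q)"
        by (simp only:)
      then have "(\<Sum>j\<in>J. f j z) powr q \<le> S powr q * (\<Sum>j\<in>J. (t j / S) * (f j z / t j) powr q)"
        using S by (simp only: pos_divide_le_eq powr_gt_zero mult.commute)
      also have "\<dots> = (\<Sum>j\<in>J. S powr q * (t j / S) / t j powr q * (f j z powr q))"
        unfolding sum_distrib_left
        by (rule sum.cong) (use t0 assms in \<open>auto simp: powr_divide less_imp_le\<close>)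
      finally show ?thesis .
    qed
    have "(\<integral>\<^sup>+z. ennreal (\<bar>\<Sum>j\<in>J. f j z\<bar> powr q) \<partial>M) \<le>
      (\<integral>\<^sup>+z. (\<Sum>j\<in>J. ennreal (S powr q * (t j / S) / t j powr q) * ennreal (\<bar>f j z\<bar> powr q)) \<partial>M)"
    proof (intro nn_integral_mono)
      fix z
      have "ennreal (\<bar>\<Sum>j\<in>J. f j z\<bar> powr q) \<le> ennreal (\<Sum>j\<in>J. S powr q * (t j / S) / t j powr q * (f j z powr q))"
        using * assms(4) by (subst abs_of_nonneg) (auto intro!: sum_nonneg ennreal_leI)
      also have "\<dots> = (\<Sum>j\<in>J. ennreal (S powr q * (t j / S) / t j powr q * (f j z powr q)))"
        using t0 S by (intro sum_ennreal[symmetric]) (auto simp: less_imp_le)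
      also have "\<dots> = (\<Sum>j\<in>J. ennreal (S powr q * (t j / S) / t j powr q) * ennreal (\<bar>f j z\<bar> powr q))"
        using t0 S assms(4) by (intro sum.cong refl) (auto simp: less_imp_le ennreal_mult[symmetric])
      finally show "ennreal (\<bar>\<Sum>j\<in>J. f j z\<bar> powr q) \<le> (\<Sum>j\<in>J. ennreal (S powr q * (t j / S) / t j powr q) * ennreal (\<bar>f j z\<bar> powr q))" .
    qed
    also have "\<dots> = (\<Sum>j\<in>J. ennreal (S powr q * (t j / S) / t j powr q) * (\<integral>\<^sup>+z. ennreal (\<bar>f j z\<bar> powr q) \<partial>M))"
      by (subst nn_integral_sum) (auto simp: nn_integral_cmult)
    also have "\<dots> \<le> (\<Sum>j\<in>J. ennreal (S powr q * (t j / S) / t j powr q) * ennreal (t j powr q))"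
      by (intro sum_mono mult_left_mono tb) auto
    also have "\<dots> = (\<Sum>j\<in>J. ennreal (S powr q * (t j / S)))"
    proof (rule sum.cong[OF refl])
      fix j assume "j \<in> J"
      then have "t j > 0" by (rule t0)
      then show "ennreal (S powr q * (t j / S) / t j powr q) * ennreal (t j powr q) = ennreal (S powr q * (t j / S))"
        using S by (subst ennreal_mult[symmetric]) auto
    qed
    also have "\<dots> = ennreal (\<Sum>j\<in>J. S powr q * (t j / S))"
      using t0 S by (intro sum_ennreal) (auto simp: less_imp_le)
    also have "(\<Sum>j\<in>J. S powr q * (t j / S)) = S powr q"
      using S unfolding sum_distrib_left[symmetric] sum_divide_distrib[symmetric] S_def[symmetric] by simp
    finally show ?thesis using S by (simp add: Lp_bounded_def S_def)
  qed
  have lim: "(\<lambda>i. \<Sum>j\<in>J. s j + 1 / (real i + 1)) \<longlonglongrightarrow> (\<Sum>j\<in>J. s j + 0)"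
    by (intro tendsto_sum tendsto_add tendsto_const) (use lim_inverse_n' LIMSEQ_inverse_real_of_nat in \<open>simp add: inverse_eq_divide add.commute\<close>)
  show ?thesis
    by (rule Lp_bounded_Fatou[where X = "\<lambda>_ z. \<Sum>j\<in>J. f j z", OF pos])
       (use lim assms in auto)
qed


lemma Lp_bounded_power2:
  assumes "Lp_bounded M p X B"
  shows "Lp_bounded M (p / 2) (\<lambda>z. (X z)\<^sup>2) (B\<^sup>2)"
proof -
  have *: "(u\<^sup>2) powr (p / 2) = \<bar>u\<bar> powr p" for u :: real
  proof -
    have "(u\<^sup>2) powr (p / 2) = (\<bar>u\<bar> powr 2) powr (p / 2)" by (simp only: powr_numeral abs_ge_zero power2_abs)
    then show ?thesis unfolding powr_powr by simp
  qed
  show ?thesis using assms by (auto simp: Lp_bounded_def *)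
qed

lemma Lp_bounded_sqrt:
  assumes "Lp_bounded M (p / 2) X B" "\<And>z. 0 \<le> X z"
  shows "Lp_bounded M p (\<lambda>z. sqrt (X z)) (sqrt B)"
proof -
  have *: "(sqrt u) powr p = u powr (p / 2)" if "u \<ge> 0" for u :: real
    using that by (simp add: powr_powr flip: powr_half_sqrt)
  show ?thesis using assms by (auto simp: Lp_bounded_def *)
qed

text \<open>Minkowski in the exponent p / 2 for the squares, which is where p >= 2 enters.\<close>

lemma Lp_bounded_l2:
  assumes "finite J" "2 \<le> p" "\<And>j. j \<in> J \<Longrightarrow> Lp_bounded M p (X j) (B j)"
  shows "Lp_bounded M p (\<lambda>z. sqrt (\<Sum>j\<in>J. (X j z)\<^sup>2)) (sqrt (\<Sum>j\<in>J. (B j)\<^sup>2))"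
  by (intro Lp_bounded_sqrt Lp_bounded_Minkowski Lp_bounded_power2 assms) (use assms in \<open>auto intro: sum_nonneg\<close>)

lemma sum_PiE_insert:
  assumes "i \<notin> I"
  shows "(\<Sum>\<nu>\<in>PiE (insert i I) (\<lambda>_. J). f \<nu>) = (\<Sum>j\<in>J. \<Sum>\<nu>\<in>PiE I (\<lambda>_. J). f (\<nu>(i := j)))"
proof -
  have "(\<Sum>\<nu>\<in>PiE (insert i I) (\<lambda>_. J). f \<nu>)
      = (\<Sum>x\<in>J \<times> PiE I (\<lambda>_. J). f ((\<lambda>(y, g). g(i := y)) x))"
    unfolding PiE_insert_eq by (subst sum.reindex[OF inj_combinator[OF assms]]) simp
  also have "\<dots> = (\<Sum>j\<in>J. \<Sum>\<nu>\<in>PiE I (\<lambda>_. J). f (\<nu>(i := j)))"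
    by (subst sum.cartesian_product) (auto intro: sum.cong)
  finally show ?thesis .
qed

text \<open>For frozen old coordinates, \<open>base\<close> applies to the new coordinate with
  coefficients \<open>B j x\<close>, and \<open>Lp_bounded_l2\<close> brings the l2 norm over
  \<open>j\<close> out of the remaining integral. The contraction is hidden in the functions
  \<open>\<psi>\<close>, so the l2 norm of the coefficients is reproduced without loss.\<close>

lemma Lp_bounded_tensor:
  fixes N :: "'b measure" and \<psi> :: "'j \<Rightarrow> 'b \<Rightarrow> real" and a :: "('i \<Rightarrow> 'j) \<Rightarrow> real"
  assumes N: "prob_space N" and p: "2 \<le> p" and J: "finite J" and I: "finite I"
    and \<psi>[measurable]: "\<And>j. \<psi> j \<in> borel_measurable N"
    and base: "\<And>a. Lp_bounded N p (\<lambda>y. \<Sum>j\<in>J. a j * \<psi> j y) (sqrt (\<Sum>j\<in>J. (a j)\<^sup>2))"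
  shows "Lp_bounded (PiM I (\<lambda>_. N)) p
           (\<lambda>x. \<Sum>\<nu>\<in>PiE I (\<lambda>_. J). a \<nu> * (\<Prod>i\<in>I. \<psi> (\<nu> i) (x i)))
           (sqrt (\<Sum>\<nu>\<in>PiE I (\<lambda>_. J). (a \<nu>)\<^sup>2))"
  using I
proof (induction I arbitrary: a rule: finite_induct)
  case empty
  interpret prob_space "PiM {} (\<lambda>_::'i. N)" by (intro prob_space_PiM N)
  show ?case by (simp add: Lp_bounded_def emeasure_space_1)
next
  case (insert i I)
  interpret N: prob_space N by fact
  interpret product_prob_space "\<lambda>_::'i. N" UNIV by unfold_locales
  define B where "B j x = (\<Sum>\<nu>\<in>PiE I (\<lambda>_. J). a (\<nu>(i := j)) * (\<Prod>k\<in>I. \<psi> (\<nu> k) (x k)))" for j x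
  define s where "s j = (\<Sum>\<nu>\<in>PiE I (\<lambda>_. J). (a (\<nu>(i := j)))\<^sup>2)" for j
  have s0: "s j \<ge> 0" for j by (auto simp: s_def intro: sum_nonneg)
  have IH: "Lp_bounded (PiM I (\<lambda>_. N)) p (B j) (sqrt (s j))" for j
    unfolding B_def s_def by (rule insert.IH)
  define f where "f x = (\<Sum>\<nu>\<in>PiE (insert i I) (\<lambda>_. J). a \<nu> * (\<Prod>k\<in>insert i I. \<psi> (\<nu> k) (x k)))" for x
  have f[measurable]: "f \<in> borel_measurable (PiM (insert i I) (\<lambda>_. N))"
    unfolding f_def by measurable
  have f_eq: "f (x(i := y)) = (\<Sum>j\<in>J. B j x * \<psi> j y)" for x y
  proof -
    have "f (x(i := y)) = (\<Sum>j\<in>J. \<Sum>\<nu>\<in>PiE I (\<lambda>_. J). a (\<nu>(i := j)) * (\<psi> j y * (\<Prod>k\<in>I. \<psi> (\<nu> k) (x k))))"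
      unfolding f_def sum_PiE_insert[OF insert(2)]
    proof (intro sum.cong refl)
      fix j \<nu>
      have "(\<Prod>k\<in>insert i I. \<psi> ((\<nu>(i := j)) k) ((x(i := y)) k)) = \<psi> j y * (\<Prod>k\<in>I. \<psi> ((\<nu>(i := j)) k) ((x(i := y)) k))"
        using insert by simp
      also have "(\<Prod>k\<in>I. \<psi> ((\<nu>(i := j)) k) ((x(i := y)) k)) = (\<Prod>k\<in>I. \<psi> (\<nu> k) (x k))"
        using insert by (intro prod.cong) auto
      finally show "a (\<nu>(i := j)) * (\<Prod>k\<in>insert i I. \<psi> ((\<nu>(i := j)) k) ((x(i := y)) k)) = a (\<nu>(i := j)) * (\<psi> j y * (\<Prod>k\<in>I. \<psi> (\<nu> k) (x k)))"
        by simp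
    qed
    then show ?thesis by (simp add: B_def sum_distrib_left mult_ac)
  qed
  have "(\<integral>\<^sup>+x. ennreal (\<bar>f x\<bar> powr p) \<partial>PiM (insert i I) (\<lambda>_. N))
      = (\<integral>\<^sup>+x. \<integral>\<^sup>+y. ennreal (\<bar>\<Sum>j\<in>J. B j x * \<psi> j y\<bar> powr p) \<partial>N \<partial>PiM I (\<lambda>_. N))"
    by (subst product_nn_integral_insert) (use insert in \<open>auto simp: f_eq\<close>)
  also have "\<dots> \<le> (\<integral>\<^sup>+x. ennreal (\<bar>sqrt (\<Sum>j\<in>J. (B j x)\<^sup>2)\<bar> powr p) \<partial>PiM I (\<lambda>_. N))"
    using base by (intro nn_integral_mono) (auto simp: Lp_bounded_def abs_of_nonneg sum_nonneg)
  also have "\<dots> \<le> ennreal (sqrt (\<Sum>j\<in>J. (sqrt (s j))\<^sup>2) powr p)"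
    using Lp_bounded_l2[OF J p IH] by (auto simp: Lp_bounded_def)
  also have "(\<Sum>j\<in>J. (sqrt (s j))\<^sup>2) = (\<Sum>\<nu>\<in>PiE (insert i I) (\<lambda>_. J). (a \<nu>)\<^sup>2)"
    using s0 unfolding sum_PiE_insert[OF insert(2)] by (simp add: s_def)
  finally show ?case using f by (auto simp: Lp_bounded_def f_def sum_nonneg)
qed

section \<open>The two-point inequality\<close>

text \<open>Taylor's formula of order two at 0. The second derivative is q (q - 1) times the mean of
  (1 + t)^(q - 2) and (1 - t)^(q - 2); as q <= 2, their product is at least 1, and so is their
  mean.\<close>

lemma two_point_lower:
  fixes q y :: real
  assumes "1 < q" "q \<le> 2" "0 \<le> y" "y < 1"
  shows "1 + q * (q - 1) / 2 * y\<^sup>2 \<le> ((1 + y) powr q + (1 - y) powr q) / 2"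
proof (cases "y = 0")
  case False
  then have y: "0 < y" using assms by simp
  define d where "d = (\<lambda>m::nat. if m = 0 then (\<lambda>t::real. ((1 + t) powr q + (1 - t) powr q) / 2)
    else if m = 1 then (\<lambda>t. q * ((1 + t) powr (q - 1) - (1 - t) powr (q - 1)) / 2)
    else (\<lambda>t. q * (q - 1) * ((1 + t) powr (q - 2) + (1 - t) powr (q - 2)) / 2))"
  have "\<exists>t>0. t \<le> y \<and> d 0 y = (\<Sum>m<2. d m 0 / fact m * y ^ m) + d 2 t / fact 2 * y ^ 2"
  proof (rule Maclaurin2[OF y refl], intro allI impI)
    fix m :: nat and t :: real
    assume *: "m < 2 \<and> 0 \<le> t \<and> t \<le> y"
    then have t: "1 + t > 0" "1 - t > 0" using assms by auto
    have "m = 0 \<or> m = 1" using * by auto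
    then show "(d m has_real_derivative d (Suc m) t) (at t)"
      using t by (auto simp: d_def field_simps intro!: derivative_eq_intros)
  qed
  then obtain t where t: "0 < t" "t \<le> y"
    and eq: "d 0 y = (\<Sum>m<2. d m 0 / fact m * y ^ m) + d 2 t / fact 2 * y ^ 2" by blast
  have t1: "t < 1" using t assms by simp
  have key: "2 \<le> (1 + t) powr (q - 2) + (1 - t) powr (q - 2)"
  proof -
    define u v where "u = (1 + t) powr (q - 2)" and "v = (1 - t) powr (q - 2)"
    have uv: "u > 0" "v > 0" using t t1 by (auto simp: u_def v_def)
    have "1 - t\<^sup>2 > 0" using t t1 by (simp add: power_less_one_iff abs_square_less_1)
    moreover have "u * v = (1 - t\<^sup>2) powr (q - 2)"
      using t t1 by (simp add: u_def v_def power2_eq_square algebra_simps flip: powr_mult)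
    moreover have "(1 - t\<^sup>2) powr (q - 2) \<ge> 1"
    proof -
      have "(1 - t\<^sup>2) powr 0 \<le> (1 - t\<^sup>2) powr (q - 2)"
        using assms \<open>1 - t\<^sup>2 > 0\<close> by (intro powr_mono') auto
      then show ?thesis using \<open>1 - t\<^sup>2 > 0\<close> by simp
    qed
    ultimately have "u * v \<ge> 1" by simp
    then have "(u + v)\<^sup>2 \<ge> 2\<^sup>2" using zero_le_power2[of "u - v"] by (simp add: power2_eq_square algebra_simps)
    then show ?thesis using uv power2_le_imp_le[of 2 "u + v"] by (simp add: u_def v_def)
  qed
  have "d 0 y = 1 + d 2 t / 2 * y\<^sup>2"
    unfolding eq by (simp add: numeral_2_eq_2 d_def)
  moreover have "d 2 t \<ge> q * (q - 1)"
  proof -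
    have "q * (q - 1) * 2 \<le> q * (q - 1) * ((1 + t) powr (q - 2) + (1 - t) powr (q - 2))"
      by (rule mult_left_mono[OF key]) (use assms in auto)
    then show ?thesis by (simp add: d_def)
  qed
  then have "1 + q * (q - 1) / 2 * y\<^sup>2 \<le> 1 + d 2 t / 2 * y\<^sup>2"
    by (intro add_left_mono mult_right_mono divide_right_mono) auto
  ultimately have "1 + q * (q - 1) / 2 * y\<^sup>2 \<le> d 0 y" by linarith
  then show ?thesis by (simp add: d_def)
qed simp

text \<open>The dual form of the two-point inequality: after contraction by sqrt (q - 1), the L^2
  norm on two points is at most the original L^q norm.\<close>

lemma two_point_lower_power:
  fixes q a b :: real
  assumes q: "1 < q" "q \<le> 2"
  shows "(a\<^sup>2 + (q - 1) * b\<^sup>2) powr (q / 2) \<le> (\<bar>a + b\<bar> powr q + \<bar>a - b\<bar> powr q) / 2"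
proof -
  have main: "(a\<^sup>2 + (q - 1) * b\<^sup>2) powr (q / 2) \<le> ((a + b) powr q + (a - b) powr q) / 2"
    if ab: "0 \<le> b" "b < a" for a b :: real
  proof -
    have a: "a > 0" using ab by simp
    define y where "y = b / a"
    have y: "0 \<le> y" "y < 1" and b: "b = a * y" using ab a by (auto simp: y_def)
    have "(1 + (q - 1) * y\<^sup>2) powr (q / 2) \<le> 1 + q / 2 * ((q - 1) * y\<^sup>2)"
      using powr_le_Bernoulli[of "1 + (q - 1) * y\<^sup>2" "q / 2"] q by simp
    also have "\<dots> \<le> ((1 + y) powr q + (1 - y) powr q) / 2"
      using two_point_lower[OF q y] by (simp add: mult.assoc)
    finally have "a powr q * (1 + (q - 1) * y\<^sup>2) powr (q / 2) \<le> a powr q * (((1 + y) powr q + (1 - y) powr q) / 2)"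
      by (intro mult_left_mono) auto
    moreover have "a powr q * (1 + (q - 1) * y\<^sup>2) powr (q / 2) = (a\<^sup>2 + (q - 1) * b\<^sup>2) powr (q / 2)"
    proof -
      have "(a\<^sup>2 + (q - 1) * b\<^sup>2) = a\<^sup>2 * (1 + (q - 1) * y\<^sup>2)"
        by (simp add: b power_mult_distrib algebra_simps)
      moreover have "(a\<^sup>2) powr (q / 2) = a powr q"
        using a by (simp add: powr_powr flip: powr_numeral)
      ultimately show ?thesis using q by (simp add: powr_mult)
    qed
    moreover have "a powr q * (((1 + y) powr q + (1 - y) powr q) / 2) = ((a + b) powr q + (a - b) powr q) / 2"
    proof -
      have "a + b = a * (1 + y)" "a - b = a * (1 - y)" by (auto simp: b algebra_simps)
      then show ?thesis using a y by (simp only: powr_mult) (simp add: algebra_simps)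
    qed
    ultimately show ?thesis by simp
  qed
  have le: "(a\<^sup>2 + (q - 1) * b\<^sup>2) powr (q / 2) \<le> ((a + b) powr q + \<bar>a - b\<bar> powr q) / 2"
    if ab: "0 \<le> b" "0 \<le> a" for a b :: real
  proof (cases a b rule: linorder_cases)
    \<comment> \<open>Swapping \<open>a\<close> and \<open>b\<close> leaves the right side unchanged
      and, since q - 1 <= 1, does not lower the left side.\<close>
    case less
    have "(a\<^sup>2 + (q - 1) * b\<^sup>2) \<le> (b\<^sup>2 + (q - 1) * a\<^sup>2)"
    proof -
      have "0 \<le> (2 - q) * (b\<^sup>2 - a\<^sup>2)" using less ab q by (intro mult_nonneg_nonneg) (auto simp: power_mono)
      then show ?thesis by (simp add: algebra_simps)
    qed
    then have "(a\<^sup>2 + (q - 1) * b\<^sup>2) powr (q / 2) \<le> (b\<^sup>2 + (q - 1) * a\<^sup>2) powr (q / 2)"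
      using q by (intro powr_mono2) auto
    also have "\<dots> \<le> ((b + a) powr q + (b - a) powr q) / 2"
      by (rule main) (use less ab in auto)
    finally show ?thesis using less by (simp add: add.commute)
  next
    case equal
    have "(a\<^sup>2 + (q - 1) * b\<^sup>2) powr (q / 2) = (q * b\<^sup>2) powr (q / 2)"
      by (simp add: equal algebra_simps)
    also have "\<dots> = q powr (q / 2) * b powr q"
      using q that by (simp add: powr_mult powr_powr flip: powr_numeral)
    also have "\<dots> \<le> 2 powr (q - 1) * b powr q"
    proof (intro mult_right_mono)
      define e where "e = (q - 1)"
      have e: "0 < e" "e \<le> 1" using q by (auto simp: e_def)
      \<comment> \<open>For a = b the claim reduces to this. It is the chord bound on [1, 2] for the
        convex function x ln x, which vanishes at 1.\<close>
      have lnq: "q / 2 * ln q \<le> (q - 1) * ln 2"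
      proof -
        have cv: "convex_on {0<..} (\<lambda>x::real. x * ln x)"
        proof (rule f''_ge0_imp_convex)
          show "((\<lambda>x. x * ln x) has_real_derivative (ln x + 1)) (at x)" if "x \<in> {0<..}" for x :: real
            using that by (auto intro!: derivative_eq_intros)
          show "((\<lambda>x. ln x + 1) has_real_derivative (1 / x)) (at x)" if "x \<in> {0<..}" for x :: real
            using that by (auto intro!: derivative_eq_intros)
        qed auto
        have "((1 - e) * 1 + e * 2) * ln ((1 - e) * 1 + e * 2) \<le> (1 - e) * (1 * ln 1) + e * (2 * ln (2::real))"
          using convex_onD[OF cv, of e 1 2] e by simp
        then show ?thesis by (simp add: e_def algebra_simps)
      qed
      then show "q powr (q / 2) \<le> 2 powr (q - 1)"
        using q by (simp add: powr_def)
    qed simp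
    also have "\<dots> = ((b + b) powr q) / 2"
    proof -
      have "(b + b) powr q = 2 powr q * b powr q" using that by (simp flip: powr_mult)
      moreover have "2 powr q = 2 * 2 powr (q - 1)" by (simp add: powr_diff)
      ultimately show ?thesis by simp
    qed
    finally show ?thesis using equal by simp
  next
    case greater
    then show ?thesis using main[OF that(1) greater] by simp
  qed
  have "(\<bar>a\<bar>\<^sup>2 + (q - 1) * \<bar>b\<bar>\<^sup>2) powr (q / 2) \<le> ((\<bar>a\<bar> + \<bar>b\<bar>) powr q + \<bar>\<bar>a\<bar> - \<bar>b\<bar>\<bar> powr q) / 2"
    by (rule le) auto
  moreover have "(\<bar>a\<bar> + \<bar>b\<bar>) powr q + \<bar>\<bar>a\<bar> - \<bar>b\<bar>\<bar> powr q = \<bar>a + b\<bar> powr q + \<bar>a - b\<bar> powr q"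
  proof -
    have "(\<bar>a\<bar> + \<bar>b\<bar> = \<bar>a + b\<bar> \<and> \<bar>\<bar>a\<bar> - \<bar>b\<bar>\<bar> = \<bar>a - b\<bar>) \<or> (\<bar>a\<bar> + \<bar>b\<bar> = \<bar>a - b\<bar> \<and> \<bar>\<bar>a\<bar> - \<bar>b\<bar>\<bar> = \<bar>a + b\<bar>)"
      by linarith
    then show ?thesis by (metis add.commute)
  qed
  ultimately show ?thesis by simp
qed

text \<open>Duality: the function is tested against its own signed power \<open>sgn u |u|\<^sup>p\<^sup>-\<^sup>1\<close>.\<close>

lemma two_point_inequality:
  fixes p a b :: real
  assumes p: "2 \<le> p" and r: "r = 1 / sqrt (p - 1)"
  shows "(\<bar>a + r * b\<bar> powr p + \<bar>a - r * b\<bar> powr p) / 2 \<le> (a\<^sup>2 + b\<^sup>2) powr (p / 2)"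
proof -
  \<comment> \<open>The conjugate exponent. As (p - 1) (q - 1) = 1, the contraction \<open>r\<close>
    belonging to \<open>p\<close> is also the one belonging to \<open>q\<close>.\<close>
  define q where "q = p / (p - 1)"
  have q: "1 < q" "q \<le> 2" and q1: "q - 1 = r\<^sup>2"
    using p by (auto simp: q_def r field_simps power_divide)
  define u v where "u = a + r * b" and "v = a - r * b"
  define A where "A = (\<bar>u\<bar> powr p + \<bar>v\<bar> powr p) / 2"
  define U V where "U = sgn u * \<bar>u\<bar> powr (p - 1)" and "V = sgn v * \<bar>v\<bar> powr (p - 1)"
  have uU: "u * U = \<bar>u\<bar> powr p" "v * V = \<bar>v\<bar> powr p"
    using p by (auto simp: U_def V_def powr_diff sgn_real_def abs_if)
  have Uq: "\<bar>U\<bar> powr q = \<bar>u\<bar> powr p" "\<bar>V\<bar> powr q = \<bar>v\<bar> powr p"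
    using p by (auto simp: U_def V_def abs_mult powr_powr q_def abs_sgn_eq)
  define c d where "c = (U + V) / 2" and "d = (U - V) / 2"
  have UV: "c + d = U" "c - d = V" by (auto simp: c_def d_def field_simps)
  show ?thesis
  proof (cases "A = 0")
    case True
    then show ?thesis by (simp add: A_def u_def v_def)
  next
    case False
    then have A: "A > 0" by (simp add: A_def add_nonneg_nonneg order_less_le)
    have "A = a * c + b * (r * d)"
      unfolding A_def uU[symmetric] by (simp add: u_def v_def c_def d_def field_simps)
    also have "\<dots> \<le> sqrt (a\<^sup>2 + b\<^sup>2) * sqrt (c\<^sup>2 + (r * d)\<^sup>2)"
    proof -
      have "(a * c + b * (r * d))\<^sup>2 \<le> (a\<^sup>2 + b\<^sup>2) * (c\<^sup>2 + (r * d)\<^sup>2)"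
        using zero_le_power2[of "a * (r * d) - b * c"] by (simp add: power2_eq_square algebra_simps)
      then show ?thesis by (metis real_le_rsqrt real_sqrt_mult)
    qed
    also have "sqrt (c\<^sup>2 + (r * d)\<^sup>2) = ((c\<^sup>2 + (q - 1) * d\<^sup>2) powr (q / 2)) powr (1 / q)"
      using q by (simp add: powr_powr q1 power_mult_distrib powr_half_sqrt)
    also have "\<dots> \<le> ((\<bar>U\<bar> powr q + \<bar>V\<bar> powr q) / 2) powr (1 / q)"
      using two_point_lower_power[OF q, of c d] q unfolding UV by (intro powr_mono2) auto
    also have "\<dots> = A powr (1 / q)" by (simp add: Uq A_def)
    finally have "A \<le> sqrt (a\<^sup>2 + b\<^sup>2) * A powr (1 / q)" by (simp add: mult_left_mono)
    then have "A * A powr (- 1 / q) \<le> sqrt (a\<^sup>2 + b\<^sup>2) * (A powr (1 / q) * A powr (- 1 / q))"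
      by (metis mult.assoc mult_right_mono powr_ge_zero)
    then have "A powr (1 - 1 / q) \<le> sqrt (a\<^sup>2 + b\<^sup>2)"
      using A by (simp add: powr_diff powr_minus_divide)
    moreover have "1 - 1 / q = 1 / p" using p by (simp add: q_def field_simps)
    ultimately have "(A powr (1 / p)) powr p \<le> (sqrt (a\<^sup>2 + b\<^sup>2)) powr p"
      using p by (intro powr_mono2) auto
    then show ?thesis using A p by (simp add: powr_powr A_def u_def v_def flip: powr_half_sqrt)
  qed
qed

section \<open>Coin tossing and Krawtchouk polynomials\<close>

text \<open>The Hermite polynomial of variance v, that is v^(n/2) He_n(x / sqrt v). Its recursion is
  polynomial in v, so v = 0 is allowed and yields x^n.\<close>

fun wick :: "nat \<Rightarrow> real \<Rightarrow> real \<Rightarrow> real" where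
  "wick 0 v x = 1"
| "wick (Suc 0) v x = x"
| "wick (Suc (Suc n)) v x = x * wick (Suc n) v x - (real n + 1) * v * wick n v x"

lemma continuous_on_wick: "continuous_on S (wick n v)"
  by (induction n v "0::real" rule: wick.induct) (auto intro!: continuous_intros)

lemma borel_measurable_wick[measurable]: "wick n v \<in> borel_measurable borel"
  by (intro borel_measurable_continuous_onI continuous_on_wick)

text \<open>A measure on the Borel sets rather than a probability mass function, to fit the central
  limit theorem and Borel measurable test functions.\<close>

definition coin :: "real measure" where
  "coin = distr (measure_pmf (pmf_of_set {1, -1})) borel (\<lambda>x. x)"

lemma prob_space_coin: "prob_space coin"
  unfolding coin_def by (intro prob_space.prob_space_distr prob_space_measure_pmf) simp

lemma sets_coin[simp, measurable_cong]: "sets coin = sets borel" and space_coin[simp]: "space coin = UNIV"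
  by (auto simp: coin_def)

lemma nn_integral_coin:
  assumes "f \<in> borel_measurable borel"
  shows "(\<integral>\<^sup>+x. f x \<partial>coin) = (f 1 + f (-1)) / 2"
  using assms unfolding coin_def by (simp add: nn_integral_distr nn_integral_pmf_of_set)

lemma integrable_coin:
  fixes f :: "real \<Rightarrow> real" assumes [measurable]: "f \<in> borel_measurable borel" shows "integrable coin f"
  unfolding coin_def by (subst integrable_distr_eq) (auto intro!: integrable_measure_pmf_finite)

lemma integral_coin:
  fixes f :: "real \<Rightarrow> real" assumes [measurable]: "f \<in> borel_measurable borel"
  shows "(\<integral>x. f x \<partial>coin) = (f 1 + f (-1)) / 2"
  unfolding coin_def by (subst integral_distr) (auto simp: integral_pmf_of_set)

text \<open>The contraction is attached to the coin itself: the functions are 1 and r y, in the form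
  that \<open>Lp_bounded_tensor\<close> expects.\<close>

lemma Lp_bounded_coin:
  assumes p: "2 \<le> p" and r: "r = 1 / sqrt (p - 1)"
  shows "Lp_bounded coin p (\<lambda>y. \<Sum>j\<in>{0,1}. a j * (r * y) ^ j) (sqrt (\<Sum>j\<in>{0,1::nat}. (a j)\<^sup>2))"
proof -
  have "(\<integral>\<^sup>+y. ennreal (\<bar>\<Sum>j\<in>{0,1}. a j * (r * y) ^ j\<bar> powr p) \<partial>coin)
      = ennreal ((\<bar>a 0 + r * a 1\<bar> powr p + \<bar>a 0 - r * a 1\<bar> powr p) / 2)"
    by (subst nn_integral_coin) (auto simp: mult.commute ennreal_plus[symmetric] ennreal_divide_numeral simp del: ennreal_plus)
  also have "\<dots> \<le> ennreal (((a 0)\<^sup>2 + (a 1)\<^sup>2) powr (p / 2))"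
    by (intro ennreal_leI two_point_inequality assms)
  also have "((a 0)\<^sup>2 + (a 1)\<^sup>2) powr (p / 2) = (sqrt (\<Sum>j\<in>{0,1::nat}. (a j)\<^sup>2)) powr p"
    by (simp add: powr_powr flip: powr_half_sqrt)
  finally show ?thesis by (simp add: Lp_bounded_def sum_nonneg)
qed

text \<open>Indexed by 0-1 functions instead of subsets, so that the index set is the one in
  \<open>Lp_bounded_tensor\<close>.\<close>

definition elem_sym :: "'i set \<Rightarrow> nat \<Rightarrow> ('i \<Rightarrow> real) \<Rightarrow> real" where
  "elem_sym I j y = (\<Sum>\<nu>\<in>PiE I (\<lambda>_. {0,1::nat}). if (\<Sum>i\<in>I. \<nu> i) = j then (\<Prod>i\<in>I. y i ^ \<nu> i) else 0)"

lemma elem_sym_empty: "elem_sym {} j y = (if j = 0 then 1 else 0)"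
  by (simp add: elem_sym_def)

lemma elem_sym_insert:
  assumes "finite I" "i \<notin> I"
  shows "elem_sym (insert i I) j y = elem_sym I j y + (if j = 0 then 0 else y i * elem_sym I (j - 1) y)"
proof -
  have s: "(\<Sum>k\<in>insert i I. (\<nu>(i := t)) k) = t + (\<Sum>k\<in>I. \<nu> k)" for \<nu> :: "'a \<Rightarrow> nat" and t
  proof -
    have "(\<Sum>k\<in>I. (\<nu>(i := t)) k) = (\<Sum>k\<in>I. \<nu> k)" using assms by (intro sum.cong) auto
    then show ?thesis using assms by simp
  qed
  have pr: "(\<Prod>k\<in>insert i I. y k ^ (\<nu>(i := t)) k) = y i ^ t * (\<Prod>k\<in>I. y k ^ \<nu> k)" for \<nu> :: "'a \<Rightarrow> nat" and t
  proof -
    have "(\<Prod>k\<in>I. y k ^ (\<nu>(i := t)) k) = (\<Prod>k\<in>I. y k ^ \<nu> k)" using assms by (intro prod.cong) auto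
    then show ?thesis using assms by simp
  qed
  show ?thesis
    unfolding elem_sym_def sum_PiE_insert[OF assms(2)] s pr
    by (cases j) (auto simp: sum_distrib_left if_distrib[of "(*) (y i)"] cong: if_cong)
qed

lemma elem_sym_one: "finite I \<Longrightarrow> elem_sym I j (\<lambda>_. 1) = real (card I choose j)"
proof (induction I arbitrary: j rule: finite_induct)
  case empty then show ?case by (cases j) (auto simp: elem_sym_empty)
next
  case (insert i I)
  then show ?case by (cases j) (auto simp: elem_sym_insert)
qed

text \<open>Multiply by the sum of the y_i. A monomial of degree j + 1 either gains a factor, and
  each monomial of degree j + 2 arises j + 2 times, or it loses one because y_i squares to 1, and
  each monomial of degree j arises card I - j times.\<close>

lemma elem_sym_recurrence:
  assumes "finite I" "\<And>i. i \<in> I \<Longrightarrow> (y i)\<^sup>2 = 1"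
  shows "(real j + 2) * elem_sym I (Suc (Suc j)) y
         = (\<Sum>i\<in>I. y i) * elem_sym I (Suc j) y - (real (card I) - real j) * elem_sym I j y"
    and "elem_sym I (Suc 0) y = (\<Sum>i\<in>I. y i)" and "elem_sym I 0 y = 1"
proof -
  have "(\<forall>j. (real j + 2) * elem_sym I (Suc (Suc j)) y
         = (\<Sum>i\<in>I. y i) * elem_sym I (Suc j) y - (real (card I) - real j) * elem_sym I j y)
    \<and> elem_sym I (Suc 0) y = (\<Sum>i\<in>I. y i) \<and> elem_sym I 0 y = 1"
    using assms
  proof (induction I rule: finite_induct)
    case empty then show ?case by (auto simp: elem_sym_empty)
  next
    case (insert i I)
    define e where "e = (\<lambda>j. elem_sym I j y)"
    define S N where "S = (\<Sum>i\<in>I. y i)" and "N = real (card I)"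
    have IH: "(real j + 2) * e (Suc (Suc j)) = S * e (Suc j) - (N - real j) * e j" for j
      using insert by (auto simp: e_def S_def N_def)
    have e01: "e (Suc 0) = S" "e 0 = 1" using insert by (auto simp: e_def S_def)
    have yi: "y i * y i = 1" using insert(4)[of i] by (simp add: power2_eq_square)
    have "(real j + 2) * elem_sym (insert i I) (Suc (Suc j)) y
         = (\<Sum>i\<in>insert i I. y i) * elem_sym (insert i I) (Suc j) y
           - (real (card (insert i I)) - real j) * elem_sym (insert i I) j y" for j
    proof (cases j)
      case 0
      have "2 * (e (Suc (Suc 0)) + y i * e (Suc 0)) = (y i + S) * (e (Suc 0) + y i * e 0) - (1 + N) * e 0"
        using IH[of 0] e01 yi by (simp add: algebra_simps)
      then show ?thesis using insert 0 by (simp add: elem_sym_insert e_def S_def N_def add.commute)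
    next
      case (Suc k)
      have "(real k + 3) * (e (Suc (Suc (Suc k))) + y i * e (Suc (Suc k)))
         = (S * e (Suc (Suc k)) - (N - real (Suc k)) * e (Suc k)) + y i * ((real k + 2) * e (Suc (Suc k))) + y i * e (Suc (Suc k))"
        using IH[of "Suc k"] by (simp add: algebra_simps)
      also have "\<dots> = (S * e (Suc (Suc k)) - (N - real (Suc k)) * e (Suc k)) + y i * (S * e (Suc k) - (N - real k) * e k) + y i * e (Suc (Suc k))"
        by (simp only: IH)
      also have "\<dots> = (y i + S) * (e (Suc (Suc k)) + y i * e (Suc k)) - (N + 1 - real (Suc k)) * (e (Suc k) + y i * e k) + (1 - y i * y i) * e (Suc k)"
        by (simp add: algebra_simps)
      finally show ?thesis using insert Suc yi by (simp add: elem_sym_insert e_def S_def N_def add.commute)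
    qed
    then show ?case using insert e01 by (auto simp: elem_sym_insert e_def S_def)
  qed
  then show "(real j + 2) * elem_sym I (Suc (Suc j)) y
         = (\<Sum>i\<in>I. y i) * elem_sym I (Suc j) y - (real (card I) - real j) * elem_sym I j y"
    and "elem_sym I (Suc 0) y = (\<Sum>i\<in>I. y i)" and "elem_sym I 0 y = 1" by auto
qed

text \<open>Krawtchouk polynomials for \<open>1 / h\<close> coins, normalised so that \<open>h = 0\<close> gives the Hermite polynomials.\<close>

fun krawtchouk :: "real \<Rightarrow> nat \<Rightarrow> real \<Rightarrow> real" where
  "krawtchouk h 0 x = 1"
| "krawtchouk h (Suc 0) x = x"
| "krawtchouk h (Suc (Suc j)) x = x * krawtchouk h (Suc j) x - (real j + 1) * (1 - real j * h) * krawtchouk h j x"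

lemma krawtchouk_measurable[measurable]: "krawtchouk h j \<in> borel_measurable borel"
  by (intro borel_measurable_continuous_onI, induction h j "0::real" rule: krawtchouk.induct)
     (auto intro!: continuous_intros)

lemma tendsto_krawtchouk:
  assumes "h \<longlonglongrightarrow> 0" "x \<longlonglongrightarrow> y"
  shows "(\<lambda>n. krawtchouk (h n) j (x n)) \<longlonglongrightarrow> wick j 1 y"
proof (induction j rule: less_induct)
  case (less j)
  consider "j = 0" | "j = 1" | i where "j = Suc (Suc i)" by (metis One_nat_def not0_implies_Suc)
  then show ?case
  proof cases
    case 3
    have "(\<lambda>n. krawtchouk (h n) j (x n)) \<longlonglongrightarrow> y * wick (Suc i) 1 y - (real i + 1) * (1 - real i * 0) * wick i 1 y"
      unfolding 3 krawtchouk.simps by (intro tendsto_intros assms less) (auto simp: 3)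
    then show ?thesis by (simp add: 3)
  qed (use assms in auto)
qed

text \<open>After scaling by j! over the j-th power of sqrt (card I), the recurrence of the
  elementary symmetric functions is that of the Krawtchouk polynomials.\<close>

lemma krawtchouk_elem_sym:
  assumes "finite I" "I \<noteq> {}" "\<And>i. i \<in> I \<Longrightarrow> (y i)\<^sup>2 = 1"
  shows "krawtchouk (1 / real (card I)) j ((\<Sum>i\<in>I. y i) / sqrt (real (card I)))
       = fact j / sqrt (real (card I)) ^ j * elem_sym I j y"
proof (induction j rule: less_induct)
  case (less j)
  define N where "N = real (card I)"
  have N: "N > 0" using assms by (simp add: N_def card_gt_0_iff)
  define q where "q = sqrt N"
  have q: "q > 0" "q * q = N" using N by (auto simp: q_def)
  define S where "S = (\<Sum>i\<in>I. y i)"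
  have rec: "(real j + 2) * elem_sym I (Suc (Suc j)) y = S * elem_sym I (Suc j) y - (N - real j) * elem_sym I j y"
    "elem_sym I (Suc 0) y = S" "elem_sym I 0 y = 1" for j
    using elem_sym_recurrence[OF assms(1,3)] by (auto simp: S_def N_def)
  consider "j = 0" | "j = Suc 0" | i where "j = Suc (Suc i)" by (metis not0_implies_Suc)
  then show ?case
  proof cases
    case 1 then show ?thesis using rec by simp
  next
    case 2 then show ?thesis using rec by (simp add: S_def)
  next
    case (3 i)
    have "krawtchouk (1 / N) j (S / q)
        = S / q * (fact (Suc i) / q ^ Suc i * elem_sym I (Suc i) y)
          - (real i + 1) * (1 - real i * (1 / N)) * (fact i / q ^ i * elem_sym I i y)"
      using less[of "Suc i"] less[of i] by (simp add: 3 N_def q_def S_def)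
    also have "(real i + 1) * (1 - real i * (1 / N)) * (fact i / q ^ i * elem_sym I i y)
       = fact (Suc i) / q ^ Suc (Suc i) * ((N - real i) * elem_sym I i y)"
      using N q(1) unfolding q(2)[symmetric] by (simp add: field_simps)
    also have "S / q * (fact (Suc i) / q ^ Suc i * elem_sym I (Suc i) y) = fact (Suc i) / q ^ Suc (Suc i) * (S * elem_sym I (Suc i) y)"
      by simp
    also have "fact (Suc i) / q ^ Suc (Suc i) * (S * elem_sym I (Suc i) y) - fact (Suc i) / q ^ Suc (Suc i) * ((N - real i) * elem_sym I i y)
       = fact (Suc i) / q ^ Suc (Suc i) * ((real i + 2) * elem_sym I (Suc (Suc i)) y)"
      by (subst rec(1)) (rule right_diff_distrib[symmetric])
    also have "\<dots> = ((real i + 2) * fact (Suc i)) / q ^ j * elem_sym I j y"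
      by (simp add: 3 mult_ac del: fact_Suc)
    also have "(real i + 2) * fact (Suc i) = fact j"
      unfolding 3 fact_Suc[of "Suc i"] by simp
    finally show ?thesis by (simp add: N_def q_def S_def)
  qed
qed

text \<open>The tensor bound for coefficients that depend on the degree alone: there are
  \<open>card I choose j\<close> index functions of degree \<open>j\<close>, and each monomial picks
  up \<open>r ^ j\<close>.\<close>

lemma Lp_bounded_elem_sym:
  assumes p: "2 \<le> p" and r: "r = 1 / sqrt (p - 1)" and I: "finite I"
  shows "Lp_bounded (PiM I (\<lambda>_. coin)) p (\<lambda>y. \<Sum>j\<le>m. c j * r ^ j * elem_sym I j y)
           (sqrt (\<Sum>j\<le>m. (c j)\<^sup>2 * real (card I choose j)))"
proof -
  define d where "d j = (if j \<le> m then c j else 0)" for j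
  have fin: "finite (PiE I (\<lambda>_. {0,1::nat}))" using I by (intro finite_PiE) auto
  have group: "(\<Sum>\<nu>\<in>PiE I (\<lambda>_. {0,1}). d (\<Sum>i\<in>I. \<nu> i) ^ s * g \<nu>)
      = (\<Sum>j\<le>m. (c j) ^ s * (\<Sum>\<nu>\<in>PiE I (\<lambda>_. {0,1}). if (\<Sum>i\<in>I. \<nu> i) = j then g \<nu> else 0))"
    if "s > 0" for s :: nat and g :: "('a \<Rightarrow> nat) \<Rightarrow> real"
  proof -
    have "(\<Sum>j\<le>m. (c j) ^ s * (\<Sum>\<nu>\<in>PiE I (\<lambda>_. {0,1}). if (\<Sum>i\<in>I. \<nu> i) = j then g \<nu> else 0))
       = (\<Sum>\<nu>\<in>PiE I (\<lambda>_. {0,1}). \<Sum>j\<le>m. if (\<Sum>i\<in>I. \<nu> i) = j then (c j) ^ s * g \<nu> else 0)"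
      unfolding sum_distrib_left by (subst sum.swap) (auto intro!: sum.cong)
    also have "\<dots> = (\<Sum>\<nu>\<in>PiE I (\<lambda>_. {0,1}). d (\<Sum>i\<in>I. \<nu> i) ^ s * g \<nu>)"
      using that by (intro sum.cong) (auto simp: d_def)
    finally show ?thesis by simp
  qed
  have "Lp_bounded (PiM I (\<lambda>_. coin)) p
           (\<lambda>x. \<Sum>\<nu>\<in>PiE I (\<lambda>_. {0,1}). d (\<Sum>i\<in>I. \<nu> i) * (\<Prod>i\<in>I. (r * x i) ^ \<nu> i))
           (sqrt (\<Sum>\<nu>\<in>PiE I (\<lambda>_. {0,1}). (d (\<Sum>i\<in>I. \<nu> i))\<^sup>2))"
    by (rule Lp_bounded_tensor[where \<psi> = "\<lambda>j y. (r * y) ^ j", OF prob_space_coin p _ I _ Lp_bounded_coin[OF p r]]) auto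
  moreover have "(\<Sum>\<nu>\<in>PiE I (\<lambda>_. {0,1}). d (\<Sum>i\<in>I. \<nu> i) * (\<Prod>i\<in>I. (r * x i) ^ \<nu> i)) = (\<Sum>j\<le>m. c j * r ^ j * elem_sym I j x)" for x
    using group[of 1 "\<lambda>\<nu>. \<Prod>i\<in>I. (r * x i) ^ \<nu> i"]
    by (auto simp: elem_sym_def power_mult_distrib prod.distrib power_sum[symmetric] sum_distrib_left intro!: sum.cong)
  moreover have "(\<Sum>\<nu>\<in>PiE I (\<lambda>_. {0,1}). (d (\<Sum>i\<in>I. \<nu> i))\<^sup>2) = (\<Sum>j\<le>m. (c j)\<^sup>2 * real (card I choose j))"
    using group[of 2 "\<lambda>_. 1"] by (simp add: elem_sym_one[OF I, symmetric] elem_sym_def cong: if_cong)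
  ultimately show ?thesis by simp
qed

text \<open>Weak convergence does not by itself control the p-th moments of unbounded polynomials.
  Skorohod's representation makes copies of the normalised coin sums converge pointwise, and Fatou
  carries the bound to the limit.\<close>

lemma Lp_bounded_wick_gaussian:
  assumes p: "2 \<le> p" and r: "r = 1 / sqrt (p - 1)"
  shows "Lp_bounded std_normal_distribution p (\<lambda>y. \<Sum>j\<le>m. d j * (r ^ j * wick j 1 y / sqrt (fact j)))
           (sqrt (\<Sum>j\<le>m. (d j)\<^sup>2))"
proof -
  interpret coin: prob_space coin by (rule prob_space_coin)
  interpret P: product_prob_space "\<lambda>_::nat. coin" UNIV by unfold_locales
  define M where "M = PiM UNIV (\<lambda>_::nat. coin)"
  interpret M: prob_space M unfolding M_def by (rule P.prob_space_axioms)
  have co[measurable]: "(\<lambda>x. x i) \<in> borel_measurable M" for i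
    unfolding M_def by measurable
  have distr_co: "distr M borel (\<lambda>x. x i) = coin" for i
  proof -
    have "distr M coin (\<lambda>x. x i) = coin"
      unfolding M_def by (rule distr_PiM_component) (auto intro: prob_space_coin)
    then show ?thesis by (metis distr_cong sets_coin)
  qed
  have indep: "M.indep_vars (\<lambda>_. borel) (\<lambda>i x. x i) UNIV"
  proof (subst M.indep_vars_iff_distr_eq_PiM')
    have "distr M (PiM UNIV (\<lambda>i. borel)) (\<lambda>x. \<lambda>i\<in>UNIV. x i) = distr M M (\<lambda>x. x)"
      by (rule distr_cong) (auto simp: M_def intro!: sets_PiM_cong)
    then show "distr M (PiM UNIV (\<lambda>i. borel)) (\<lambda>x. \<lambda>i\<in>UNIV. x i) = PiM UNIV (\<lambda>i. distr M borel (\<lambda>x. x i))"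
      by (simp add: distr_co) (simp add: M_def)
  qed auto
  define S where "S n x = (\<Sum>i<n. x i) / sqrt (real n)" for n :: nat and x :: "nat \<Rightarrow> real"
  have S[measurable]: "S n \<in> borel_measurable M" for n unfolding S_def by measurable
  have tr: "(\<integral>x. f (x i) \<partial>M) = (\<integral>y. f y \<partial>coin)" if [measurable]: "f \<in> borel_measurable borel" for f :: "real \<Rightarrow> real" and i
    by (subst distr_co[of i, symmetric]) (simp add: integral_distr)
  have tri: "integrable M (\<lambda>x. f (x i))" if [measurable]: "f \<in> borel_measurable borel" for f :: "real \<Rightarrow> real" and i
    using integrable_coin[OF that] by (subst (asm) distr_co[of i, symmetric]) (simp add: integrable_distr_eq)
  have "weak_conv_m (\<lambda>n. distr M borel (\<lambda>x. (\<Sum>i<n. x i) / sqrt (real n * 1\<^sup>2))) std_normal_distribution"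
  proof (rule M.central_limit_theorem_zero_mean[OF indep])
    show "integral\<^sup>L M (\<lambda>x. x n) = 0" for n using tr[of "\<lambda>y. y" n] by (simp add: integral_coin)
    then show "(LINT x|M. (x n - integral\<^sup>L M (\<lambda>x. x n))\<^sup>2) = 1\<^sup>2" for n
      using tr[of "\<lambda>y. y\<^sup>2" n] by (simp add: integral_coin)
    show "integrable M (\<lambda>x. (x n)\<^sup>2)" for n using tri[of "\<lambda>y. y\<^sup>2" n] by simp
    show "distr M borel (\<lambda>x. x n) = coin" for n by (rule distr_co)
  qed simp
  then have wc: "weak_conv_m (\<lambda>n. distr M borel (S n)) std_normal_distribution" by (simp add: S_def[abs_def])
  have rd: "real_distribution (distr M borel (S n))" for n
    by (rule M.real_distribution_distr) simp
  obtain \<Omega> :: "real measure" and Ys Y where \<Omega>: "prob_space \<Omega>" and Ys[measurable]: "\<And>n. Ys n \<in> borel_measurable \<Omega>"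
    and dYs: "\<And>n. distr \<Omega> borel (Ys n) = distr M borel (S n)" and Y: "Y \<in> \<Omega> \<rightarrow>\<^sub>M lborel"
    and dY: "distr \<Omega> borel Y = std_normal_distribution" and lim: "\<And>x. x \<in> space \<Omega> \<Longrightarrow> (\<lambda>n. Ys n x) \<longlonglongrightarrow> Y x"
    using Skorohod[OF rd real_dist_normal_dist wc] by blast
  have Y'[measurable]: "Y \<in> borel_measurable \<Omega>" using Y by simp
  \<comment> \<open>\<open>Suc n\<close> coins, so that there is always at least one.\<close>
  define Q where "Q n y = (\<Sum>j\<le>m. d j * (r ^ j * krawtchouk (1 / real (Suc n)) j y / sqrt (fact j)))" for n y
  have Q[measurable]: "Q n \<in> borel_measurable borel" for n unfolding Q_def by measurable
  have bnd: "Lp_bounded \<Omega> p (\<lambda>x. Q n (Ys (Suc n) x)) (sqrt (\<Sum>j\<le>m. (d j)\<^sup>2))" for n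
  proof -
    define I where "I = {..<Suc n}"
    have I: "finite I" "I \<noteq> {}" "card I = Suc n" by (auto simp: I_def)
    \<comment> \<open>Chosen so that \<open>krawtchouk_elem_sym\<close> turns the Krawtchouk sum
      \<open>Q n\<close> into the elementary symmetric sum with coefficients
      \<open>c\<close>.\<close>
    define c where "c j = d j * (sqrt (fact j) / sqrt (real (Suc n)) ^ j)" for j
    have fI: "Lp_bounded (PiM I (\<lambda>_. coin)) p (\<lambda>y. \<Sum>j\<le>m. c j * r ^ j * elem_sym I j y)
           (sqrt (\<Sum>j\<le>m. (c j)\<^sup>2 * real (Suc n choose j)))"
      using Lp_bounded_elem_sym[OF p r I(1), of c m] by (simp add: I)
    \<comment> \<open>\<open>coin\<close> lives on the whole real line, so the signs square to 1
      only almost everywhere.\<close>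
    have AEpm: "AE x in M. (x i)\<^sup>2 = 1" for i
    proof -
      have "AE y in coin. y\<^sup>2 = 1"
        unfolding coin_def by (subst AE_distr_iff) (auto simp: AE_measure_pmf_iff)
      then show ?thesis by (subst (asm) distr_co[of i, symmetric]) (simp add: AE_distr_iff)
    qed
    have "AE x in M. \<forall>i\<in>I. (x i)\<^sup>2 = 1" by (rule AE_finite_allI) (use I AEpm in auto)
    then have AEeq: "AE x in M. Q n (S (Suc n) x) = (\<Sum>j\<le>m. c j * r ^ j * elem_sym I j (restrict x I))"
    proof eventually_elim
      case (elim x)
      have "krawtchouk (1 / real (Suc n)) j (S (Suc n) x) = fact j / sqrt (real (Suc n)) ^ j * elem_sym I j (restrict x I)" for j
        using krawtchouk_elem_sym[OF I(1,2), of "restrict x I" j] elim by (simp add: I S_def I_def cong: sum.cong_simp)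
      then show ?case unfolding Q_def c_def
        by (intro sum.cong) (auto simp: field_simps simp flip: real_sqrt_mult power2_eq_square)
    qed
    have "(\<integral>\<^sup>+x. ennreal (\<bar>Q n (Ys (Suc n) x)\<bar> powr p) \<partial>\<Omega>) = (\<integral>\<^sup>+y. ennreal (\<bar>Q n y\<bar> powr p) \<partial>distr \<Omega> borel (Ys (Suc n)))"
      by (subst nn_integral_distr) auto
    also have "\<dots> = (\<integral>\<^sup>+x. ennreal (\<bar>Q n (S (Suc n) x)\<bar> powr p) \<partial>M)"
      unfolding dYs by (subst nn_integral_distr) auto
    also have "\<dots> = (\<integral>\<^sup>+x. ennreal (\<bar>\<Sum>j\<le>m. c j * r ^ j * elem_sym I j (restrict x I)\<bar> powr p) \<partial>M)"
      by (rule nn_integral_cong_AE) (use AEeq in auto)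
    also have "\<dots> = (\<integral>\<^sup>+y. ennreal (\<bar>\<Sum>j\<le>m. c j * r ^ j * elem_sym I j y\<bar> powr p) \<partial>distr M (PiM I (\<lambda>_. coin)) (\<lambda>x. restrict x I))"
      using fI by (subst nn_integral_distr) (auto simp: M_def Lp_bounded_def)
    also have "distr M (PiM I (\<lambda>_. coin)) (\<lambda>x. restrict x I) = PiM I (\<lambda>_. coin)"
      unfolding M_def using I by (intro P.distr_PiM_restrict_finite) auto
    also have "(\<integral>\<^sup>+y. ennreal (\<bar>\<Sum>j\<le>m. c j * r ^ j * elem_sym I j y\<bar> powr p) \<partial>PiM I (\<lambda>_. coin))
         \<le> ennreal (sqrt (\<Sum>j\<le>m. (c j)\<^sup>2 * real (Suc n choose j)) powr p)"
      using fI by (simp add: Lp_bounded_def)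
    also have "\<dots> \<le> ennreal (sqrt (\<Sum>j\<le>m. (d j)\<^sup>2) powr p)"
    proof (intro ennreal_leI powr_mono2 real_sqrt_le_mono sum_mono)
      fix j
      \<comment> \<open>With N coins the j-th normalised polynomial has variance j! (N choose j) /
        N^j. This is at most 1, so the Gaussian bound holds for every N.\<close>
      have "real (fact j * (Suc n choose j)) \<le> real (Suc n ^ j)"
        using binomial_fact_pow[of "Suc n" j] by (simp only: of_nat_le_iff mult.commute)
      then have *: "fact j * real (Suc n choose j) \<le> real (Suc n) ^ j" by simp
      have "(sqrt (real (Suc n)) ^ j)\<^sup>2 = ((sqrt (real (Suc n)))\<^sup>2) ^ j"
        by (simp only: power_mult[symmetric] mult.commute)
      then have sq: "(sqrt (real (Suc n)) ^ j)\<^sup>2 = real (Suc n) ^ j" by simp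
      have "(c j)\<^sup>2 * real (Suc n choose j) = (d j)\<^sup>2 * (fact j * real (Suc n choose j) / real (Suc n) ^ j)"
        by (simp add: c_def power_mult_distrib power_divide sq del: of_nat_Suc)
      also have "\<dots> \<le> (d j)\<^sup>2 * 1"
        using * by (intro mult_left_mono) (simp_all add: divide_le_eq_1 del: of_nat_Suc)
      finally show "(c j)\<^sup>2 * real (Suc n choose j) \<le> (d j)\<^sup>2" by simp
    qed (use p in \<open>auto intro!: sum_nonneg\<close>)
    finally show ?thesis by (simp add: Lp_bounded_def sum_nonneg)
  qed
  have h0: "(\<lambda>n. 1 / real (Suc n)) \<longlonglongrightarrow> 0"
    using LIMSEQ_inverse_real_of_nat by (simp add: inverse_eq_divide)
  have "Lp_bounded \<Omega> p (\<lambda>x. \<Sum>j\<le>m. d j * (r ^ j * wick j 1 (Y x) / sqrt (fact j))) (sqrt (\<Sum>j\<le>m. (d j)\<^sup>2))"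
  proof (rule Lp_bounded_Fatou[OF bnd tendsto_const])
    show "AE x in \<Omega>. (\<lambda>n. Q n (Ys (Suc n) x)) \<longlonglongrightarrow> (\<Sum>j\<le>m. d j * (r ^ j * wick j 1 (Y x) / sqrt (fact j)))"
      unfolding Q_def
      by (intro AE_I2 tendsto_intros tendsto_krawtchouk h0 LIMSEQ_Suc lim) auto
  qed (use p in auto)
  then show ?thesis
    unfolding Lp_bounded_def dY[symmetric] by (auto simp: nn_integral_distr)
qed

section \<open>Wick polynomials and Gaussian hypercontractivity\<close>

lemma wick_Suc: "wick (Suc n) v x = x * wick n v x - real n * v * wick (n - 1) v x"
  by (cases n) auto

lemma DERIV_wick: "(wick n v has_real_derivative real n * wick (n - 1) v x) (at x)"
proof (induction n rule: less_induct)
  case (less n)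
  consider "n = 0" | m where "n = Suc m" by (cases n) auto
  then show ?case
  proof cases
    case 1 then show ?thesis by simp
  next
    case (2 m)
    have "((\<lambda>x. x * wick m v x - real m * v * wick (m - 1) v x) has_real_derivative
        (1 * wick m v x + (real m * wick (m - 1) v x) * x) - real m * v * (real (m - 1) * wick (m - 1 - 1) v x)) (at x)"
      using 2 by (intro DERIV_diff DERIV_mult DERIV_cmult DERIV_ident less) (cases m, auto)
    moreover have "(\<lambda>x. x * wick m v x - real m * v * wick (m - 1) v x) = wick n v"
      unfolding 2 wick_Suc by (rule refl ext)
    moreover have "(1 * wick m v x + (real m * wick (m - 1) v x) * x) - real m * v * (real (m - 1) * wick (m - 1 - 1) v x) = real n * wick (n - 1) v x"
    proof (cases m)
      case (Suc k)
      have "(1 * wick m v x + (real m * wick (m - 1) v x) * x) - real m * v * (real (m - 1) * wick (m - 1 - 1) v x)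
          = wick m v x + real m * (x * wick k v x - real k * v * wick (k - 1) v x)"
        by (simp add: Suc algebra_simps)
      also have "\<dots> = wick m v x + real m * wick (Suc k) v x" by (simp only: wick_Suc)
      finally show ?thesis by (simp add: Suc 2 algebra_simps)
    qed (simp add: 2)
    ultimately show ?thesis by simp
  qed
qed

lemma hermite_wick: "hermite n x = wick n 1 x / sqrt (fact n)"
proof -
  have *: "(deriv ^^ n) (\<lambda>t. exp (- (t\<^sup>2) / 2)) = (\<lambda>t::real. (- 1) ^ n * wick n 1 t * exp (- (t\<^sup>2) / 2))"
  proof (induction n)
    case (Suc n)
    have "deriv (\<lambda>t::real. (- 1) ^ n * wick n 1 t * exp (- (t\<^sup>2) / 2)) x = (- 1) ^ Suc n * wick (Suc n) 1 x * exp (- (x\<^sup>2) / 2)" for x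
      by (rule DERIV_imp_deriv)
         (auto intro!: derivative_eq_intros DERIV_wick[THEN DERIV_chain2] simp: wick_Suc algebra_simps power2_eq_square)
    then show ?case unfolding funpow.simps comp_apply Suc by (rule ext)
  qed simp
  have "exp (x\<^sup>2 / 2) * exp (- (x\<^sup>2) / 2) = 1" by (simp flip: exp_add)
  moreover have "(- 1 :: real) ^ n * (- 1) ^ n = 1" by (simp flip: power_mult_distrib)
  ultimately show ?thesis unfolding hermite_def *
    by (simp add: divide_simps mult_ac)
qed

lemma borel_measurable_hermite[measurable]: "hermite n \<in> borel_measurable borel"
  unfolding hermite_wick[abs_def] by measurable

lemma wick_scale: "wick n (c\<^sup>2 * v) (c * x) = c ^ n * wick n v x"
  by (induction n v x rule: wick.induct) (auto simp: algebra_simps power2_eq_square)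

lemma wick_hermite:
  assumes "r > 0" shows "sqrt (fact n) * r ^ n * hermite n (x / r) = wick n (r\<^sup>2) x"
  using assms wick_scale[of n r 1 "x / r"] by (simp add: hermite_wick)

lemma wick_0: "wick n 0 x = x ^ n"
  by (induction n "0::real" x rule: wick.induct) auto

text \<open>The generating function exp(x t - v t^2 / 2), handled as a formal power series through
  its differential equation in t.\<close>

definition wick_fps :: "real \<Rightarrow> real \<Rightarrow> real fps" where
  "wick_fps v x = Abs_fps (\<lambda>n. wick n v x / fact n)"

lemma fps_nth_linear_mult:
  "fps_nth ((fps_const x - fps_const v * fps_X) * R) m = x * fps_nth R m - (if m = 0 then 0 else v * fps_nth R (m - 1))"
  for R :: "real fps"
  by (simp add: algebra_simps)

lemma wick_fps_deriv: "fps_deriv (wick_fps v x) = (fps_const x - fps_const v * fps_X) * wick_fps v x"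
proof (rule fps_ext)
  fix n
  have "fps_nth (fps_deriv (wick_fps v x)) n = wick (Suc n) v x / fact n"
    by (simp add: wick_fps_def divide_simps)
  also have "\<dots> = fps_nth ((fps_const x - fps_const v * fps_X) * wick_fps v x) n"
  proof (cases n)
    case (Suc m)
    have "real (Suc m) * v * wick m v x / fact (Suc m) = v * wick m v x / fact m"
      unfolding fact_Suc by (simp del: of_nat_Suc)
    then show ?thesis unfolding fps_nth_linear_mult wick_Suc[of n]
      by (simp add: wick_fps_def Suc diff_divide_distrib del: of_nat_Suc fact_Suc)
  qed (simp add: fps_nth_linear_mult wick_fps_def)
  finally show "fps_nth (fps_deriv (wick_fps v x)) n = fps_nth ((fps_const x - fps_const v * fps_X) * wick_fps v x) n" .
qed

lemma wick_fps_unique: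
  assumes "fps_deriv P = (fps_const x - fps_const v * fps_X) * P" "fps_nth P 0 = 1"
  shows "P = wick_fps v x"
proof (rule fps_ext)
  fix n
  show "fps_nth P n = fps_nth (wick_fps v x) n"
  proof (induction n rule: less_induct)
    case (less n)
    show ?case
    proof (cases n)
      case 0 then show ?thesis using assms by (simp add: wick_fps_def)
    next
      case (Suc m)
      have "real (Suc m) * fps_nth P (Suc m) = fps_nth ((fps_const x - fps_const v * fps_X) * P) m"
        using arg_cong[OF assms(1), of "\<lambda>f. fps_nth f m"] by simp
      also have "\<dots> = fps_nth ((fps_const x - fps_const v * fps_X) * wick_fps v x) m"
        unfolding fps_nth_linear_mult using less[of m] less[of "m - 1"] Suc by simp
      also have "\<dots> = real (Suc m) * fps_nth (wick_fps v x) (Suc m)"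
        using arg_cong[OF wick_fps_deriv, of "\<lambda>f. fps_nth f m" v x] by simp
      finally show ?thesis using Suc by (simp del: of_nat_Suc)
    qed
  qed
qed

text \<open>The exponentials multiply: the product of two generating functions solves the
  differential equation for the added parameters.\<close>

lemma wick_add:
  "wick n (v + w) (x + y) / fact n = (\<Sum>j\<le>n. (wick j v x / fact j) * (wick (n - j) w y / fact (n - j)))"
proof -
  have "wick_fps v x * wick_fps w y = wick_fps (v + w) (x + y)"
  proof (rule wick_fps_unique)
    show "fps_deriv (wick_fps v x * wick_fps w y) = (fps_const (x + y) - fps_const (v + w) * fps_X) * (wick_fps v x * wick_fps w y)"
      unfolding fps_deriv_mult wick_fps_deriv fps_const_add[symmetric] by (simp only: algebra_simps)
  qed (simp add: wick_fps_def)
  from arg_cong[OF this, of "\<lambda>f. fps_nth f n"] show ?thesis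
    by (simp add: wick_fps_def fps_mult_nth atMost_atLeast0)
qed

text \<open>The cap \<open>m\<close> on the entries stays fixed while the degree \<open>n\<close>
  drops in the induction; entries above the degree contribute nothing.\<close>

lemma wick_multinomial_aux:
  assumes "finite K" "n \<le> m"
  shows "wick n (\<Sum>k\<in>K. v k) (\<Sum>k\<in>K. x k) / fact n
    = (\<Sum>\<nu>\<in>PiE K (\<lambda>_. {..m}). if (\<Sum>k\<in>K. \<nu> k) = n then (\<Prod>k\<in>K. wick (\<nu> k) (v k) (x k) / fact (\<nu> k)) else 0)"
  using assms
proof (induction K arbitrary: n rule: finite_induct)
  case empty
  then show ?case by (cases n rule: wick.cases[of "(n, 0, 0)" for n]) (auto simp: wick_0)
next
  case (insert i I)
  define T where "T \<nu> = (\<Prod>k\<in>I. wick (\<nu> k) (v k) (x k) / fact (\<nu> k))" for \<nu>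
  have s: "(\<Sum>k\<in>insert i I. (\<nu>(i := t)) k) = t + (\<Sum>k\<in>I. \<nu> k)" for \<nu> :: "'a \<Rightarrow> nat" and t
  proof -
    have "(\<Sum>k\<in>I. (\<nu>(i := t)) k) = (\<Sum>k\<in>I. \<nu> k)" using insert by (intro sum.cong) auto
    then show ?thesis using insert by simp
  qed
  have pr: "(\<Prod>k\<in>insert i I. wick ((\<nu>(i := t)) k) (v k) (x k) / fact ((\<nu>(i := t)) k)) = (wick t (v i) (x i) / fact t) * T \<nu>" for \<nu> t
  proof -
    have "(\<Prod>k\<in>I. wick ((\<nu>(i := t)) k) (v k) (x k) / fact ((\<nu>(i := t)) k)) = T \<nu>"
      unfolding T_def using insert by (intro prod.cong) auto
    then show ?thesis using insert by simp
  qed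
  have "(\<Sum>\<nu>\<in>PiE (insert i I) (\<lambda>_. {..m}). if (\<Sum>k\<in>insert i I. \<nu> k) = n then (\<Prod>k\<in>insert i I. wick (\<nu> k) (v k) (x k) / fact (\<nu> k)) else 0)
     = (\<Sum>j\<le>m. \<Sum>\<nu>\<in>PiE I (\<lambda>_. {..m}). if j + (\<Sum>k\<in>I. \<nu> k) = n then (wick j (v i) (x i) / fact j) * T \<nu> else 0)"
    unfolding sum_PiE_insert[OF insert(2)] s pr ..
  also have "\<dots> = (\<Sum>j\<le>n. \<Sum>\<nu>\<in>PiE I (\<lambda>_. {..m}). if j + (\<Sum>k\<in>I. \<nu> k) = n then (wick j (v i) (x i) / fact j) * T \<nu> else 0)"
    using insert.prems by (intro sum.mono_neutral_right) (auto intro!: sum.neutral)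
  also have "\<dots> = (\<Sum>j\<le>n. (wick j (v i) (x i) / fact j) * (\<Sum>\<nu>\<in>PiE I (\<lambda>_. {..m}). if (\<Sum>k\<in>I. \<nu> k) = n - j then T \<nu> else 0))"
    unfolding sum_distrib_left by (intro sum.cong refl) auto
  also have "\<dots> = (\<Sum>j\<le>n. (wick j (v i) (x i) / fact j) * (wick (n - j) (\<Sum>k\<in>I. v k) (\<Sum>k\<in>I. x k) / fact (n - j)))"
    unfolding T_def using insert.prems by (intro sum.cong refl) (subst insert.IH, auto)
  also have "\<dots> = wick n (\<Sum>k\<in>insert i I. v k) (\<Sum>k\<in>insert i I. x k) / fact n"
    using insert(1,2) by (simp add: wick_add)
  finally show ?case by simp
qed

abbreviation multi_idx :: "'i set \<Rightarrow> nat \<Rightarrow> ('i \<Rightarrow> nat) set" where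
  "multi_idx K n \<equiv> PiE K (\<lambda>_. {..n})"

text \<open>The multinomial formula has 1 / (\<nu> k)! at each index. One square root of it goes
  into the normalised Hermite polynomial, the other stays here.\<close>

definition chaos_coeff :: "nat \<Rightarrow> 'i set \<Rightarrow> ('i \<Rightarrow> real) \<Rightarrow> ('i \<Rightarrow> nat) \<Rightarrow> real" where
  "chaos_coeff n K c \<nu> = (if (\<Sum>k\<in>K. \<nu> k) = n then fact n * (\<Prod>k\<in>K. c k ^ \<nu> k / sqrt (fact (\<nu> k))) else 0)"

lemma wick_chaos_expansion:
  assumes "finite K"
  shows "wick n (\<Sum>k\<in>K. (c k)\<^sup>2) (\<Sum>k\<in>K. c k * \<xi> k)
    = (\<Sum>\<nu>\<in>multi_idx K n. chaos_coeff n K c \<nu> * (\<Prod>k\<in>K. hermite (\<nu> k) (\<xi> k)))"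
proof -
  have t: "wick j ((c k)\<^sup>2) (c k * \<xi> k) / fact j = c k ^ j / sqrt (fact j) * hermite j (\<xi> k)" for j k
    using wick_scale[of j "c k" 1 "\<xi> k"] by (simp add: hermite_wick)
  have "wick n (\<Sum>k\<in>K. (c k)\<^sup>2) (\<Sum>k\<in>K. c k * \<xi> k) = fact n *
     (\<Sum>\<nu>\<in>multi_idx K n. if (\<Sum>k\<in>K. \<nu> k) = n then (\<Prod>k\<in>K. wick (\<nu> k) ((c k)\<^sup>2) (c k * \<xi> k) / fact (\<nu> k)) else 0)"
    using wick_multinomial_aux[OF assms order_refl, of n "\<lambda>k. (c k)\<^sup>2" "\<lambda>k. c k * \<xi> k"]
    by (simp add: field_simps)
  also have "\<dots> = (\<Sum>\<nu>\<in>multi_idx K n. chaos_coeff n K c \<nu> * (\<Prod>k\<in>K. hermite (\<nu> k) (\<xi> k)))"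
    unfolding t prod.distrib sum_distrib_left chaos_coeff_def by (intro sum.cong) auto
  finally show ?thesis .
qed

text \<open>The multinomial theorem for the numbers \<open>c k * d k\<close>, obtained as the case
  of variance 0, in which Wick powers are ordinary powers.\<close>

lemma chaos_coeff_inner:
  assumes "finite K"
  shows "(\<Sum>\<nu>\<in>multi_idx K n. chaos_coeff n K c \<nu> * chaos_coeff n K d \<nu>) = fact n * (\<Sum>k\<in>K. c k * d k) ^ n"
proof -
  have "(\<Sum>k\<in>K. c k * d k) ^ n / fact n
    = (\<Sum>\<nu>\<in>multi_idx K n. if (\<Sum>k\<in>K. \<nu> k) = n then (\<Prod>k\<in>K. (c k * d k) ^ (\<nu> k) / fact (\<nu> k)) else 0)"
    using wick_multinomial_aux[OF assms order_refl, of n "\<lambda>_. 0" "\<lambda>k. c k * d k"] by (simp add: wick_0 cong: if_cong)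
  then have "fact n * (\<Sum>k\<in>K. c k * d k) ^ n = fact n * fact n *
    (\<Sum>\<nu>\<in>multi_idx K n. if (\<Sum>k\<in>K. \<nu> k) = n then (\<Prod>k\<in>K. (c k * d k) ^ (\<nu> k) / fact (\<nu> k)) else 0)"
    by (simp add: field_simps)
  also have "\<dots> = (\<Sum>\<nu>\<in>multi_idx K n. chaos_coeff n K c \<nu> * chaos_coeff n K d \<nu>)"
  proof -
    have *: "(\<Prod>k\<in>K. c k ^ \<nu> k / sqrt (fact (\<nu> k))) * (\<Prod>k\<in>K. d k ^ \<nu> k / sqrt (fact (\<nu> k))) = (\<Prod>k\<in>K. (c k * d k) ^ (\<nu> k) / fact (\<nu> k))" for \<nu>
      unfolding prod.distrib[symmetric] by (simp add: power_mult_distrib)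
    show ?thesis unfolding sum_distrib_left
      by (intro sum.cong refl) (simp add: chaos_coeff_def *[symmetric])
  qed
  finally show ?thesis by simp
qed

text \<open>In a homogeneous sum of degree n the contraction is the common factor r^n. It is undone
  by R = r^(-n), which is (p - 1)^(n/2).\<close>

lemma Lp_bounded_homogeneous_chaos:
  assumes K: "finite K" and p: "2 \<le> p" and a: "\<And>\<nu>. (\<Sum>k\<in>K. \<nu> k) \<noteq> n \<Longrightarrow> a \<nu> = 0"
  shows "Lp_bounded (PiM K (\<lambda>_. std_normal_distribution)) p
     (\<lambda>x. \<Sum>\<nu>\<in>multi_idx K n. a \<nu> * (\<Prod>k\<in>K. hermite (\<nu> k) (x k)))
     ((p - 1) powr (real n / 2) * sqrt (\<Sum>\<nu>\<in>multi_idx K n. (a \<nu>)\<^sup>2))"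
proof -
  define r where "r = 1 / sqrt (p - 1)"
  define R where "R = (p - 1) powr (real n / 2)"
  have rR: "r ^ n * R = 1"
    using p by (simp add: r_def R_def power_divide powr_half_sqrt[symmetric] powr_powr flip: powr_realpow)
  have ns: "prob_space std_normal_distribution" by (rule prob_space_normal_density) simp
  have [measurable_cong]: "sets std_normal_distribution = sets borel" by simp
  have base: "Lp_bounded std_normal_distribution p (\<lambda>y. \<Sum>j\<in>{..n}. d j * (r ^ j * hermite j y)) (sqrt (\<Sum>j\<in>{..n}. (d j)\<^sup>2))" for d
    using Lp_bounded_wick_gaussian[OF p r_def, of d n] by (simp add: hermite_wick)
  have L: "Lp_bounded (PiM K (\<lambda>_. std_normal_distribution)) p
     (\<lambda>x. \<Sum>\<nu>\<in>multi_idx K n. (R * a \<nu>) * (\<Prod>k\<in>K. r ^ \<nu> k * hermite (\<nu> k) (x k)))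
     (sqrt (\<Sum>\<nu>\<in>multi_idx K n. (R * a \<nu>)\<^sup>2))"
    by (rule Lp_bounded_tensor[where \<psi> = "\<lambda>j y. r ^ j * hermite j y", OF ns p _ K _ base]) measurable
  have e1: "(R * a \<nu>) * (\<Prod>k\<in>K. r ^ \<nu> k * hermite (\<nu> k) (x k)) = a \<nu> * (\<Prod>k\<in>K. hermite (\<nu> k) (x k))" for \<nu> x
  proof (cases "(\<Sum>k\<in>K. \<nu> k) = n")
    case True
    have "(\<Prod>k\<in>K. r ^ \<nu> k * hermite (\<nu> k) (x k)) = r ^ n * (\<Prod>k\<in>K. hermite (\<nu> k) (x k))"
      unfolding prod.distrib True[symmetric] power_sum ..
    then have "(R * a \<nu>) * (\<Prod>k\<in>K. r ^ \<nu> k * hermite (\<nu> k) (x k)) = (r ^ n * R) * (a \<nu> * (\<Prod>k\<in>K. hermite (\<nu> k) (x k)))"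
      by simp
    then show ?thesis unfolding rR by simp
  qed (simp add: a)
  have e2: "sqrt (\<Sum>\<nu>\<in>multi_idx K n. (R * a \<nu>)\<^sup>2) = R * sqrt (\<Sum>\<nu>\<in>multi_idx K n. (a \<nu>)\<^sup>2)"
    by (simp add: power_mult_distrib real_sqrt_mult R_def flip: sum_distrib_left)
  show ?thesis using L unfolding e1 e2 by (simp only: R_def)
qed

section \<open>Sobolev spaces on the coefficient side\<close>

text \<open>Turns unordered sums over the lattice into series, for which measurability and monotone
  limits are at hand.\<close>

definition lat_enum :: "nat \<Rightarrow> int \<times> int" where
  "lat_enum = from_nat_into UNIV"

lemma bij_lat_enum: "bij_betw lat_enum UNIV UNIV"
proof -
  have "infinite (UNIV :: (int \<times> int) set)" by (simp add: finite_prod)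
  then show ?thesis unfolding lat_enum_def by (intro bij_betw_from_nat_into) auto
qed

text \<open>The square of the Japanese bracket of the frequency.\<close>

definition japanese :: "int \<times> int \<Rightarrow> real" where
  "japanese k = 1 + (norm (lat k))\<^sup>2"

lemma japanese_ge1: "1 \<le> japanese k" by (simp add: japanese_def)
lemma japanese_pos: "0 < japanese k" using japanese_ge1[of k] by linarith

text \<open>The squared norm, infinite off the space: membership in the Sobolev space becomes
  finiteness of a measurable function.\<close>

definition sobolev_enn :: "real \<Rightarrow> dist_coeffs \<Rightarrow> ennreal" where
  "sobolev_enn s u = (\<Sum>n. ennreal (japanese (lat_enum n) powr s * (u (lat_enum n))\<^sup>2))"

lemma sobolev_summable_iff: "u \<in> sobolev s \<longleftrightarrow> summable (\<lambda>n. japanese (lat_enum n) powr s * (u (lat_enum n))\<^sup>2)"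
proof -
  have "u \<in> sobolev s \<longleftrightarrow> (\<lambda>n. japanese (lat_enum n) powr s * (u (lat_enum n))\<^sup>2) summable_on UNIV"
    unfolding sobolev_def japanese_def[symmetric]
    using summable_on_reindex_bij_betw[OF bij_lat_enum, of "\<lambda>k. japanese k powr s * (u k)\<^sup>2"] by simp
  then show ?thesis by (simp add: summable_on_UNIV_nonneg_real_iff)
qed

lemma sobolev_norm_suminf:
  assumes "u \<in> sobolev s"
  shows "(\<lambda>n. japanese (lat_enum n) powr s * (u (lat_enum n))\<^sup>2) sums (sobolev_norm s u)\<^sup>2"
proof -
  define f where "f = (\<lambda>k. japanese k powr s * (u k)\<^sup>2)"
  have f: "f summable_on UNIV" using assms by (simp add: sobolev_def f_def japanese_def)
  have f0: "f k \<ge> 0" for k by (simp add: f_def)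
  have "((\<lambda>n. f (lat_enum n)) has_sum infsum f UNIV) UNIV"
    using has_sum_reindex_bij_betw[OF bij_lat_enum, of f "infsum f UNIV"] f by simp
  then have "(\<lambda>n. f (lat_enum n)) sums infsum f UNIV" by (rule has_sum_imp_sums)
  moreover have "(sobolev_norm s u)\<^sup>2 = infsum f UNIV"
    using infsum_nonneg[of UNIV f] f0 by (simp add: sobolev_norm_def f_def japanese_def)
  ultimately show ?thesis by (simp add: f_def)
qed

lemma sobolev_enn_finite_iff: "u \<in> sobolev s \<longleftrightarrow> sobolev_enn s u < \<top>"
proof
  assume "u \<in> sobolev s"
  then show "sobolev_enn s u < \<top>"
    unfolding sobolev_summable_iff sobolev_enn_def by (simp add: suminf_ennreal2 )
next
  assume "sobolev_enn s u < \<top>"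
  then show "u \<in> sobolev s"
    unfolding sobolev_summable_iff sobolev_enn_def by (intro summable_suminf_not_top) auto
qed

text \<open>Valid off the space too, since a divergent sum and the real value of infinity both
  default to 0. This makes the norm measurable on all families with measurable coordinates.\<close>

lemma sobolev_norm_enn: "sobolev_norm s u = sqrt (enn2real (sobolev_enn s u))"
proof (cases "u \<in> sobolev s")
  case True
  have "sobolev_enn s u = ennreal ((sobolev_norm s u)\<^sup>2)"
    unfolding sobolev_enn_def
    by (rule suminf_ennreal_eq[OF _ sobolev_norm_suminf[OF True]]) auto
  then show ?thesis by (simp add: sobolev_norm_def infsum_nonneg)
next
  case False
  then have "sobolev_enn s u = \<top>" by (simp add: sobolev_enn_finite_iff less_top[symmetric])
  moreover have "sobolev_norm s u = 0"
    using False by (simp add: sobolev_norm_def sobolev_def infsum_not_exists)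
  ultimately show ?thesis by simp
qed

lemma sobolev_norm_nonneg: "0 \<le> sobolev_norm s u"
  by (simp add: sobolev_norm_enn)

lemma measurable_sobolev_enn[measurable]:
  assumes [measurable]: "\<And>k. (\<lambda>z. F z k) \<in> borel_measurable M"
  shows "(\<lambda>z. sobolev_enn s (F z)) \<in> borel_measurable M"
  unfolding sobolev_enn_def by measurable

lemma measurable_sobolev_norm[measurable]:
  assumes [measurable]: "\<And>k. (\<lambda>z. F z k) \<in> borel_measurable M"
  shows "(\<lambda>z. sobolev_norm s (F z)) \<in> borel_measurable M"
  unfolding sobolev_norm_enn by measurable

lemma sobolev_coord_le:
  assumes "u \<in> sobolev s"
  shows "japanese k powr s * (u k)\<^sup>2 \<le> (sobolev_norm s u)\<^sup>2"
proof -
  obtain n where n: "lat_enum n = k" using bij_lat_enum by (metis bij_betw_iff_bijections iso_tuple_UNIV_I)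
  have "(\<Sum>i\<in>{n}. japanese (lat_enum i) powr s * (u (lat_enum i))\<^sup>2) \<le> (sobolev_norm s u)\<^sup>2"
    using sobolev_norm_suminf[OF assms] by (metis (no_types, lifting) finite.emptyI finite_insert mult_nonneg_nonneg powr_ge_zero sum_le_suminf sums_iff zero_le_power2)
  then show ?thesis by (simp add: n)
qed

lemma sobolev_antimono:
  assumes "u \<in> sobolev s" "t \<le> s"
  shows "u \<in> sobolev t" "sobolev_norm t u \<le> sobolev_norm s u"
proof -
  have le: "japanese k powr t * (u k)\<^sup>2 \<le> japanese k powr s * (u k)\<^sup>2" for k
    using assms japanese_ge1[of k] by (intro mult_right_mono powr_mono) auto
  have "sobolev_enn t u \<le> sobolev_enn s u"
    unfolding sobolev_enn_def by (intro suminf_le ennreal_leI le) auto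
  moreover have "sobolev_enn s u < \<top>" using assms by (simp add: sobolev_enn_finite_iff)
  ultimately show "u \<in> sobolev t" "sobolev_norm t u \<le> sobolev_norm s u"
    by (auto simp: sobolev_enn_finite_iff sobolev_norm_enn enn2real_mono)
qed

section \<open>Borel sets of the Sobolev spaces\<close>

lemma space_sobolev_borel: "space (sobolev_borel s) = sobolev s"
proof -
  interpret S: Metric_space "sobolev s" "sobolev_dist s" by (rule Metric_space_sobolev)
  show ?thesis unfolding sobolev_borel_def
    by (rule space_measure_of) (auto dest: openin_subset simp: S.openin_mtopology)
qed

lemma sets_sobolev_borel:
  "sets (sobolev_borel s) = sigma_sets (sobolev s) {U. openin (Metric_space.mtopology (sobolev s) (sobolev_dist s)) U}"
proof -
  interpret S: Metric_space "sobolev s" "sobolev_dist s" by (rule Metric_space_sobolev)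
  show ?thesis unfolding sobolev_borel_def
    by (rule sets_measure_of) (auto dest: openin_subset simp: S.openin_mtopology)
qed

text \<open>Evaluation at a frequency is continuous: the weighted coordinate difference is at most
  the distance.\<close>

lemma measurable_sobolev_coord: "(\<lambda>u. u k) \<in> borel_measurable (sobolev_borel s)"
proof (rule borel_measurableI_greater, unfold space_sobolev_borel)
  fix c :: real
  interpret S: Metric_space "sobolev s" "sobolev_dist s" by (rule Metric_space_sobolev)
  have "openin S.mtopology {u \<in> sobolev s. c < u k}"
  proof (subst S.openin_mtopology, intro conjI allI impI)
    fix u assume u: "u \<in> {u \<in> sobolev s. c < u k}"
    define w where "w = sqrt (japanese k powr s)"
    have w: "w > 0" using japanese_pos[of k] by (simp add: w_def)
    show "\<exists>r>0. S.mball u r \<subseteq> {u \<in> sobolev s. c < u k}"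
    proof (intro exI[of _ "w * (u k - c)"] conjI subsetI)
      show "0 < w * (u k - c)" using u w by simp
      fix v assume "v \<in> S.mball u (w * (u k - c))"
      then have v: "v \<in> sobolev s" and d: "sobolev_dist s u v < w * (u k - c)" by (auto simp: S.in_mball)
      have "(w * (u k - v k))\<^sup>2 \<le> (sobolev_norm s (\<lambda>k. u k - v k))\<^sup>2"
        using sobolev_coord_le[OF sobolev_diff[of u s v], of k] u v by (simp add: w_def power_mult_distrib)
      then have "w * (u k - v k) \<le> sobolev_norm s (\<lambda>k. u k - v k)"
        using sobolev_norm_nonneg by (meson power2_le_imp_le)
      then have "w * (u k - v k) < w * (u k - c)" using d by (simp add: sobolev_dist_def)
      then show "v \<in> {u \<in> sobolev s. c < u k}" using w v by simp
    qed
  qed auto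
  then show "{u \<in> sobolev s. c < u k} \<in> sets (sobolev_borel s)"
    unfolding sets_sobolev_borel by (intro sigma_sets.Basic) simp
qed

text \<open>Finitely supported rational families, coded as lists so that they are countable by their
  type.\<close>

definition rat_coeffs :: "((int \<times> int) \<times> rat) list \<Rightarrow> dist_coeffs" where
  "rat_coeffs xs k = (case map_of xs k of None \<Rightarrow> 0 | Some q \<Rightarrow> of_rat q)"

lemma finite_support_sobolev:
  assumes "finite A" "\<And>k. k \<notin> A \<Longrightarrow> u k = 0"
  shows "u \<in> sobolev s" "sobolev_norm s u = sqrt (\<Sum>k\<in>A. japanese k powr s * (u k)\<^sup>2)"
proof -
  define f where "f = (\<lambda>k. japanese k powr s * (u k)\<^sup>2)"
  have "(f has_sum (\<Sum>k\<in>A. f k)) UNIV"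
    using has_sum_finite[OF assms(1), of f]
    by (rule has_sum_cong_neutral[THEN iffD1, rotated -1]) (auto simp: f_def assms)
  then show "u \<in> sobolev s" "sobolev_norm s u = sqrt (\<Sum>k\<in>A. japanese k powr s * (u k)\<^sup>2)"
    using infsumI[of f UNIV] by (auto simp: sobolev_def sobolev_norm_def f_def japanese_def summable_on_def)
qed

lemma rat_coeffs_sobolev: "rat_coeffs xs \<in> sobolev s"
  by (rule finite_support_sobolev[of "fst ` set xs"])
     (auto simp: rat_coeffs_def split: option.split dest: map_of_SomeD intro: rev_image_eqI)

lemma rat_coeffs_dense:
  assumes "u \<in> sobolev s" "e > 0"
  shows "\<exists>xs. sobolev_dist s u (rat_coeffs xs) < e"
proof -
  define w where "w k = japanese k powr s" for k
  have w: "w k > 0" for k using japanese_pos[of k] by (simp add: w_def)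
  define f where "f k = w k * (u k)\<^sup>2" for k
  have f: "f summable_on UNIV" using assms by (simp add: sobolev_def f_def[abs_def] w_def japanese_def)
  have f0: "f k \<ge> 0" for k using w[of k] by (simp add: f_def)
  obtain A where A: "finite A" "dist (sum f A) (infsum f UNIV) \<le> e\<^sup>2 / 4"
    using infsum_finite_approximation[OF f, of "e\<^sup>2 / 4"] assms by auto
  have tail: "infsum f (- A) \<le> e\<^sup>2 / 4"
  proof -
    have "infsum f UNIV = infsum f A + infsum f (- A)"
      using infsum_Un_disjoint[of f A "- A"] f A(1) by (simp add: summable_on_subset_banach)
    then show ?thesis using A(2) A(1) by (simp add: dist_real_def)
  qed
  \<comment> \<open>Half of the tolerance e^2 / 2 is spent on the tail. The frequencies in
    \<open>A\<close> share the other half, and the added 1 keeps the quotient meaningful for empty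
    \<open>A\<close>.\<close>
  define \<eta> where "\<eta> k = sqrt (e\<^sup>2 / (4 * (real (card A) + 1)) / w k)" for k
  have \<eta>: "\<eta> k > 0" for k using w[of k] assms by (auto simp: \<eta>_def intro!: divide_pos_pos)
  have "\<exists>q. \<bar>u k - real_of_rat q\<bar> < \<eta> k" for k
  proof -
    obtain q where "u k - \<eta> k < real_of_rat q" "real_of_rat q < u k + \<eta> k"
      using of_rat_dense[of "u k - \<eta> k" "u k + \<eta> k"] \<eta>[of k] by auto
    then show ?thesis by (intro exI[of _ q]) auto
  qed
  then obtain q where q: "\<And>k. \<bar>u k - real_of_rat (q k)\<bar> < \<eta> k" by metis
  obtain as where as: "set as = A" "distinct as" using finite_distinct_list[OF A(1)] by blast
  define xs where "xs = map (\<lambda>k. (k, q k)) as"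
  have rc: "rat_coeffs xs k = (if k \<in> A then real_of_rat (q k) else 0)" for k
    by (simp add: rat_coeffs_def xs_def map_of_map_restrict restrict_map_def as)
  define g where "g k = w k * (u k - rat_coeffs xs k)\<^sup>2" for k
  have g: "g summable_on UNIV"
    using sobolev_diff[OF assms(1) rat_coeffs_sobolev[of xs s]] by (simp add: sobolev_def g_def[abs_def] w_def japanese_def)
  have "infsum g UNIV = infsum g A + infsum g (- A)"
    using infsum_Un_disjoint[of g A "- A"] g A(1) by (simp add: summable_on_subset_banach)
  also have "infsum g (- A) = infsum f (- A)"
    by (rule infsum_cong) (simp add: g_def f_def rc)
  also have "infsum g A \<le> (\<Sum>k\<in>A. e\<^sup>2 / (4 * (real (card A) + 1)))"
    unfolding infsum_finite[OF A(1)]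
  proof (rule sum_mono)
    fix k assume k: "k \<in> A"
    have "(u k - rat_coeffs xs k)\<^sup>2 \<le> (\<eta> k)\<^sup>2"
      using q[of k] k by (simp add: rc abs_le_square_iff[symmetric] less_imp_le)
    then have "g k \<le> w k * (\<eta> k)\<^sup>2" unfolding g_def using w[of k] by (intro mult_left_mono) auto
    also have "\<dots> = e\<^sup>2 / (4 * (real (card A) + 1))"
      using w[of k] by (simp add: \<eta>_def)
    finally show "g k \<le> e\<^sup>2 / (4 * (real (card A) + 1))" .
  qed
  also have "\<dots> \<le> e\<^sup>2 / 4"
    by (simp add: field_simps mult_left_mono)
  finally have "infsum g UNIV \<le> e\<^sup>2 / 2" using tail by simp
  also have "\<dots> < e\<^sup>2" using assms by simp
  finally have "sqrt (infsum g UNIV) < sqrt (e\<^sup>2)" by (simp only: real_sqrt_less_iff)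
  then have "sobolev_dist s u (rat_coeffs xs) < e"
    using assms by (simp add: sobolev_dist_def sobolev_norm_def g_def[abs_def] w_def japanese_def)
  then show ?thesis by blast
qed

text \<open>By separability an open set is a countable union of balls with rational centres and
  radii, and the distance to a fixed centre is measurable once the coordinates are.\<close>

lemma measurable_sobolevI:
  assumes F: "\<And>z. z \<in> space M \<Longrightarrow> F z \<in> sobolev s"
    and m[measurable]: "\<And>k. (\<lambda>z. F z k) \<in> borel_measurable M"
  shows "F \<in> measurable M (sobolev_borel s)"
proof -
  interpret S: Metric_space "sobolev s" "sobolev_dist s" by (rule Metric_space_sobolev)
  show ?thesis unfolding sobolev_borel_def
  proof (rule measurable_measure_of)
    fix U assume "U \<in> {U. openin S.mtopology U}"
    then have U: "U \<subseteq> sobolev s" "\<And>u. u \<in> U \<Longrightarrow> \<exists>r>0. S.mball u r \<subseteq> U"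
      by (auto simp: S.openin_mtopology)
    define P where "P = {(xs, q :: rat). S.mball (rat_coeffs xs) (of_rat q) \<subseteq> U}"
    have "countable P" by (rule countable_subset[OF subset_UNIV]) simp
    have "F -` U \<inter> space M = (\<Union>(xs, q)\<in>P. {z \<in> space M. sobolev_dist s (rat_coeffs xs) (F z) < of_rat q})"
    proof (intro set_eqI iffI)
      fix z assume "z \<in> F -` U \<inter> space M"
      then have z: "z \<in> space M" "F z \<in> U" by auto
      then obtain r where r: "r > 0" "S.mball (F z) r \<subseteq> U" using U by blast
      obtain q where q: "0 < real_of_rat q" "real_of_rat q < r / 2" using of_rat_dense[of 0 "r / 2"] r by auto
      obtain xs where xs: "sobolev_dist s (F z) (rat_coeffs xs) < real_of_rat q"
        using rat_coeffs_dense[OF F[OF z(1)] q(1)] by blast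
      have "S.mball (rat_coeffs xs) (of_rat q) \<subseteq> S.mball (F z) r"
      proof
        fix v assume "v \<in> S.mball (rat_coeffs xs) (of_rat q)"
        then have v: "v \<in> sobolev s" "sobolev_dist s (rat_coeffs xs) v < of_rat q" by (auto simp: S.in_mball)
        then show "v \<in> S.mball (F z) r"
          using S.triangle[of "F z" "rat_coeffs xs" v] F[OF z(1)] rat_coeffs_sobolev[of xs s] xs q
          by (auto simp: S.in_mball)
      qed
      then have "(xs, q) \<in> P" using r by (auto simp: P_def)
      then show "z \<in> (\<Union>(xs, q)\<in>P. {z \<in> space M. sobolev_dist s (rat_coeffs xs) (F z) < of_rat q})"
        using xs z by (auto simp: S.commute intro!: bexI[of _ "(xs, q)"])
    next
      fix z assume "z \<in> (\<Union>(xs, q)\<in>P. {z \<in> space M. sobolev_dist s (rat_coeffs xs) (F z) < of_rat q})"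
      then obtain xs q where "(xs, q) \<in> P" "z \<in> space M" "sobolev_dist s (rat_coeffs xs) (F z) < of_rat q" by auto
      then show "z \<in> F -` U \<inter> space M"
        using F[of z] rat_coeffs_sobolev[of xs s] by (auto simp: P_def S.in_mball subset_iff)
    qed
    also have "\<dots> \<in> sets M"
    proof (rule sets.countable_UN'[OF \<open>countable P\<close>], clarify)
      fix xs q
      have "(\<lambda>z. sobolev_norm s (\<lambda>k. rat_coeffs xs k - F z k)) \<in> borel_measurable M"
        by (rule measurable_sobolev_norm) simp
      then show "{z \<in> space M. sobolev_dist s (rat_coeffs xs) (F z) < of_rat q} \<in> sets M"
        unfolding sobolev_dist_def by measurable
    qed
    finally show "F -` U \<inter> space M \<in> sets M" .
  qed (use F in \<open>auto simp: S.openin_mtopology\<close>)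
qed

text \<open>Squares of coordinate bounds add up by \<open>Lp_bounded_l2\<close>, uniformly in the
  number of coordinates; Fatou passes to the full norm where the series converges.\<close>

lemma Lp_bounded_sobolev_norm:
  assumes p: "2 \<le> p" and F: "AE z in M. F z \<in> sobolev s"
    and B: "\<And>k. Lp_bounded M p (\<lambda>z. F z k) (B k)"
    and S: "\<And>A. finite A \<Longrightarrow> (\<Sum>k\<in>A. japanese k powr s * (B k)\<^sup>2) \<le> S\<^sup>2" and S0: "0 \<le> S"
  shows "Lp_bounded M p (\<lambda>z. sobolev_norm s (F z)) S"
proof -
  have [measurable]: "(\<lambda>z. F z k) \<in> borel_measurable M" for k using B by (rule Lp_bounded_measurable)
  define w where "w k = sqrt (japanese k powr s)" for k
  have w2: "(w k)\<^sup>2 = japanese k powr s" for k by (simp add: w_def)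
  have wB: "Lp_bounded M p (\<lambda>z. w k * F z k) (w k * B k)" for k
  proof -
    have "(\<integral>\<^sup>+z. ennreal (\<bar>w k * F z k\<bar> powr p) \<partial>M) = (\<integral>\<^sup>+z. ennreal (w k powr p) * ennreal (\<bar>F z k\<bar> powr p) \<partial>M)"
      by (intro nn_integral_cong) (simp add: abs_mult powr_mult w_def flip: ennreal_mult)
    also have "\<dots> = ennreal (w k powr p) * (\<integral>\<^sup>+z. ennreal (\<bar>F z k\<bar> powr p) \<partial>M)"
      by (rule nn_integral_cmult) simp
    also have "\<dots> \<le> ennreal (w k powr p) * ennreal (B k powr p)"
      using B by (intro mult_left_mono) (auto simp: Lp_bounded_def)
    finally show ?thesis using B[of k] by (simp add: Lp_bounded_def powr_mult w_def flip: ennreal_mult)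
  qed
  have part: "Lp_bounded M p (\<lambda>z. sqrt (\<Sum>n<N. japanese (lat_enum n) powr s * (F z (lat_enum n))\<^sup>2)) S" for N
  proof -
    have inj: "inj_on lat_enum {..<N}" using bij_lat_enum by (meson bij_betw_def inj_on_subset subset_UNIV)
    have "Lp_bounded M p (\<lambda>z. sqrt (\<Sum>n<N. (w (lat_enum n) * F z (lat_enum n))\<^sup>2)) (sqrt (\<Sum>n<N. (w (lat_enum n) * B (lat_enum n))\<^sup>2))"
      by (rule Lp_bounded_l2[OF _ p wB]) simp
    moreover have "(\<Sum>n<N. (w (lat_enum n) * B (lat_enum n))\<^sup>2) \<le> S\<^sup>2"
      using S[of "lat_enum ` {..<N}"] by (simp add: power_mult_distrib w2 sum.reindex[OF inj])
    then have "sqrt (\<Sum>n<N. (w (lat_enum n) * B (lat_enum n))\<^sup>2) \<le> S" using S0 real_le_lsqrt by blast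
    ultimately have "Lp_bounded M p (\<lambda>z. sqrt (\<Sum>n<N. (w (lat_enum n) * F z (lat_enum n))\<^sup>2)) S"
      using p by (auto intro: Lp_bounded_mono)
    then show ?thesis by (simp only: power_mult_distrib w2)
  qed
  show ?thesis
  proof (rule Lp_bounded_Fatou[OF part tendsto_const])
    show "AE z in M. (\<lambda>N. sqrt (\<Sum>n<N. japanese (lat_enum n) powr s * (F z (lat_enum n))\<^sup>2)) \<longlonglongrightarrow> sobolev_norm s (F z)"
      using F
    proof eventually_elim
      case (elim z)
      have "(\<lambda>N. sqrt (\<Sum>n<N. japanese (lat_enum n) powr s * (F z (lat_enum n))\<^sup>2)) \<longlonglongrightarrow> sqrt ((sobolev_norm s (F z))\<^sup>2)"
        using sobolev_norm_suminf[OF elim] by (intro tendsto_real_sqrt) (simp add: sums_def)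
      then show ?case by (simp add: sobolev_norm_nonneg)
    qed
  qed (use p in auto)
qed

text \<open>The extended squared norm has finite expectation, hence it is finite almost
  everywhere.\<close>

lemma AE_sobolev:
  assumes B: "\<And>k. Lp_bounded M 2 (\<lambda>z. F z k) (B k)"
    and S: "\<And>A. finite A \<Longrightarrow> (\<Sum>k\<in>A. japanese k powr s * (B k)\<^sup>2) \<le> S"
  shows "AE z in M. F z \<in> sobolev s"
proof -
  have [measurable]: "(\<lambda>z. F z k) \<in> borel_measurable M" for k using B by (rule Lp_bounded_measurable)
  have S0: "S \<ge> 0" using S[of "{}"] by simp
  have "(\<integral>\<^sup>+z. sobolev_enn s (F z) \<partial>M) = (\<Sum>n. \<integral>\<^sup>+z. ennreal (japanese (lat_enum n) powr s * (F z (lat_enum n))\<^sup>2) \<partial>M)"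
    unfolding sobolev_enn_def by (rule nn_integral_suminf) simp
  also have "\<dots> \<le> (\<Sum>n. ennreal (japanese (lat_enum n) powr s * (B (lat_enum n))\<^sup>2))"
  proof (intro suminf_le)
    fix n
    have "(\<integral>\<^sup>+z. ennreal (japanese (lat_enum n) powr s * (F z (lat_enum n))\<^sup>2) \<partial>M)
       = (\<integral>\<^sup>+z. ennreal (japanese (lat_enum n) powr s) * ennreal ((F z (lat_enum n))\<^sup>2) \<partial>M)"
      by (simp add: ennreal_mult)
    also have "\<dots> = ennreal (japanese (lat_enum n) powr s) * (\<integral>\<^sup>+z. ennreal ((F z (lat_enum n))\<^sup>2) \<partial>M)"
      by (rule nn_integral_cmult) simp
    also have "\<dots> \<le> ennreal (japanese (lat_enum n) powr s) * ennreal ((B (lat_enum n))\<^sup>2)"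
      using B[of "lat_enum n"] by (intro mult_left_mono) (auto simp: Lp_bounded_def)
    finally show "(\<integral>\<^sup>+z. ennreal (japanese (lat_enum n) powr s * (F z (lat_enum n))\<^sup>2) \<partial>M) \<le> ennreal (japanese (lat_enum n) powr s * (B (lat_enum n))\<^sup>2)"
      by (simp add: ennreal_mult)
  qed auto
  also have "\<dots> \<le> ennreal S"
  proof (rule suminf_le_const)
    fix N
    have inj: "inj_on lat_enum {..<N}" using bij_lat_enum by (meson bij_betw_def inj_on_subset subset_UNIV)
    have "(\<Sum>n<N. ennreal (japanese (lat_enum n) powr s * (B (lat_enum n))\<^sup>2)) = ennreal (\<Sum>n<N. japanese (lat_enum n) powr s * (B (lat_enum n))\<^sup>2)"
      by (rule sum_ennreal) simp
    also have "\<dots> \<le> ennreal S"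
      using S[of "lat_enum ` {..<N}"] by (intro ennreal_leI) (simp add: sum.reindex[OF inj])
    finally show "(\<Sum>n<N. ennreal (japanese (lat_enum n) powr s * (B (lat_enum n))\<^sup>2)) \<le> ennreal S" .
  qed simp
  also have "\<dots> < \<top>" by simp
  finally have "AE z in M. sobolev_enn s (F z) \<noteq> \<infinity>"
    by (intro nn_integral_PInf_AE) (auto simp: less_top)
  then show ?thesis by (simp add: sobolev_enn_finite_iff less_top)
qed

section \<open>Independence from characteristic functions\<close>

text \<open>Under the probability measure with density w / E w, the variable \<open>X\<close> has
  the characteristic function of \<nu>, and Levy's theorem identifies its law. If E w = 0, the
  weight vanishes almost everywhere.\<close>

lemma (in prob_space) weighted_Levy_uniqueness:
  fixes X w :: "'a \<Rightarrow> real"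
  assumes [measurable]: "X \<in> borel_measurable M" "w \<in> borel_measurable M"
    and w: "\<And>z. 0 \<le> w z" "\<And>z. w z \<le> C" and nu: "real_distribution \<nu>"
    and char: "\<And>s. (CLINT z|M. iexp (s * X z) * complex_of_real (w z)) = char \<nu> s * complex_of_real (expectation w)"
    and A[measurable]: "A \<in> sets borel"
  shows "expectation (\<lambda>z. indicator A (X z) * w z) = measure \<nu> A * expectation w"
proof -
  have iw: "integrable M w" by (rule integrable_const_bound[where B = C]) (use w in auto)
  show ?thesis
  proof (cases "expectation w = 0")
    case True
    then have "AE z in M. w z = 0" using integral_nonneg_eq_0_iff_AE[OF iw] w by simp
    then have "expectation (\<lambda>z. indicator A (X z) * w z) = expectation (\<lambda>_. 0)"
      by (intro integral_cong_AE) auto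
    then show ?thesis using True by simp
  next
    case False
    then have c: "expectation w > 0" using integral_nonneg_AE[of w M] w by (simp add: order_less_le)
    define c where "c = expectation w"
    define D where "D = density M (\<lambda>z. ennreal (w z / c))"
    have "emeasure D (space D) = ennreal (expectation (\<lambda>z. w z / c))"
      unfolding D_def using iw w c by (simp add: emeasure_density nn_integral_eq_integral c_def cong: nn_integral_cong)
    also have "\<dots> = 1" using c by (simp add: c_def)
    finally interpret D: prob_space D by (intro prob_spaceI) simp
    interpret N: real_distribution \<nu> by fact
    have [measurable]: "X \<in> borel_measurable D" by (simp add: D_def)
    have rd: "real_distribution (distr D borel X)" by (rule D.real_distribution_distr) simp
    have "distr D borel X = \<nu>"
    proof (rule Levy_uniqueness[OF rd nu], rule ext)
      fix s
      have "char (distr D borel X) s = (CLINT z|D. iexp (s * X z))"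
        unfolding char_def by (rule integral_distr) auto
      also have "\<dots> = (CLINT z|M. (w z / c) *\<^sub>R iexp (s * X z))"
        unfolding D_def using w c by (intro integral_density) (auto simp: c_def)
      also have "\<dots> = (CLINT z|M. (iexp (s * X z) * complex_of_real (w z)) / complex_of_real c)"
        by (intro Bochner_Integration.integral_cong) (auto simp: scaleR_conv_of_real)
      also have "\<dots> = (CLINT z|M. iexp (s * X z) * complex_of_real (w z)) / complex_of_real c"
        by simp
      also have "\<dots> = char \<nu> s" using c unfolding char by (simp add: c_def)
      finally show "char (distr D borel X) s = char \<nu> s" .
    qed
    then have "measure \<nu> A = measure (distr D borel X) A" by simp
    also have "\<dots> = (LINT y|distr D borel X. indicator A y)" by simp
    also have "\<dots> = (LINT z|D. indicator A (X z))" by (rule integral_distr) auto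
    also have "\<dots> = (LINT z|M. (w z / c) *\<^sub>R indicator A (X z))"
      unfolding D_def using w c by (intro integral_density) (auto simp: c_def)
    also have "\<dots> = (LINT z|M. (indicator A (X z) * w z) / c)"
      by (intro Bochner_Integration.integral_cong) auto
    also have "\<dots> = expectation (\<lambda>z. indicator A (X z) * w z) / c" by simp
    finally show ?thesis using c by (simp add: c_def)
  qed
qed

text \<open>Exchanges exponentials of \<open>X\<close> for indicators of \<open>X\<close> while a
  bounded variable \<open>V\<close>, which stands for all other coordinates, is carried
  along.\<close>

lemma (in prob_space) char_factor_indicator:
  fixes X V :: "'a \<Rightarrow> real"
  assumes [measurable]: "X \<in> borel_measurable M" "V \<in> borel_measurable M"
    and V: "\<And>z. \<bar>V z\<bar> \<le> C" and nu: "real_distribution \<nu>"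
    and char1: "\<And>s. (CLINT z|M. iexp (s * X z)) = char \<nu> s"
    and charV: "\<And>s. (CLINT z|M. iexp (s * X z) * complex_of_real (V z)) = char \<nu> s * complex_of_real (expectation V)"
    and A[measurable]: "A \<in> sets borel"
  shows "expectation (\<lambda>z. indicator A (X z) * V z) = measure \<nu> A * expectation V"
proof -
  have C: "C \<ge> 0" using V[of undefined] by linarith
  have iV: "integrable M V" by (rule integrable_const_bound[where B = C]) (use V in auto)
  have i1: "integrable M (\<lambda>z. iexp (s * X z) * complex_of_real (V z))" for s
    by (rule integrable_const_bound[where B = C]) (use V in \<open>auto simp: norm_mult\<close>)
  have i2: "integrable M (\<lambda>z. iexp (s * X z) * complex_of_real C)" for s
    by (rule integrable_const_bound[where B = C]) (use C in \<open>auto simp: norm_mult\<close>)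
  have iA: "integrable M (\<lambda>z. indicator A (X z) * V z)"
    by (rule integrable_const_bound[where B = C]) (use V C in \<open>auto simp: indicator_def\<close>)
  have iA2: "integrable M (\<lambda>z. indicator A (X z) * C)"
    by (rule integrable_const_bound[where B = C]) (use V C in \<open>auto simp: indicator_def\<close>)
  \<comment> \<open>Levy's theorem needs a nonnegative weight.\<close>
  have VC: "0 \<le> V z + C" "V z + C \<le> 2 * C" for z using V[of z] by linarith+
  have "expectation (\<lambda>z. indicator A (X z) * (V z + C)) = measure \<nu> A * expectation (\<lambda>z. V z + C)"
  proof (rule weighted_Levy_uniqueness[OF _ _ VC nu])
    fix s
    have "(CLINT z|M. iexp (s * X z) * complex_of_real (V z + C))
        = (CLINT z|M. iexp (s * X z) * complex_of_real (V z) + iexp (s * X z) * complex_of_real C)"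
      by (simp add: algebra_simps)
    also have "\<dots> = (CLINT z|M. iexp (s * X z) * complex_of_real (V z)) + (CLINT z|M. iexp (s * X z) * complex_of_real C)"
      by (rule Bochner_Integration.integral_add[OF i1 i2])
    also have "\<dots> = char \<nu> s * complex_of_real (expectation (\<lambda>z. V z + C))"
    proof -
      have "(CLINT z|M. iexp (s * X z) * complex_of_real C) = (CLINT z|M. iexp (s * X z)) * complex_of_real C"
        by (rule integral_mult_left_zero)
      then show ?thesis unfolding charV char1 using iV by (simp add: prob_space algebra_simps)
    qed
    finally show "(CLINT z|M. iexp (s * X z) * complex_of_real (V z + C)) = char \<nu> s * complex_of_real (expectation (\<lambda>z. V z + C))" .
  qed auto
  moreover have "expectation (\<lambda>z. indicator A (X z) * C) = measure \<nu> A * expectation (\<lambda>_. C)"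
  proof (rule weighted_Levy_uniqueness[OF _ _ _ _ nu, where C = C])
    show "(CLINT z|M. iexp (s * X z) * complex_of_real C) = char \<nu> s * complex_of_real (expectation (\<lambda>z. C))" for s
      using char1[of s] by (simp add: prob_space)
  qed (use C in auto)
  moreover have "expectation (\<lambda>z. indicator A (X z) * (V z + C)) = expectation (\<lambda>z. indicator A (X z) * V z) + expectation (\<lambda>z. indicator A (X z) * C)"
    unfolding distrib_left by (rule Bochner_Integration.integral_add[OF iA iA2])
  moreover have "expectation (\<lambda>z. V z + C) = expectation V + expectation (\<lambda>_. C)"
    using iV by simp
  ultimately have "expectation (\<lambda>z. indicator A (X z) * V z) + measure \<nu> A * expectation (\<lambda>_. C)
      = measure \<nu> A * (expectation V + expectation (\<lambda>_. C))"
    by (simp only:)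
  then show ?thesis by (simp add: distrib_left)
qed

lemma char_std_normal_eq: "char std_normal_distribution s = complex_of_real (exp (- (s\<^sup>2) / 2))"
  using fun_cong[OF char_std_normal_distribution, of s] by simp

text \<open>The joint characteristic function is inverted one variable at a time, which reduces the
  statement to the uniqueness theorem on the line.\<close>

lemma (in prob_space) distr_std_normal_PiM:
  fixes \<xi> :: "'i \<Rightarrow> 'a \<Rightarrow> real"
  assumes K: "finite K" and \<xi>[measurable]: "\<And>k. \<xi> k \<in> borel_measurable M"
    and char: "\<And>t. (CLINT z|M. iexp (\<Sum>k\<in>K. t k * \<xi> k z)) = complex_of_real (exp (- (\<Sum>k\<in>K. (t k)\<^sup>2) / 2))"
  shows "distr M (PiM K (\<lambda>_. std_normal_distribution)) (\<lambda>z. \<lambda>k\<in>K. \<xi> k z) = PiM K (\<lambda>_. std_normal_distribution)"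
proof -
  let ?\<gamma> = "std_normal_distribution"
  have rd: "real_distribution ?\<gamma>" by (rule real_dist_normal_dist)
  interpret G: real_distribution ?\<gamma> by (rule rd)
  \<comment> \<open>\<open>J\<close> collects the coordinates whose exponentials have already been
    exchanged for indicators.\<close>
  have claim: "(CLINT z|M. complex_of_real (\<Prod>k\<in>J. indicator (A k) (\<xi> k z)) * iexp (\<Sum>k\<in>K - J. t k * \<xi> k z))
      = complex_of_real ((\<Prod>k\<in>J. measure ?\<gamma> (A k)) * exp (- (\<Sum>k\<in>K - J. (t k)\<^sup>2) / 2))"
    if "finite J" "J \<subseteq> K" "\<And>k. A k \<in> sets borel" for J A t
    using that
  proof (induction J arbitrary: t rule: finite_induct)
    case empty
    then show ?case using char[of t] by simp
  next
    case (insert j J)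
    have A[measurable]: "A k \<in> sets borel" for k using insert by auto
    define L where "L = K - insert j J"
    have L: "finite L" "j \<notin> L" "K - J = insert j L" using insert K by (auto simp: L_def)
    define R where "R z = (\<Prod>k\<in>J. indicator (A k) (\<xi> k z) :: real)" for z
    define g where "g = (\<Prod>k\<in>J. measure ?\<gamma> (A k))"
    define \<theta> where "\<theta> z = (\<Sum>k\<in>L. t k * \<xi> k z)" for z
    define q where "q = exp (- (\<Sum>k\<in>L. (t k)\<^sup>2) / 2)"
    have [measurable]: "R \<in> borel_measurable M" "\<theta> \<in> borel_measurable M"
      unfolding R_def \<theta>_def by measurable
    have R: "0 \<le> R z" "R z \<le> 1" for z
      unfolding R_def by (auto intro!: prod_nonneg prod_le_1 simp: indicator_def)
    \<comment> \<open>The signs e = 1 and e = -1 in front of \<theta> give its cosine and sine, the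
      real weights that \<open>char_factor_indicator\<close> can carry.\<close>
    have IH: "(CLINT z|M. complex_of_real (R z) * iexp (s * \<xi> j z + e * \<theta> z)) = complex_of_real (g * (exp (- (s\<^sup>2) / 2) * exp (- (\<Sum>k\<in>L. (e * t k)\<^sup>2) / 2)))" for s e
    proof -
      define t' where "t' = (\<lambda>k. e * t k)(j := s)"
      have "(\<Sum>k\<in>L. t' k * \<xi> k z) = e * \<theta> z" for z
        unfolding \<theta>_def sum_distrib_left using L(2) by (intro sum.cong) (auto simp: t'_def)
      then have 1: "(\<Sum>k\<in>K - J. t' k * \<xi> k z) = s * \<xi> j z + e * \<theta> z" for z
        unfolding L(3) using L by (simp add: t'_def)
      have "(\<Sum>k\<in>L. (t' k)\<^sup>2) = (\<Sum>k\<in>L. (e * t k)\<^sup>2)"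
        using L(2) by (intro sum.cong) (auto simp: t'_def)
      then have 2: "(\<Sum>k\<in>K - J. (t' k)\<^sup>2) = s\<^sup>2 + (\<Sum>k\<in>L. (e * t k)\<^sup>2)"
        unfolding L(3) using L by (simp add: t'_def)
      show ?thesis using insert.IH[of t'] insert.prems unfolding 1 2
        by (simp add: R_def g_def exp_add[symmetric] add_divide_distrib diff_divide_distrib)
    qed
    have int: "integrable M (\<lambda>z. complex_of_real (R z) * iexp (s * \<xi> j z + e * \<theta> z))" for s e
      by (rule integrable_const_bound[where B = 1]) (use R in \<open>auto simp: norm_mult\<close>)
    have char1: "(CLINT z|M. iexp (s * \<xi> j z)) = char ?\<gamma> s" for s
    proof -
      have "j \<in> K" using insert by auto
      then have "(\<Sum>k\<in>K. (if k = j then s else 0) * \<xi> k z) = s * \<xi> j z" for z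
        using K by (simp add: if_distrib[of "\<lambda>x. x * _"] sum.delta cong: if_cong)
      moreover have "(\<Sum>k\<in>K. (if k = j then s else 0)\<^sup>2) = s\<^sup>2"
        using K \<open>j \<in> K\<close> by (simp add: if_distrib[of "\<lambda>x. x\<^sup>2"] sum.delta cong: if_cong)
      ultimately show ?thesis using char[of "\<lambda>k. if k = j then s else 0"] by (simp add: char_std_normal_eq)
    qed
    have e1: "iexp (s * \<xi> j z + 1 * \<theta> z) = iexp (s * \<xi> j z) * iexp (\<theta> z)" for s z
      by (simp add: distrib_left exp_add)
    have e2: "iexp (s * \<xi> j z + (- 1) * \<theta> z) = iexp (s * \<xi> j z) * iexp (- \<theta> z)" for s z
      unfolding exp_add[symmetric] by (rule arg_cong[where f = exp]) (simp add: algebra_simps)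
    have cs: "complex_of_real (cos (\<theta> z)) = (iexp (\<theta> z) + iexp (- \<theta> z)) / 2"
      "complex_of_real (sin (\<theta> z)) = (iexp (\<theta> z) - iexp (- \<theta> z)) / (2 * \<i>)" for z
      unfolding cos_of_real[symmetric] sin_of_real[symmetric] cos_exp_eq sin_exp_eq by simp_all
    have neg: "(\<Sum>k\<in>L. (- 1 * t k)\<^sup>2) = (\<Sum>k\<in>L. (t k)\<^sup>2)" by simp
    have cosV: "(CLINT z|M. iexp (s * \<xi> j z) * complex_of_real (R z * cos (\<theta> z))) = complex_of_real (g * exp (- (s\<^sup>2) / 2) * q)" for s
    proof -
      have "(CLINT z|M. iexp (s * \<xi> j z) * complex_of_real (R z * cos (\<theta> z)))
         = (CLINT z|M. (complex_of_real (R z) * iexp (s * \<xi> j z + 1 * \<theta> z) + complex_of_real (R z) * iexp (s * \<xi> j z + (- 1) * \<theta> z)) / 2)"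
        by (intro Bochner_Integration.integral_cong refl)
           (simp only: e1 e2 cs of_real_mult times_divide_eq_right distrib_left mult_ac)
      also have "\<dots> = complex_of_real (g * exp (- (s\<^sup>2) / 2) * q)"
        using Bochner_Integration.integral_add[OF int int, of s 1 s "- 1"]
        unfolding IH neg by (simp add: q_def)
      finally show ?thesis .
    qed
    have sinV: "(CLINT z|M. iexp (s * \<xi> j z) * complex_of_real (R z * sin (\<theta> z))) = 0" for s
    proof -
      have "(CLINT z|M. iexp (s * \<xi> j z) * complex_of_real (R z * sin (\<theta> z)))
         = (CLINT z|M. (complex_of_real (R z) * iexp (s * \<xi> j z + 1 * \<theta> z) - complex_of_real (R z) * iexp (s * \<xi> j z + (- 1) * \<theta> z)) / (2 * \<i>))"
        by (intro Bochner_Integration.integral_cong refl)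
           (simp only: e1 e2 cs of_real_mult times_divide_eq_right right_diff_distrib mult_ac)
      also have "\<dots> = 0"
        using Bochner_Integration.integral_diff[OF int int, of s 1 s "- 1"]
        unfolding IH neg by simp
      finally show ?thesis .
    qed
    have E1: "expectation (\<lambda>z. R z * cos (\<theta> z)) = g * q"
    proof -
      have "complex_of_real (expectation (\<lambda>z. R z * cos (\<theta> z))) = (CLINT z|M. complex_of_real (R z * cos (\<theta> z)))"
        by (rule integral_complex_of_real[symmetric])
      also have "\<dots> = complex_of_real (g * q)" using cosV[of 0] by simp
      finally show ?thesis using of_real_eq_iff by blast
    qed
    have E2: "expectation (\<lambda>z. R z * sin (\<theta> z)) = 0"
    proof -
      have "complex_of_real (expectation (\<lambda>z. R z * sin (\<theta> z))) = (CLINT z|M. complex_of_real (R z * sin (\<theta> z)))"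
        by (rule integral_complex_of_real[symmetric])
      also have "\<dots> = complex_of_real 0" using sinV[of 0] by simp
      finally show ?thesis using of_real_eq_iff by blast
    qed
    have bd: "\<bar>R z * cos (\<theta> z)\<bar> \<le> 1" "\<bar>R z * sin (\<theta> z)\<bar> \<le> 1" for z
      using R[of z] by (auto simp: abs_mult intro!: mult_le_one)
    have A1: "expectation (\<lambda>z. indicator (A j) (\<xi> j z) * (R z * cos (\<theta> z))) = measure ?\<gamma> (A j) * (g * q)"
      unfolding E1[symmetric]
    proof (rule char_factor_indicator[OF \<xi> _ bd(1) rd char1])
      show "(CLINT z|M. iexp (s * \<xi> j z) * complex_of_real (R z * cos (\<theta> z))) = char ?\<gamma> s * complex_of_real (expectation (\<lambda>z. R z * cos (\<theta> z)))" for s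
        unfolding cosV E1 char_std_normal_eq by simp
    qed auto
    have A2: "expectation (\<lambda>z. indicator (A j) (\<xi> j z) * (R z * sin (\<theta> z))) = 0"
    proof -
      have "expectation (\<lambda>z. indicator (A j) (\<xi> j z) * (R z * sin (\<theta> z))) = measure ?\<gamma> (A j) * expectation (\<lambda>z. R z * sin (\<theta> z))"
      proof (rule char_factor_indicator[OF \<xi> _ bd(2) rd char1])
        show "(CLINT z|M. iexp (s * \<xi> j z) * complex_of_real (R z * sin (\<theta> z))) = char ?\<gamma> s * complex_of_real (expectation (\<lambda>z. R z * sin (\<theta> z)))" for s
          unfolding sinV E2 by simp
      qed auto
      then show ?thesis by (simp add: E2)
    qed
    have ib: "integrable M (\<lambda>z. indicator (A j) (\<xi> j z) * (R z * cos (\<theta> z)))" "integrable M (\<lambda>z. indicator (A j) (\<xi> j z) * (R z * sin (\<theta> z)))"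
      by (rule integrable_const_bound[where B = 1], use bd in \<open>auto simp: indicator_def\<close>)+
    have "(CLINT z|M. complex_of_real (\<Prod>k\<in>insert j J. indicator (A k) (\<xi> k z)) * iexp (\<Sum>k\<in>K - insert j J. t k * \<xi> k z))
      = (CLINT z|M. complex_of_real (indicator (A j) (\<xi> j z) * (R z * cos (\<theta> z))) + \<i> * complex_of_real (indicator (A j) (\<xi> j z) * (R z * sin (\<theta> z))))"
    proof (intro Bochner_Integration.integral_cong refl)
      fix z
      have "iexp (\<theta> z) = complex_of_real (cos (\<theta> z)) + \<i> * complex_of_real (sin (\<theta> z))"
        using cis_conv_exp[of "\<theta> z"] by (simp add: complex_eq_iff)
      then show "complex_of_real (\<Prod>k\<in>insert j J. indicator (A k) (\<xi> k z)) * iexp (\<Sum>k\<in>K - insert j J. t k * \<xi> k z)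
        = complex_of_real (indicator (A j) (\<xi> j z) * (R z * cos (\<theta> z))) + \<i> * complex_of_real (indicator (A j) (\<xi> j z) * (R z * sin (\<theta> z)))"
        unfolding L_def[symmetric] \<theta>_def[symmetric] using insert(1,2) by (simp add: R_def algebra_simps)
    qed
    also have "\<dots> = complex_of_real (measure ?\<gamma> (A j) * (g * q))"
      using ib by (simp add: A1 A2 del: of_real_mult)
    also have "\<dots> = complex_of_real ((\<Prod>k\<in>insert j J. measure ?\<gamma> (A k)) * exp (- (\<Sum>k\<in>K - insert j J. (t k)\<^sup>2) / 2))"
      unfolding L_def[symmetric] q_def[symmetric] using insert(1,2) by (simp add: g_def)
    finally show ?case .
  qed
  have [measurable]: "(\<lambda>z. \<lambda>k\<in>K. \<xi> k z) \<in> measurable M (PiM K (\<lambda>_. ?\<gamma>))"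
    by (intro measurable_restrict) simp
  interpret P: product_prob_space "\<lambda>_::'i. ?\<gamma>" K by unfold_locales
  show ?thesis
  proof (rule P.PiM_eqI[OF K])
    fix A assume A: "\<And>k. k \<in> K \<Longrightarrow> A k \<in> sets ?\<gamma>"
    \<comment> \<open>Outside \<open>K\<close> the empty set serves as a Borel default, since
      \<open>claim\<close> asks for Borel sets at every index.\<close>
    define A' where "A' k = (if k \<in> K then A k else {})" for k
    have A'[measurable]: "A' k \<in> sets borel" for k using A[of k] by (auto simp: A'_def)
    have "complex_of_real (expectation (\<lambda>z. \<Prod>k\<in>K. indicator (A' k) (\<xi> k z))) = (CLINT z|M. complex_of_real (\<Prod>k\<in>K. indicator (A' k) (\<xi> k z)))"
      by (rule integral_complex_of_real[symmetric])
    also have "\<dots> = complex_of_real (\<Prod>k\<in>K. measure ?\<gamma> (A' k))"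
      using claim[of K A'] K by simp
    finally have E: "expectation (\<lambda>z. \<Prod>k\<in>K. indicator (A' k) (\<xi> k z)) = (\<Prod>k\<in>K. measure ?\<gamma> (A' k))"
      using of_real_eq_iff by blast
    have "emeasure (distr M (PiM K (\<lambda>_. ?\<gamma>)) (\<lambda>z. \<lambda>k\<in>K. \<xi> k z)) (PiE K A) = emeasure M ((\<lambda>z. \<lambda>k\<in>K. \<xi> k z) -` (PiE K A) \<inter> space M)"
      using A K by (intro emeasure_distr sets_PiM_I_finite) auto
    also have "\<dots> = ennreal (measure M ((\<lambda>z. \<lambda>k\<in>K. \<xi> k z) -` (PiE K A) \<inter> space M))"
      by (rule emeasure_eq_measure)
    also have "measure M ((\<lambda>z. \<lambda>k\<in>K. \<xi> k z) -` (PiE K A) \<inter> space M) = expectation (indicator ((\<lambda>z. \<lambda>k\<in>K. \<xi> k z) -` (PiE K A) \<inter> space M))"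
      by simp
    also have "\<dots> = expectation (\<lambda>z. \<Prod>k\<in>K. indicator (A' k) (\<xi> k z))"
    proof (intro Bochner_Integration.integral_cong refl)
      fix z assume z: "z \<in> space M"
      show "indicator ((\<lambda>z. \<lambda>k\<in>K. \<xi> k z) -` (PiE K A) \<inter> space M) z = (\<Prod>k\<in>K. indicator (A' k) (\<xi> k z) :: real)"
      proof (cases "\<forall>k\<in>K. \<xi> k z \<in> A k")
        case True then show ?thesis using z by (auto simp: indicator_def A'_def)
      next
        case False
        then obtain k where k: "k \<in> K" "\<xi> k z \<notin> A k" by blast
        then have "(\<Prod>k\<in>K. indicator (A' k) (\<xi> k z) :: real) = 0"
          using K by (intro prod_zero) (auto simp: A'_def intro!: bexI[of _ k])
        moreover have "z \<notin> (\<lambda>z. \<lambda>k\<in>K. \<xi> k z) -` (PiE K A)" using k by (auto simp: PiE_iff)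
        ultimately show ?thesis by simp
      qed
    qed
    also have "\<dots> = (\<Prod>k\<in>K. measure ?\<gamma> (A k))" unfolding E by (intro prod.cong) (auto simp: A'_def)
    also have "ennreal \<dots> = (\<Prod>k\<in>K. emeasure ?\<gamma> (A k))"
      by (simp add: G.emeasure_eq_measure prod_ennreal)
    finally show "emeasure (distr M (PiM K (\<lambda>_. ?\<gamma>)) (\<lambda>z. \<lambda>k\<in>K. \<xi> k z)) (PiE K A) = (\<Prod>k\<in>K. emeasure ?\<gamma> (A k))" .
  qed simp
qed

section \<open>Lattice sums\<close>

lemma japanese_eq: "japanese k = 1 + (real_of_int (fst k))\<^sup>2 + (real_of_int (snd k))\<^sup>2"
  by (simp add: japanese_def lat_def norm_Pair)

text \<open>The integral test for 1 / (b^2 + u^2), one unit step at a time.\<close>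

lemma arctan_diff_ge:
  fixes b x :: real assumes "b > 0" "x \<ge> 0"
  shows "1 / (b\<^sup>2 + (x + 1)\<^sup>2) \<le> (arctan ((x + 1) / b) - arctan (x / b)) / b"
proof -
  have d: "((\<lambda>u. arctan (u / b) / b) has_real_derivative 1 / (b\<^sup>2 + u\<^sup>2)) (at u)" for u
    using assms by (auto intro!: derivative_eq_intros simp: divide_simps power2_eq_square)
  have "\<exists>u>x. u < x + 1 \<and> arctan ((x + 1) / b) / b - arctan (x / b) / b = (x + 1 - x) * (1 / (b\<^sup>2 + u\<^sup>2))"
    by (rule MVT2[of x "x + 1"]) (use d in auto)
  then obtain u where u: "x < u" "u < x + 1" "arctan ((x + 1) / b) / b - arctan (x / b) / b = 1 / (b\<^sup>2 + u\<^sup>2)"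
    by auto
  have "u\<^sup>2 \<le> (x + 1)\<^sup>2" using u assms by (intro power_mono) auto
  moreover have "b\<^sup>2 > 0" using assms by simp
  ultimately have "1 / (b\<^sup>2 + (x + 1)\<^sup>2) \<le> 1 / (b\<^sup>2 + u\<^sup>2)"
    by (intro divide_left_mono mult_pos_pos) (auto intro: add_pos_nonneg)
  then show ?thesis using u by (simp add: diff_divide_distrib)
qed

lemma int_interval_Suc: "{- int (Suc n)..int (Suc n)} = insert (- int (Suc n)) (insert (int (Suc n)) {- int n..int n})"
  by auto

text \<open>The arctan differences telescope on both half lines; twice the limit pi / 2 is the
  pi.\<close>

lemma row_sum_bound:
  fixes b :: real assumes "b > 0"
  shows "(\<Sum>j\<in>{- int n..int n}. 1 / (b\<^sup>2 + (real_of_int j)\<^sup>2)) \<le> 1 / b\<^sup>2 + pi / b"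
proof -
  have "(\<Sum>j\<in>{- int n..int n}. 1 / (b\<^sup>2 + (real_of_int j)\<^sup>2)) \<le> 1 / b\<^sup>2 + 2 * arctan (real n / b) / b"
  proof (induction n)
    case (Suc n)
    have "(\<Sum>j\<in>{- int (Suc n)..int (Suc n)}. 1 / (b\<^sup>2 + (real_of_int j)\<^sup>2))
        = 2 / (b\<^sup>2 + (real n + 1)\<^sup>2) + (\<Sum>j\<in>{- int n..int n}. 1 / (b\<^sup>2 + (real_of_int j)\<^sup>2))"
      unfolding int_interval_Suc by (simp add: add.commute power2_commute[of "- 1"] power2_eq_square[of "- 1 - real n"])
    also have "\<dots> \<le> 2 * ((arctan ((real n + 1) / b) - arctan (real n / b)) / b) + (1 / b\<^sup>2 + 2 * arctan (real n / b) / b)"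
      using arctan_diff_ge[OF assms, of "real n"] Suc by linarith
    also have "\<dots> = 1 / b\<^sup>2 + 2 * arctan (real (Suc n) / b) / b"
      by (simp add: diff_divide_distrib add.commute)
    finally show ?case .
  qed simp
  also have "\<dots> \<le> 1 / b\<^sup>2 + pi / b"
    using arctan_ubound[of "real n / b"] assms by (intro add_left_mono divide_right_mono) auto
  finally show ?thesis .
qed

text \<open>The term -2 / n is slack for the induction: it absorbs 2 / m^2 through 1 / m^2 <= 1 / (m
  - 1) - 1 / m, while the logarithm absorbs 2 pi / m.\<close>

lemma column_sum_bound:
  assumes "n \<ge> 1"
  shows "(\<Sum>i\<in>{- int n..int n}. 1 / (1 + (real_of_int i)\<^sup>2) + pi / sqrt (1 + (real_of_int i)\<^sup>2))
     \<le> 5 + 3 * pi + 2 * pi * ln (real n) - 2 / real n"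
  using assms
proof (induction n rule: nat_induct_at_least)
  case base
  have "pi / sqrt 2 \<le> pi / 1" by (intro divide_left_mono) auto
  moreover have "{- int 1..int 1} = {- 1, 0, 1}" by auto
  ultimately show ?case by simp
next
  case (Suc n)
  define m where "m = real n + 1"
  have m: "m > 1" "real (Suc n) = m" using Suc by (auto simp: m_def)
  define T where "T i = 1 / (1 + (real_of_int i)\<^sup>2) + pi / sqrt (1 + (real_of_int i)\<^sup>2)" for i
  have T: "T (int (Suc n)) \<le> 1 / m\<^sup>2 + pi / m" "T (- int (Suc n)) \<le> 1 / m\<^sup>2 + pi / m"
  proof -
    have "sqrt (1 + m\<^sup>2) \<ge> m" by (rule real_le_rsqrt) simp
    then have "1 / (1 + m\<^sup>2) + pi / sqrt (1 + m\<^sup>2) \<le> 1 / m\<^sup>2 + pi / m"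
      using m by (intro add_mono divide_left_mono mult_pos_pos) (auto intro: add_pos_nonneg)
    moreover have "real_of_int (int (Suc n)) = m" "(real_of_int (- int (Suc n)))\<^sup>2 = m\<^sup>2"
      by (auto simp: m_def power2_eq_square algebra_simps)
    ultimately show "T (int (Suc n)) \<le> 1 / m\<^sup>2 + pi / m" "T (- int (Suc n)) \<le> 1 / m\<^sup>2 + pi / m"
      by (simp_all only: T_def)
  qed
  have "(\<Sum>i\<in>{- int (Suc n)..int (Suc n)}. T i) = T (- int (Suc n)) + (T (int (Suc n)) + (\<Sum>i\<in>{- int n..int n}. T i))"
    unfolding int_interval_Suc by (subst sum.insert, simp, simp, subst sum.insert) auto
  also have "\<dots> \<le> 2 * (1 / m\<^sup>2 + pi / m) + (5 + 3 * pi + 2 * pi * ln (m - 1) - 2 / (m - 1))"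
    using T Suc.IH by (simp add: T_def m_def)
  also have "\<dots> \<le> 5 + 3 * pi + 2 * pi * ln m - 2 / m"
  proof -
    have h1: "1 / m\<^sup>2 \<le> 1 / (m - 1) - 1 / m"
      using m(1) by (simp add: field_simps power2_eq_square)
    have "1 / m \<le> ln m - ln (m - 1)"
    proof -
      have "ln ((m - 1) / m) \<le> (m - 1) / m - 1" by (rule ln_le_minus_one) (use m in auto)
      then show ?thesis using m(1) by (simp add: ln_div field_simps)
    qed
    then have h2: "pi * (1 / m) \<le> pi * (ln m - ln (m - 1))" by (intro mult_left_mono) auto
    have "2 * (1 / m\<^sup>2) + 2 * (pi * (1 / m)) \<le> 2 * (1 / (m - 1) - 1 / m) + 2 * (pi * (ln m - ln (m - 1)))"
      by (rule add_mono[OF mult_left_mono[OF h1] mult_left_mono[OF h2]]) simp_all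
    then show ?thesis by (simp add: algebra_simps)
  qed
  finally show ?case unfolding m(2) T_def .
qed

definition log_jap :: "int \<times> int \<Rightarrow> real" where
  "log_jap k = ln (japanese k)"

lemma log_jap_nonneg: "0 \<le> log_jap k"
  using japanese_ge1[of k] by (simp add: log_jap_def)

lemma exp_log_jap: "exp (log_jap k) = japanese k"
  using japanese_pos[of k] by (simp add: log_jap_def)

lemma log_jap_le_imp:
  assumes "log_jap k \<le> s"
  shows "fst k \<in> {- int (nat \<lfloor>exp (s / 2)\<rfloor>)..int (nat \<lfloor>exp (s / 2)\<rfloor>)}"
    "snd k \<in> {- int (nat \<lfloor>exp (s / 2)\<rfloor>)..int (nat \<lfloor>exp (s / 2)\<rfloor>)}"
proof -
  have "japanese k \<le> exp s" using assms by (simp flip: exp_log_jap)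
  also have "exp s = (exp (s / 2))\<^sup>2" by (simp flip: exp_double)
  finally have le: "(real_of_int (fst k))\<^sup>2 \<le> (exp (s / 2))\<^sup>2" "(real_of_int (snd k))\<^sup>2 \<le> (exp (s / 2))\<^sup>2"
    using zero_le_power2[of "real_of_int (fst k)"] zero_le_power2[of "real_of_int (snd k)"] unfolding japanese_eq by linarith+
  have *: "i \<in> {- int (nat \<lfloor>exp (s / 2)\<rfloor>)..int (nat \<lfloor>exp (s / 2)\<rfloor>)}" if "(real_of_int i)\<^sup>2 \<le> (exp (s / 2))\<^sup>2" for i
  proof -
    have "\<bar>real_of_int i\<bar> \<le> exp (s / 2)" using that by (simp add: abs_le_square_iff[symmetric])
    then have "\<bar>i\<bar> \<le> \<lfloor>exp (s / 2)\<rfloor>" by (simp add: le_floor_iff)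
    then show ?thesis by auto
  qed
  show "fst k \<in> {- int (nat \<lfloor>exp (s / 2)\<rfloor>)..int (nat \<lfloor>exp (s / 2)\<rfloor>)}" "snd k \<in> {- int (nat \<lfloor>exp (s / 2)\<rfloor>)..int (nat \<lfloor>exp (s / 2)\<rfloor>)}"
    by (rule *[OF le(1)], rule *[OF le(2)])
qed

text \<open>The slope pi is the sharp one. Apart from bounded terms, the row at height i contributes
  pi / |i|, and these sum over 0 < |i| <= exp(s / 2) to 2 pi (s / 2).\<close>

lemma lattice_log_sum:
  assumes "s \<ge> 0"
  shows "(\<Sum>k | k \<in> F \<and> log_jap k \<le> s. 1 / japanese k) \<le> pi * s + (5 + 3 * pi)"
proof -
  define R where "R = nat \<lfloor>exp (s / 2)\<rfloor>"
  have "\<lfloor>exp (s / 2)\<rfloor> \<ge> 1" using assms by (simp add: le_floor_iff)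
  then have R: "R \<ge> 1" "real R \<le> exp (s / 2)" unfolding R_def by linarith+
  have sub: "{k. k \<in> F \<and> log_jap k \<le> s} \<subseteq> {- int R..int R} \<times> {- int R..int R}"
    using log_jap_le_imp by (auto simp: R_def mem_Times_iff simp del: atLeastAtMost_iff)
  have "(\<Sum>k | k \<in> F \<and> log_jap k \<le> s. 1 / japanese k) \<le> (\<Sum>k\<in>{- int R..int R} \<times> {- int R..int R}. 1 / japanese k)"
    using japanese_pos by (intro sum_mono2 sub) (auto simp: less_imp_le)
  also have "\<dots> = (\<Sum>i\<in>{- int R..int R}. \<Sum>j\<in>{- int R..int R}. 1 / ((sqrt (1 + (real_of_int i)\<^sup>2))\<^sup>2 + (real_of_int j)\<^sup>2))"
    unfolding sum.cartesian_product by (intro sum.cong) (auto simp: japanese_eq)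
  also have "\<dots> \<le> (\<Sum>i\<in>{- int R..int R}. 1 / (sqrt (1 + (real_of_int i)\<^sup>2))\<^sup>2 + pi / sqrt (1 + (real_of_int i)\<^sup>2))"
    by (intro sum_mono row_sum_bound) (auto intro: add_pos_nonneg)
  also have "\<dots> = (\<Sum>i\<in>{- int R..int R}. 1 / (1 + (real_of_int i)\<^sup>2) + pi / sqrt (1 + (real_of_int i)\<^sup>2))"
    by (intro sum.cong) auto
  also have "\<dots> \<le> 5 + 3 * pi + 2 * pi * ln (real R) - 2 / real R"
    by (rule column_sum_bound[OF R(1)])
  also have "\<dots> \<le> 5 + 3 * pi + 2 * pi * (s / 2)"
  proof -
    have "ln (real R) \<le> s / 2" using R by (metis exp_gt_zero ln_exp ln_le_cancel_iff of_nat_0_less_iff less_le_trans zero_less_one)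
    then have "2 * pi * ln (real R) \<le> 2 * pi * (s / 2)" by (intro mult_left_mono) auto
    moreover have "2 / real R \<ge> 0" by simp
    ultimately show ?thesis by linarith
  qed
  finally show ?thesis by simp
qed

lemma lattice_count:
  assumes "s \<ge> 0"
  shows "real (card {k. k \<in> F \<and> log_jap k \<le> s}) \<le> 9 * exp s"
proof -
  define R where "R = nat \<lfloor>exp (s / 2)\<rfloor>"
  have "\<lfloor>exp (s / 2)\<rfloor> \<ge> 1" using assms by (simp add: le_floor_iff)
  then have R: "R \<ge> 1" "real R \<le> exp (s / 2)" unfolding R_def by linarith+
  have sub: "{k. k \<in> F \<and> log_jap k \<le> s} \<subseteq> {- int R..int R} \<times> {- int R..int R}"
    using log_jap_le_imp by (auto simp: R_def mem_Times_iff simp del: atLeastAtMost_iff)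
  have "card {k. k \<in> F \<and> log_jap k \<le> s} \<le> card ({- int R..int R} \<times> {- int R..int R})"
    by (intro card_mono sub) auto
  also have "\<dots> = (2 * R + 1)\<^sup>2" by (simp add: card_cartesian_product power2_eq_square nat_add_distrib nat_mult_distrib)
  finally have "real (card {k. k \<in> F \<and> log_jap k \<le> s}) \<le> (2 * real R + 1)\<^sup>2"
    by (metis (mono_tags, lifting) of_nat_1 of_nat_add of_nat_le_iff of_nat_mult of_nat_numeral of_nat_power)
  also have "\<dots> \<le> (3 * exp (s / 2))\<^sup>2" using R by (intro power_mono) auto
  also have "\<dots> = 9 * exp s" by (simp add: power_mult_distrib flip: exp_double)
  finally show ?thesis .
qed

section \<open>Exponential weights on the lattice\<close>

lemma nn_integral_exp_tail:
  assumes "c > 0"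
  shows "(\<integral>\<^sup>+s. ennreal (c * exp (- c * s)) * indicator {y..} s \<partial>lborel) = ennreal (exp (- c * y))"
proof -
  have "(\<integral>\<^sup>+s. ennreal (c * exp (- c * s)) * indicator {y..} s \<partial>lborel) = ennreal (0 - (- exp (- c * y)))"
  proof (rule nn_integral_FTC_atLeast)
    show "((\<lambda>s. - exp (- c * s)) has_real_derivative c * exp (- c * x)) (at x)" for x
      by (auto intro!: derivative_eq_intros)
    have "filterlim (\<lambda>s. c * s) at_top at_top"
      using assms by (intro filterlim_tendsto_pos_mult_at_top[OF tendsto_const]) (auto simp: filterlim_ident)
    then have "((\<lambda>s. exp (- (c * s))) \<longlongrightarrow> 0) at_top"
      by (intro filterlim_compose[OF exp_at_bot] filterlim_compose[OF filterlim_uminus_at_bot_at_top]) 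
    then show "((\<lambda>s. - exp (- c * s)) \<longlongrightarrow> 0) at_top"
      using tendsto_minus by fastforce
  qed (use assms in auto)
  then show ?thesis by simp
qed

text \<open>Each factor exp(-c Y) is the integral of c exp(-c s) over s >= Y; the finite sum is
  exchanged with the integral.\<close>

lemma layer_cake:
  assumes "finite S" "c > 0" "\<And>k. k \<in> S \<Longrightarrow> 0 \<le> W k"
  shows "ennreal (\<Sum>k\<in>S. W k * exp (- c * Y k)) = (\<integral>\<^sup>+s. ennreal (c * exp (- c * s) * (\<Sum>k | k \<in> S \<and> Y k \<le> s. W k)) \<partial>lborel)"
proof -
  have "ennreal (\<Sum>k\<in>S. W k * exp (- c * Y k)) = (\<Sum>k\<in>S. ennreal (W k * exp (- c * Y k)))"
    using assms by (intro sum_ennreal[symmetric]) auto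
  also have "\<dots> = (\<Sum>k\<in>S. \<integral>\<^sup>+s. ennreal (W k) * (ennreal (c * exp (- c * s)) * indicator {Y k..} s) \<partial>lborel)"
    by (intro sum.cong refl, subst nn_integral_cmult, simp, subst nn_integral_exp_tail[OF assms(2)]) (simp add: ennreal_mult assms(3))
  also have "\<dots> = (\<integral>\<^sup>+s. (\<Sum>k\<in>S. ennreal (W k) * (ennreal (c * exp (- c * s)) * indicator {Y k..} s)) \<partial>lborel)"
    by (rule nn_integral_sum[symmetric]) simp
  also have "\<dots> = (\<integral>\<^sup>+s. ennreal (c * exp (- c * s) * (\<Sum>k | k \<in> S \<and> Y k \<le> s. W k)) \<partial>lborel)"
  proof (intro nn_integral_cong)
    fix s
    have "(\<Sum>k\<in>S. ennreal (W k) * (ennreal (c * exp (- c * s)) * indicator {Y k..} s)) = (\<Sum>k\<in>S. ennreal (c * exp (- c * s) * (if Y k \<le> s then W k else 0)))"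
      using assms by (intro sum.cong refl) (auto simp: indicator_def mult.commute simp flip: ennreal_mult)
    also have "\<dots> = ennreal (\<Sum>k\<in>S. c * exp (- c * s) * (if Y k \<le> s then W k else 0))"
      using assms by (intro sum_ennreal) auto
    also have "(\<Sum>k\<in>S. c * exp (- c * s) * (if Y k \<le> s then W k else 0)) = c * exp (- c * s) * (\<Sum>k | k \<in> S \<and> Y k \<le> s. W k)"
      using assms(1) by (simp only: sum_distrib_left[symmetric] sum.inter_filter)
    finally show "(\<Sum>k\<in>S. ennreal (W k) * (ennreal (c * exp (- c * s)) * indicator {Y k..} s)) = ennreal (c * exp (- c * s) * (\<Sum>k | k \<in> S \<and> Y k \<le> s. W k))" .
  qed
  finally show ?thesis .
qed

lemma lattice_tail_sum:
  assumes "finite F" "0 < \<alpha>" "\<alpha> \<le> 1" "0 \<le> t"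
  shows "(\<Sum>k | k \<in> F \<and> t \<le> log_jap k. exp (- (1 + \<alpha>) * log_jap k)) \<le> 18 / \<alpha> * exp (- \<alpha> * t)"
proof -
  define S where "S = {k. k \<in> F \<and> t \<le> log_jap k}"
  have S: "finite S" using assms by (simp add: S_def)
  have "ennreal (\<Sum>k\<in>S. 1 * exp (- (1 + \<alpha>) * log_jap k)) = (\<integral>\<^sup>+s. ennreal ((1 + \<alpha>) * exp (- (1 + \<alpha>) * s) * (\<Sum>k | k \<in> S \<and> log_jap k \<le> s. 1)) \<partial>lborel)"
    by (rule layer_cake) (use S assms in auto)
  also have "\<dots> \<le> (\<integral>\<^sup>+s. ennreal (18 / \<alpha>) * (ennreal (\<alpha> * exp (- \<alpha> * s)) * indicator {t..} s) \<partial>lborel)"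
  proof (intro nn_integral_mono)
    fix s
    show "ennreal ((1 + \<alpha>) * exp (- (1 + \<alpha>) * s) * (\<Sum>k | k \<in> S \<and> log_jap k \<le> s. 1)) \<le> ennreal (18 / \<alpha>) * (ennreal (\<alpha> * exp (- \<alpha> * s)) * indicator {t..} s)"
    proof (cases "t \<le> s")
      case True
      \<comment> \<open>The 18 is 2 * 9: the factor 1 + \<alpha> is at most 2, and at most 9 exp(s)
        frequencies have \<open>log_jap\<close> below s.\<close>
      have "(1 + \<alpha>) * exp (- (1 + \<alpha>) * s) * real (card {k. k \<in> S \<and> log_jap k \<le> s}) \<le> 2 * exp (- (1 + \<alpha>) * s) * (9 * exp s)"
        using assms True lattice_count[of s S] by (intro mult_mono) auto
      also have "\<dots> = 18 / \<alpha> * (\<alpha> * exp (- \<alpha> * s))"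
        using assms by (simp add: algebra_simps flip: exp_add)
      finally show ?thesis using True assms by (simp add: ennreal_leI flip: ennreal_mult)
    next
      case False
      then have "{k. k \<in> S \<and> log_jap k \<le> s} = {}" by (auto simp: S_def)
      then show ?thesis by (simp del: Collect_empty_eq)
    qed
  qed
  also have "\<dots> = ennreal (18 / \<alpha>) * ennreal (exp (- \<alpha> * t))"
    by (subst nn_integral_cmult) (auto simp: nn_integral_exp_tail[OF assms(2), simplified])
  also have "\<dots> = ennreal (18 / \<alpha> * exp (- \<alpha> * t))" using assms by (simp flip: ennreal_mult)
  finally show ?thesis using assms by (simp add: S_def)
qed

lemma lattice_ball_sum:
  assumes "finite F" "0 < \<alpha>" "\<alpha> < 1" "0 \<le> t"
  shows "(\<Sum>k | k \<in> F \<and> log_jap k \<le> t. exp (- \<alpha> * log_jap k)) \<le> 18 / (1 - \<alpha>) * exp ((1 - \<alpha>) * t)"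
proof -
  define S where "S = {k. k \<in> F \<and> log_jap k \<le> t}"
  have S: "finite S" using assms by (simp add: S_def)
  have "ennreal (\<Sum>k\<in>S. 1 * exp (- \<alpha> * log_jap k)) = (\<integral>\<^sup>+s. ennreal (\<alpha> * exp (- \<alpha> * s) * (\<Sum>k | k \<in> S \<and> log_jap k \<le> s. 1)) \<partial>lborel)"
    by (rule layer_cake) (use S assms in auto)
  \<comment> \<open>Beyond t the count stays below 9 exp(t), before t it is at most 9 exp(s). The
    second part is integrable towards minus infinity because 1 - \<alpha> > 0.\<close>
  also have "\<dots> \<le> (\<integral>\<^sup>+s. ennreal (9 * exp t) * (ennreal (\<alpha> * exp (- \<alpha> * s)) * indicator {t..} s)
       + ennreal (9 / (1 - \<alpha>)) * (ennreal ((1 - \<alpha>) * exp ((1 - \<alpha>) * s)) * indicator {..t} s) \<partial>lborel)"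
  proof (intro nn_integral_mono)
    fix s
    have 1: "ennreal (\<alpha> * exp (- \<alpha> * s) * real (card {k. k \<in> S \<and> log_jap k \<le> s})) \<le> ennreal (9 * exp t) * (ennreal (\<alpha> * exp (- \<alpha> * s)) * indicator {t..} s)" if "t \<le> s"
    proof -
      have "{k. k \<in> S \<and> log_jap k \<le> s} = {k. k \<in> S \<and> log_jap k \<le> t}" using that by (auto simp: S_def)
      then have "\<alpha> * exp (- \<alpha> * s) * real (card {k. k \<in> S \<and> log_jap k \<le> s}) \<le> \<alpha> * exp (- \<alpha> * s) * (9 * exp t)"
        using assms lattice_count[of t S] by (intro mult_mono) auto
      also have "\<dots> = (9 * exp t) * (\<alpha> * exp (- \<alpha> * s))" by simp
      finally show ?thesis using that assms by (simp add: ennreal_leI flip: ennreal_mult)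
    qed
    have 2: "ennreal (\<alpha> * exp (- \<alpha> * s) * real (card {k. k \<in> S \<and> log_jap k \<le> s})) \<le> ennreal (9 / (1 - \<alpha>)) * (ennreal ((1 - \<alpha>) * exp ((1 - \<alpha>) * s)) * indicator {..t} s)" if "s \<le> t"
    proof (cases "0 \<le> s")
      case True
      have "\<alpha> * exp (- \<alpha> * s) * real (card {k. k \<in> S \<and> log_jap k \<le> s}) \<le> 1 * exp (- \<alpha> * s) * (9 * exp s)"
        using assms lattice_count[OF True, of S] by (intro mult_mono) auto
      also have "\<dots> = 9 * exp ((1 - \<alpha>) * s)" by (simp add: algebra_simps flip: exp_add)
      also have "\<dots> = 9 / (1 - \<alpha>) * ((1 - \<alpha>) * exp ((1 - \<alpha>) * s))"
        using assms by simp
      finally show ?thesis using that assms by (simp add: ennreal_leI flip: ennreal_mult)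
    next
      case False
      then have "{k. k \<in> S \<and> log_jap k \<le> s} = {}"
        using log_jap_nonneg by (auto simp: not_le) (meson less_le_trans not_less)
      then show ?thesis by (simp del: Collect_empty_eq)
    qed
    show "ennreal (\<alpha> * exp (- \<alpha> * s) * (\<Sum>k | k \<in> S \<and> log_jap k \<le> s. 1)) \<le> ennreal (9 * exp t) * (ennreal (\<alpha> * exp (- \<alpha> * s)) * indicator {t..} s)
       + ennreal (9 / (1 - \<alpha>)) * (ennreal ((1 - \<alpha>) * exp ((1 - \<alpha>) * s)) * indicator {..t} s)"
      using 1 2 by (cases "t \<le> s") (auto intro: add_increasing add_increasing2)
  qed
  also have "\<dots> = ennreal (9 * exp t) * ennreal (exp (- \<alpha> * t)) + ennreal (9 / (1 - \<alpha>)) * ennreal (exp ((1 - \<alpha>) * t))"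
  proof -
    have "(\<integral>\<^sup>+s. ennreal ((1 - \<alpha>) * exp ((1 - \<alpha>) * s)) * indicator {..t} s \<partial>lborel)
        = (\<integral>\<^sup>+s. ennreal ((1 - \<alpha>) * exp (- (1 - \<alpha>) * s)) * indicator {- t..} s \<partial>lborel)"
      by (subst nn_integral_real_affine[where c = "- 1" and t = 0]) (auto intro!: nn_integral_cong simp: indicator_def algebra_simps)
    then have "(\<integral>\<^sup>+s. ennreal ((1 - \<alpha>) * exp ((1 - \<alpha>) * s)) * indicator {..t} s \<partial>lborel) = ennreal (exp ((1 - \<alpha>) * t))"
      using nn_integral_exp_tail[of "1 - \<alpha>" "- t"] assms by (simp add: algebra_simps)
    then show ?thesis
      by (subst nn_integral_add) (auto simp: nn_integral_cmult nn_integral_exp_tail[OF assms(2), simplified])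
  qed
  also have "\<dots> = ennreal (9 * exp ((1 - \<alpha>) * t) + 9 / (1 - \<alpha>) * exp ((1 - \<alpha>) * t))"
  proof -
    have "exp t * exp (- \<alpha> * t) = exp ((1 - \<alpha>) * t)" by (simp add: algebra_simps flip: exp_add)
    then show ?thesis using assms by (simp flip: ennreal_mult ennreal_plus)
  qed
  also have "\<dots> \<le> ennreal (18 / (1 - \<alpha>) * exp ((1 - \<alpha>) * t))"
  proof (intro ennreal_leI)
    have "9 \<le> 9 / (1 - \<alpha>)" using assms by (simp add: field_simps)
    then have "9 * exp ((1 - \<alpha>) * t) \<le> 9 / (1 - \<alpha>) * exp ((1 - \<alpha>) * t)" by (intro mult_right_mono) auto
    then show "9 * exp ((1 - \<alpha>) * t) + 9 / (1 - \<alpha>) * exp ((1 - \<alpha>) * t) \<le> 18 / (1 - \<alpha>) * exp ((1 - \<alpha>) * t)" by simp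
  qed
  finally show ?thesis using assms by (simp add: S_def)
qed

text \<open>The value at \<beta> = 1 of the cost exp(\<beta> c / pi) of the translation in
  \<open>nn_integral_exp_affine_power\<close>, with the c = 5 + 3 pi of
  \<open>lattice_log_sum\<close>.\<close>

abbreviation lat_const :: real where
  "lat_const \<equiv> exp ((5 + 3 * pi) / pi)"

section \<open>Sums over tuples of frequencies\<close>

abbreviation tuples :: "nat \<Rightarrow> (int \<times> int) set \<Rightarrow> (nat \<Rightarrow> int \<times> int) set" where
  "tuples n F \<equiv> PiE {..<n} (\<lambda>_. F)"

abbreviation sobolev_wt :: "real \<Rightarrow> int \<times> int \<Rightarrow> real" where
  "sobolev_wt \<alpha> \<equiv> (\<lambda>k. japanese k powr (- \<alpha>))"

text \<open>The n-fold convolution power of 1 / \<open>japanese\<close> restricted to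
  \<open>F\<close>, summed against the weight \<open>w\<close>.\<close>

definition conv_sum :: "nat \<Rightarrow> (int \<times> int) set \<Rightarrow> (int \<times> int \<Rightarrow> real) \<Rightarrow> real" where
  "conv_sum n F w = (\<Sum>\<kappa>\<in>tuples n F. (\<Prod>i<n. 1 / japanese (\<kappa> i)) * w (\<Sum>i<n. \<kappa> i))"

lemma prod_japanese_nonneg: "0 \<le> (\<Prod>i\<in>I. 1 / japanese (\<kappa> i))"
  using japanese_pos by (intro prod_nonneg) (auto simp: less_imp_le)

text \<open>Substituting s = x / \<beta> - c / pi turns the affine factor into the monomial pi x /
  \<beta>. What remains is a Gamma integral, so c leaves the leading constant pi / \<beta>
  intact.\<close>

lemma nn_integral_exp_affine_power:
  assumes \<beta>: "\<beta> > 0" and c: "c \<ge> 0"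
  shows "(\<integral>\<^sup>+s. ennreal (\<beta> * exp (- \<beta> * s) * (pi * s + c) ^ m) * indicator {0..} s \<partial>lborel)
     \<le> ennreal (exp (\<beta> * c / pi) * (pi / \<beta>) ^ m * fact m)"
proof -
  have "(\<integral>\<^sup>+s. ennreal (\<beta> * exp (- \<beta> * s) * (pi * s + c) ^ m) * indicator {0..} s \<partial>lborel)
     = ennreal (1 / \<beta>) * (\<integral>\<^sup>+x. ennreal (\<beta> * exp (- \<beta> * (- c / pi + 1 / \<beta> * x)) * (pi * (- c / pi + 1 / \<beta> * x) + c) ^ m) * indicator {0..} (- c / pi + 1 / \<beta> * x) \<partial>lborel)"
    by (subst nn_integral_real_affine[where c = "1 / \<beta>" and t = "- c / pi"]) (use \<beta> in auto)
  also have "\<dots> \<le> ennreal (1 / \<beta>) * (\<integral>\<^sup>+x. ennreal (\<beta> * exp (\<beta> * c / pi) * (pi / \<beta>) ^ m) * (ennreal (x ^ m * exp (- x)) * indicator {0..} x) \<partial>lborel)"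
  proof (intro mult_left_mono nn_integral_mono)
    fix x :: real
    show "ennreal (\<beta> * exp (- \<beta> * (- c / pi + 1 / \<beta> * x)) * (pi * (- c / pi + 1 / \<beta> * x) + c) ^ m) * indicator {0..} (- c / pi + 1 / \<beta> * x)
      \<le> ennreal (\<beta> * exp (\<beta> * c / pi) * (pi / \<beta>) ^ m) * (ennreal (x ^ m * exp (- x)) * indicator {0..} x)"
    proof (cases "0 \<le> - c / pi + 1 / \<beta> * x")
      case True
      then have "c / pi \<le> x / \<beta>" by simp
      then have "0 \<le> x / \<beta>" using c by (smt (verit) divide_nonneg_pos pi_gt_zero)
      then have x: "0 \<le> x" using \<beta> by (simp add: zero_le_divide_iff)
      have 1: "- \<beta> * (- c / pi + 1 / \<beta> * x) = \<beta> * c / pi + - x" using \<beta> by (simp add: algebra_simps)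
      have 2: "pi * (- c / pi + 1 / \<beta> * x) + c = pi / \<beta> * x" by (simp add: algebra_simps)
      show ?thesis unfolding 1 2 exp_add power_mult_distrib using x \<beta>
        by (auto simp: indicator_def ennreal_mult[symmetric] mult_ac)
    qed simp
  qed simp
  also have "\<dots> = ennreal (1 / \<beta>) * (ennreal (\<beta> * exp (\<beta> * c / pi) * (pi / \<beta>) ^ m) * ennreal (fact m))"
    by (subst nn_integral_cmult) (use nn_intergal_power_times_exp_Ici[of m] in auto)
  also have "\<dots> = ennreal (exp (\<beta> * c / pi) * (pi / \<beta>) ^ m * fact m)"
    using \<beta> by (simp add: ennreal_mult[symmetric])
  finally show ?thesis .
qed

text \<open>The condition that the maximum is at most s is a product condition, so after the
  layer-cake formula the inner sum factors into lattice sums. Inserting 0 gives the maximum a value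
  for empty \<open>I\<close>.\<close>

lemma sum_max_decay_bound:
  assumes F: "finite F" and I: "finite I" and \<beta>: "\<beta> > 0"
  shows "(\<Sum>\<kappa>\<in>PiE I (\<lambda>_. F). (\<Prod>i\<in>I. 1 / japanese (\<kappa> i)) * exp (- \<beta> * Max (insert 0 ((\<lambda>i. log_jap (\<kappa> i)) ` I))))
      \<le> exp (\<beta> * (5 + 3 * pi) / pi) * (pi / \<beta>) ^ card I * fact (card I)"
proof -
  define c where "c = 5 + 3 * pi"
  have c: "c \<ge> 0" by (simp add: c_def add_nonneg_nonneg)
  define Y where "Y \<kappa> = Max (insert 0 ((\<lambda>i. log_jap (\<kappa> i)) ` I))" for \<kappa>
  define W where "W \<kappa> = (\<Prod>i\<in>I. 1 / japanese (\<kappa> i))" for \<kappa>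
  have W: "0 \<le> W \<kappa>" for \<kappa> unfolding W_def by (rule prod_japanese_nonneg)
  have fin: "finite (PiE I (\<lambda>_. F))" using F I by (intro finite_PiE) auto
  have Yle: "Y \<kappa> \<le> s \<longleftrightarrow> 0 \<le> s \<and> (\<forall>i\<in>I. log_jap (\<kappa> i) \<le> s)" for \<kappa> s
    using I by (simp add: Y_def)
  have "ennreal (\<Sum>\<kappa>\<in>PiE I (\<lambda>_. F). W \<kappa> * exp (- \<beta> * Y \<kappa>))
      = (\<integral>\<^sup>+s. ennreal (\<beta> * exp (- \<beta> * s) * (\<Sum>\<kappa> | \<kappa> \<in> PiE I (\<lambda>_. F) \<and> Y \<kappa> \<le> s. W \<kappa>)) \<partial>lborel)"
    by (rule layer_cake[OF fin \<beta> W])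
  also have "\<dots> \<le> (\<integral>\<^sup>+s. ennreal (\<beta> * exp (- \<beta> * s) * (pi * s + c) ^ card I) * indicator {0..} s \<partial>lborel)"
  proof (intro nn_integral_mono)
    fix s :: real
    show "ennreal (\<beta> * exp (- \<beta> * s) * (\<Sum>\<kappa> | \<kappa> \<in> PiE I (\<lambda>_. F) \<and> Y \<kappa> \<le> s. W \<kappa>)) \<le> ennreal (\<beta> * exp (- \<beta> * s) * (pi * s + c) ^ card I) * indicator {0..} s"
    proof (cases "0 \<le> s")
      case True
      define G where "G = {k. k \<in> F \<and> log_jap k \<le> s}"
      have "{\<kappa>. \<kappa> \<in> PiE I (\<lambda>_. F) \<and> Y \<kappa> \<le> s} = PiE I (\<lambda>_. G)"
        using True unfolding Yle by (auto simp: G_def PiE_iff dest: extensional_arb)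
      then have "(\<Sum>\<kappa> | \<kappa> \<in> PiE I (\<lambda>_. F) \<and> Y \<kappa> \<le> s. W \<kappa>) = (\<Sum>\<kappa>\<in>PiE I (\<lambda>_. G). W \<kappa>)" by simp
      also have "\<dots> = (\<Prod>i\<in>I. \<Sum>k\<in>G. 1 / japanese k)"
        unfolding W_def using F I by (intro prod_sum_PiE[symmetric]) (auto simp: G_def)
      also have "\<dots> = (\<Sum>k\<in>G. 1 / japanese k) ^ card I" by simp
      also have "\<dots> \<le> (pi * s + c) ^ card I"
        unfolding G_def c_def using japanese_pos
        by (intro power_mono lattice_log_sum True sum_nonneg) (auto simp: less_imp_le)
      finally show ?thesis using True \<beta> by (auto intro!: ennreal_leI mult_left_mono)
    next
      case False
      then have "{\<kappa>. \<kappa> \<in> PiE I (\<lambda>_. F) \<and> Y \<kappa> \<le> s} = {}" by (auto simp: Yle)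
      then show ?thesis by (simp del: Collect_empty_eq)
    qed
  qed
  also have "\<dots> \<le> ennreal (exp (\<beta> * c / pi) * (pi / \<beta>) ^ card I * fact (card I))"
    by (rule nn_integral_exp_affine_power[OF \<beta> c])
  finally show ?thesis
    using \<beta> by (subst (asm) ennreal_le_iff) (auto simp: W_def Y_def c_def)
qed

text \<open>The n positions of the largest entry times the (n - 1)! of the Gamma integral give n!.
  With ties, every maximal position is counted; as the terms are nonnegative, this only enlarges the
  sum. The bound \<open>D\<close> is uniform in the shift \<open>v\<close>, the sum of the remaining
  entries.\<close>

lemma conv_sum_bound:
  assumes F: "finite F" and n: "n \<ge> 1" and \<beta>: "\<beta> > 0" and w: "\<And>k. 0 \<le> w k"
    and D: "\<And>v t. t \<ge> 0 \<Longrightarrow> (\<Sum>k | k \<in> F \<and> t \<le> log_jap k. 1 / japanese k * w (k + v)) \<le> D * exp (- \<beta> * t)"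
  shows "conv_sum n F w \<le> D * exp (\<beta> * (5 + 3 * pi) / pi) * fact n * (pi / \<beta>) ^ (n - 1)"
proof -
  define T where "T \<kappa> = (\<Prod>i<n. 1 / japanese (\<kappa> i)) * w (\<Sum>i<n. \<kappa> i)" for \<kappa>
  have T: "0 \<le> T \<kappa>" for \<kappa> unfolding T_def using w by (intro mult_nonneg_nonneg prod_japanese_nonneg)
  have D0: "0 \<le> D"
  proof -
    have "0 \<le> (\<Sum>k | k \<in> F \<and> 0 \<le> log_jap k. 1 / japanese k * w (k + 0))"
      using w japanese_pos by (intro sum_nonneg) (auto simp: less_imp_le)
    then show ?thesis using D[of 0 0] by simp
  qed
  define E where "E = exp (\<beta> * (5 + 3 * pi) / pi) * (pi / \<beta>) ^ (n - 1) * fact (n - 1)"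
  have one: "T \<kappa> \<le> (\<Sum>i<n. if \<forall>j\<in>{..<n} - {i}. log_jap (\<kappa> j) \<le> log_jap (\<kappa> i) then T \<kappa> else 0)" for \<kappa>
  proof -
    have "finite ((\<lambda>i. log_jap (\<kappa> i)) ` {..<n})" "(\<lambda>i. log_jap (\<kappa> i)) ` {..<n} \<noteq> {}" using n by (auto simp: lessThan_empty_iff)
    then obtain i where i: "i < n" "log_jap (\<kappa> i) = Max ((\<lambda>i. log_jap (\<kappa> i)) ` {..<n})"
      using Max_in by (metis (mono_tags, lifting) image_iff lessThan_iff)
    then have "\<forall>j\<in>{..<n} - {i}. log_jap (\<kappa> j) \<le> log_jap (\<kappa> i)" by auto
    then have "T \<kappa> = (if \<forall>j\<in>{..<n} - {i}. log_jap (\<kappa> j) \<le> log_jap (\<kappa> i) then T \<kappa> else 0)" by simp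
    also have "\<dots> \<le> (\<Sum>i<n. if \<forall>j\<in>{..<n} - {i}. log_jap (\<kappa> j) \<le> log_jap (\<kappa> i) then T \<kappa> else 0)"
      using i T by (intro member_le_sum[where i = i]) auto
    finally show ?thesis .
  qed
  have "conv_sum n F w \<le> (\<Sum>\<kappa>\<in>tuples n F. \<Sum>i<n. if \<forall>j\<in>{..<n} - {i}. log_jap (\<kappa> j) \<le> log_jap (\<kappa> i) then T \<kappa> else 0)"
    unfolding conv_sum_def T_def[symmetric] by (intro sum_mono one)
  also have "\<dots> = (\<Sum>i<n. \<Sum>\<kappa>\<in>tuples n F. if \<forall>j\<in>{..<n} - {i}. log_jap (\<kappa> j) \<le> log_jap (\<kappa> i) then T \<kappa> else 0)"
    by (rule sum.swap)
  also have "\<dots> \<le> (\<Sum>i<n. D * E)"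
  proof (rule sum_mono)
    fix i assume "i \<in> {..<n}"
    define I where "I = {..<n} - {i}"
    have I: "finite I" "i \<notin> I" "{..<n} = insert i I" "card I = n - 1"
      using \<open>i \<in> {..<n}\<close> by (auto simp: I_def)
    define Y where "Y \<kappa> = Max (insert 0 ((\<lambda>i. log_jap (\<kappa> i)) ` I))" for \<kappa>
    have Yle: "Y \<kappa> \<le> s \<longleftrightarrow> 0 \<le> s \<and> (\<forall>i\<in>I. log_jap (\<kappa> i) \<le> s)" for \<kappa> s
      using I by (simp add: Y_def)
    have Y0: "0 \<le> Y \<kappa>" for \<kappa> using I by (simp add: Y_def)
    define W where "W \<kappa> = (\<Prod>i\<in>I. 1 / japanese (\<kappa> i))" for \<kappa>
    have W: "0 \<le> W \<kappa>" for \<kappa> unfolding W_def by (rule prod_japanese_nonneg)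
    have step: "(if \<forall>j\<in>I. log_jap ((\<kappa>(i := k)) j) \<le> log_jap ((\<kappa>(i := k)) i) then T (\<kappa>(i := k)) else 0)
        = W \<kappa> * (if Y \<kappa> \<le> log_jap k then 1 / japanese k * w (k + (\<Sum>j\<in>I. \<kappa> j)) else 0)" for \<kappa> k
    proof -
      have 1: "(\<forall>j\<in>I. log_jap ((\<kappa>(i := k)) j) \<le> log_jap ((\<kappa>(i := k)) i)) \<longleftrightarrow> Y \<kappa> \<le> log_jap k"
        unfolding Yle using I(2) log_jap_nonneg by auto
      have 2: "(\<Sum>j\<in>I. (\<kappa>(i := k)) j) = (\<Sum>j\<in>I. \<kappa> j)" using I(2) by (intro sum.cong) auto
      have 3: "(\<Prod>j\<in>I. 1 / japanese ((\<kappa>(i := k)) j)) = W \<kappa>" unfolding W_def using I(2) by (intro prod.cong) auto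
      have "T (\<kappa>(i := k)) = 1 / japanese k * W \<kappa> * w (k + (\<Sum>j\<in>I. \<kappa> j))"
        unfolding T_def I(3) using I(1,2) 2 3 by (simp del: fun_upd_apply) simp
      then show ?thesis unfolding 1 by simp
    qed
    have "(\<Sum>\<kappa>\<in>tuples n F. if \<forall>j\<in>{..<n} - {i}. log_jap (\<kappa> j) \<le> log_jap (\<kappa> i) then T \<kappa> else 0)
       = (\<Sum>k\<in>F. \<Sum>\<kappa>\<in>PiE I (\<lambda>_. F). W \<kappa> * (if Y \<kappa> \<le> log_jap k then 1 / japanese k * w (k + (\<Sum>j\<in>I. \<kappa> j)) else 0))"
      unfolding I_def[symmetric] unfolding I(3) sum_PiE_insert[OF I(2)] step ..
    also have "\<dots> = (\<Sum>\<kappa>\<in>PiE I (\<lambda>_. F). W \<kappa> * (\<Sum>k | k \<in> F \<and> Y \<kappa> \<le> log_jap k. 1 / japanese k * w (k + (\<Sum>j\<in>I. \<kappa> j))))"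
      using F by (subst sum.swap) (simp only: sum_distrib_left[symmetric] sum.inter_filter)
    also have "\<dots> \<le> (\<Sum>\<kappa>\<in>PiE I (\<lambda>_. F). W \<kappa> * (D * exp (- \<beta> * Y \<kappa>)))"
      by (intro sum_mono mult_left_mono D Y0 W)
    also have "\<dots> = D * (\<Sum>\<kappa>\<in>PiE I (\<lambda>_. F). W \<kappa> * exp (- \<beta> * Y \<kappa>))"
      by (simp add: sum_distrib_left mult_ac)
    also have "\<dots> \<le> D * E"
      using sum_max_decay_bound[OF F I(1) \<beta>] D0 unfolding W_def Y_def E_def I(4) by (intro mult_left_mono) auto
    finally show "(\<Sum>\<kappa>\<in>tuples n F. if \<forall>j\<in>{..<n} - {i}. log_jap (\<kappa> j) \<le> log_jap (\<kappa> i) then T \<kappa> else 0) \<le> D * E" .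
  qed
  also have "\<dots> = D * exp (\<beta> * (5 + 3 * pi) / pi) * fact n * (pi / \<beta>) ^ (n - 1)"
    using n by (cases n) (auto simp: E_def)
  finally show ?thesis .
qed

lemma conv_sum_mono:
  assumes "finite F'" "F \<subseteq> F'" "\<And>k. 0 \<le> w k"
  shows "conv_sum n F w \<le> conv_sum n F' w"
  unfolding conv_sum_def
proof (rule sum_mono2)
  show "finite (tuples n F')" using assms by (intro finite_PiE) auto
  show "tuples n F \<subseteq> tuples n F'" using assms by (intro PiE_mono) auto
qed (intro mult_nonneg_nonneg prod_japanese_nonneg assms)

lemma conv_sum_sobolev_bound:
  assumes F: "finite F" and n: "n \<ge> 1" and \<alpha>: "0 < \<alpha>" "\<alpha> < 1"
  shows "conv_sum n F (sobolev_wt \<alpha>)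
     \<le> 54 / (1 - \<alpha>) * lat_const * (1 / \<alpha>) * fact n * (pi / \<alpha>) ^ (n - 1)"
proof -
  have jp: "japanese k powr c = exp (c * log_jap k)" for k c
    using japanese_pos[of k] by (simp add: powr_def log_jap_def)
  have ja: "1 / japanese k = exp (- log_jap k)" for k
    by (simp add: exp_minus exp_log_jap divide_inverse)
  have D: "(\<Sum>k | k \<in> F \<and> t \<le> log_jap k. 1 / japanese k * japanese (k + v) powr (- \<alpha>)) \<le> (54 / (\<alpha> * (1 - \<alpha>))) * exp (- \<alpha> * t)"
    if t: "t \<ge> 0" for v t
  proof -
    define S where "S = {k. k \<in> F \<and> t \<le> log_jap k}"
    have S: "finite S" using F by (simp add: S_def)
    define F' where "F' = (\<lambda>k. k + v) ` S"
    have F': "finite F'" using S by (simp add: F'_def)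
    have inj: "inj_on (\<lambda>k. k + v) A" for A by (auto intro: inj_onI)
    define P where "P k = exp (- (1 + \<alpha>) * log_jap k)" for k
    have P0: "0 \<le> P k" for k by (simp add: P_def)
    \<comment> \<open>If \<open>k\<close> is not farther out than \<open>k + v\<close>, the summand
      is at most \<open>P k\<close>. Otherwise it is at most \<open>P (k + v)\<close>, except when
      \<open>k + v\<close> lies inside radius \<open>t\<close>; then 1 / \<open>japanese k\<close>
      is at most exp(-t).\<close>
    have pt: "1 / japanese k * japanese (k + v) powr (- \<alpha>)
       \<le> P k + (if t \<le> log_jap (k + v) then P (k + v) else 0)
           + (if log_jap (k + v) \<le> t then exp (- t) * exp (- \<alpha> * log_jap (k + v)) else 0)" if "k \<in> S" for k
    proof -
      have kt: "t \<le> log_jap k" using that by (simp add: S_def)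
      have eq: "1 / japanese k * japanese (k + v) powr (- \<alpha>) = exp (- log_jap k - \<alpha> * log_jap (k + v))"
        by (simp add: ja jp flip: exp_add)
      have nn: "0 \<le> (if t \<le> log_jap (k + v) then P (k + v) else 0)"
        "0 \<le> (if log_jap (k + v) \<le> t then exp (- t) * exp (- \<alpha> * log_jap (k + v)) else 0)"
        using P0 by auto
      consider "log_jap k \<le> log_jap (k + v)" | "log_jap (k + v) \<le> log_jap k" "t \<le> log_jap (k + v)" | "log_jap (k + v) \<le> t"
        using kt by linarith
      then show ?thesis
      proof cases
        case 1
        then have "\<alpha> * log_jap k \<le> \<alpha> * log_jap (k + v)" using \<alpha> by simp
        then have "exp (- log_jap k - \<alpha> * log_jap (k + v)) \<le> P k" by (simp add: P_def algebra_simps)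
        then show ?thesis unfolding eq using nn by linarith
      next
        case 2
        then have "exp (- log_jap k - \<alpha> * log_jap (k + v)) \<le> P (k + v)" by (simp add: P_def algebra_simps)
        then have "exp (- log_jap k - \<alpha> * log_jap (k + v)) \<le> (if t \<le> log_jap (k + v) then P (k + v) else 0)" using 2 by simp
        then show ?thesis unfolding eq using nn P0[of k] by linarith
      next
        case 3
        then have "exp (- log_jap k - \<alpha> * log_jap (k + v)) \<le> exp (- t) * exp (- \<alpha> * log_jap (k + v))"
          using kt by (simp flip: exp_add)
        then have "exp (- log_jap k - \<alpha> * log_jap (k + v)) \<le> (if log_jap (k + v) \<le> t then exp (- t) * exp (- \<alpha> * log_jap (k + v)) else 0)" using 3 by simp
        then show ?thesis unfolding eq using nn P0[of k] by linarith
      qed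
    qed
    have "(\<Sum>k\<in>S. 1 / japanese k * japanese (k + v) powr (- \<alpha>))
      \<le> (\<Sum>k\<in>S. P k + (if t \<le> log_jap (k + v) then P (k + v) else 0)
           + (if log_jap (k + v) \<le> t then exp (- t) * exp (- \<alpha> * log_jap (k + v)) else 0))"
      by (intro sum_mono pt)
    also have "\<dots> = (\<Sum>k\<in>S. P k) + (\<Sum>k\<in>F'. if t \<le> log_jap k then P k else 0) + (\<Sum>k\<in>F'. if log_jap k \<le> t then exp (- t) * exp (- \<alpha> * log_jap k) else 0)"
      unfolding F'_def by (simp add: sum.distrib sum.reindex[OF inj] o_def)
    also have "\<dots> = (\<Sum>k\<in>S. P k) + (\<Sum>k | k \<in> F' \<and> t \<le> log_jap k. P k) + exp (- t) * (\<Sum>k | k \<in> F' \<and> log_jap k \<le> t. exp (- \<alpha> * log_jap k))"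
      using F' by (simp only: sum.inter_filter sum_distrib_left)
        (simp add: if_distrib[of "\<lambda>x. exp (- t) * x"] cong: if_cong)
    also have "\<dots> \<le> 18 / \<alpha> * exp (- \<alpha> * t) + 18 / \<alpha> * exp (- \<alpha> * t) + exp (- t) * (18 / (1 - \<alpha>) * exp ((1 - \<alpha>) * t))"
      unfolding P_def S_def using \<alpha> t F F'
      by (intro add_mono mult_left_mono lattice_tail_sum lattice_ball_sum) auto
    also have "exp (- t) * (18 / (1 - \<alpha>) * exp ((1 - \<alpha>) * t)) = 18 / (1 - \<alpha>) * exp (- \<alpha> * t)"
    proof -
      have "exp (- t) * exp ((1 - \<alpha>) * t) = exp (- \<alpha> * t)" by (simp add: algebra_simps flip: exp_add)
      then show ?thesis by (metis mult.left_commute)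
    qed
    also have "18 / \<alpha> * exp (- \<alpha> * t) + 18 / \<alpha> * exp (- \<alpha> * t) + 18 / (1 - \<alpha>) * exp (- \<alpha> * t) = (36 / \<alpha> + 18 / (1 - \<alpha>)) * exp (- \<alpha> * t)"
      by (simp add: algebra_simps)
    \<comment> \<open>Over the common denominator the numerator is 36 - 18 \<alpha>, which is below
      54.\<close>
    also have "\<dots> \<le> (54 / (\<alpha> * (1 - \<alpha>))) * exp (- \<alpha> * t)"
      using \<alpha> by (intro mult_right_mono) (auto simp: field_simps intro!: mult_le_one)
    finally show ?thesis by (simp add: S_def)
  qed
  have "conv_sum n F (sobolev_wt \<alpha>) \<le> (54 / (\<alpha> * (1 - \<alpha>))) * exp (\<alpha> * (5 + 3 * pi) / pi) * fact n * (pi / \<alpha>) ^ (n - 1)"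
    by (rule conv_sum_bound[OF F n \<alpha>(1) _ D]) auto
  also have "\<dots> \<le> (54 / (\<alpha> * (1 - \<alpha>))) * lat_const * fact n * (pi / \<alpha>) ^ (n - 1)"
  proof -
    have "\<alpha> * (5 + 3 * pi) / pi \<le> 1 * (5 + 3 * pi) / pi"
      using \<alpha> by (intro divide_right_mono mult_right_mono) (auto intro: add_nonneg_nonneg)
    then show ?thesis using \<alpha> by (intro mult_right_mono mult_left_mono) auto
  qed
  also have "\<dots> = 54 / (1 - \<alpha>) * lat_const * (1 / \<alpha>) * fact n * (pi / \<alpha>) ^ (n - 1)" by simp
  finally show ?thesis .
qed

text \<open>A summable weight bounds every shifted sum by its total mass, so 1 /
  \<open>japanese\<close> contributes its full decay exp(-t): the rate is 1 in place of
  \<alpha>.\<close>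

lemma conv_sum_summable_bound:
  assumes F: "finite F" and n: "n \<ge> 1" and w: "\<And>k. 0 \<le> w k" and W: "\<And>A. finite A \<Longrightarrow> (\<Sum>k\<in>A. w k) \<le> W"
  shows "conv_sum n F w \<le> W * lat_const * fact n * pi ^ (n - 1)"
proof -
  have "conv_sum n F w \<le> W * exp (1 * (5 + 3 * pi) / pi) * fact n * (pi / 1) ^ (n - 1)"
  proof (rule conv_sum_bound[OF F n _ w])
    fix v :: "int \<times> int" and t :: real assume "t \<ge> 0"
    define S where "S = {k. k \<in> F \<and> t \<le> log_jap k}"
    have S: "finite S" using F by (simp add: S_def)
    have inj: "inj_on (\<lambda>k. k + v) S" by (auto intro: inj_onI)
    have "(\<Sum>k\<in>S. 1 / japanese k * w (k + v)) \<le> (\<Sum>k\<in>S. exp (- t) * w (k + v))"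
    proof (intro sum_mono mult_right_mono w)
      fix k assume "k \<in> S"
      then show "1 / japanese k \<le> exp (- t)"
        by (simp add: S_def exp_minus exp_log_jap[symmetric] divide_inverse)
    qed
    also have "\<dots> = exp (- t) * (\<Sum>k\<in>(\<lambda>k. k + v) ` S. w k)"
      by (simp add: sum_distrib_left sum.reindex[OF inj])
    also have "\<dots> \<le> exp (- t) * W" using S by (intro mult_left_mono W) auto
    finally show "(\<Sum>k | k \<in> F \<and> t \<le> log_jap k. 1 / japanese k * w (k + v)) \<le> W * exp (- 1 * t)"
      by (simp add: S_def mult.commute)
  qed simp
  then show ?thesis by simp
qed

section \<open>The trigonometric basis\<close>

lemma lat_add: "lat (k + l) = lat k + lat l" and lat_diff: "lat (k - l) = lat k - lat l"
  and lat_minus: "lat (- k) = - lat k" and lat_0: "lat 0 = 0"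
  by (auto simp: lat_def zero_prod_def)

lemma japanese_minus: "japanese (- k) = japanese k"
  by (simp add: japanese_def lat_minus)

lemma space_torus: "space torus = {0..<2 * pi} \<times> {0..<2 * pi}"
  by (auto simp: torus_def space_restrict_space)

lemma sets_torus_measurable:
  assumes "f \<in> borel_measurable borel" shows "f \<in> borel_measurable torus"
  using assms by (simp add: torus_def measurable_restrict_space1)

lemma torus_set_borel: "{0..<2 * pi} \<times> {0..<2 * pi} \<in> sets (borel :: (real \<times> real) measure)"
  unfolding borel_prod[symmetric] by (intro pair_measureI) auto

lemma finite_measure_torus: "finite_measure torus"
proof (rule finite_measureI)
  have "emeasure torus (space torus) = emeasure lborel ({0..<2 * pi} \<times> {0..<2 * pi} :: (real \<times> real) set)"
    unfolding space_torus unfolding torus_def by (rule emeasure_restrict_space) (auto simp: torus_set_borel)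
  also have "\<dots> \<le> emeasure lborel (cbox (0, 0) (2 * pi, 2 * pi) :: (real \<times> real) set)"
  proof (rule emeasure_mono)
    show "{0..<2 * pi} \<times> {0..<2 * pi} \<subseteq> (cbox (0, 0) (2 * pi, 2 * pi) :: (real \<times> real) set)"
      by (auto simp: cbox_Pair_eq)
  qed simp
  also have "\<dots> < \<infinity>" by (rule emeasure_lborel_cbox_finite)
  finally show "emeasure torus (space torus) \<noteq> \<infinity>" by simp
qed

interpretation torus: finite_measure torus by (rule finite_measure_torus)

lemma integral_cos_period:
  "(LBINT y. indicator {0..<2 * pi} y *\<^sub>R cos (a + real_of_int m * y)) = (if m = 0 then 2 * pi * cos a else 0)"
proof -
  have "(LBINT y. indicator {0..<2 * pi} y *\<^sub>R cos (a + real_of_int m * y)) = (LBINT y. cos (a + real_of_int m * y) * indicator {0..2 * pi} y)"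
  proof (rule integral_cong_AE)
    show "AE y in lborel. indicator {0..<2 * pi} y *\<^sub>R cos (a + real_of_int m * y) = cos (a + real_of_int m * y) * indicator {0..2 * pi} y"
      using AE_lborel_singleton[of "2 * pi"] by eventually_elim (auto simp: indicator_def)
  qed auto
  also have "\<dots> = (if m = 0 then 2 * pi * cos a else 0)"
  proof (cases "m = 0")
    case True
    have "(LBINT y. cos (a + real_of_int m * y) * indicator {0..2 * pi} y) = 2 * pi * cos a - 0 * cos a"
      by (rule integral_FTC_Icc_real[where F = "\<lambda>y. y * cos a"]) (auto intro!: derivative_eq_intros simp: True)
    then show ?thesis using True by simp
  next
    case False
    have "(LBINT y. cos (a + real_of_int m * y) * indicator {0..2 * pi} y)
       = sin (a + real_of_int m * (2 * pi)) / m - sin (a + real_of_int m * 0) / m"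
      by (rule integral_FTC_Icc_real[where F = "\<lambda>y. sin (a + real_of_int m * y) / m"])
         (use False in \<open>auto intro!: derivative_eq_intros continuous_intros\<close>)
    moreover have "sin (a + real_of_int m * (2 * pi)) = sin a"
      using sin.plus_of_int[of a m] by (simp add: mult.commute)
    ultimately show ?thesis using False by simp
  qed
  finally show ?thesis .
qed

lemma integral_torus_cos:
  "(LINT x|torus. cos (c + lat k \<bullet> x)) = (if k = 0 then 4 * pi\<^sup>2 * cos c else 0)"
proof -
  let ?Q = "{0..<2 * pi} \<times> {0..<2 * pi} :: (real \<times> real) set"
  have int: "integrable torus (\<lambda>x. cos (c + lat k \<bullet> x))"
    by (rule torus.integrable_const_bound[where B = 1]) (auto intro!: sets_torus_measurable)
  have eq: "(LINT x|torus. cos (c + lat k \<bullet> x)) = (LINT x|lborel. indicator ?Q x *\<^sub>R cos (c + lat k \<bullet> x))"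
    unfolding torus_def by (rule integral_restrict_space) (auto simp: torus_set_borel)
  have "integrable lborel (\<lambda>x. indicator ?Q x *\<^sub>R cos (c + lat k \<bullet> x))"
    using int unfolding torus_def by (subst (asm) integrable_restrict_space) (auto simp: torus_set_borel)
  then have int2: "integrable (lborel \<Otimes>\<^sub>M lborel) (\<lambda>x. indicator ?Q x *\<^sub>R cos (c + lat k \<bullet> x))"
    unfolding lborel_prod .
  have "(LINT x|lborel. indicator ?Q x *\<^sub>R cos (c + lat k \<bullet> x)) = (LBINT x. LBINT y. indicator ?Q (x, y) *\<^sub>R cos (c + lat k \<bullet> (x, y)))"
    using lborel_pair.integral_fst'[OF int2] by (simp add: lborel_prod)
  also have "\<dots> = (LBINT x. indicator {0..<2 * pi} x *\<^sub>R (LBINT y. indicator {0..<2 * pi} y *\<^sub>R cos ((c + real_of_int (fst k) * x) + real_of_int (snd k) * y)))"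
    by (intro Bochner_Integration.integral_cong refl) (simp add: indicator_times lat_def add.assoc mult.assoc)
  also have "\<dots> = (LBINT x. indicator {0..<2 * pi} x *\<^sub>R (if snd k = 0 then 2 * pi * cos (c + real_of_int (fst k) * x) else 0))"
    unfolding integral_cos_period ..
  also have "\<dots> = (if snd k = 0 then 2 * pi * (LBINT x. indicator {0..<2 * pi} x *\<^sub>R cos (c + real_of_int (fst k) * x)) else 0)"
    by (simp add: mult.left_commute)
  also have "\<dots> = (if k = 0 then 4 * pi\<^sup>2 * cos c else 0)"
    unfolding integral_cos_period by (cases k) (auto simp: zero_prod_def power2_eq_square)
  finally show ?thesis unfolding eq .
qed

text \<open>Amplitude and phase write every basis function as one cosine, so the cases of sine,
  cosine and constant share the product formulas.\<close>

definition e_amp :: "int \<times> int \<Rightarrow> real" where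
  "e_amp k = (if k = 0 then 1 / (2 * pi) else 1 / (sqrt 2 * pi))"

definition e_phase :: "int \<times> int \<Rightarrow> real" where
  "e_phase k = (if k = 0 \<or> k \<in> Z2_plus then 0 else pi / 2)"

lemma e_basis_cos: "e_basis k x = e_amp k * cos (- e_phase k + lat k \<bullet> x)"
proof -
  have "cos (- (pi / 2) + t) = sin t" for t :: real
    by (simp add: cos_diff)
  then show ?thesis
    by (auto simp: e_basis_def e_amp_def e_phase_def zero_prod_def lat_def simp flip: zero_prod_def)
qed

lemma Z2_plus_cases: "k = 0 \<or> (k \<in> Z2_plus \<and> - k \<notin> Z2_plus) \<or> (k \<notin> Z2_plus \<and> - k \<in> Z2_plus)"
  by (cases k) (auto simp: Z2_plus_def zero_prod_def)

lemma e_amp_minus: "e_amp (- k) = e_amp k"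
  by (simp add: e_amp_def)

text \<open>One of k and -k carries the cosine and the other the sine, so the sum is the addition
  formula for the cosine of a difference. Only the pair is translation invariant.\<close>

lemma e_basis_pair_sum:
  "e_basis k x * e_basis k y + e_basis (- k) x * e_basis (- k) y = cos (lat k \<bullet> (x - y)) / (2 * pi\<^sup>2)"
proof -
  have sc: "cos (- (pi / 2) + t) = sin t" for t :: real by (simp add: cos_diff)
  have a: "k \<noteq> 0 \<Longrightarrow> e_amp k * e_amp k = 1 / (2 * pi\<^sup>2)" by (simp add: e_amp_def power2_eq_square)
  have main: "e_amp k * cos (- e_phase k + s) * (e_amp k * cos (- e_phase k + t)) + e_amp k * cos (- e_phase (- k) - s) * (e_amp k * cos (- e_phase (- k) - t)) = cos (s - t) / (2 * pi\<^sup>2)" if "k \<noteq> 0" for s t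
  proof -
    have "e_amp k * cos (- e_phase k + s) * (e_amp k * cos (- e_phase k + t)) + e_amp k * cos (- e_phase (- k) - s) * (e_amp k * cos (- e_phase (- k) - t))
      = (e_amp k * e_amp k) * (cos (- e_phase k + s) * cos (- e_phase k + t) + cos (- e_phase (- k) - s) * cos (- e_phase (- k) - t))"
      by (simp add: algebra_simps)
    also have "cos (- e_phase k + s) * cos (- e_phase k + t) + cos (- e_phase (- k) - s) * cos (- e_phase (- k) - t) = cos (s - t)"
      using Z2_plus_cases[of k] that sc[of "- s"] sc[of "- t"]
      by (auto simp: e_phase_def sc cos_diff)
    finally show ?thesis using a[OF that] by simp
  qed
  show ?thesis
  proof (cases "k = 0")
    case True
    then show ?thesis by (simp add: e_basis_cos e_amp_def e_phase_def lat_0 power2_eq_square)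
  next
    case False
    then show ?thesis using main[of "lat k \<bullet> x" "lat k \<bullet> y"]
      by (simp add: e_basis_cos e_amp_minus lat_minus inner_diff_right)
  qed
qed

lemma e_basis_measurable[measurable]: "e_basis k \<in> borel_measurable borel"
  unfolding e_basis_cos[abs_def] by measurable

lemma e_basis_measurable_torus[measurable]: "e_basis k \<in> borel_measurable torus"
  by (rule sets_torus_measurable) simp

lemma e_basis_bound: "\<bar>e_basis k x\<bar> \<le> 1"
proof -
  have "e_amp k \<le> 1" "0 \<le> e_amp k"
  proof -
    have "1 \<le> 2 * pi" "1 \<le> sqrt 2 * pi"
      using pi_ge_two mult_mono[of 1 "sqrt 2" 1 pi] by auto
    then show "e_amp k \<le> 1" by (auto simp: e_amp_def)
  qed (auto simp: e_amp_def)
  then show ?thesis unfolding e_basis_cos by (auto simp: abs_mult intro!: mult_le_one)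
qed

lemma H_inner_e_basis: "H_inner (e_basis k) (e_basis l) = (if k = l then 1 else 0)"
proof -
  have i: "integrable torus (\<lambda>x. cos (c + lat m \<bullet> x))" for c m
    by (rule torus.integrable_const_bound[where B = 1]) (auto intro!: sets_torus_measurable)
  have "H_inner (e_basis k) (e_basis l)
      = (LINT x|torus. e_amp k * e_amp l / 2 * (cos ((- e_phase k + e_phase l) + lat (k - l) \<bullet> x) + cos ((- e_phase k - e_phase l) + lat (k + l) \<bullet> x)))"
    unfolding H_inner_def
  proof (intro Bochner_Integration.integral_cong refl)
    fix x
    define s t where "s = - e_phase k + lat k \<bullet> x" and "t = - e_phase l + lat l \<bullet> x"
    have 1: "(- e_phase k + e_phase l) + lat (k - l) \<bullet> x = s - t" "(- e_phase k - e_phase l) + lat (k + l) \<bullet> x = s + t"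
      by (auto simp: s_def t_def lat_diff lat_add inner_add_left inner_diff_left)
    show "e_basis k x * e_basis l x = e_amp k * e_amp l / 2 * (cos ((- e_phase k + e_phase l) + lat (k - l) \<bullet> x) + cos ((- e_phase k - e_phase l) + lat (k + l) \<bullet> x))"
      unfolding 1 e_basis_cos s_def[symmetric] t_def[symmetric] by (simp add: cos_diff cos_add)
  qed
  also have "\<dots> = e_amp k * e_amp l / 2 * ((LINT x|torus. cos ((- e_phase k + e_phase l) + lat (k - l) \<bullet> x)) + (LINT x|torus. cos ((- e_phase k - e_phase l) + lat (k + l) \<bullet> x)))"
    by (subst integral_mult_right_zero, subst Bochner_Integration.integral_add) (use i in auto)
  also have "\<dots> = e_amp k * e_amp l / 2 * ((if k = l then 4 * pi\<^sup>2 * cos (- e_phase k + e_phase l) else 0) + (if k = - l then 4 * pi\<^sup>2 * cos (- e_phase k - e_phase l) else 0))"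
    unfolding integral_torus_cos by (simp add: eq_neg_iff_add_eq_0)
  also have "\<dots> = (if k = l then 1 else 0)"
  proof (cases "k = l")
    case True
    show ?thesis
    proof (cases "l = 0")
      case True
      then show ?thesis using \<open>k = l\<close> by (simp add: e_amp_def e_phase_def power2_eq_square)
    next
      case False
      have "l \<noteq> - l" using False by (cases l) (auto simp: zero_prod_def)
      then show ?thesis using \<open>k = l\<close> False by (simp add: e_amp_def power2_eq_square)
    qed
  next
    case False
    show ?thesis
    proof (cases "k = - l")
      case True
      then have "l \<noteq> 0" using False by auto
      then have "cos (- e_phase (- l) - e_phase l) = 0"
        using Z2_plus_cases[of l] by (auto simp: e_phase_def)
      then show ?thesis using False unfolding True by simp
    qed (use False in simp)
  qed
  finally show ?thesis .
qed

section \<open>Square-integrable functions on the torus\<close>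

lemma H_space_integrable:
  assumes "g \<in> H_space"
  shows "g \<in> borel_measurable torus" "integrable torus (\<lambda>x. (g x)\<^sup>2)" "integrable torus g"
proof -
  show m[measurable]: "g \<in> borel_measurable torus" and i: "integrable torus (\<lambda>x. (g x)\<^sup>2)"
    using assms by (auto simp: Lp_space_def)
  show "integrable torus g"
  proof (rule Bochner_Integration.integrable_bound[where f = "\<lambda>x. 1 + (g x)\<^sup>2"])
    show "AE x in torus. norm (g x) \<le> norm (1 + (g x)\<^sup>2)"
    proof (intro AE_I2)
      fix x
      have "0 \<le> (\<bar>g x\<bar> - 1)\<^sup>2" by simp
      then have "2 * \<bar>g x\<bar> \<le> 1 + (g x)\<^sup>2" by (simp add: power2_eq_square algebra_simps)
      then show "norm (g x) \<le> norm (1 + (g x)\<^sup>2)" by simp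
    qed
  qed (use i in auto)
qed

lemma H_norm_power2:
  assumes "g \<in> H_space" shows "(H_norm g)\<^sup>2 = (LINT x|torus. (g x)\<^sup>2)" "0 \<le> H_norm g"
proof -
  have "0 \<le> (LINT x|torus. (g x)\<^sup>2)" by simp
  then show "(H_norm g)\<^sup>2 = (LINT x|torus. (g x)\<^sup>2)" unfolding Lp_norm_def by (simp add: powr_half_sqrt)
  show "0 \<le> H_norm g" by (simp add: Lp_norm_def)
qed

lemma integrable_bounded_mult:
  assumes g: "g \<in> H_space" and [measurable]: "f \<in> borel_measurable torus" and b: "\<And>x. x \<in> space torus \<Longrightarrow> \<bar>f x\<bar> \<le> B"
  shows "integrable torus (\<lambda>x. f x * g x)"
proof (rule Bochner_Integration.integrable_bound[where f = "\<lambda>x. B * \<bar>g x\<bar>"])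
  note [measurable] = H_space_integrable(1)[OF g]
  show "integrable torus (\<lambda>x. B * \<bar>g x\<bar>)" using H_space_integrable(3)[OF g] by simp
  show "AE x in torus. norm (f x * g x) \<le> norm (B * \<bar>g x\<bar>)"
  proof (intro AE_I2)
    fix x assume "x \<in> space torus"
    then have "\<bar>f x\<bar> \<le> \<bar>B\<bar>" using b[of x] by linarith
    then show "norm (f x * g x) \<le> norm (B * \<bar>g x\<bar>)" by (simp add: abs_mult mult_right_mono)
  qed
qed (use H_space_integrable(1)[OF g] in measurable)

lemma bounded_H_space:
  assumes [measurable]: "f \<in> borel_measurable torus" and b: "\<And>x. x \<in> space torus \<Longrightarrow> \<bar>f x\<bar> \<le> B"
  shows "f \<in> H_space"
proof -
  have "integrable torus (\<lambda>x. (f x)\<^sup>2)"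
  proof (rule torus.integrable_const_bound[where B = "B\<^sup>2"])
    show "AE x in torus. norm ((f x)\<^sup>2) \<le> B\<^sup>2"
    proof (intro AE_I2)
      fix x assume "x \<in> space torus"
      then have "\<bar>f x\<bar> \<le> \<bar>B\<bar>" using b[of x] by linarith
      then show "norm ((f x)\<^sup>2) \<le> B\<^sup>2" by (simp add: abs_le_square_iff)
    qed
  qed simp
  then show ?thesis by (simp add: Lp_space_def)
qed

lemma e_basis_H: "e_basis k \<in> H_space"
  by (rule bounded_H_space[where B = 1]) (auto simp: e_basis_bound)

text \<open>The remainder of \<open>g\<close> after finitely many modes. Its squared norm gives
  Bessel's inequality, and it measures how well finitely many modes determine the pairing with
  \<open>g\<close>.\<close>

definition trunc :: "(int \<times> int) set \<Rightarrow> (real \<times> real \<Rightarrow> real) \<Rightarrow> real \<times> real \<Rightarrow> real" where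
  "trunc A g x = g x - (\<Sum>k\<in>A. fourier_coeffs g k * e_basis k x)"

lemma integrable_e_basis_mult:
  assumes "g \<in> H_space" shows "integrable torus (\<lambda>x. g x * e_basis k x)"
  using integrable_bounded_mult[OF assms, of "e_basis k" 1] by (simp add: e_basis_bound mult.commute)

lemma trunc_facts:
  assumes g: "g \<in> H_space" and A: "finite A"
  shows "trunc A g \<in> H_space"
    and "fourier_coeffs (trunc A g) k = (if k \<in> A then 0 else fourier_coeffs g k)"
    and "(LINT x|torus. (trunc A g x)\<^sup>2) = (LINT x|torus. (g x)\<^sup>2) - (\<Sum>k\<in>A. (fourier_coeffs g k)\<^sup>2)"
proof -
  note [measurable] = H_space_integrable(1)[OF g]
  define h where "h x = (\<Sum>k\<in>A. fourier_coeffs g k * e_basis k x)" for x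
  have [measurable]: "h \<in> borel_measurable torus" unfolding h_def by measurable
  have hb: "\<bar>h x\<bar> \<le> (\<Sum>k\<in>A. \<bar>fourier_coeffs g k\<bar>)" for x
    unfolding h_def using e_basis_bound
    by (intro order_trans[OF sum_abs] sum_mono) (auto simp: abs_mult mult_left_le)
  have h: "h \<in> H_space" by (rule bounded_H_space[OF _ hb]) simp
  have igh: "integrable torus (\<lambda>x. h x * g x)" by (rule integrable_bounded_mult[OF g _ hb]) simp
  note i2 = H_space_integrable(2)[OF g] H_space_integrable(2)[OF h]
  have ee: "integrable torus (\<lambda>x. e_basis k x * e_basis l x)" for k l
    by (rule integrable_e_basis_mult[OF e_basis_H])
  have hk: "(LINT x|torus. h x * e_basis k x) = (if k \<in> A then fourier_coeffs g k else 0)" for k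
  proof -
    have "(LINT x|torus. h x * e_basis k x) = (\<Sum>l\<in>A. fourier_coeffs g l * H_inner (e_basis l) (e_basis k))"
      unfolding h_def sum_distrib_right H_inner_def mult.assoc
      by (subst Bochner_Integration.integral_sum) (use ee in auto)
    also have "\<dots> = (if k \<in> A then fourier_coeffs g k else 0)"
      unfolding H_inner_e_basis using A by (simp add: if_distrib[of "(*) _"] cong: if_cong)
    finally show ?thesis .
  qed
  have gh: "(LINT x|torus. h x * g x) = (\<Sum>k\<in>A. (fourier_coeffs g k)\<^sup>2)"
  proof -
    have "(LINT x|torus. h x * g x) = (\<Sum>l\<in>A. fourier_coeffs g l * H_inner g (e_basis l))"
      unfolding h_def sum_distrib_right H_inner_def mult.assoc
      by (subst Bochner_Integration.integral_sum) (use integrable_e_basis_mult[OF g] in \<open>auto simp: mult.commute\<close>)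
    then show ?thesis by (simp add: fourier_coeffs_def power2_eq_square)
  qed
  have hh: "(LINT x|torus. (h x)\<^sup>2) = (\<Sum>k\<in>A. (fourier_coeffs g k)\<^sup>2)"
  proof -
    have "(LINT x|torus. (h x)\<^sup>2) = (LINT x|torus. (\<Sum>l\<in>A. fourier_coeffs g l * (h x * e_basis l x)))"
      by (intro Bochner_Integration.integral_cong refl) (simp add: power2_eq_square h_def sum_distrib_left mult_ac)
    also have "\<dots> = (\<Sum>l\<in>A. fourier_coeffs g l * (LINT x|torus. h x * e_basis l x))"
      by (subst Bochner_Integration.integral_sum) (use integrable_e_basis_mult[OF h] in auto)
    finally show ?thesis by (simp add: hk power2_eq_square cong: sum.cong)
  qed
  have sq: "(trunc A g x)\<^sup>2 = (g x)\<^sup>2 - 2 * (h x * g x) + (h x)\<^sup>2" for x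
    unfolding trunc_def h_def[symmetric] by (simp add: power2_eq_square algebra_simps)
  have tm: "trunc A g \<in> borel_measurable torus" unfolding trunc_def[abs_def] by measurable
  show "trunc A g \<in> H_space"
    using tm i2 igh unfolding Lp_space_def by (simp add: sq)
  show "(LINT x|torus. (trunc A g x)\<^sup>2) = (LINT x|torus. (g x)\<^sup>2) - (\<Sum>k\<in>A. (fourier_coeffs g k)\<^sup>2)"
    unfolding sq using i2 igh by (simp add: gh hh)
  have tr: "trunc A g x = g x - h x" for x by (simp add: trunc_def h_def)
  have "fourier_coeffs (trunc A g) k = (LINT x|torus. g x * e_basis k x - h x * e_basis k x)"
    unfolding fourier_coeffs_def H_inner_def tr by (simp add: algebra_simps)
  also have "\<dots> = fourier_coeffs g k - (LINT x|torus. h x * e_basis k x)"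
    unfolding fourier_coeffs_def H_inner_def
    by (rule Bochner_Integration.integral_diff[OF integrable_e_basis_mult[OF g] integrable_e_basis_mult[OF h]])
  finally show "fourier_coeffs (trunc A g) k = (if k \<in> A then 0 else fourier_coeffs g k)"
    by (simp add: hk)
qed

lemma Bessel:
  assumes "g \<in> H_space" "finite A"
  shows "(\<Sum>k\<in>A. (fourier_coeffs g k)\<^sup>2) \<le> (H_norm g)\<^sup>2"
proof -
  have "0 \<le> (LINT x|torus. (trunc A g x)\<^sup>2)" by simp
  then show ?thesis using trunc_facts(3)[OF assms] H_norm_power2(1)[OF assms(1)] by simp
qed

section \<open>The n-th power of the covariance kernel\<close>

lemma cis_sum: "finite I \<Longrightarrow> (\<Prod>i\<in>I. cis (f i)) = cis (\<Sum>i\<in>I. f i)"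
  by (induction I rule: finite_induct) (auto simp: cis_mult)

lemma lat_sum: "lat (\<Sum>i\<in>I. f i) = (\<Sum>i\<in>I. lat (f i))"
  by (induction I rule: infinite_finite_induct) (auto simp: lat_0 lat_add)

lemma sum_symmetric: 
  fixes f :: "int \<times> int \<Rightarrow> 'a::comm_monoid_add"
  assumes "F = uminus ` F" shows "(\<Sum>k\<in>F. f (- k)) = (\<Sum>k\<in>F. f k)"
proof -
  have "(\<Sum>k\<in>uminus ` F. f k) = (\<Sum>k\<in>F. f (- k))"
    by (subst sum.reindex) auto
  then show ?thesis using assms by simp
qed

lemma sum_symmetric_PiE:
  fixes f :: "(nat \<Rightarrow> int \<times> int) \<Rightarrow> real"
  assumes "F = uminus ` F"
  shows "(\<Sum>\<kappa>\<in>tuples n F. f (\<lambda>i\<in>{..<n}. - \<kappa> i)) = (\<Sum>\<kappa>\<in>tuples n F. f \<kappa>)"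
proof (rule sum.reindex_bij_witness[where i = "\<lambda>\<kappa>. \<lambda>i\<in>{..<n}. - \<kappa> i" and j = "\<lambda>\<kappa>. \<lambda>i\<in>{..<n}. - \<kappa> i"])
  have neg: "- k \<in> F" if "k \<in> F" for k using that assms by (metis image_eqI)
  fix \<kappa> assume \<kappa>: "\<kappa> \<in> tuples n F"
  show "(\<lambda>i\<in>{..<n}. - (\<lambda>i\<in>{..<n}. - \<kappa> i) i) = \<kappa>" "(\<lambda>i\<in>{..<n}. - (\<lambda>i\<in>{..<n}. - \<kappa> i) i) = \<kappa>"
  proof -
    show "(\<lambda>i\<in>{..<n}. - (\<lambda>i\<in>{..<n}. - \<kappa> i) i) = \<kappa>"
    proof
      fix i show "(\<lambda>i\<in>{..<n}. - (\<lambda>i\<in>{..<n}. - \<kappa> i) i) i = \<kappa> i"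
        by (cases "i < n") (simp_all add: PiE_arb[OF \<kappa>])
    qed
    then show "(\<lambda>i\<in>{..<n}. - (\<lambda>i\<in>{..<n}. - \<kappa> i) i) = \<kappa>" .
  qed
  show "(\<lambda>i\<in>{..<n}. - \<kappa> i) \<in> tuples n F" "(\<lambda>i\<in>{..<n}. - \<kappa> i) \<in> tuples n F"
    by (auto intro!: neg PiE_mem[OF \<kappa>])
qed simp

text \<open>Products of basis functions do not multiply well, exponentials do. Pairing k with -k
  makes the kernel 1 / (4 pi^2) times a cosine sum, which is a sum of exponentials because the sines
  cancel. After expansion, pairing a tuple with its negative turns the cosine at the total frequency
  back into basis functions, which returns one factor 4 pi^2.\<close>

lemma kernel_power:
  assumes F: "finite F" and sym: "F = uminus ` F"
  shows "(\<Sum>k\<in>F. 1 / japanese k * (e_basis k x * e_basis k y)) ^ n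
    = 4 * pi\<^sup>2 / (4 * pi\<^sup>2) ^ n * (\<Sum>\<kappa>\<in>tuples n F. (\<Prod>i<n. 1 / japanese (\<kappa> i)) * (e_basis (\<Sum>i<n. \<kappa> i) x * e_basis (\<Sum>i<n. \<kappa> i) y))"
proof -
  define a where "a k = 1 / japanese k" for k
  define G where "G = (\<Sum>k\<in>F. a k * (e_basis k x * e_basis k y))"
  define C where "C = (\<Sum>k\<in>F. a k * cos (lat k \<bullet> (x - y)))"
  have am: "a (- k) = a k" for k by (simp add: a_def japanese_minus)
  have "2 * G = (\<Sum>k\<in>F. a k * (e_basis k x * e_basis k y)) + (\<Sum>k\<in>F. a (- k) * (e_basis (- k) x * e_basis (- k) y))"
    using sum_symmetric[OF sym, of "\<lambda>k. a k * (e_basis k x * e_basis k y)"] by (simp add: G_def)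
  also have "\<dots> = (\<Sum>k\<in>F. a k * (e_basis k x * e_basis k y + e_basis (- k) x * e_basis (- k) y))"
    by (simp add: am distrib_left sum.distrib)
  also have "\<dots> = C / (2 * pi\<^sup>2)" by (simp add: e_basis_pair_sum C_def sum_divide_distrib)
  finally have G: "G = C / (4 * pi\<^sup>2)" by simp
  have S0: "(\<Sum>k\<in>F. a k * sin (lat k \<bullet> (x - y))) = 0"
  proof -
    have "(\<Sum>k\<in>F. a k * sin (lat k \<bullet> (x - y))) = (\<Sum>k\<in>F. a (- k) * sin (lat (- k) \<bullet> (x - y)))"
      by (rule sum_symmetric[OF sym, symmetric])
    also have "\<dots> = - (\<Sum>k\<in>F. a k * sin (lat k \<bullet> (x - y)))" by (simp add: am lat_minus sum_negf)
    finally show ?thesis by simp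
  qed
  have Cc: "complex_of_real C = (\<Sum>k\<in>F. of_real (a k) * cis (lat k \<bullet> (x - y)))"
    using S0 by (simp add: complex_eq_iff C_def)
  have "complex_of_real (C ^ n) = (\<Prod>i<n. \<Sum>k\<in>F. of_real (a k) * cis (lat k \<bullet> (x - y)))"
    by (simp add: Cc)
  also have "\<dots> = (\<Sum>\<kappa>\<in>tuples n F. \<Prod>i<n. of_real (a (\<kappa> i)) * cis (lat (\<kappa> i) \<bullet> (x - y)))"
    using F by (intro prod_sum_PiE) auto
  also have "\<dots> = (\<Sum>\<kappa>\<in>tuples n F. of_real (\<Prod>i<n. a (\<kappa> i)) * cis (lat (\<Sum>i<n. \<kappa> i) \<bullet> (x - y)))"
    by (simp add: prod.distrib cis_sum lat_sum inner_sum_left)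
  finally have "Re (complex_of_real (C ^ n)) = Re (\<Sum>\<kappa>\<in>tuples n F. of_real (\<Prod>i<n. a (\<kappa> i)) * cis (lat (\<Sum>i<n. \<kappa> i) \<bullet> (x - y)))"
    by simp
  then have Cn: "C ^ n = (\<Sum>\<kappa>\<in>tuples n F. (\<Prod>i<n. a (\<kappa> i)) * cos (lat (\<Sum>i<n. \<kappa> i) \<bullet> (x - y)))"
    by (simp only: Re_complex_of_real Re_sum) (simp del: of_real_prod)
  define S where "S = (\<Sum>\<kappa>\<in>tuples n F. (\<Prod>i<n. a (\<kappa> i)) * (e_basis (\<Sum>i<n. \<kappa> i) x * e_basis (\<Sum>i<n. \<kappa> i) y))"
  have "S + S = S + (\<Sum>\<kappa>\<in>tuples n F. (\<Prod>i<n. a (\<kappa> i)) * (e_basis (- (\<Sum>i<n. \<kappa> i)) x * e_basis (- (\<Sum>i<n. \<kappa> i)) y))"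
  proof -
    have "(\<Sum>\<kappa>\<in>tuples n F. (\<Prod>i<n. a (\<kappa> i)) * (e_basis (- (\<Sum>i<n. \<kappa> i)) x * e_basis (- (\<Sum>i<n. \<kappa> i)) y)) = S"
      using sum_symmetric_PiE[OF sym, of "\<lambda>\<kappa>. (\<Prod>i<n. a (\<kappa> i)) * (e_basis (\<Sum>i<n. \<kappa> i) x * e_basis (\<Sum>i<n. \<kappa> i) y)" n]
      by (simp add: S_def am sum_negf)
    then show ?thesis by simp
  qed
  also have "\<dots> = (\<Sum>\<kappa>\<in>tuples n F. (\<Prod>i<n. a (\<kappa> i)) * (cos (lat (\<Sum>i<n. \<kappa> i) \<bullet> (x - y)) / (2 * pi\<^sup>2)))"
    unfolding S_def sum.distrib[symmetric] distrib_left[symmetric] e_basis_pair_sum ..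
  also have "\<dots> = C ^ n / (2 * pi\<^sup>2)" unfolding Cn by (simp add: sum_divide_distrib)
  finally have "C ^ n = 4 * pi\<^sup>2 * S" by (simp add: field_simps)
  then have "G ^ n = 4 * pi\<^sup>2 / (4 * pi\<^sup>2) ^ n * S" unfolding G by (simp add: power_divide)
  then show ?thesis by (simp add: G_def S_def a_def)
qed

text \<open>The right side depends on the kernel alone. Two finite-rank expansions of the same
  kernel therefore give equal left sides, which is how multi-indices are exchanged for frequency
  tuples.\<close>

lemma bilinear_finite_rank:
  fixes u v :: "'i \<Rightarrow> 'a \<Rightarrow> real"
  assumes "\<And>i. i \<in> V \<Longrightarrow> integrable M (\<lambda>x. u i x * g x)" "\<And>i. i \<in> V \<Longrightarrow> integrable M (\<lambda>x. v i x * g x)"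
  shows "(\<Sum>i\<in>V. (LINT x|M. u i x * g x) * (LINT x|M. v i x * g x))
     = (LINT x|M. g x * (LINT y|M. (\<Sum>i\<in>V. u i x * v i y) * g y))"
proof -
  have "(LINT y|M. (\<Sum>i\<in>V. u i x * v i y) * g y) = (\<Sum>i\<in>V. u i x * (LINT y|M. v i y * g y))" for x
    unfolding sum_distrib_right mult.assoc using assms by (subst Bochner_Integration.integral_sum) auto
  then have "(LINT x|M. g x * (LINT y|M. (\<Sum>i\<in>V. u i x * v i y) * g y)) = (LINT x|M. (\<Sum>i\<in>V. (u i x * g x) * (LINT y|M. v i y * g y)))"
    by (simp add: sum_distrib_left mult_ac)
  also have "\<dots> = (\<Sum>i\<in>V. (LINT x|M. u i x * g x) * (LINT x|M. v i x * g x))"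
    using assms by (subst Bochner_Integration.integral_sum) auto
  finally show ?thesis by simp
qed

section \<open>Chaos expansion of the approximate Wick powers\<close>

text \<open>Containing 0 makes the variance of the projected field positive, as the division by
  \<open>rho\<close> demands.\<close>

definition sym_set :: "(int \<times> int) set \<Rightarrow> bool" where
  "sym_set F \<longleftrightarrow> finite F \<and> F = uminus ` F \<and> 0 \<in> F"

lemma sym_setD: assumes "sym_set F" shows "finite F" "F = uminus ` F" "0 \<in> F"
  using assms by (simp_all add: sym_set_def)

lemma sym_set_Int: assumes "sym_set F" "sym_set G" shows "sym_set (F \<inter> G)"
proof -
  have "uminus ` (F \<inter> G) = uminus ` F \<inter> uminus ` G" by (rule image_Int) (auto intro: injI)
  then show ?thesis using assms unfolding sym_set_def by auto
qed

text \<open>The variance is written at the point x, which lets the chaos expansion hold for every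
  finite \<open>F\<close>; on symmetric sets it is the constant square of
  \<open>rho\<close>.\<close>

definition Phi :: "nat \<Rightarrow> (int \<times> int) set \<Rightarrow> dist_coeffs \<Rightarrow> real \<times> real \<Rightarrow> real" where
  "Phi n F z x = wick n (\<Sum>k\<in>F. (e_basis k x)\<^sup>2 / japanese k) (\<Sum>k\<in>F. z k * e_basis k x)"

lemma variance_e_basis:
  assumes F: "sym_set F"
  shows "(\<Sum>k\<in>F. (e_basis k x)\<^sup>2 / japanese k) = (\<Sum>k\<in>F. 1 / japanese k) / (4 * pi\<^sup>2)"
proof -
  have "2 * (\<Sum>k\<in>F. (e_basis k x)\<^sup>2 / japanese k) = (\<Sum>k\<in>F. (e_basis k x)\<^sup>2 / japanese k) + (\<Sum>k\<in>F. (e_basis (- k) x)\<^sup>2 / japanese (- k))"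
    using sum_symmetric[OF sym_setD(2)[OF F], of "\<lambda>k. (e_basis k x)\<^sup>2 / japanese k"] by simp
  also have "\<dots> = (\<Sum>k\<in>F. (e_basis k x * e_basis k x + e_basis (- k) x * e_basis (- k) x) / japanese k)"
    by (simp add: japanese_minus power2_eq_square add_divide_distrib sum.distrib)
  also have "\<dots> = (\<Sum>k\<in>F. 1 / japanese k) / (2 * pi\<^sup>2)"
    unfolding e_basis_pair_sum by (simp add: sum_divide_distrib mult.commute)
  finally show ?thesis by simp
qed

lemma Phi_approx_eq:
  assumes F: "sym_set {k. lat k \<in> \<Lambda>}"
  shows "Phi_approx n \<Lambda> z x = Phi n {k. lat k \<in> \<Lambda>} z x"
proof -
  let ?F = "{k. lat k \<in> \<Lambda>}"
  have pos: "(\<Sum>k\<in>?F. 1 / japanese k) > 0"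
  proof (rule sum_pos)
    show "?F \<noteq> {}" using sym_setD(3)[OF F] by blast
  qed (use sym_setD(1)[OF F] japanese_pos in auto)
  have r: "rho \<Lambda> = 1 / (2 * pi) * sqrt (\<Sum>k\<in>?F. 1 / japanese k)"
    by (simp add: rho_def japanese_def)
  have rp: "rho \<Lambda> > 0" unfolding r using pos by simp
  have "(rho \<Lambda>)\<^sup>2 = (\<Sum>k\<in>?F. (e_basis k x)\<^sup>2 / japanese k)"
    unfolding variance_e_basis[OF F] r using pos by (simp add: power_mult_distrib power_divide)
  then show ?thesis
    unfolding Phi_approx_def wick_hermite[OF rp] proj_def Phi_def by simp
qed

text \<open>The coefficients of \<open>\<Pi>\<^sub>F z\<close> at \<open>x\<close> with respect to the variables \<open>white k\<close>, which are independent and standard normal.\<close>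

definition field_coeff :: "(int \<times> int) set \<Rightarrow> real \<times> real \<Rightarrow> int \<times> int \<Rightarrow> real" where
  "field_coeff F x k = (if k \<in> F then e_basis k x / sqrt (japanese k) else 0)"

definition white :: "int \<times> int \<Rightarrow> dist_coeffs \<Rightarrow> real" where
  "white k z = sqrt (japanese k) * z k"

abbreviation hermite_prod :: "(int \<times> int) set \<Rightarrow> (int \<times> int \<Rightarrow> nat) \<Rightarrow> dist_coeffs \<Rightarrow> real" where
  "hermite_prod K \<nu> z \<equiv> (\<Prod>k\<in>K. hermite (\<nu> k) (white k z))"

text \<open>The index set \<open>K\<close> may exceed \<open>F\<close>, so that two sets can be
  compared in one common system of Hermite products.\<close>

lemma Phi_chaos_expansion:
  assumes "finite K" "F \<subseteq> K"
  shows "Phi n F z x = (\<Sum>\<nu>\<in>multi_idx K n. chaos_coeff n K (field_coeff F x) \<nu> * hermite_prod K \<nu> z)"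
proof -
  have 1: "(\<Sum>k\<in>K. (field_coeff F x k)\<^sup>2) = (\<Sum>k\<in>F. (e_basis k x)\<^sup>2 / japanese k)"
    using assms japanese_pos
    by (intro sum.mono_neutral_cong_right) (auto simp: field_coeff_def power_divide less_imp_le)
  have 2: "(\<Sum>k\<in>K. field_coeff F x k * white k z) = (\<Sum>k\<in>F. z k * e_basis k x)"
  proof (intro sum.mono_neutral_cong_right assms ballI)
    fix k assume "k \<in> F"
    then show "field_coeff F x k * white k z = z k * e_basis k x"
      using japanese_pos[of k] by (simp add: field_coeff_def white_def)
  qed (simp add: field_coeff_def)
  show ?thesis unfolding Phi_def 1[symmetric] 2[symmetric] by (rule wick_chaos_expansion[OF assms(1)])
qed

lemma field_coeff_bound: "\<bar>field_coeff F x k\<bar> \<le> 1"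
proof -
  have "\<bar>e_basis k x\<bar> / sqrt (japanese k) \<le> 1 / 1"
    using e_basis_bound[of k x] japanese_ge1[of k] by (intro frac_le) auto
  moreover have "0 \<le> sqrt (japanese k)" using japanese_ge1[of k] by simp
  ultimately show ?thesis by (simp add: field_coeff_def)
qed

lemma chaos_coeff_bound: "\<bar>chaos_coeff n K (field_coeff F x) \<nu>\<bar> \<le> fact n"
proof -
  have "(\<Prod>k\<in>K. \<bar>field_coeff F x k ^ \<nu> k / sqrt (fact (\<nu> k))\<bar>) \<le> 1"
  proof (intro prod_le_1 conjI)
    fix k
    have "\<bar>field_coeff F x k\<bar> ^ \<nu> k / sqrt (fact (\<nu> k)) \<le> 1 / 1"
      using field_coeff_bound[of F x k] by (intro frac_le power_le_one) (auto simp: fact_ge_1)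
    then show "\<bar>field_coeff F x k ^ \<nu> k / sqrt (fact (\<nu> k))\<bar> \<le> 1" by (simp add: power_abs)
  qed auto
  then show ?thesis by (simp add: chaos_coeff_def abs_mult abs_prod)
qed

lemma chaos_coeff_measurable[measurable]:
  "(\<lambda>x. chaos_coeff n K (field_coeff F x) \<nu>) \<in> borel_measurable torus"
proof -
  have [measurable]: "(\<lambda>x. field_coeff F x k) \<in> borel_measurable torus" for k
    unfolding field_coeff_def by measurable
  show ?thesis unfolding chaos_coeff_def by measurable
qed

lemma integrable_chaos_coeff:
  assumes "g \<in> H_space" shows "integrable torus (\<lambda>x. chaos_coeff n K (field_coeff F x) \<nu> * g x)"
  by (rule integrable_bounded_mult[OF assms _ chaos_coeff_bound]) simp

lemma Phi_H_space:
  assumes "finite F" shows "Phi n F z \<in> H_space"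
proof (rule bounded_H_space)
  have eq: "Phi n F z x = (\<Sum>\<nu>\<in>multi_idx F n. chaos_coeff n F (field_coeff F x) \<nu> * hermite_prod F \<nu> z)" for x
    by (rule Phi_chaos_expansion) (use assms in auto)
  show "Phi n F z \<in> borel_measurable torus" unfolding eq[abs_def] by measurable
  show "\<bar>Phi n F z x\<bar> \<le> (\<Sum>\<nu>\<in>multi_idx F n. fact n * \<bar>hermite_prod F \<nu> z\<bar>)" for x
    unfolding eq by (intro order_trans[OF sum_abs] sum_mono) (simp add: abs_mult chaos_coeff_bound mult_right_mono)
qed

definition Phi_coeff :: "nat \<Rightarrow> (int \<times> int) set \<Rightarrow> (int \<times> int) set \<Rightarrow> (real \<times> real \<Rightarrow> real) \<Rightarrow> (int \<times> int \<Rightarrow> nat) \<Rightarrow> real" where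
  "Phi_coeff n K F g \<nu> = (LINT x|torus. chaos_coeff n K (field_coeff F x) \<nu> * g x)"

lemma Phi_coeff_0: "(\<Sum>k\<in>K. \<nu> k) \<noteq> n \<Longrightarrow> Phi_coeff n K F g \<nu> = 0"
  by (simp add: Phi_coeff_def chaos_coeff_def)

lemma H_inner_Phi:
  assumes "finite K" "F \<subseteq> K" "g \<in> H_space"
  shows "H_inner (Phi n F z) g = (\<Sum>\<nu>\<in>multi_idx K n. Phi_coeff n K F g \<nu> * hermite_prod K \<nu> z)"
proof -
  have "H_inner (Phi n F z) g = (LINT x|torus. (\<Sum>\<nu>\<in>multi_idx K n. (chaos_coeff n K (field_coeff F x) \<nu> * g x) * hermite_prod K \<nu> z))"
    unfolding H_inner_def Phi_chaos_expansion[OF assms(1,2)] by (simp add: sum_distrib_left mult_ac)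
  also have "\<dots> = (\<Sum>\<nu>\<in>multi_idx K n. Phi_coeff n K F g \<nu> * hermite_prod K \<nu> z)"
    unfolding Phi_coeff_def by (subst Bochner_Integration.integral_sum) (use integrable_chaos_coeff[OF assms(3)] in auto)
  finally show ?thesis .
qed

text \<open>The n! comes from \<open>chaos_coeff_inner\<close>, the quotient from
  \<open>kernel_power\<close>. The quotient form is also right at n = 0, where subtraction of
  natural numbers would not give the exponent 1 - n.\<close>

definition chaos_const :: "nat \<Rightarrow> real" where
  "chaos_const n = fact n * (4 * pi\<^sup>2 / (4 * pi\<^sup>2) ^ n)"

text \<open>Summed over the multi-indices, the coefficients at x and y give n! times the n-th power
  of the kernel of F Int F', because \<open>field_coeff\<close> vanishes off its set.
  \<open>kernel_power\<close> expands this kernel a second way.\<close>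

lemma Phi_coeff_inner:
  assumes K: "finite K" and F: "sym_set F" "F \<subseteq> K" and F': "sym_set F'" "F' \<subseteq> K" and g: "g \<in> H_space"
  shows "(\<Sum>\<nu>\<in>multi_idx K n. Phi_coeff n K F g \<nu> * Phi_coeff n K F' g \<nu>)
     = chaos_const n * conv_sum n (F \<inter> F') (\<lambda>k. (fourier_coeffs g k)\<^sup>2)"
proof -
  define D where "D = F \<inter> F'"
  have D: "finite D" "D = uminus ` D" using sym_setD[OF sym_set_Int[OF F(1) F'(1)]] by (auto simp: D_def)
  define q where "q = (\<lambda>\<kappa>::nat \<Rightarrow> int \<times> int. \<Prod>i<n. 1 / japanese (\<kappa> i))"
  define \<sigma> where "\<sigma> = (\<lambda>\<kappa>::nat \<Rightarrow> int \<times> int. \<Sum>i<n. \<kappa> i)"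
  have ker: "(\<Sum>\<nu>\<in>multi_idx K n. chaos_coeff n K (field_coeff F x) \<nu> * chaos_coeff n K (field_coeff F' y) \<nu>)
      = (\<Sum>\<kappa>\<in>tuples n D. (chaos_const n * q \<kappa> * e_basis (\<sigma> \<kappa>) x) * e_basis (\<sigma> \<kappa>) y)" for x y
  proof -
    have "(\<Sum>k\<in>K. field_coeff F x k * field_coeff F' y k) = (\<Sum>k\<in>D. 1 / japanese k * (e_basis k x * e_basis k y))"
    proof (intro sum.mono_neutral_cong_right ballI)
      fix k assume "k \<in> D"
      then show "field_coeff F x k * field_coeff F' y k = 1 / japanese k * (e_basis k x * e_basis k y)"
        using japanese_pos[of k] by (simp add: field_coeff_def D_def less_imp_le)
    qed (use K F F' in \<open>auto simp: D_def field_coeff_def\<close>)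
    then show ?thesis
      unfolding chaos_coeff_inner[OF K] using kernel_power[OF D, of x y n]
      by (simp add: chaos_const_def q_def \<sigma>_def sum_distrib_left mult_ac)
  qed
  have ie: "integrable torus (\<lambda>x. (c * e_basis k x) * g x)" for c k
    using integrable_e_basis_mult[OF g, of k] by (simp add: mult_ac)
  have "(\<Sum>\<nu>\<in>multi_idx K n. Phi_coeff n K F g \<nu> * Phi_coeff n K F' g \<nu>)
     = (LINT x|torus. g x * (LINT y|torus. (\<Sum>\<nu>\<in>multi_idx K n. chaos_coeff n K (field_coeff F x) \<nu> * chaos_coeff n K (field_coeff F' y) \<nu>) * g y))"
    unfolding Phi_coeff_def by (rule bilinear_finite_rank) (auto intro: integrable_chaos_coeff[OF g])
  also have "\<dots> = (\<Sum>\<kappa>\<in>tuples n D. (LINT x|torus. chaos_const n * q \<kappa> * e_basis (\<sigma> \<kappa>) x * g x) * (LINT x|torus. e_basis (\<sigma> \<kappa>) x * g x))"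
    unfolding ker by (rule bilinear_finite_rank[symmetric]) (use ie[of 1] ie in auto)
  also have "\<dots> = (\<Sum>\<kappa>\<in>tuples n D. chaos_const n * (q \<kappa> * (fourier_coeffs g (\<sigma> \<kappa>))\<^sup>2))"
    by (intro sum.cong refl) (simp add: fourier_coeffs_def H_inner_def power2_eq_square mult.assoc, simp add: mult_ac)
  also have "\<dots> = chaos_const n * conv_sum n (F \<inter> F') (\<lambda>k. (fourier_coeffs g k)\<^sup>2)"
    unfolding conv_sum_def q_def \<sigma>_def D_def by (simp add: sum_distrib_left)
  finally show ?thesis .
qed

section \<open>Gaussian law of the coordinates\<close>

lemma dual_pairing_finite:
  assumes "finite A" "\<And>k. k \<notin> A \<Longrightarrow> l k = 0"
  shows "dual_pairing u l = (\<Sum>k\<in>A. u k * l k)"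
proof -
  have "((\<lambda>k. u k * l k) has_sum (\<Sum>k\<in>A. u k * l k)) UNIV"
    using has_sum_finite[OF assms(1), of "\<lambda>k. u k * l k"]
    by (rule has_sum_cong_neutral[THEN iffD1, rotated -1]) (auto simp: assms)
  then show ?thesis unfolding dual_pairing_def by (rule infsumI)
qed

locale free_field_measure = prob_space M for \<delta> :: real and M :: "dist_coeffs measure" +
  assumes delta_pos: "0 < \<delta>" and free: "free_field \<delta> M"
begin

lemma coord_measurable[measurable]: "(\<lambda>z. z k) \<in> borel_measurable M"
proof -
  have "sets M = sets (sobolev_borel (- \<delta>))" using free by (simp add: free_field_def)
  then show ?thesis using measurable_sobolev_coord[of k "- \<delta>"] measurable_cong_sets by blast
qed

lemma white_measurable[measurable]: "white k \<in> borel_measurable M"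
  unfolding white_def[abs_def] by measurable

text \<open>A finite linear combination of the coordinates is the pairing with a finitely supported
  \<open>l\<close>, so the assumption on single functionals applies and the covariance formula
  yields the variance. The Dirac law is the case of variance 0.\<close>

lemma white_char:
  assumes K: "finite K"
  shows "(CLINT z|M. iexp (\<Sum>k\<in>K. t k * white k z)) = complex_of_real (exp (- (\<Sum>k\<in>K. (t k)\<^sup>2) / 2))"
proof -
  define l where "l k = (if k \<in> K then t k * sqrt (japanese k) else 0)" for k
  define X where "X z = dual_pairing z l" for z
  have l: "l \<in> sobolev \<delta>" by (rule finite_support_sobolev[OF K]) (simp add: l_def)
  have dp: "dual_pairing u l = (\<Sum>k\<in>K. u k * l k)" for u
    by (rule dual_pairing_finite[OF K]) (simp add: l_def)
  have X: "X z = (\<Sum>k\<in>K. t k * white k z)" for z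
    unfolding X_def dp by (intro sum.cong) (auto simp: l_def white_def)
  have [measurable]: "X \<in> borel_measurable M" unfolding X[abs_def] by measurable
  have cov: "expectation (\<lambda>z. X z * X z) = (\<Sum>k\<in>K. (t k)\<^sup>2)"
  proof -
    have "expectation (\<lambda>z. X z * X z) = dual_pairing (inv_one_minus_laplacian l) l"
      using free l unfolding free_field_def X_def by blast
    also have "\<dots> = (\<Sum>k\<in>K. l k / japanese k * l k)"
      unfolding dp by (simp add: inv_one_minus_laplacian_def japanese_def)
    also have "\<dots> = (\<Sum>k\<in>K. (t k)\<^sup>2)"
    proof (intro sum.cong refl)
      fix k assume "k \<in> K"
      then show "l k / japanese k * l k = (t k)\<^sup>2"
        using japanese_pos[of k] by (simp add: l_def power2_eq_square field_simps)
    qed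
    finally show ?thesis .
  qed
  have "centered_gaussian_law (distr M borel X)"
    using free l unfolding free_field_def X_def[abs_def] by blast
  then consider "distr M borel X = return borel 0" | \<sigma> where "\<sigma> > 0" "distr M borel X = density lborel (\<lambda>x. ennreal (normal_density 0 \<sigma> x))"
    unfolding centered_gaussian_law_def by blast
  then have "(CLINT z|M. iexp (X z)) = complex_of_real (exp (- (expectation (\<lambda>z. X z * X z)) / 2))"
  proof cases
    case 1
    have "(CLINT z|M. iexp (X z)) = (CLINT y|distr M borel X. iexp y)" by (subst integral_distr) auto
    also have "\<dots> = 1" unfolding 1 by (subst integral_return) auto
    finally have c: "(CLINT z|M. iexp (X z)) = 1" .
    have "expectation (\<lambda>z. X z * X z) = (LINT y|distr M borel X. y * y)" by (subst integral_distr) auto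
    also have "\<dots> = 0" unfolding 1 by (subst integral_return) auto
    finally show ?thesis using c by simp
  next
    case (2 \<sigma>)
    have dist: "distributed M lborel X (normal_density 0 \<sigma>)"
      unfolding distributed_def using 2 by (auto cong: distr_cong)
    have "distributed M lborel (\<lambda>z. (X z - 0) / \<sigma>) std_normal_density"
      using normal_standard_normal_convert[OF 2(1), of X 0] dist by simp
    then have sd: "distr M lborel (\<lambda>z. X z / \<sigma>) = density lborel std_normal_density"
      by (simp add: distributed_def)
    have "(CLINT z|M. iexp (X z)) = (CLINT z|M. iexp (\<sigma> * (X z / \<sigma>)))" using 2 by simp
    also have "\<dots> = (CLINT y|distr M lborel (\<lambda>z. X z / \<sigma>). iexp (\<sigma> * y))" by (subst integral_distr) auto
    also have "\<dots> = char std_normal_distribution \<sigma>" unfolding sd char_def by simp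
    finally have c: "(CLINT z|M. iexp (X z)) = complex_of_real (exp (- (\<sigma>\<^sup>2) / 2))"
      by (simp add: char_std_normal_eq)
    have "expectation X = 0" using normal_distributed_expectation[OF 2(1) dist] .
    then have "expectation (\<lambda>z. X z * X z) = \<sigma>\<^sup>2"
      using normal_distributed_variance[OF 2(1) dist] by (simp add: power2_eq_square)
    then show ?thesis using c by simp
  qed
  then show ?thesis unfolding cov unfolding X .
qed

lemma white_law:
  assumes "finite K"
  shows "distr M (PiM K (\<lambda>_. std_normal_distribution)) (\<lambda>z. \<lambda>k\<in>K. white k z) = PiM K (\<lambda>_. std_normal_distribution)"
  by (rule distr_std_normal_PiM[OF assms white_measurable white_char[OF assms]])

lemma Lp_bounded_white_chaos:
  assumes K: "finite K" and p: "2 \<le> p" and a: "\<And>\<nu>. (\<Sum>k\<in>K. \<nu> k) \<noteq> n \<Longrightarrow> a \<nu> = 0"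
  shows "Lp_bounded M p (\<lambda>z. \<Sum>\<nu>\<in>multi_idx K n. a \<nu> * hermite_prod K \<nu> z)
     ((p - 1) powr (real n / 2) * sqrt (\<Sum>\<nu>\<in>multi_idx K n. (a \<nu>)\<^sup>2))"
proof -
  let ?P = "PiM K (\<lambda>_. std_normal_distribution)"
  define f where "f x = (\<Sum>\<nu>\<in>multi_idx K n. a \<nu> * (\<Prod>k\<in>K. hermite (\<nu> k) (x k)))" for x
  have L: "Lp_bounded ?P p f ((p - 1) powr (real n / 2) * sqrt (\<Sum>\<nu>\<in>multi_idx K n. (a \<nu>)\<^sup>2))"
    unfolding f_def by (rule Lp_bounded_homogeneous_chaos[OF K p a])
  have [measurable]: "f \<in> borel_measurable ?P" by (rule Lp_bounded_measurable[OF L])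
  have [measurable]: "(\<lambda>z. \<lambda>k\<in>K. white k z) \<in> measurable M ?P"
    by (intro measurable_restrict) simp
  have eq: "f (\<lambda>k\<in>K. white k z) = (\<Sum>\<nu>\<in>multi_idx K n. a \<nu> * hermite_prod K \<nu> z)" for z
    unfolding f_def by simp
  have "(\<integral>\<^sup>+x. ennreal (\<bar>f x\<bar> powr p) \<partial>?P) = (\<integral>\<^sup>+z. ennreal (\<bar>f (\<lambda>k\<in>K. white k z)\<bar> powr p) \<partial>M)"
    by (subst white_law[OF K, symmetric], subst nn_integral_distr) auto
  then show ?thesis using L unfolding Lp_bounded_def eq[symmetric] by auto
qed

abbreviation wsq :: "(real \<times> real \<Rightarrow> real) \<Rightarrow> int \<times> int \<Rightarrow> real" where
  "wsq g \<equiv> (\<lambda>k. (fourier_coeffs g k)\<^sup>2)"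

lemma Phi_Lp_bounded:
  assumes F: "sym_set F" and g: "g \<in> H_space" and p: "2 \<le> p"
  shows "Lp_bounded M p (\<lambda>z. H_inner (Phi n F z) g) ((p - 1) powr (real n / 2) * sqrt (chaos_const n * conv_sum n F (wsq g)))"
proof -
  have fin: "finite F" using sym_setD[OF F] by simp
  have "(\<Sum>\<nu>\<in>multi_idx F n. (Phi_coeff n F F g \<nu>)\<^sup>2) = chaos_const n * conv_sum n F (wsq g)"
    using Phi_coeff_inner[OF fin F order_refl F order_refl g, of n] by (simp add: power2_eq_square)
  moreover have "Lp_bounded M p (\<lambda>z. \<Sum>\<nu>\<in>multi_idx F n. Phi_coeff n F F g \<nu> * hermite_prod F \<nu> z)
     ((p - 1) powr (real n / 2) * sqrt (\<Sum>\<nu>\<in>multi_idx F n. (Phi_coeff n F F g \<nu>)\<^sup>2))"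
    by (rule Lp_bounded_white_chaos[OF fin p Phi_coeff_0])
  ultimately show ?thesis by (simp add: H_inner_Phi[OF fin order_refl g])
qed

lemma Phi_diff_Lp_bounded:
  assumes F: "sym_set F" and F': "sym_set F'" and g: "g \<in> H_space" and p: "2 \<le> p"
  shows "Lp_bounded M p (\<lambda>z. H_inner (Phi n F z) g - H_inner (Phi n F' z) g)
    ((p - 1) powr (real n / 2) * sqrt (chaos_const n * (conv_sum n F (wsq g) + conv_sum n F' (wsq g) - 2 * conv_sum n (F \<inter> F') (wsq g))))"
proof -
  define K where "K = F \<union> F'"
  have K: "finite K" "F \<subseteq> K" "F' \<subseteq> K" using sym_setD[OF F] sym_setD[OF F'] by (auto simp: K_def)
  define a where "a \<nu> = Phi_coeff n K F g \<nu> - Phi_coeff n K F' g \<nu>" for \<nu>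
  have "(\<Sum>\<nu>\<in>multi_idx K n. (a \<nu>)\<^sup>2)
     = (\<Sum>\<nu>\<in>multi_idx K n. Phi_coeff n K F g \<nu> * Phi_coeff n K F g \<nu>)
      + (\<Sum>\<nu>\<in>multi_idx K n. Phi_coeff n K F' g \<nu> * Phi_coeff n K F' g \<nu>)
      - 2 * (\<Sum>\<nu>\<in>multi_idx K n. Phi_coeff n K F g \<nu> * Phi_coeff n K F' g \<nu>)"
    unfolding a_def by (simp add: power2_eq_square algebra_simps sum.distrib sum_subtractf sum_distrib_left)
  also have "\<dots> = chaos_const n * (conv_sum n F (wsq g) + conv_sum n F' (wsq g) - 2 * conv_sum n (F \<inter> F') (wsq g))"
    unfolding Phi_coeff_inner[OF K(1) F K(2) F K(2) g] Phi_coeff_inner[OF K(1) F' K(3) F' K(3) g] Phi_coeff_inner[OF K(1) F K(2) F' K(3) g]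
    by (simp add: algebra_simps)
  finally have s: "(\<Sum>\<nu>\<in>multi_idx K n. (a \<nu>)\<^sup>2) = chaos_const n * (conv_sum n F (wsq g) + conv_sum n F' (wsq g) - 2 * conv_sum n (F \<inter> F') (wsq g))" .
  have "H_inner (Phi n F z) g - H_inner (Phi n F' z) g = (\<Sum>\<nu>\<in>multi_idx K n. a \<nu> * hermite_prod K \<nu> z)" for z
    unfolding H_inner_Phi[OF K(1,2) g] H_inner_Phi[OF K(1,3) g] a_def by (simp add: sum_subtractf left_diff_distrib)
  moreover have "Lp_bounded M p (\<lambda>z. \<Sum>\<nu>\<in>multi_idx K n. a \<nu> * hermite_prod K \<nu> z)
     ((p - 1) powr (real n / 2) * sqrt (\<Sum>\<nu>\<in>multi_idx K n. (a \<nu>)\<^sup>2))"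
    by (rule Lp_bounded_white_chaos[OF K(1) p]) (simp add: a_def Phi_coeff_0)
  ultimately show ?thesis by (simp add: s)
qed

end

section \<open>The limits\<close>

text \<open>An exhaustion of the lattice that does not refer to \<Lambda>. Comparing every \<Lambda>
  with it makes the limits the same for all of them.\<close>

definition lat_box :: "nat \<Rightarrow> (int \<times> int) set" where
  "lat_box r = {- int r..int r} \<times> {- int r..int r}"

lemma sym_set_box: "sym_set (lat_box r)"
proof -
  have "lat_box r = uminus ` lat_box r"
  proof (intro set_eqI iffI)
    fix k assume "k \<in> lat_box r"
    then show "k \<in> uminus ` lat_box r" by (intro image_eqI[of _ _ "- k"]) (auto simp: lat_box_def)
  qed (auto simp: lat_box_def)
  then show ?thesis by (auto simp: sym_set_def lat_box_def zero_prod_def)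
qed

lemma finite_box: "finite (lat_box r)" using sym_setD[OF sym_set_box] by simp

lemma box_mono: "r \<le> r' \<Longrightarrow> lat_box r \<subseteq> lat_box r'"
  by (auto simp: lat_box_def)

lemma finite_subset_box:
  assumes "finite F" shows "\<exists>r. F \<subseteq> lat_box r"
proof -
  define r where "r = (\<Sum>k\<in>F. nat (\<bar>fst k\<bar> + \<bar>snd k\<bar>))"
  have "k \<in> lat_box r" if "k \<in> F" for k
  proof -
    have "nat (\<bar>fst k\<bar> + \<bar>snd k\<bar>) \<le> r" unfolding r_def using assms that by (intro member_le_sum) auto
    then show ?thesis by (cases k) (auto simp: lat_box_def)
  qed
  then show ?thesis by blast
qed

definition conv_bdd :: "nat \<Rightarrow> (int \<times> int \<Rightarrow> real) \<Rightarrow> bool" where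
  "conv_bdd n w \<longleftrightarrow> (\<forall>k. 0 \<le> w k) \<and> (\<exists>B. \<forall>F. finite F \<longrightarrow> conv_sum n F w \<le> B)"

text \<open>By monotonicity in the set this is the supremum over all finite sets whenever
  \<open>conv_bdd\<close> holds.\<close>

definition conv_lim :: "nat \<Rightarrow> (int \<times> int \<Rightarrow> real) \<Rightarrow> real" where
  "conv_lim n w = (SUP r. conv_sum n (lat_box r) w)"

lemma conv_sum_nonneg: "(\<And>k. 0 \<le> w k) \<Longrightarrow> 0 \<le> conv_sum n F w"
  unfolding conv_sum_def by (intro sum_nonneg mult_nonneg_nonneg prod_japanese_nonneg)

lemma conv_sum_0: "conv_sum 0 F w = w 0"
  by (simp add: conv_sum_def)

lemma conv_sum_diff: "conv_sum n F (\<lambda>k. v k - w k) = conv_sum n F v - conv_sum n F w"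
  by (simp add: conv_sum_def right_diff_distrib sum_subtractf)

lemma conv_sum_sum: "conv_sum n F (\<lambda>k. \<Sum>j\<in>A. b j * w j k) = (\<Sum>j\<in>A. b j * conv_sum n F (w j))"
  unfolding conv_sum_def sum_distrib_left by (subst sum.swap) (simp add: mult_ac)

lemma conv_sum_mono_weight: "(\<And>k. v k \<le> w k) \<Longrightarrow> conv_sum n F v \<le> conv_sum n F w"
  unfolding conv_sum_def by (intro sum_mono mult_left_mono prod_japanese_nonneg)

lemma conv_bdd_mono:
  assumes "conv_bdd n w" "\<And>k. 0 \<le> v k" "\<And>k. v k \<le> w k"
  shows "conv_bdd n v"
  using assms conv_sum_mono_weight[of v w n] unfolding conv_bdd_def by (meson order_trans)

lemma conv_lim_upper:
  assumes "conv_bdd n w" "finite F"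
  shows "conv_sum n F w \<le> conv_lim n w"
proof -
  obtain B where B: "\<And>F. finite F \<Longrightarrow> conv_sum n F w \<le> B" and w: "\<And>k. 0 \<le> w k" using assms by (auto simp: conv_bdd_def)
  obtain r where r: "F \<subseteq> lat_box r" using finite_subset_box[OF assms(2)] by blast
  have "conv_sum n F w \<le> conv_sum n (lat_box r) w" by (rule conv_sum_mono[OF finite_box r w])
  also have "\<dots> \<le> conv_lim n w" unfolding conv_lim_def
    by (intro cSUP_upper bdd_aboveI2[where M = B] B finite_box) auto
  finally show ?thesis .
qed

lemma conv_lim_le:
  assumes "\<And>F. finite F \<Longrightarrow> conv_sum n F w \<le> B" shows "conv_lim n w \<le> B"
  unfolding conv_lim_def by (rule cSUP_least) (auto intro: assms finite_box)

lemma conv_lim_tendsto: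
  assumes "conv_bdd n w" shows "(\<lambda>r. conv_sum n (lat_box r) w) \<longlonglongrightarrow> conv_lim n w"
  unfolding conv_lim_def
proof (rule LIMSEQ_incseq_SUP)
  show "bdd_above (range (\<lambda>r. conv_sum n (lat_box r) w))"
    using conv_lim_upper[OF assms finite_box] by (intro bdd_aboveI2)
  show "incseq (\<lambda>r. conv_sum n (lat_box r) w)"
    using assms by (intro incseq_SucI conv_sum_mono finite_box box_mono) (auto simp: conv_bdd_def)
qed

lemma conv_bdd_summable:
  assumes "\<And>k. 0 \<le> w k" "\<And>A. finite A \<Longrightarrow> (\<Sum>k\<in>A. w k) \<le> W"
  shows "conv_bdd n w"
proof (cases "n = 0")
  case True then show ?thesis using assms by (auto simp: conv_bdd_def conv_sum_0)
next
  case False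
  then have "n \<ge> 1" by simp
  from conv_sum_summable_bound[OF _ this assms] show ?thesis using assms(1) unfolding conv_bdd_def by blast
qed

lemma conv_bdd_sobolev:
  assumes "\<alpha> > 0" shows "conv_bdd n (sobolev_wt \<alpha>)"
proof (cases "n = 0")
  case True then show ?thesis by (auto simp: conv_bdd_def conv_sum_0)
next
  case False
  \<comment> \<open>The lattice bound asks for an exponent below 1; larger exponents have smaller
    weights.\<close>
  define \<beta> where "\<beta> = min \<alpha> (1 / 2)"
  have \<beta>: "0 < \<beta>" "\<beta> < 1" "\<beta> \<le> \<alpha>" using assms by (auto simp: \<beta>_def)
  have "conv_bdd n (sobolev_wt \<beta>)"
  proof -
    have "n \<ge> 1" using False by simp
    from conv_sum_sobolev_bound[OF _ this \<beta>(1,2)] show ?thesis unfolding conv_bdd_def using powr_ge_zero by blast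
  qed
  then show ?thesis
    by (rule conv_bdd_mono) (use \<beta> japanese_ge1 in \<open>auto intro!: powr_mono\<close>)
qed

abbreviation unit_at :: "int \<times> int \<Rightarrow> int \<times> int \<Rightarrow> real" where
  "unit_at m \<equiv> (\<lambda>k. if k = m then 1 else 0)"

lemma conv_bdd_unit_at: "conv_bdd n (unit_at m)"
  by (rule conv_bdd_summable[where W = 1]) auto

text \<open>Restricting the weight \<open>b\<close> to \<open>A\<close> cannot enlarge the increment
  between two boxes, because the increment of the nonnegative remainder is nonnegative. This
  controls sums over coordinates of single tail errors by one tail error.\<close>

lemma conv_lim_unit_at_sum:
  assumes b: "conv_bdd n b" and A: "finite A"
  shows "(\<Sum>m\<in>A. b m * (conv_lim n (unit_at m) - conv_sum n (lat_box r) (unit_at m))) \<le> conv_lim n b - conv_sum n (lat_box r) b"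
    and "(\<Sum>m\<in>A. b m * conv_lim n (unit_at m)) \<le> conv_lim n b"
proof -
  define bA where "bA k = (\<Sum>m\<in>A. b m * unit_at m k)" for k
  have bA: "bA k = (if k \<in> A then b k else 0)" for k
    unfolding bA_def using A by (simp add: if_distrib[of "(*) _"] cong: if_cong)
  have b0: "0 \<le> b k" for k using b unfolding conv_bdd_def by blast
  have cA: "conv_sum n F bA = (\<Sum>m\<in>A. b m * conv_sum n F (unit_at m))" for F
    unfolding bA_def by (rule conv_sum_sum)
  have step: "conv_sum n (lat_box r') bA - conv_sum n (lat_box r) bA \<le> conv_sum n (lat_box r') b - conv_sum n (lat_box r) b" if "r \<le> r'" for r'
  proof -
    have "conv_sum n (lat_box r) (\<lambda>k. b k - bA k) \<le> conv_sum n (lat_box r') (\<lambda>k. b k - bA k)"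
      by (rule conv_sum_mono[OF finite_box box_mono[OF that]]) (simp add: bA b0)
    then show ?thesis by (simp add: conv_sum_diff)
  qed
  have lim: "(\<lambda>r'. \<Sum>m\<in>A. b m * conv_sum n (lat_box r') (unit_at m)) \<longlonglongrightarrow> (\<Sum>m\<in>A. b m * conv_lim n (unit_at m))"
    by (intro tendsto_intros conv_lim_tendsto conv_bdd_unit_at)
  have l1: "(\<lambda>r'. conv_sum n (lat_box r') bA - conv_sum n (lat_box r) bA) \<longlonglongrightarrow> (\<Sum>m\<in>A. b m * conv_lim n (unit_at m)) - conv_sum n (lat_box r) bA"
    unfolding cA by (rule tendsto_diff[OF lim tendsto_const])
  have l2: "(\<lambda>r'. conv_sum n (lat_box r') b - conv_sum n (lat_box r) b) \<longlonglongrightarrow> conv_lim n b - conv_sum n (lat_box r) b"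
    by (intro tendsto_intros conv_lim_tendsto b)
  have "(\<Sum>m\<in>A. b m * conv_lim n (unit_at m)) - conv_sum n (lat_box r) bA \<le> conv_lim n b - conv_sum n (lat_box r) b"
    by (rule LIMSEQ_le[OF l1 l2]) (use step in auto)
  then show "(\<Sum>m\<in>A. b m * (conv_lim n (unit_at m) - conv_sum n (lat_box r) (unit_at m))) \<le> conv_lim n b - conv_sum n (lat_box r) b"
    by (simp add: cA right_diff_distrib sum_subtractf)
  have "conv_sum n (lat_box r') bA \<le> conv_sum n (lat_box r') b" for r'
    by (rule conv_sum_mono_weight) (simp add: bA b0)
  then show "(\<Sum>m\<in>A. b m * conv_lim n (unit_at m)) \<le> conv_lim n b"
    using lim unfolding cA[symmetric] by (intro LIMSEQ_le[OF _ conv_lim_tendsto[OF b]]) auto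
qed

lemma fourier_coeffs_e_basis: "fourier_coeffs (e_basis m) k = (if k = m then 1 else 0)"
  by (auto simp: fourier_coeffs_def H_inner_e_basis)

lemma wsq_e_basis: "(\<lambda>k. (fourier_coeffs (e_basis m) k)\<^sup>2) = unit_at m"
  by (auto simp: fourier_coeffs_e_basis)

lemma conv_bdd_H:
  assumes "g \<in> H_space" shows "conv_bdd n (\<lambda>k. (fourier_coeffs g k)\<^sup>2)"
  by (rule conv_bdd_summable[OF _ Bessel[OF assms]]) auto

lemma chaos_const_pos: "chaos_const n > 0"
  by (simp add: chaos_const_def)

text \<open>Bounds the distance between the approximations on any two symmetric sets containing box
  \<open>r\<close>. The 2 appears because each of the two sets may exceed the box by the full
  tail.\<close>

abbreviation tail_err :: "real \<Rightarrow> nat \<Rightarrow> (int \<times> int \<Rightarrow> real) \<Rightarrow> nat \<Rightarrow> real" where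
  "tail_err p n w r \<equiv> (p - 1) powr (real n / 2) * sqrt (2 * chaos_const n * (conv_lim n w - conv_sum n (lat_box r) w))"

text \<open>The limit is obtained as an almost everywhere limit of a subsequence, so that one and
  the same function can serve as the limit in every Lp.\<close>

lemma (in prob_space) L2_Cauchy_AE_subseq:
  fixes X :: "nat \<Rightarrow> 'a \<Rightarrow> real"
  assumes b: "\<And>i. \<exists>B. Lp_bounded M 2 (X i) B"
    and c: "\<And>r i j. r \<le> i \<Longrightarrow> r \<le> j \<Longrightarrow> Lp_bounded M 2 (\<lambda>z. X i z - X j z) (B r)" and B: "B \<longlonglongrightarrow> 0"
  obtains Y \<phi> where "Y \<in> borel_measurable M" "strict_mono (\<phi> :: nat \<Rightarrow> nat)" "AE z in M. (\<lambda>j. X (\<phi> j) z) \<longlonglongrightarrow> Y z"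
proof -
  have [measurable]: "X i \<in> borel_measurable M" for i using b Lp_bounded_measurable by blast
  have l1: "integrable M Z \<and> expectation (\<lambda>z. \<bar>Z z\<bar>) \<le> C" if "Lp_bounded M 2 Z C" for Z C
  proof -
    have L: "Lp_bounded M 1 Z C" by (rule Lp_bounded_le2[OF prob_space_axioms that]) auto
    have [measurable]: "Z \<in> borel_measurable M" by (rule Lp_bounded_measurable[OF that])
    have "integrable M (\<lambda>z. \<bar>Z z\<bar>)" using Lp_bounded_imp(1)[OF L] by (simp add: Lp_space_def)
    moreover have "expectation (\<lambda>z. \<bar>Z z\<bar>) \<le> C" using Lp_bounded_imp(2)[OF L] by (simp add: Lp_norm_def)
    ultimately show ?thesis by (simp add: integrable_abs_iff)
  qed
  obtain \<phi> where \<phi>: "strict_mono \<phi>" "AE z in M. Cauchy (\<lambda>i. X (\<phi> i) z)"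
  proof (rule cauchy_L1_AE_cauchy_subseq)
    show "integrable M (X i)" for i using b l1 by blast
    fix e :: real assume "0 < e"
    then obtain N where N: "\<And>n. n \<ge> N \<Longrightarrow> norm (B n - 0) < e" using B LIMSEQ_iff by metis
    show "\<exists>N. \<forall>i\<ge>N. \<forall>j\<ge>N. (LINT z|M. norm (X i z - X j z)) < e"
    proof (intro exI[of _ N] allI impI)
      fix i j assume "N \<le> i" "N \<le> j"
      then have "expectation (\<lambda>z. \<bar>X i z - X j z\<bar>) \<le> B N" using l1[OF c] by blast
      then show "(LINT z|M. norm (X i z - X j z)) < e" using N[of N] by simp
    qed
  qed
  show thesis
  proof (rule that[OF _ \<phi>(1)])
    show "(\<lambda>z. lim (\<lambda>i. X (\<phi> i) z)) \<in> borel_measurable M" by measurable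
    show "AE z in M. (\<lambda>j. X (\<phi> j) z) \<longlonglongrightarrow> lim (\<lambda>i. X (\<phi> i) z)"
      using \<phi>(2) by eventually_elim (simp add: Cauchy_convergent_iff convergent_LIMSEQ_iff)
  qed
qed

context free_field_measure
begin

lemma Phi_diff_Lp_bounded_box:
  assumes F: "sym_set F" "lat_box r \<subseteq> F" and F': "sym_set F'" "lat_box r \<subseteq> F'" and g: "g \<in> H_space" and p: "2 \<le> p"
  shows "Lp_bounded M p (\<lambda>z. H_inner (Phi n F z) g - H_inner (Phi n F' z) g)
    (tail_err p n (wsq g) r)"
proof -
  note w = conv_bdd_H[OF g, of n]
  have "conv_sum n F (wsq g) + conv_sum n F' (wsq g) - 2 * conv_sum n (F \<inter> F') (wsq g) \<le> 2 * (conv_lim n (wsq g) - conv_sum n (lat_box r) (wsq g))"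
  proof -
    have "conv_sum n (lat_box r) (wsq g) \<le> conv_sum n (F \<inter> F') (wsq g)"
      using F F' sym_setD by (intro conv_sum_mono) auto
    moreover have "a + b - 2 * e \<le> 2 * (l - d)" if "d \<le> e" "a \<le> l" "b \<le> l" for a b d e l :: real
      using that by (simp add: algebra_simps)
    ultimately show ?thesis using conv_lim_upper[OF w sym_setD(1)[OF F(1)]] conv_lim_upper[OF w sym_setD(1)[OF F'(1)]] by blast
  qed
  then have "chaos_const n * (conv_sum n F (wsq g) + conv_sum n F' (wsq g) - 2 * conv_sum n (F \<inter> F') (wsq g)) \<le> chaos_const n * (2 * (conv_lim n (wsq g) - conv_sum n (lat_box r) (wsq g)))"
    using chaos_const_pos[of n] by (intro mult_left_mono) auto
  then have "(p - 1) powr (real n / 2) * sqrt (chaos_const n * (conv_sum n F (wsq g) + conv_sum n F' (wsq g) - 2 * conv_sum n (F \<inter> F') (wsq g)))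
    \<le> tail_err p n (wsq g) r"
    by (intro mult_left_mono real_sqrt_le_mono) (simp_all add: mult_ac)
  then show ?thesis using Lp_bounded_mono[OF Phi_diff_Lp_bounded[OF F(1) F'(1) g p]] p by simp
qed

lemma err_tendsto:
  assumes "conv_bdd n w"
  shows "(\<lambda>r. tail_err p n w r) \<longlonglongrightarrow> 0"
proof -
  have "(\<lambda>r. tail_err p n w r) \<longlonglongrightarrow> (p - 1) powr (real n / 2) * sqrt (2 * chaos_const n * (conv_lim n w - conv_lim n w))"
    by (intro tendsto_intros conv_lim_tendsto assms)
  then show ?thesis by simp
qed

lemma bound_tendsto:
  assumes "conv_bdd n w"
  shows "(\<lambda>r. c * sqrt (chaos_const n * conv_sum n (lat_box r) w)) \<longlonglongrightarrow> c * sqrt (chaos_const n * conv_lim n w)"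
  by (intro tendsto_mult tendsto_real_sqrt tendsto_const conv_lim_tendsto assms)

lemma ex_Psi:
  assumes g: "g \<in> H_space"
  shows "\<exists>Y \<phi>. Y \<in> borel_measurable M \<and> strict_mono (\<phi> :: nat \<Rightarrow> nat) \<and> (AE z in M. (\<lambda>j. H_inner (Phi n (lat_box (\<phi> j)) z) g) \<longlonglongrightarrow> Y z)"
proof -
  obtain Y \<phi> where "Y \<in> borel_measurable M" "strict_mono (\<phi> :: nat \<Rightarrow> nat)" "AE z in M. (\<lambda>j. H_inner (Phi n (lat_box (\<phi> j)) z) g) \<longlonglongrightarrow> Y z"
  proof (rule L2_Cauchy_AE_subseq[where X = "\<lambda>i z. H_inner (Phi n (lat_box i) z) g"])
    show "\<exists>B. Lp_bounded M 2 (\<lambda>z. H_inner (Phi n (lat_box i) z) g) B" for i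
      using Phi_Lp_bounded[OF sym_set_box g, of 2] by blast
    show "Lp_bounded M 2 (\<lambda>z. H_inner (Phi n (lat_box i) z) g - H_inner (Phi n (lat_box j) z) g)
       (tail_err 2 n (wsq g) r)" if "r \<le> i" "r \<le> j" for r i j
      by (rule Phi_diff_Lp_bounded_box[OF sym_set_box box_mono[OF that(1)] sym_set_box box_mono[OF that(2)] g]) simp
  qed (rule err_tendsto[OF conv_bdd_H[OF g]])
  then show ?thesis by blast
qed

text \<open>One version of the limit, fixed along boxes, hence common to all p and all
  \<Lambda>.\<close>

definition Psi :: "nat \<Rightarrow> (real \<times> real \<Rightarrow> real) \<Rightarrow> dist_coeffs \<Rightarrow> real" where
  "Psi n g = (SOME Y. \<exists>\<phi>. Y \<in> borel_measurable M \<and> strict_mono (\<phi> :: nat \<Rightarrow> nat) \<and> (AE z in M. (\<lambda>j. H_inner (Phi n (lat_box (\<phi> j)) z) g) \<longlonglongrightarrow> Y z))"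

definition Psi_seq :: "nat \<Rightarrow> (real \<times> real \<Rightarrow> real) \<Rightarrow> nat \<Rightarrow> nat" where
  "Psi_seq n g = (SOME \<phi>. strict_mono \<phi> \<and> (AE z in M. (\<lambda>j. H_inner (Phi n (lat_box (\<phi> j)) z) g) \<longlonglongrightarrow> Psi n g z))"

lemma Psi_limit:
  assumes g: "g \<in> H_space"
  shows "Psi n g \<in> borel_measurable M" and "strict_mono (Psi_seq n g)"
    and "AE z in M. (\<lambda>j. H_inner (Phi n (lat_box (Psi_seq n g j)) z) g) \<longlonglongrightarrow> Psi n g z"
proof -
  note * = someI_ex[OF ex_Psi[OF g, of n], folded Psi_def]
  show "Psi n g \<in> borel_measurable M" using * by (elim exE conjE)
  have "\<exists>\<phi>. strict_mono \<phi> \<and> (AE z in M. (\<lambda>j. H_inner (Phi n (lat_box (\<phi> j)) z) g) \<longlonglongrightarrow> Psi n g z)"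
    using * by (elim exE conjE) (rule exI, rule conjI)
  note ** = someI_ex[OF this, folded Psi_seq_def]
  show "strict_mono (Psi_seq n g)" using ** by (rule conjunct1)
  show "AE z in M. (\<lambda>j. H_inner (Phi n (lat_box (Psi_seq n g j)) z) g) \<longlonglongrightarrow> Psi n g z" using ** by (rule conjunct2)
qed

lemma Psi_measurable: "g \<in> H_space \<Longrightarrow> Psi n g \<in> borel_measurable M"
  by (rule Psi_limit(1))

lemma Psi_Lp_bounded:
  assumes g: "g \<in> H_space" and p: "2 \<le> p"
  shows "Lp_bounded M p (Psi n g) ((p - 1) powr (real n / 2) * sqrt (chaos_const n * conv_lim n (wsq g)))"
proof -
  define \<phi> where "\<phi> = Psi_seq n g"
  note \<phi> = Psi_limit[OF g, of n, folded \<phi>_def]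
  have "(\<lambda>j. (p - 1) powr (real n / 2) * sqrt (chaos_const n * conv_sum n (lat_box (\<phi> j)) (wsq g))) \<longlonglongrightarrow> (p - 1) powr (real n / 2) * sqrt (chaos_const n * conv_lim n (wsq g))"
    using LIMSEQ_subseq_LIMSEQ[OF bound_tendsto[OF conv_bdd_H[OF g]] \<phi>(2)] by (simp only: o_def)
  then show ?thesis
  proof (rule Lp_bounded_Fatou[rotated])
    show "Lp_bounded M p (\<lambda>z. H_inner (Phi n (lat_box (\<phi> j)) z) g) ((p - 1) powr (real n / 2) * sqrt (chaos_const n * conv_sum n (lat_box (\<phi> j)) (wsq g)))" for j
      by (rule Phi_Lp_bounded[OF sym_set_box g p])
    show "0 < p" using p by simp
  qed (use \<phi> in auto)
qed

lemma Phi_Psi_Lp_bounded: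
  assumes g: "g \<in> H_space" and p: "2 \<le> p" and F: "sym_set F" "lat_box r \<subseteq> F"
  shows "Lp_bounded M p (\<lambda>z. H_inner (Phi n F z) g - Psi n g z) (tail_err p n (wsq g) r)"
proof -
  define \<phi> where "\<phi> = Psi_seq n g"
  note \<phi> = Psi_limit[OF g, of n, folded \<phi>_def]
  have [measurable]: "(\<lambda>z. H_inner (Phi n F z) g) \<in> borel_measurable M"
    by (rule Lp_bounded_measurable[OF Phi_Lp_bounded[OF F(1) g p]])
  note [measurable] = \<phi>(1)
  show ?thesis
  proof (rule Lp_bounded_Fatou[OF _ tendsto_const])
    show "Lp_bounded M p (\<lambda>z. H_inner (Phi n F z) g - H_inner (Phi n (lat_box (\<phi> (j + r))) z) g) (tail_err p n (wsq g) r)" for j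
    proof (rule Phi_diff_Lp_bounded_box[OF F sym_set_box _ g p])
      \<comment> \<open>A strictly increasing \<phi> is at least the identity, so from the shifted
        index on all boxes contain box \<open>r\<close>.\<close>
      have "r \<le> \<phi> (j + r)" using seq_suble[OF \<phi>(2), of "j + r"] by simp
      then show "lat_box r \<subseteq> lat_box (\<phi> (j + r))" by (rule box_mono)
    qed
    show "AE z in M. (\<lambda>j. H_inner (Phi n F z) g - H_inner (Phi n (lat_box (\<phi> (j + r))) z) g) \<longlonglongrightarrow> H_inner (Phi n F z) g - Psi n g z"
      using \<phi>(3)
    proof eventually_elim
      case (elim z)
      show ?case using LIMSEQ_ignore_initial_segment[OF elim, of r] by (intro tendsto_intros)
    qed
  qed (use p in auto)
qed

text \<open>The coordinates are versions chosen separately for each frequency, so membership in a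
  Sobolev space holds only almost everywhere.\<close>

definition wick_raw :: "nat \<Rightarrow> dist_coeffs \<Rightarrow> dist_coeffs" where
  "wick_raw n z k = Psi n (e_basis k) z"

lemma wick_raw_measurable[measurable]: "(\<lambda>z. wick_raw n z k) \<in> borel_measurable M"
  unfolding wick_raw_def by (rule Psi_measurable[OF e_basis_H])

text \<open>At frequency k the error has the weight \<open>unit_at k\<close>. Summing the squares
  against the Sobolev weight gives the same expression with \<open>sobolev_wt\<close>;
  \<open>c\<close> stands for the factor that depends on p.\<close>

lemma sobolev_sum_bound:
  assumes "\<alpha> > 0" "finite A"
  shows "(\<Sum>k\<in>A. japanese k powr (- \<alpha>) * (c * sqrt (2 * chaos_const n * (conv_lim n (unit_at k) - conv_sum n (lat_box r) (unit_at k))))\<^sup>2)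
    \<le> (c * sqrt (2 * chaos_const n * (conv_lim n (sobolev_wt \<alpha>) - conv_sum n (lat_box r) (sobolev_wt \<alpha>))))\<^sup>2"
    and "(\<Sum>k\<in>A. japanese k powr (- \<alpha>) * (c * sqrt (chaos_const n * conv_lim n (unit_at k)))\<^sup>2)
    \<le> (c * sqrt (chaos_const n * conv_lim n (sobolev_wt \<alpha>)))\<^sup>2"
proof -
  let ?b = "\<lambda>k. japanese k powr (- \<alpha>)"
  note b = conv_bdd_sobolev[OF assms(1), of n]
  have d: "0 \<le> conv_lim n w - conv_sum n (lat_box r) w" if "conv_bdd n w" for w
    using conv_lim_upper[OF that finite_box, of r] by simp
  have d0: "0 \<le> conv_lim n w" if "conv_bdd n w" for w
    using conv_lim_upper[OF that, of "{}"] conv_sum_nonneg[of w n "{}"] that by (auto simp: conv_bdd_def)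
  have c: "chaos_const n \<ge> 0" using chaos_const_pos[of n] by simp
  have "(\<Sum>k\<in>A. ?b k * (c * sqrt (2 * chaos_const n * (conv_lim n (unit_at k) - conv_sum n (lat_box r) (unit_at k))))\<^sup>2)
      = c\<^sup>2 * (2 * chaos_const n) * (\<Sum>k\<in>A. ?b k * (conv_lim n (unit_at k) - conv_sum n (lat_box r) (unit_at k)))"
    using c d[OF conv_bdd_unit_at] by (simp add: power_mult_distrib sum_distrib_left mult_ac del: right_diff_distrib_numeral)
  also have "\<dots> \<le> c\<^sup>2 * (2 * chaos_const n) * (conv_lim n ?b - conv_sum n (lat_box r) ?b)"
    using c by (intro mult_left_mono conv_lim_unit_at_sum(1) b assms) auto
  also have "\<dots> = (c * sqrt (2 * chaos_const n * (conv_lim n ?b - conv_sum n (lat_box r) ?b)))\<^sup>2"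
    using c d[OF b] by (simp add: power_mult_distrib mult_ac del: right_diff_distrib_numeral)
  finally show "(\<Sum>k\<in>A. ?b k * (c * sqrt (2 * chaos_const n * (conv_lim n (unit_at k) - conv_sum n (lat_box r) (unit_at k))))\<^sup>2) \<le> (c * sqrt (2 * chaos_const n * (conv_lim n ?b - conv_sum n (lat_box r) ?b)))\<^sup>2" .
  have "(\<Sum>k\<in>A. ?b k * (c * sqrt (chaos_const n * conv_lim n (unit_at k)))\<^sup>2) = c\<^sup>2 * chaos_const n * (\<Sum>k\<in>A. ?b k * conv_lim n (unit_at k))"
    using c d0[OF conv_bdd_unit_at] by (simp add: power_mult_distrib sum_distrib_left mult_ac)
  also have "\<dots> \<le> c\<^sup>2 * chaos_const n * conv_lim n ?b"
    using c by (intro mult_left_mono conv_lim_unit_at_sum(2) b assms) auto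
  also have "\<dots> = (c * sqrt (chaos_const n * conv_lim n ?b))\<^sup>2"
    using c d0[OF b] by (simp add: power_mult_distrib mult_ac)
  finally show "(\<Sum>k\<in>A. ?b k * (c * sqrt (chaos_const n * conv_lim n (unit_at k)))\<^sup>2) \<le> (c * sqrt (chaos_const n * conv_lim n ?b))\<^sup>2" .
qed

lemma wick_raw_coord_bounded:
  assumes "2 \<le> p"
  shows "Lp_bounded M p (\<lambda>z. wick_raw n z k) ((p - 1) powr (real n / 2) * sqrt (chaos_const n * conv_lim n (unit_at k)))"
  using Psi_Lp_bounded[OF e_basis_H assms, of n k] unfolding wsq_e_basis wick_raw_def .

lemma AE_wick_raw_sobolev: "\<alpha> > 0 \<Longrightarrow> AE z in M. wick_raw n z \<in> sobolev (- \<alpha>)"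
  by (rule AE_sobolev[OF wick_raw_coord_bounded[OF order_refl] sobolev_sum_bound(2)])

text \<open>The correction on a null set puts every value into all \<open>H\<^sup>-\<^sup>\<alpha>\<close>, \<open>\<alpha> > 0\<close>, at once.\<close>

definition wick_power :: "nat \<Rightarrow> dist_coeffs \<Rightarrow> dist_coeffs" where
  "wick_power n z = (if \<forall>j::nat. wick_raw n z \<in> sobolev (- (1 / (real j + 1))) then wick_raw n z else (\<lambda>_. 0))"

lemma wick_power_sobolev: assumes "\<alpha> > 0" shows "wick_power n z \<in> sobolev (- \<alpha>)"
proof (cases "\<forall>j::nat. wick_raw n z \<in> sobolev (- (1 / (real j + 1)))")
  case True
  obtain j where j: "inverse (real (Suc j)) < \<alpha>" using reals_Archimedean[OF assms] by blast
  have "wick_raw n z \<in> sobolev (- \<alpha>)"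
    by (rule sobolev_antimono(1)[of _ "- (1 / (real j + 1))"]) (use True j in \<open>auto simp: inverse_eq_divide add.commute\<close>)
  then show ?thesis using True by (simp add: wick_power_def)
next
  case False
  then have "wick_power n z = (\<lambda>_. 0)" unfolding wick_power_def by (rule if_not_P)
  then show ?thesis by (simp add: sobolev_def)
qed

lemma AE_wick_power: "AE z in M. wick_power n z = wick_raw n z"
proof -
  have "AE z in M. \<forall>j::nat. wick_raw n z \<in> sobolev (- (1 / (real j + 1)))"
    unfolding AE_all_countable by (intro allI AE_wick_raw_sobolev) auto
  then show ?thesis by eventually_elim (simp add: wick_power_def)
qed

lemma wick_power_measurable[measurable]: "(\<lambda>z. wick_power n z k) \<in> borel_measurable M"
proof -
  have "wick_power n z k = (if \<forall>j::nat. sobolev_enn (- (1 / (real j + 1))) (wick_raw n z) < \<top> then wick_raw n z k else 0)" for z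
    by (simp add: wick_power_def sobolev_enn_finite_iff)
  then show ?thesis by simp
qed

section \<open>Distances in the Sobolev norm\<close>

lemma Phi_coeffs_sobolev:
  assumes "finite F" "\<alpha> > 0"
  shows "fourier_coeffs (Phi n F z) \<in> sobolev (- \<alpha>)"
proof -
  let ?u = "fourier_coeffs (Phi n F z)"
  have "(\<lambda>k. japanese k powr (- \<alpha>) * (?u k)\<^sup>2) summable_on UNIV"
  proof (rule nonneg_bdd_above_summable_on)
    show "bdd_above (sum (\<lambda>k. japanese k powr (- \<alpha>) * (?u k)\<^sup>2) ` {A. A \<subseteq> UNIV \<and> finite A})"
    proof (rule bdd_aboveI2)
      fix A :: "(int \<times> int) set" assume "A \<in> {A. A \<subseteq> UNIV \<and> finite A}"
      then have A: "finite A" by simp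
      have "(\<Sum>k\<in>A. japanese k powr (- \<alpha>) * (?u k)\<^sup>2) \<le> (\<Sum>k\<in>A. 1 * (?u k)\<^sup>2)"
      proof (intro sum_mono mult_right_mono)
        fix k
        have "japanese k powr (- \<alpha>) \<le> japanese k powr 0" using assms japanese_ge1[of k] by (intro powr_mono) auto
        then show "japanese k powr (- \<alpha>) \<le> 1" using japanese_pos[of k] by simp
      qed auto
      also have "\<dots> \<le> (H_norm (Phi n F z))\<^sup>2" using Bessel[OF Phi_H_space[OF assms(1)] A] by simp
      finally show "sum (\<lambda>k. japanese k powr (- \<alpha>) * (?u k)\<^sup>2) A \<le> (H_norm (Phi n F z))\<^sup>2" .
    qed
  qed simp
  then show ?thesis by (simp add: sobolev_def japanese_def)
qed

lemma Phi_coeffs_measurable: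
  assumes "sym_set F" shows "(\<lambda>z. fourier_coeffs (Phi n F z) k) \<in> borel_measurable M"
  unfolding fourier_coeffs_def
  by (rule Lp_bounded_measurable[OF Phi_Lp_bounded[OF assms e_basis_H order_refl]])

definition sob_err :: "nat \<Rightarrow> real \<Rightarrow> real \<Rightarrow> nat \<Rightarrow> real" where
  "sob_err n p \<alpha> r = tail_err p n (sobolev_wt \<alpha>) r"

lemma sob_err_tendsto: "\<alpha> > 0 \<Longrightarrow> sob_err n p \<alpha> \<longlonglongrightarrow> 0"
  unfolding sob_err_def[abs_def] by (rule err_tendsto[OF conv_bdd_sobolev])

lemma sob_err_nonneg: "\<alpha> > 0 \<Longrightarrow> 0 \<le> sob_err n p \<alpha> r"
  unfolding sob_err_def using conv_lim_upper[OF conv_bdd_sobolev finite_box] chaos_const_pos[of n]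
  by (auto intro!: mult_nonneg_nonneg simp: less_imp_le)

lemma sobolev_Phi_diff:
  assumes F: "sym_set F" "lat_box r \<subseteq> F" and F': "sym_set F'" "lat_box r \<subseteq> F'" and p: "2 \<le> p" and \<alpha>: "\<alpha> > 0"
  shows "Lp_bounded M p (\<lambda>z. sobolev_norm (- \<alpha>) (\<lambda>k. fourier_coeffs (Phi n F z) k - fourier_coeffs (Phi n F' z) k)) (sob_err n p \<alpha> r)"
proof (rule Lp_bounded_sobolev_norm[OF p])
  show "AE z in M. (\<lambda>k. fourier_coeffs (Phi n F z) k - fourier_coeffs (Phi n F' z) k) \<in> sobolev (- \<alpha>)"
    using sym_setD[OF F(1)] sym_setD[OF F'(1)] \<alpha> by (intro AE_I2 sobolev_diff Phi_coeffs_sobolev) auto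
  show "Lp_bounded M p (\<lambda>z. fourier_coeffs (Phi n F z) k - fourier_coeffs (Phi n F' z) k) (tail_err p n (unit_at k) r)" for k
    using Phi_diff_Lp_bounded_box[OF F F' e_basis_H p, of n k] unfolding wsq_e_basis unfolding fourier_coeffs_def .
  show "(\<Sum>k\<in>A. japanese k powr (- \<alpha>) * (tail_err p n (unit_at k) r)\<^sup>2) \<le> (sob_err n p \<alpha> r)\<^sup>2" if "finite A" for A
    unfolding sob_err_def by (rule sobolev_sum_bound(1)[OF \<alpha> that])
qed (rule sob_err_nonneg[OF \<alpha>])

lemma sobolev_Phi_wick_power:
  assumes F: "sym_set F" "lat_box r \<subseteq> F" and p: "2 \<le> p" and \<alpha>: "\<alpha> > 0"
  shows "Lp_bounded M p (\<lambda>z. sobolev_norm (- \<alpha>) (\<lambda>k. fourier_coeffs (Phi n F z) k - wick_power n z k)) (sob_err n p \<alpha> r)"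
proof (rule Lp_bounded_sobolev_norm[OF p])
  show "AE z in M. (\<lambda>k. fourier_coeffs (Phi n F z) k - wick_power n z k) \<in> sobolev (- \<alpha>)"
    using sym_setD[OF F(1)] \<alpha> by (intro AE_I2 sobolev_diff Phi_coeffs_sobolev wick_power_sobolev) auto
  show "Lp_bounded M p (\<lambda>z. fourier_coeffs (Phi n F z) k - wick_power n z k) (tail_err p n (unit_at k) r)" for k
  proof (rule Lp_bounded_cong_AE)
    show "Lp_bounded M p (\<lambda>z. fourier_coeffs (Phi n F z) k - wick_raw n z k) (tail_err p n (unit_at k) r)"
      using Phi_Psi_Lp_bounded[OF e_basis_H p F, of n k] unfolding wsq_e_basis unfolding fourier_coeffs_def wick_raw_def .
    show "AE z in M. fourier_coeffs (Phi n F z) k - wick_raw n z k = fourier_coeffs (Phi n F z) k - wick_power n z k"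
      using AE_wick_power[of n] by eventually_elim simp
    show "(\<lambda>z. fourier_coeffs (Phi n F z) k - wick_power n z k) \<in> borel_measurable M"
      using Phi_coeffs_measurable[OF F(1)] by measurable
  qed
  show "(\<Sum>k\<in>A. japanese k powr (- \<alpha>) * (tail_err p n (unit_at k) r)\<^sup>2) \<le> (sob_err n p \<alpha> r)\<^sup>2" if "finite A" for A
    unfolding sob_err_def by (rule sobolev_sum_bound(1)[OF \<alpha> that])
qed (rule sob_err_nonneg[OF \<alpha>])

lemma sobolev_wick_power:
  assumes p: "2 \<le> p" and \<alpha>: "\<alpha> > 0"
  shows "Lp_bounded M p (\<lambda>z. sobolev_norm (- \<alpha>) (wick_power n z)) ((p - 1) powr (real n / 2) * sqrt (chaos_const n * conv_lim n (sobolev_wt \<alpha>)))"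
proof (rule Lp_bounded_sobolev_norm[OF p])
  show "AE z in M. wick_power n z \<in> sobolev (- \<alpha>)" using \<alpha> by (intro AE_I2 wick_power_sobolev)
  show "Lp_bounded M p (\<lambda>z. wick_power n z k) ((p - 1) powr (real n / 2) * sqrt (chaos_const n * conv_lim n (unit_at k)))" for k
  proof (rule Lp_bounded_cong_AE[OF wick_raw_coord_bounded[OF p]])
    show "AE z in M. wick_raw n z k = wick_power n z k" using AE_wick_power[of n] by eventually_elim simp
  qed simp
  show "(\<Sum>k\<in>A. japanese k powr (- \<alpha>) * ((p - 1) powr (real n / 2) * sqrt (chaos_const n * conv_lim n (unit_at k)))\<^sup>2) \<le> ((p - 1) powr (real n / 2) * sqrt (chaos_const n * conv_lim n (sobolev_wt \<alpha>)))\<^sup>2" if "finite A" for A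
    by (rule sobolev_sum_bound(2)[OF \<alpha> that])
  have "0 \<le> conv_sum n {} (sobolev_wt \<alpha>)" by (rule conv_sum_nonneg) simp
  then have "0 \<le> conv_lim n (sobolev_wt \<alpha>)"
    using conv_lim_upper[OF conv_bdd_sobolev[OF \<alpha>], of "{}" n] by simp
  then show "0 \<le> (p - 1) powr (real n / 2) * sqrt (chaos_const n * conv_lim n (sobolev_wt \<alpha>))"
    using chaos_const_pos[of n] by simp
qed

end

section \<open>Calculus of Lp bounds\<close>

lemma Lp_bounded_abs: "Lp_bounded M p X B \<Longrightarrow> Lp_bounded M p (\<lambda>z. \<bar>X z\<bar>) B"
  by (auto simp: Lp_bounded_def)

lemma Lp_bounded_dominated:
  assumes "Lp_bounded M p Y B" "\<And>z. \<bar>X z\<bar> \<le> \<bar>Y z\<bar>" "X \<in> borel_measurable M" "p > 0"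
  shows "Lp_bounded M p X B"
proof -
  have "(\<integral>\<^sup>+z. ennreal (\<bar>X z\<bar> powr p) \<partial>M) \<le> (\<integral>\<^sup>+z. ennreal (\<bar>Y z\<bar> powr p) \<partial>M)"
    using assms by (intro nn_integral_mono ennreal_leI powr_mono2) auto
  then show ?thesis using assms(1,3) unfolding Lp_bounded_def by (auto intro: order_trans)
qed

lemma Lp_bounded_sum:
  assumes "finite J" "1 \<le> p" "\<And>j. j \<in> J \<Longrightarrow> Lp_bounded M p (X j) (B j)"
  shows "Lp_bounded M p (\<lambda>z. \<Sum>j\<in>J. X j z) (\<Sum>j\<in>J. B j)"
proof (rule Lp_bounded_dominated)
  show "Lp_bounded M p (\<lambda>z. \<Sum>j\<in>J. \<bar>X j z\<bar>) (\<Sum>j\<in>J. B j)"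
    by (rule Lp_bounded_Minkowski) (use assms in \<open>auto intro: Lp_bounded_abs\<close>)
  show "\<bar>\<Sum>j\<in>J. X j z\<bar> \<le> \<bar>\<Sum>j\<in>J. \<bar>X j z\<bar>\<bar>" for z
    using sum_abs[of "\<lambda>j. X j z" J] by linarith
  show "(\<lambda>z. \<Sum>j\<in>J. X j z) \<in> borel_measurable M"
    using assms(3) by (intro borel_measurable_sum) (auto intro: Lp_bounded_measurable)
qed (use assms in auto)

lemma Lp_bounded_add:
  assumes "1 \<le> p" "Lp_bounded M p X B" "Lp_bounded M p Y C"
  shows "Lp_bounded M p (\<lambda>z. X z + Y z) (B + C)"
  using Lp_bounded_sum[of "{True, False}" p M "\<lambda>b. if b then X else Y" "\<lambda>b. if b then B else C"] assms by simp

lemma Lp_bounded_scale: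
  assumes "Lp_bounded M p X B" shows "Lp_bounded M p (\<lambda>z. c * X z) (\<bar>c\<bar> * B)"
proof -
  have [measurable]: "X \<in> borel_measurable M" using assms by (rule Lp_bounded_measurable)
  have "(\<integral>\<^sup>+z. ennreal (\<bar>c * X z\<bar> powr p) \<partial>M) = (\<integral>\<^sup>+z. ennreal (\<bar>c\<bar> powr p) * ennreal (\<bar>X z\<bar> powr p) \<partial>M)"
    by (intro nn_integral_cong) (simp add: abs_mult powr_mult flip: ennreal_mult)
  also have "\<dots> = ennreal (\<bar>c\<bar> powr p) * (\<integral>\<^sup>+z. ennreal (\<bar>X z\<bar> powr p) \<partial>M)"
    by (rule nn_integral_cmult) simp
  also have "\<dots> \<le> ennreal (\<bar>c\<bar> powr p) * ennreal (B powr p)"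
    using assms by (intro mult_left_mono) (auto simp: Lp_bounded_def)
  finally show ?thesis using assms by (simp add: Lp_bounded_def powr_mult flip: ennreal_mult)
qed

lemma Lp_bounded_0_AE:
  assumes "Lp_bounded M p X 0" "p > 0" shows "AE z in M. X z = 0"
proof -
  have [measurable]: "X \<in> borel_measurable M" using assms(1) by (rule Lp_bounded_measurable)
  have "(\<integral>\<^sup>+z. ennreal (\<bar>X z\<bar> powr p) \<partial>M) = 0"
    using assms by (simp add: Lp_bounded_def)
  then have "AE z in M. ennreal (\<bar>X z\<bar> powr p) = 0" by (subst (asm) nn_integral_0_iff_AE) auto
  then show ?thesis by eventually_elim (use assms in \<open>auto simp: powr_eq_0_iff ennreal_eq_0_iff\<close>)
qed

abbreviation lat_pts :: "nat \<Rightarrow> (real \<times> real) set \<Rightarrow> (int \<times> int) set" where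
  "lat_pts N \<Lambda> \<equiv> {k. lat k \<in> dilate N \<Lambda>}"

text \<open>Compactness makes the set of lattice points finite, and a ball around 0 inside \<Lambda>
  swallows every box after dilation. The first claim covers N = 0, where the dilate is {0}.\<close>

lemma admissible_lattice:
  assumes "admissible \<Lambda>"
  shows "sym_set (lat_pts N \<Lambda>)"
    and "eventually (\<lambda>N. lat_box r \<subseteq> (lat_pts N \<Lambda>)) sequentially"
proof -
  have cpt: "compact \<Lambda>" and sym: "\<Lambda> = uminus ` \<Lambda>" and int: "0 \<in> interior \<Lambda>"
    using assms by (auto simp: admissible_def)
  have "compact (dilate N \<Lambda>)" unfolding dilate_def
    by (intro compact_continuous_image cpt continuous_intros)
  then obtain R where R: "\<And>x. x \<in> dilate N \<Lambda> \<Longrightarrow> norm x \<le> R"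
    using compact_imp_bounded bounded_iff by metis
  have "(lat_pts N \<Lambda>) \<subseteq> lat_box (nat \<lceil>R\<rceil>)"
  proof
    fix k assume "k \<in> (lat_pts N \<Lambda>)"
    then have n: "norm (lat k) \<le> R" using R by simp
    have "\<bar>real_of_int (fst k)\<bar> \<le> R" "\<bar>real_of_int (snd k)\<bar> \<le> R"
      using norm_fst_le[of "real_of_int (fst k)" "real_of_int (snd k)"] norm_snd_le[of "real_of_int (snd k)" "real_of_int (fst k)"] n by (simp_all add: lat_def)
    then have "\<bar>fst k\<bar> \<le> \<lceil>R\<rceil>" "\<bar>snd k\<bar> \<le> \<lceil>R\<rceil>" by linarith+
    moreover have "0 \<le> R" using n norm_ge_zero order_trans by blast
    ultimately show "k \<in> lat_box (nat \<lceil>R\<rceil>)" by (cases k) (auto simp: lat_box_def)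
  qed
  then have fin: "finite (lat_pts N \<Lambda>)" using finite_box finite_subset by blast
  have neg: "- x \<in> dilate N \<Lambda>" if x: "x \<in> dilate N \<Lambda>" for x
  proof -
    obtain y where y: "y \<in> \<Lambda>" "x = real N *\<^sub>R y" using x unfolding dilate_def by blast
    have "- y \<in> \<Lambda>" using y(1) sym by (metis image_eqI)
    then show ?thesis unfolding y(2) dilate_def by (intro image_eqI[of _ _ "- y"]) auto
  qed
  have "(lat_pts N \<Lambda>) = uminus ` (lat_pts N \<Lambda>)"
  proof (intro set_eqI iffI)
    fix k assume "k \<in> (lat_pts N \<Lambda>)"
    then have "- k \<in> (lat_pts N \<Lambda>)" by (simp add: lat_minus neg)
    then show "k \<in> uminus ` (lat_pts N \<Lambda>)" by (intro image_eqI[of _ _ "- k"]) auto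
  next
    fix k assume "k \<in> uminus ` (lat_pts N \<Lambda>)"
    then obtain j where "k = - j" "lat j \<in> dilate N \<Lambda>" by blast
    then show "k \<in> (lat_pts N \<Lambda>)" by (simp add: lat_minus neg)
  qed
  moreover have "lat 0 \<in> dilate N \<Lambda>"
    unfolding dilate_def lat_0 using int interior_subset by (intro image_eqI[of _ _ 0]) auto
  ultimately show "sym_set (lat_pts N \<Lambda>)" using fin by (simp add: sym_set_def)
  obtain e where e: "e > 0" "ball 0 e \<subseteq> \<Lambda>" using int mem_interior by blast
  show "eventually (\<lambda>N. lat_box r \<subseteq> (lat_pts N \<Lambda>)) sequentially"
  proof (rule eventually_sequentiallyI[of "nat \<lceil>(2 * real r + 1) / e\<rceil>"], rule subsetI)
    fix N k assume N: "nat \<lceil>(2 * real r + 1) / e\<rceil> \<le> N" and k: "k \<in> lat_box r"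
    \<comment> \<open>Points of the box have norm at most 2 r. The extra 1 makes the comparison with
      N e strict, which also forces N > 0.\<close>
    have "(2 * real r + 1) / e \<le> real N" using N by linarith
    then have Ne: "2 * real r < real N * e" using e by (simp add: pos_divide_le_eq)
    then have N0: "real N > 0" using e by (metis le_less_trans mult_nonneg_nonneg of_nat_0_le_iff zero_le_numeral zero_less_mult_pos2)
    have "norm (lat k) \<le> \<bar>real_of_int (fst k)\<bar> + \<bar>real_of_int (snd k)\<bar>"
      unfolding lat_def using norm_Pair_le[of "real_of_int (fst k)" "real_of_int (snd k)"] by simp
    also have "\<dots> \<le> real r + real r" using k by (cases k) (auto simp: lat_box_def)
    also have "\<dots> < real N * e" using Ne by simp
    finally have "norm ((1 / real N) *\<^sub>R lat k) < e" using N0 by (simp add: pos_divide_less_eq mult.commute)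
    then have "(1 / real N) *\<^sub>R lat k \<in> ball 0 e" by (simp only: mem_ball_0)
    then have "(1 / real N) *\<^sub>R lat k \<in> \<Lambda>" using e(2) by (rule set_mp[rotated])
    then show "k \<in> (lat_pts N \<Lambda>)" unfolding dilate_def
      using N0 by (auto intro!: image_eqI[of _ _ "(1 / real N) *\<^sub>R lat k"])
  qed
qed

lemma chaos_const_eq:
  assumes "n \<ge> 1" shows "chaos_const n = fact n / (4 * pi\<^sup>2) ^ (n - 1)"
  using assms by (cases n) (auto simp: chaos_const_def)

lemma conv_lim_H_bound:
  assumes g: "\<And>A. finite A \<Longrightarrow> (\<Sum>k\<in>A. w k) \<le> W" and w: "\<And>k. 0 \<le> w k"
  shows "conv_lim n w \<le> W * lat_const * fact n * pi ^ (n - 1)"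
proof (rule conv_lim_le)
  fix F :: "(int \<times> int) set" assume F: "finite F"
  show "conv_sum n F w \<le> W * lat_const * fact n * pi ^ (n - 1)"
  proof (cases "n = 0")
    case True
    have W: "w 0 \<le> W" using g[of "{0}"] by simp
    also have "\<dots> \<le> W * lat_const"
    proof -
      have "0 \<le> (5 + 3 * pi) / pi" by (intro divide_nonneg_nonneg add_nonneg_nonneg) auto
      then have "1 \<le> lat_const" by (rule one_le_exp_iff[THEN iffD2])
      moreover have "0 \<le> W" using W w[of 0] by linarith
      ultimately show ?thesis using mult_left_mono[of 1 "lat_const" W] by simp
    qed
    finally show ?thesis using True by (simp add: conv_sum_0)
  next
    case False
    then show ?thesis using F w g by (intro conv_sum_summable_bound) auto
  qed
qed

context free_field_measure
begin

section \<open>The limit as a dual pairing\<close>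

lemma H_inner_Phi_trunc:
  assumes g: "g \<in> H_space" and A: "finite A" and F: "finite F"
  shows "H_inner (Phi n F z) (trunc A g) = H_inner (Phi n F z) g - (\<Sum>k\<in>A. fourier_coeffs g k * H_inner (Phi n F z) (e_basis k))"
proof -
  note P = Phi_H_space[OF F, of n z]
  have eq: "Phi n F z x = (\<Sum>\<nu>\<in>multi_idx F n. chaos_coeff n F (field_coeff F x) \<nu> * hermite_prod F \<nu> z)" for x
    by (rule Phi_chaos_expansion) (use F in auto)
  have bd: "\<bar>Phi n F z x\<bar> \<le> (\<Sum>\<nu>\<in>multi_idx F n. fact n * \<bar>hermite_prod F \<nu> z\<bar>)" for x
    unfolding eq by (intro order_trans[OF sum_abs] sum_mono) (simp add: abs_mult chaos_coeff_bound mult_right_mono)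
  have ig: "integrable torus (\<lambda>x. Phi n F z x * f x)" if "f \<in> H_space" for f
    by (rule integrable_bounded_mult[OF that H_space_integrable(1)[OF P] bd])
  have "H_inner (Phi n F z) (trunc A g) = (LINT x|torus. Phi n F z x * g x - (\<Sum>k\<in>A. fourier_coeffs g k * (Phi n F z x * e_basis k x)))"
    unfolding H_inner_def trunc_def by (simp add: right_diff_distrib sum_distrib_left mult_ac)
  also have "\<dots> = H_inner (Phi n F z) g - (\<Sum>k\<in>A. fourier_coeffs g k * H_inner (Phi n F z) (e_basis k))"
    unfolding H_inner_def
    by (subst Bochner_Integration.integral_diff) (use ig[OF g] ig[OF e_basis_H] in \<open>auto simp: Bochner_Integration.integral_sum\<close>)
  finally show ?thesis .
qed

text \<open>The separately chosen versions are linear in \<open>g\<close> only up to null sets, so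
  linearity is taken from the approximations on boxes. Their errors vanish as \<open>r\<close> grows
  and leave the bound for the truncated function.\<close>

lemma Psi_trunc_Lp_bounded:
  assumes g: "g \<in> H_space" and A: "finite A"
  shows "Lp_bounded M 2 (\<lambda>z. Psi n g z - (\<Sum>k\<in>A. fourier_coeffs g k * wick_raw n z k))
     (sqrt (chaos_const n * conv_lim n (wsq (trunc A g))))"
proof -
  define E where "E h r = tail_err (2::real) n (wsq h) r" for h r
  note tg = trunc_facts(1)[OF g A]
  have EB: "Lp_bounded M 2 (\<lambda>z. H_inner (Phi n (lat_box r) z) h - Psi n h z) (E h r)" if "h \<in> H_space" for h r
    unfolding E_def by (rule Phi_Psi_Lp_bounded[OF that order_refl sym_set_box order_refl])
  have Elim: "E h \<longlonglongrightarrow> 0" if "h \<in> H_space" for h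
    unfolding E_def[abs_def] by (rule err_tendsto[OF conv_bdd_H[OF that]])
  define D where "D z = Psi n g z - (\<Sum>k\<in>A. fourier_coeffs g k * wick_raw n z k)" for z
  define b where "b = sqrt (chaos_const n * conv_lim n (wsq (trunc A g)))"
  have [measurable]: "D \<in> borel_measurable M"
    unfolding D_def[abs_def] using Psi_measurable[OF g] by measurable
  have "Lp_bounded M 2 D (b + (E g r + (\<Sum>k\<in>A. \<bar>fourier_coeffs g k\<bar> * E (e_basis k) r)))" for r
  proof -
    let ?P = "\<lambda>h z. H_inner (Phi n (lat_box r) z) h"
    have 1: "Lp_bounded M 2 (?P (trunc A g)) b"
    proof (rule Lp_bounded_mono)
      show "Lp_bounded M 2 (?P (trunc A g)) ((2 - 1) powr (real n / 2) * sqrt (chaos_const n * conv_sum n (lat_box r) (wsq (trunc A g))))"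
        by (rule Phi_Lp_bounded[OF sym_set_box tg order_refl])
      show "(2 - 1) powr (real n / 2) * sqrt (chaos_const n * conv_sum n (lat_box r) (wsq (trunc A g))) \<le> b"
        unfolding b_def using conv_lim_upper[OF conv_bdd_H[OF tg] finite_box] chaos_const_pos[of n] by simp
    qed simp
    have 2: "Lp_bounded M 2 (\<lambda>z. (- 1) * (?P g z - Psi n g z)) (\<bar>- 1\<bar> * E g r)"
      by (rule Lp_bounded_scale[OF EB[OF g]])
    have 3: "Lp_bounded M 2 (\<lambda>z. \<Sum>k\<in>A. fourier_coeffs g k * (?P (e_basis k) z - Psi n (e_basis k) z)) (\<Sum>k\<in>A. \<bar>fourier_coeffs g k\<bar> * E (e_basis k) r)"
      using A by (intro Lp_bounded_sum Lp_bounded_scale EB e_basis_H) auto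
    have "Lp_bounded M 2 (\<lambda>z. ?P (trunc A g) z + ((- 1) * (?P g z - Psi n g z) + (\<Sum>k\<in>A. fourier_coeffs g k * (?P (e_basis k) z - Psi n (e_basis k) z))))
       (b + (\<bar>- 1\<bar> * E g r + (\<Sum>k\<in>A. \<bar>fourier_coeffs g k\<bar> * E (e_basis k) r)))"
      by (intro Lp_bounded_add 1 2 3) auto
    moreover have "?P (trunc A g) z + ((- 1) * (?P g z - Psi n g z) + (\<Sum>k\<in>A. fourier_coeffs g k * (?P (e_basis k) z - Psi n (e_basis k) z))) = D z" for z
      unfolding H_inner_Phi_trunc[OF g A finite_box] D_def wick_raw_def
      by (simp add: right_diff_distrib sum_subtractf)
    ultimately show ?thesis by simp
  qed
  moreover have "(\<lambda>r. b + (E g r + (\<Sum>k\<in>A. \<bar>fourier_coeffs g k\<bar> * E (e_basis k) r))) \<longlonglongrightarrow> b + (0 + (\<Sum>k\<in>A. \<bar>fourier_coeffs g k\<bar> * 0))"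
    by (intro tendsto_add tendsto_sum tendsto_mult tendsto_const Elim g e_basis_H)
  ultimately have "Lp_bounded M 2 D (b + (0 + (\<Sum>k\<in>A. \<bar>fourier_coeffs g k\<bar> * 0)))"
    by (rule Lp_bounded_Fatou) auto
  then show ?thesis by (simp add: D_def[abs_def] b_def)
qed

lemma sums_dual_pairing:
  assumes u: "u \<in> sobolev (- \<alpha>)" and v: "v \<in> sobolev \<alpha>"
  shows "(\<lambda>i. v (lat_enum i) * u (lat_enum i)) sums dual_pairing u v"
proof -
  have pos: "japanese k powr (- \<alpha>) * japanese k powr \<alpha> = 1" for k
    using japanese_pos[of k] by (simp flip: powr_add)
  have le: "norm (u k * v k) \<le> japanese k powr (- \<alpha>) * (u k)\<^sup>2 + japanese k powr \<alpha> * (v k)\<^sup>2" for k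
  proof -
    define a b where "a = sqrt (japanese k powr (- \<alpha>)) * \<bar>u k\<bar>" and "b = sqrt (japanese k powr \<alpha>) * \<bar>v k\<bar>"
    have "a * b = (sqrt (japanese k powr (- \<alpha>)) * sqrt (japanese k powr \<alpha>)) * (\<bar>u k\<bar> * \<bar>v k\<bar>)"
      by (simp add: a_def b_def)
    also have "\<dots> = \<bar>u k\<bar> * \<bar>v k\<bar>" unfolding real_sqrt_mult[symmetric] pos by simp
    finally have ab: "a * b = norm (u k * v k)" by (simp add: abs_mult)
    have "0 \<le> (a - b)\<^sup>2" "0 \<le> a * b" by (auto simp: a_def b_def)
    then have "a * b \<le> a\<^sup>2 + b\<^sup>2" by (simp add: power2_eq_square algebra_simps)
    then show ?thesis unfolding ab by (simp add: a_def b_def power_mult_distrib)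
  qed
  have "(\<lambda>k. japanese k powr (- \<alpha>) * (u k)\<^sup>2 + japanese k powr \<alpha> * (v k)\<^sup>2) summable_on UNIV"
    using u v by (intro summable_on_add) (auto simp: sobolev_def japanese_def)
  then have "(\<lambda>k. norm (u k * v k)) summable_on UNIV"
    by (rule summable_on_comparison_test) (use le in auto)
  then have "(\<lambda>k. u k * v k) summable_on UNIV" by (rule abs_summable_summable)
  then have "((\<lambda>k. u k * v k) has_sum dual_pairing u v) UNIV" unfolding dual_pairing_def by simp
  then have "((\<lambda>i. u (lat_enum i) * v (lat_enum i)) has_sum dual_pairing u v) UNIV"
    using has_sum_reindex_bij_betw[OF bij_lat_enum, of "\<lambda>k. u k * v k"] by simp
  then show ?thesis using has_sum_imp_sums by (simp add: mult.commute)
qed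

text \<open>By \<open>Psi_trunc_Lp_bounded\<close> the partial sums over modes approach
  \<open>Psi n g\<close> in L^2, with an error governed by the tail of the squared coefficients.
  Almost everywhere they also converge to the pairing, since both factors lie in dual Sobolev
  spaces. Fatou with limiting bound 0 identifies the two limits.\<close>

lemma AE_Psi_dual_pairing:
  assumes g: "g \<in> H_space" and \<alpha>: "\<alpha> > 0" and gs: "fourier_coeffs g \<in> sobolev \<alpha>"
  shows "AE z in M. Psi n g z = dual_pairing (wick_power n z) (fourier_coeffs g)"
proof -
  let ?c = "fourier_coeffs g"
  define f where "f k = (?c k)\<^sup>2" for k
  have f0: "0 \<le> f k" for k by (simp add: f_def)
  have fs: "f summable_on UNIV"
    by (rule nonneg_bdd_above_summable_on) (use Bessel[OF g] in \<open>auto simp: f_def intro!: bdd_aboveI2\<close>)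
  define T where "T = infsum f UNIV"
  have fT: "(\<Sum>k\<in>A. f k) \<le> T" if "finite A" for A
    unfolding T_def using that f0 by (intro finite_sum_le_infsum fs) auto
  define A where "A j = lat_enum ` {..<j}" for j :: nat
  have inj: "inj_on lat_enum X" for X using bij_lat_enum by (meson bij_betw_def inj_on_subset subset_UNIV)
  have finA: "finite (A j)" for j by (simp add: A_def)
  have sumA: "(\<Sum>k\<in>A j. h k) = (\<Sum>i<j. h (lat_enum i))" for h :: "int \<times> int \<Rightarrow> real" and j
    unfolding A_def by (simp add: sum.reindex[OF inj])
  have "(\<lambda>i. f (lat_enum i)) sums T"
    using has_sum_reindex_bij_betw[OF bij_lat_enum, of f T] fs unfolding T_def by (intro has_sum_imp_sums) simp
  then have limT: "(\<lambda>j. T - (\<Sum>k\<in>A j. f k)) \<longlonglongrightarrow> T - T"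
    unfolding sumA sums_def by (intro tendsto_diff tendsto_const)
  define C where "C = lat_const * fact n * pi ^ (n - 1)"
  have C0: "C \<ge> 0" by (simp add: C_def)
  have bd: "Lp_bounded M 2 (\<lambda>z. Psi n g z - (\<Sum>k\<in>A j. ?c k * wick_raw n z k)) (sqrt (chaos_const n * ((T - (\<Sum>k\<in>A j. f k)) * C)))" for j
  proof (rule Lp_bounded_mono[OF Psi_trunc_Lp_bounded[OF g finA]])
    have "conv_lim n (wsq (trunc (A j) g)) \<le> (T - (\<Sum>k\<in>A j. f k)) * lat_const * fact n * pi ^ (n - 1)"
    proof (rule conv_lim_H_bound)
      fix B :: "(int \<times> int) set" assume B: "finite B"
      have "(\<Sum>k\<in>B. (fourier_coeffs (trunc (A j) g) k)\<^sup>2) = (\<Sum>k\<in>B - A j. f k)"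
        unfolding trunc_facts(2)[OF g finA] f_def using B
        by (intro sum.mono_neutral_cong_right) auto
      also have "\<dots> = (\<Sum>k\<in>(B - A j) \<union> A j. f k) - (\<Sum>k\<in>A j. f k)"
        using B finA by (subst sum.union_disjoint) auto
      also have "\<dots> \<le> T - (\<Sum>k\<in>A j. f k)" using B finA fT[of "(B - A j) \<union> A j"] by simp
      finally show "(\<Sum>k\<in>B. (fourier_coeffs (trunc (A j) g) k)\<^sup>2) \<le> T - (\<Sum>k\<in>A j. f k)" .
    qed simp
    then show "sqrt (chaos_const n * conv_lim n (wsq (trunc (A j) g))) \<le> sqrt (chaos_const n * ((T - (\<Sum>k\<in>A j. f k)) * C))"
      using chaos_const_pos[of n] by (simp add: C_def mult.assoc)
  qed simp
  have blim: "(\<lambda>j. sqrt (chaos_const n * ((T - (\<Sum>k\<in>A j. f k)) * C))) \<longlonglongrightarrow> sqrt (chaos_const n * ((T - T) * C))"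
    by (intro tendsto_real_sqrt tendsto_mult tendsto_const limT)
  \<comment> \<open>The pairing as a pointwise limit, in a form whose measurability is
    immediate.\<close>
  define Y where "Y z = lim (\<lambda>j. \<Sum>k\<in>A j. ?c k * wick_raw n z k)" for z
  have [measurable]: "Y \<in> borel_measurable M" unfolding Y_def[abs_def] by measurable
  have conv: "AE z in M. (\<lambda>j. \<Sum>k\<in>A j. ?c k * wick_raw n z k) \<longlonglongrightarrow> dual_pairing (wick_raw n z) ?c"
    using AE_wick_raw_sobolev[OF \<alpha>, of n]
  proof eventually_elim
    case (elim z)
    then show ?case unfolding sumA using sums_dual_pairing[OF elim gs] by (simp add: sums_def)
  qed
  have "Lp_bounded M 2 (\<lambda>z. Psi n g z - Y z) (sqrt (chaos_const n * ((T - T) * C)))"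
  proof (rule Lp_bounded_Fatou[OF bd blim])
    show "AE z in M. (\<lambda>j. Psi n g z - (\<Sum>k\<in>A j. ?c k * wick_raw n z k)) \<longlonglongrightarrow> Psi n g z - Y z"
      using conv
    proof eventually_elim
      case (elim z)
      have "Y z = dual_pairing (wick_raw n z) ?c" unfolding Y_def by (rule limI[OF elim])
      then show ?case using tendsto_diff[OF tendsto_const elim] by simp
    qed
    show "(\<lambda>z. Psi n g z - Y z) \<in> borel_measurable M" using Psi_measurable[OF g] by measurable
  qed simp
  then have "AE z in M. Psi n g z - Y z = 0" by (intro Lp_bounded_0_AE[of _ 2]) auto
  then show ?thesis using conv AE_wick_power[of n]
  proof eventually_elim
    case (elim z)
    have "Y z = dual_pairing (wick_raw n z) ?c" unfolding Y_def by (rule limI[OF elim(2)])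
    then show ?case using elim(1,3) by simp
  qed
qed

section \<open>Membership in the Wiener chaos\<close>

lemma Phi_eq_hermite:
  assumes F: "sym_set F" and \<rho>: "\<rho> = sqrt ((\<Sum>k\<in>F. 1 / japanese k) / (4 * pi\<^sup>2))"
  shows "\<rho> > 0" and "Phi n F z y = sqrt (fact n) * \<rho> ^ n * hermite n ((\<Sum>k\<in>F. z k * e_basis k y) / \<rho>)"
proof -
  have q: "(\<Sum>k\<in>F. 1 / japanese k) > 0"
  proof (rule sum_pos)
    show "F \<noteq> {}" using sym_setD(3)[OF F] by blast
  qed (use sym_setD(1)[OF F] japanese_pos in auto)
  then show p: "\<rho> > 0" by (simp add: \<rho>)
  have "\<rho>\<^sup>2 = (\<Sum>k\<in>F. (e_basis k y)\<^sup>2 / japanese k)"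
    unfolding variance_e_basis[OF F] using q by (simp add: \<rho>)
  then show "Phi n F z y = sqrt (fact n) * \<rho> ^ n * hermite n ((\<Sum>k\<in>F. z k * e_basis k y) / \<rho>)"
    unfolding wick_hermite[OF p] Phi_def by simp
qed

text \<open>The normalised field at a point is the pairing with a finitely supported
  \<open>f\<close>; dividing by \<rho> gives it norm 1 in H^(-1). As \<open>f\<close> lies in every
  Sobolev space, the constant sequence \<open>f\<close> approximates itself.\<close>

lemma is_W_field:
  assumes F: "sym_set F" and \<rho>: "\<rho> = sqrt ((\<Sum>k\<in>F. 1 / japanese k) / (4 * pi\<^sup>2))"
  shows "\<exists>f. sobolev_norm (- 1) f = 1 \<and> is_W \<delta> M f (\<lambda>z. (\<Sum>k\<in>F. z k * e_basis k y) / \<rho>)"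
proof -
  note p = Phi_eq_hermite(1)[OF F \<rho>]
  have fin: "finite F" using sym_setD[OF F] by simp
  define f where "f k = (if k \<in> F then e_basis k y / \<rho> else 0)" for k
  have fs: "f \<in> sobolev s" for s by (rule finite_support_sobolev(1)[OF fin]) (simp add: f_def)
  have "sobolev_norm (- 1) f = sqrt (\<Sum>k\<in>F. japanese k powr (- 1) * (f k)\<^sup>2)"
    by (rule finite_support_sobolev(2)[OF fin]) (simp add: f_def)
  also have "(\<Sum>k\<in>F. japanese k powr (- 1) * (f k)\<^sup>2) = (\<Sum>k\<in>F. (e_basis k y)\<^sup>2 / japanese k) / \<rho>\<^sup>2"
    unfolding sum_divide_distrib
  proof (intro sum.cong refl)
    fix k assume "k \<in> F"
    then show "japanese k powr (- 1) * (f k)\<^sup>2 = (e_basis k y)\<^sup>2 / japanese k / \<rho>\<^sup>2"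
      using japanese_pos[of k] by (simp add: f_def powr_minus_divide power_divide mult.commute)
  qed
  also have "\<dots> = 1"
  proof -
    have "(\<Sum>k\<in>F. 1 / japanese k) / (4 * pi\<^sup>2) > 0" using p unfolding \<rho> real_sqrt_gt_0_iff .
    moreover have "t / (sqrt t)\<^sup>2 = 1" if "t > 0" for t :: real using that by simp
    ultimately show ?thesis unfolding variance_e_basis[OF F] \<rho> by blast
  qed
  finally have n1: "sobolev_norm (- 1) f = 1" by simp
  have dp: "dual_pairing z f = (\<Sum>k\<in>F. z k * e_basis k y) / \<rho>" for z
    unfolding sum_divide_distrib
    by (subst dual_pairing_finite[OF fin]) (auto simp: f_def intro!: sum.cong)
  \<comment> \<open>The Wick power of degree 1 is the field itself, so the chaos bound yields its
    square integrability.\<close>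
  have L: "Lp_bounded M 2 (\<lambda>z. Phi 1 F z y) ((2 - 1) powr (real 1 / 2) * sqrt (\<Sum>\<nu>\<in>PiE F (\<lambda>_. {..1}). (chaos_coeff 1 F (field_coeff F y) \<nu>)\<^sup>2))"
    unfolding Phi_chaos_expansion[OF fin order_refl]
    by (rule Lp_bounded_white_chaos[OF fin order_refl]) (simp add: chaos_coeff_def)
  have "(\<lambda>z. (\<Sum>k\<in>F. z k * e_basis k y) / \<rho>) \<in> Lp_space M 2"
    using Lp_bounded_imp(1)[OF Lp_bounded_scale[OF L, of "1 / \<rho>"]] by (simp add: Phi_def)
  then have "is_W \<delta> M f (\<lambda>z. (\<Sum>k\<in>F. z k * e_basis k y) / \<rho>)"
    unfolding is_W_def
    by (intro conjI exI[of _ "\<lambda>_. f"]) (auto simp: fs dp sobolev_dist_def sobolev_norm_def Lp_norm_def)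
  then show ?thesis using n1 by blast
qed

text \<open>The pairing with \<open>g\<close> is an integral over points y of Hermite polynomials in
  the normalised field at y. Simple functions approximating the identity of the torus replace it by
  finite sums over points, which lie in the span. Convergence is checked on the finitely many chaos
  coefficients, by dominated convergence.\<close>

lemma Phi_chaos_approx:
  assumes F: "sym_set F" and g: "g \<in> H_space" and \<eta>: "\<eta> > 0"
  shows "\<exists>G\<in>chaos_span \<delta> M n. \<exists>B<\<eta>. Lp_bounded M 2 (\<lambda>z. H_inner (Phi n F z) g - G z) B"
proof -
  have fin: "finite F" using sym_setD[OF F] by simp
  define \<rho> where "\<rho> = sqrt ((\<Sum>k\<in>F. 1 / japanese k) / (4 * pi\<^sup>2))"
  note gi = H_space_integrable[OF g]
  note [measurable] = gi(1)
  let ?P = "multi_idx F n"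
  let ?cc = "\<lambda>x \<nu>. chaos_coeff n F (field_coeff F x) \<nu>"
  have "(\<lambda>x. x) \<in> borel_measurable torus" by (rule sets_torus_measurable) simp
  from borel_measurable_implies_sequence_metric[OF this, of 0]
  obtain s where s: "\<And>i. simple_function torus (s i)" "\<And>x. x \<in> space torus \<Longrightarrow> (\<lambda>i. s i x) \<longlonglongrightarrow> x" by blast
  have sm[measurable]: "s i \<in> measurable torus (count_space UNIV)" for i
    by (rule measurable_simple_function[OF s(1)])
  have cont: "(\<lambda>i. ?cc (s i x) \<nu>) \<longlonglongrightarrow> ?cc x \<nu>" if "x \<in> space torus" for x \<nu>
  proof -
    have e: "(\<lambda>i. e_basis k (s i x)) \<longlonglongrightarrow> e_basis k x" for k
      unfolding e_basis_cos by (intro tendsto_intros s(2) that)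
    have "(\<lambda>i. field_coeff F (s i x) k) \<longlonglongrightarrow> field_coeff F x k" for k
      unfolding field_coeff_def using japanese_pos[of k] by (auto intro!: tendsto_intros e)
    then show ?thesis unfolding chaos_coeff_def by (auto intro!: tendsto_intros)
  qed
  have ccm[measurable]: "(\<lambda>x. ?cc (s i x) \<nu>) \<in> borel_measurable torus" for i \<nu>
    by (rule measurable_compose[OF sm]) simp
  define a where "a i \<nu> = (LINT x|torus. ?cc (s i x) \<nu> * g x)" for i \<nu>
  have int: "integrable torus (\<lambda>x. ?cc (s i x) \<nu> * g x)" for i \<nu>
    by (rule integrable_bounded_mult[OF g ccm chaos_coeff_bound])
  have alim: "(\<lambda>i. a i \<nu>) \<longlonglongrightarrow> Phi_coeff n F F g \<nu>" for \<nu>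
    unfolding a_def Phi_coeff_def
  proof (rule integral_dominated_convergence[where w = "\<lambda>x. fact n * \<bar>g x\<bar>"])
    show "integrable torus (\<lambda>x. fact n * \<bar>g x\<bar>)" using gi(3) by simp
    show "AE x in torus. (\<lambda>i. ?cc (s i x) \<nu> * g x) \<longlonglongrightarrow> ?cc x \<nu> * g x"
      by (intro AE_I2 tendsto_mult tendsto_const cont)
    show "AE x in torus. norm (?cc (s i x) \<nu> * g x) \<le> fact n * \<bar>g x\<bar>" for i
      using chaos_coeff_bound by (intro AE_I2) (simp add: abs_mult mult_right_mono)
  qed measurable
  define G where "G i z = (\<Sum>\<nu>\<in>?P. a i \<nu> * hermite_prod F \<nu> z)" for i z
  have bd: "Lp_bounded M 2 (\<lambda>z. H_inner (Phi n F z) g - G i z) (sqrt (\<Sum>\<nu>\<in>?P. (Phi_coeff n F F g \<nu> - a i \<nu>)\<^sup>2))" for i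
  proof -
    have "Lp_bounded M 2 (\<lambda>z. \<Sum>\<nu>\<in>?P. (Phi_coeff n F F g \<nu> - a i \<nu>) * hermite_prod F \<nu> z)
      ((2 - 1) powr (real n / 2) * sqrt (\<Sum>\<nu>\<in>?P. (Phi_coeff n F F g \<nu> - a i \<nu>)\<^sup>2))"
    proof (rule Lp_bounded_white_chaos[OF fin order_refl])
      show "Phi_coeff n F F g \<nu> - a i \<nu> = 0" if "(\<Sum>k\<in>F. \<nu> k) \<noteq> n" for \<nu>
        using that by (simp add: Phi_coeff_0 a_def chaos_coeff_def)
    qed
    then show ?thesis
      by (simp add: H_inner_Phi[OF fin order_refl g] G_def sum_subtractf left_diff_distrib)
  qed
  have "(\<lambda>i. sqrt (\<Sum>\<nu>\<in>?P. (Phi_coeff n F F g \<nu> - a i \<nu>)\<^sup>2)) \<longlonglongrightarrow> sqrt (\<Sum>\<nu>\<in>?P. (Phi_coeff n F F g \<nu> - Phi_coeff n F F g \<nu>)\<^sup>2)"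
    by (intro tendsto_real_sqrt tendsto_sum tendsto_power tendsto_diff tendsto_const alim)
  then have "(\<lambda>i. sqrt (\<Sum>\<nu>\<in>?P. (Phi_coeff n F F g \<nu> - a i \<nu>)\<^sup>2)) \<longlonglongrightarrow> 0" by simp
  then have "eventually (\<lambda>i. sqrt (\<Sum>\<nu>\<in>?P. (Phi_coeff n F F g \<nu> - a i \<nu>)\<^sup>2) < \<eta>) sequentially"
    using \<eta> by (rule order_tendstoD(2))
  then obtain i where i: "sqrt (\<Sum>\<nu>\<in>?P. (Phi_coeff n F F g \<nu> - a i \<nu>)\<^sup>2) < \<eta>"
    using eventually_happens' sequentially_bot by blast
  define S where "S = s i ` space torus"
  have S: "finite S" using simple_functionD(1)[OF s(1)] by (simp add: S_def)
  define b where "b y = (LINT x|torus. indicator {x. s i x = y} x * g x)" for y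
  have ind: "integrable torus (\<lambda>x. indicator {x. s i x = y} x * g x)" for y
  proof (rule integrable_bounded_mult[OF g, where B = 1])
    have "(\<lambda>x. indicator {y} (s i x) :: real) \<in> borel_measurable torus" by (rule measurable_compose[OF sm]) simp
    then show "(\<lambda>x. indicator {x. s i x = y} x :: real) \<in> borel_measurable torus"
      by (simp add: indicator_def)
  qed (auto simp: indicator_def)
  have a_eq: "a i \<nu> = (\<Sum>y\<in>S. ?cc y \<nu> * b y)" for \<nu>
  proof -
    have "a i \<nu> = (LINT x|torus. (\<Sum>y\<in>S. ?cc y \<nu> * (indicator {x. s i x = y} x * g x)))"
      unfolding a_def
    proof (intro Bochner_Integration.integral_cong refl)
      fix x assume "x \<in> space torus"
      then have "s i x \<in> S" by (simp add: S_def)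
      then show "?cc (s i x) \<nu> * g x = (\<Sum>y\<in>S. ?cc y \<nu> * (indicator {x. s i x = y} x * g x))"
      proof -
        have "(\<Sum>y\<in>S. ?cc y \<nu> * (indicator {x. s i x = y} x * g x)) = (\<Sum>y\<in>{s i x}. ?cc y \<nu> * (indicator {x. s i x = y} x * g x))"
          using S \<open>s i x \<in> S\<close> by (intro sum.mono_neutral_right) (auto simp: indicator_def)
        then show ?thesis by simp
      qed
    qed
    also have "\<dots> = (\<Sum>y\<in>S. ?cc y \<nu> * b y)"
      unfolding b_def by (subst Bochner_Integration.integral_sum) (use ind in auto)
    finally show ?thesis .
  qed
  have G_eq: "G i z = (\<Sum>y\<in>S. b y * Phi n F z y)" for z
  proof -
    have "G i z = (\<Sum>\<nu>\<in>?P. \<Sum>y\<in>S. b y * (?cc y \<nu> * hermite_prod F \<nu> z))"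
      unfolding G_def a_eq sum_distrib_right by (simp add: mult_ac)
    also have "\<dots> = (\<Sum>y\<in>S. b y * Phi n F z y)"
      unfolding Phi_chaos_expansion[OF fin order_refl] sum_distrib_left by (rule sum.swap)
    finally show ?thesis .
  qed
  obtain h m where h: "bij_betw h {..<m::nat} S" using ex_bij_betw_nat_finite[OF S] by (auto simp: atLeast0LessThan)
  have "G i = (\<lambda>z. \<Sum>j<m. (b (h j) * (sqrt (fact n) * \<rho> ^ n)) * hermite n ((\<lambda>z. (\<Sum>k\<in>F. z k * e_basis k (h j)) / \<rho>) z))"
  proof
    fix z
    have "G i z = (\<Sum>j<m. b (h j) * Phi n F z (h j))"
      unfolding G_eq using sum.reindex_bij_betw[OF h, of "\<lambda>y. b y * Phi n F z y"] by simp
    then show "G i z = (\<Sum>j<m. (b (h j) * (sqrt (fact n) * \<rho> ^ n)) * hermite n ((\<lambda>z. (\<Sum>k\<in>F. z k * e_basis k (h j)) / \<rho>) z))"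
      unfolding Phi_eq_hermite(2)[OF F \<rho>_def] by (simp add: mult.assoc)
  qed
  then have "G i \<in> chaos_span \<delta> M n"
    unfolding chaos_span_def mem_Collect_eq
    by (intro exI[of _ m] exI[of _ "\<lambda>j. b (h j) * (sqrt (fact n) * \<rho> ^ n)"] exI[of _ "\<lambda>j z. (\<Sum>k\<in>F. z k * e_basis k (h j)) / \<rho>"] conjI allI impI is_W_field[OF F \<rho>_def])
  then show ?thesis using bd[of i] i by blast
qed

lemma Psi_chaos:
  assumes g: "g \<in> H_space" shows "Psi n g \<in> chaos \<delta> M n"
proof (cases "n = 0")
  case True
  note lim = Psi_limit[OF g, of n]
  have "H_inner (Phi 0 F z) g = (LINT x|torus. g x)" for F z by (simp add: H_inner_def Phi_def)
  note c = this
  have "AE z in M. Psi n g z = (LINT x|torus. g x)"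
    using lim(3) unfolding True
  proof eventually_elim
    case (elim z)
    then show ?case unfolding c by (simp add: LIMSEQ_const_iff)
  qed
  then show ?thesis using True lim(1) by (auto simp: chaos_def)
next
  case False
  have "\<exists>G\<in>chaos_span \<delta> M n. Lp_norm M 2 (\<lambda>z. Psi n g z - G z) < \<eta>" if \<eta>: "\<eta> > 0" for \<eta>
  proof -
    define E where "E r = tail_err (2::real) n (wsq g) r" for r
    have "E \<longlonglongrightarrow> 0" unfolding E_def[abs_def] by (rule err_tendsto[OF conv_bdd_H[OF g]])
    then have "eventually (\<lambda>r. E r < \<eta> / 2) sequentially" using \<eta> by (intro order_tendstoD(2)) auto
    then obtain r where r: "E r < \<eta> / 2" using eventually_happens' sequentially_bot by blast
    have 1: "Lp_bounded M 2 (\<lambda>z. H_inner (Phi n (lat_box r) z) g - Psi n g z) (E r)"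
      unfolding E_def by (rule Phi_Psi_Lp_bounded[OF g order_refl sym_set_box order_refl])
    obtain G B where G: "G \<in> chaos_span \<delta> M n" "B < \<eta> / 2" "Lp_bounded M 2 (\<lambda>z. H_inner (Phi n (lat_box r) z) g - G z) B"
      using Phi_chaos_approx[OF sym_set_box g, of "\<eta> / 2" n r] \<eta> by auto
    have "Lp_bounded M 2 (\<lambda>z. (- 1) * (H_inner (Phi n (lat_box r) z) g - Psi n g z) + (H_inner (Phi n (lat_box r) z) g - G z)) (\<bar>- 1\<bar> * E r + B)"
      by (intro Lp_bounded_add Lp_bounded_scale 1 G) simp
    then have "Lp_bounded M 2 (\<lambda>z. Psi n g z - G z) (E r + B)" by simp
    then have "Lp_norm M 2 (\<lambda>z. Psi n g z - G z) \<le> E r + B" by (rule Lp_bounded_imp) simp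
    then show ?thesis using r G(1,2) by (intro bexI[of _ G]) auto
  qed
  moreover have "Psi n g \<in> Lp_space M 2" by (rule Lp_bounded_imp(1)[OF Psi_Lp_bounded[OF g order_refl]]) simp
  ultimately show ?thesis using False by (simp add: chaos_def)
qed

end

section \<open>The estimates\<close>

context free_field_measure
begin

lemma LpS_of_bounded:
  assumes "\<And>z. F z \<in> sobolev s" "\<And>k. (\<lambda>z. F z k) \<in> borel_measurable M"
    and L: "Lp_bounded M p (\<lambda>z. sobolev_norm s (F z)) S" "p > 0"
  shows "F \<in> LpS_space M p s"
proof -
  have "integrable M (\<lambda>z. \<bar>sobolev_norm s (F z)\<bar> powr p)"
    using Lp_bounded_imp(1)[OF L] by (simp add: Lp_space_def)
  then have "integrable M (\<lambda>z. sobolev_norm s (F z) powr p)" by (simp add: sobolev_norm_nonneg)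
  moreover have "F \<in> measurable M (sobolev_borel s)" by (rule measurable_sobolevI) (use assms in auto)
  ultimately show ?thesis by (simp add: LpS_space_def)
qed

lemma Lp_bounded_max2:
  assumes "Lp_bounded M (max p 2) X B" "1 \<le> p" shows "Lp_bounded M p X B"
proof (cases "p \<le> 2")
  case True
  then have "max p 2 = 2" by simp
  then have "Lp_bounded M 2 X B" using assms(1) by (simp only:)
  then show ?thesis by (rule Lp_bounded_le2[OF prob_space_axioms]) (use True assms(2) in auto)
next
  case False
  then have "max p 2 = p" by simp
  then show ?thesis using assms(1) by (simp only:)
qed

lemma Phi_LpS:
  assumes F: "sym_set F" and p: "1 \<le> p" and \<alpha>: "\<alpha> > 0"
  shows "(\<lambda>z. fourier_coeffs (Phi n F z)) \<in> LpS_space M p (- \<alpha>)"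
proof -
  let ?q = "max p 2"
  let ?u = "\<lambda>z. fourier_coeffs (Phi n F z)"
  \<comment> \<open>Box 0 is {0}, so it lies in every symmetric set and the comparison with the
    limit is available at r = 0.\<close>
  have fin: "finite F" and box: "lat_box 0 \<subseteq> F" using sym_setD[OF F] by (auto simp: lat_box_def zero_prod_def)
  have q: "2 \<le> ?q" by simp
  have us: "?u z \<in> sobolev (- \<alpha>)" for z by (rule Phi_coeffs_sobolev[OF fin \<alpha>])
  note um[measurable] = Phi_coeffs_measurable[OF F, of n]
  have "Lp_bounded M ?q (\<lambda>z. sobolev_norm (- \<alpha>) (?u z))
     (sob_err n ?q \<alpha> 0 + (?q - 1) powr (real n / 2) * sqrt (chaos_const n * conv_lim n (sobolev_wt \<alpha>)))"
  proof (rule Lp_bounded_dominated[OF Lp_bounded_add[OF _ sobolev_Phi_wick_power[OF F box q \<alpha>] sobolev_wick_power[OF q \<alpha>]]])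
    fix z
    have "sobolev_norm (- \<alpha>) (\<lambda>k. (?u z k - wick_power n z k) + wick_power n z k) \<le> sobolev_norm (- \<alpha>) (\<lambda>k. ?u z k - wick_power n z k) + sobolev_norm (- \<alpha>) (wick_power n z)"
      by (intro sobolev_add(2) sobolev_diff us wick_power_sobolev \<alpha>)
    then show "\<bar>sobolev_norm (- \<alpha>) (?u z)\<bar> \<le> \<bar>sobolev_norm (- \<alpha>) (\<lambda>k. ?u z k - wick_power n z k) + sobolev_norm (- \<alpha>) (wick_power n z)\<bar>"
      by (simp add: sobolev_norm_nonneg)
  qed (use q in auto)
  from Lp_bounded_max2[OF this p] show ?thesis
    by (rule LpS_of_bounded[OF us um]) (use p in simp)
qed

lemma sob_err_eventually:
  assumes \<alpha>: "\<alpha> > 0" and adm: "admissible \<Lambda>" and \<eta>: "\<eta> > 0"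
  obtains r where "sob_err n q \<alpha> r < \<eta>" "eventually (\<lambda>N. lat_box r \<subseteq> (lat_pts N \<Lambda>)) sequentially"
proof -
  have "eventually (\<lambda>r. sob_err n q \<alpha> r < \<eta>) sequentially"
    by (rule order_tendstoD(2)[OF sob_err_tendsto[OF \<alpha>] \<eta>])
  then obtain r where "sob_err n q \<alpha> r < \<eta>" using eventually_happens' sequentially_bot by blast
  then show thesis using that admissible_lattice(2)[OF adm] by blast
qed

lemma LpS_norm_le:
  assumes "Lp_bounded M p (\<lambda>z. sobolev_norm s (F z)) B" "p > 0" shows "LpS_norm M p s F \<le> B"
  unfolding LpS_norm_def by (rule Lp_bounded_imp(2)[OF assms])

text \<open>\<open>C\<close> stands outside the root of the bound, hence \<open>C\<^sup>2\<close>
  has to dominate the lattice constant \<open>K\<close>. Fixing \<open>\<alpha>\<^sub>0\<close>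
  below 1 keeps \<open>K\<close> uniform in both n and \<alpha>.\<close>

lemma wick_power_norm_small:
  assumes n: "n \<ge> 1" and p: "2 \<le> p" and \<alpha>: "0 < \<alpha>" "\<alpha> \<le> \<alpha>\<^sub>0" "\<alpha>\<^sub>0 < 1" and \<epsilon>: "\<epsilon> > 0"
    and C: "C \<ge> 1 + 54 / (1 - \<alpha>\<^sub>0) * lat_const"
  shows "LpS_norm M p (- \<alpha>) (wick_power n) \<le> wick_bound C n p \<alpha> \<epsilon>"
proof -
  define K where "K = 54 / (1 - \<alpha>\<^sub>0) * lat_const"
  have K0: "K \<ge> 0" using \<alpha> by (simp add: K_def)
  have C1: "C \<ge> 1" "C \<ge> K" using C K0 by (auto simp: K_def)
  have "K \<le> C * 1" using C1 by simp
  also have "\<dots> \<le> C * C" using C1 by (intro mult_left_mono) auto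
  finally have KC: "K \<le> C\<^sup>2" by (simp add: power2_eq_square)
  let ?b = "\<lambda>k. japanese k powr (- \<alpha>)"
  have V: "conv_lim n ?b \<le> K * (1 / \<alpha>\<^sup>2) * fact n * (pi / \<alpha>) ^ (n - 1)"
  proof (rule conv_lim_le)
    fix F :: "(int \<times> int) set" assume "finite F"
    then have "conv_sum n F ?b \<le> 54 / (1 - \<alpha>) * lat_const * (1 / \<alpha>) * fact n * (pi / \<alpha>) ^ (n - 1)"
      using n \<alpha> by (intro conv_sum_sobolev_bound) auto
    also have "\<dots> \<le> K * (1 / \<alpha>\<^sup>2) * fact n * (pi / \<alpha>) ^ (n - 1)"
    proof -
      have "54 / (1 - \<alpha>) \<le> 54 / (1 - \<alpha>\<^sub>0)" using \<alpha> by (intro divide_left_mono) auto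
      then have 1: "54 / (1 - \<alpha>) * lat_const \<le> K" unfolding K_def by (intro mult_right_mono) auto
      \<comment> \<open>As \<alpha> < 1, the factor 1 / \<alpha> of the lattice bound may be
        enlarged to the squared one in \<open>wick_bound\<close>.\<close>
      have "\<alpha>\<^sup>2 \<le> \<alpha>" using \<alpha> by (simp add: power2_eq_square mult_left_le)
      then have 2: "1 / \<alpha> \<le> 1 / \<alpha>\<^sup>2" using \<alpha> by (intro divide_left_mono) auto
      show ?thesis using \<alpha> K0 by (intro mult_right_mono mult_mono 1 2) auto
    qed
    finally show "conv_sum n F ?b \<le> K * (1 / \<alpha>\<^sup>2) * fact n * (pi / \<alpha>) ^ (n - 1)" .
  qed
  have eq: "chaos_const n * (K * (1 / \<alpha>\<^sup>2) * fact n * (pi / \<alpha>) ^ (n - 1)) = K * fact n * (1 / \<alpha>\<^sup>2 * (1 / (4 * pi * \<alpha>)) ^ (n - 1) * fact n)"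
  proof -
    \<comment> \<open>Here 4 pi arises: the slope pi of the lattice sum against 4 pi^2 from the
      kernel.\<close>
    have base: "pi / \<alpha> / (4 * pi\<^sup>2) = 1 / (4 * pi * \<alpha>)" by (simp add: power2_eq_square)
    have key: "(pi / \<alpha>) ^ (n - 1) / (4 * pi\<^sup>2) ^ (n - 1) = (1 / (4 * pi * \<alpha>)) ^ (n - 1)"
      unfolding base[symmetric] by (rule power_divide[symmetric])
    show ?thesis unfolding chaos_const_eq[OF n] key[symmetric] by (simp add: mult_ac)
  qed
  have "chaos_const n * conv_lim n ?b \<le> chaos_const n * (K * (1 / \<alpha>\<^sup>2) * fact n * (pi / \<alpha>) ^ (n - 1))"
    using V chaos_const_pos[of n] by (intro mult_left_mono) auto
  also have "\<dots> \<le> C\<^sup>2 * fact n * (1 / \<alpha>\<^sup>2 * ((1 + \<epsilon>) / (4 * pi * \<alpha>)) ^ (n - 1) * fact n + C ^ n * ((1 + \<epsilon>) / \<epsilon>) ^ (n - 1))"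
    unfolding eq
  proof (intro mult_mono KC order_refl)
    have "(1 / (4 * pi * \<alpha>)) ^ (n - 1) \<le> ((1 + \<epsilon>) / (4 * pi * \<alpha>)) ^ (n - 1)"
      using \<alpha> \<epsilon> by (intro power_mono divide_right_mono) auto
    then have "1 / \<alpha>\<^sup>2 * (1 / (4 * pi * \<alpha>)) ^ (n - 1) * fact n \<le> 1 / \<alpha>\<^sup>2 * ((1 + \<epsilon>) / (4 * pi * \<alpha>)) ^ (n - 1) * fact n"
      by (intro mult_right_mono mult_left_mono) auto
    moreover have "0 \<le> C ^ n * ((1 + \<epsilon>) / \<epsilon>) ^ (n - 1)" using C1 \<epsilon> by auto
    ultimately show "1 / \<alpha>\<^sup>2 * (1 / (4 * pi * \<alpha>)) ^ (n - 1) * fact n \<le> 1 / \<alpha>\<^sup>2 * ((1 + \<epsilon>) / (4 * pi * \<alpha>)) ^ (n - 1) * fact n + C ^ n * ((1 + \<epsilon>) / \<epsilon>) ^ (n - 1)"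
      by linarith
  qed (use \<alpha> in auto)
  finally have "sqrt (chaos_const n * conv_lim n ?b) \<le> sqrt (C\<^sup>2 * fact n * (1 / \<alpha>\<^sup>2 * ((1 + \<epsilon>) / (4 * pi * \<alpha>)) ^ (n - 1) * fact n + C ^ n * ((1 + \<epsilon>) / \<epsilon>) ^ (n - 1)))"
    by (rule real_sqrt_le_mono)
  then have "(p - 1) powr (real n / 2) * sqrt (chaos_const n * conv_lim n ?b) \<le> wick_bound C n p \<alpha> \<epsilon>"
    using C1 unfolding wick_bound_def real_sqrt_mult
    by (simp add: mult_left_mono mult.assoc mult.left_commute[of C])
  moreover have "LpS_norm M p (- \<alpha>) (wick_power n) \<le> (p - 1) powr (real n / 2) * sqrt (chaos_const n * conv_lim n ?b)"
    by (rule LpS_norm_le[OF sobolev_wick_power[OF p \<alpha>(1)]]) (use p in simp)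
  ultimately show ?thesis by linarith
qed

text \<open>The norms decrease as \<alpha> grows, so the value at 1/2 controls all of them. The
  first summand of the bound can be tiny for large \<alpha>, whereas the second is at least 1
  because C >= 1; with \<open>C\<close> depending on n, it absorbs everything.\<close>

lemma wick_power_norm_large:
  assumes p: "2 \<le> p" and \<alpha>: "1 / 2 \<le> \<alpha>" and \<epsilon>: "\<epsilon> > 0"
    and C: "C \<ge> 1 + chaos_const n * conv_lim n (sobolev_wt (1 / 2))"
  shows "LpS_norm M p (- \<alpha>) (wick_power n) \<le> wick_bound C n p \<alpha> \<epsilon>"
proof -
  let ?b = "\<lambda>k. japanese k powr (- \<alpha>)" and ?h = "\<lambda>k. japanese k powr (- (1 / 2))"
  have a0: "0 < \<alpha>" using \<alpha> by simp
  have hb: "conv_bdd n ?h" by (rule conv_bdd_sobolev) simp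
  define V where "V = chaos_const n * conv_lim n ?h"
  have "conv_lim n ?b \<le> conv_lim n ?h"
  proof (rule conv_lim_le)
    fix F :: "(int \<times> int) set" assume F: "finite F"
    have "conv_sum n F ?b \<le> conv_sum n F ?h"
      using \<alpha> japanese_ge1 by (intro conv_sum_mono_weight powr_mono) auto
    also have "\<dots> \<le> conv_lim n ?h" by (rule conv_lim_upper[OF hb F])
    finally show "conv_sum n F ?b \<le> conv_lim n ?h" .
  qed
  then have bV: "chaos_const n * conv_lim n ?b \<le> V"
    unfolding V_def using chaos_const_pos[of n] by (intro mult_left_mono) auto
  have "0 \<le> conv_lim n ?h"
    using conv_lim_upper[OF hb, of "{}"] conv_sum_nonneg[of ?h n "{}"] by simp
  then have V0: "0 \<le> V" using chaos_const_pos[of n] by (simp add: V_def)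
  have C1: "C \<ge> 1" "V \<le> C" using C V0 by (auto simp: V_def)
  have "V \<le> C * 1" using C1 by simp
  also have "\<dots> \<le> C * C" using C1 by (intro mult_left_mono) auto
  finally have VC: "V \<le> C\<^sup>2" by (simp add: power2_eq_square)
  have X1: "1 \<le> C ^ n * ((1 + \<epsilon>) / \<epsilon>) ^ (n - 1)"
  proof -
    have "1 * 1 \<le> C ^ n * ((1 + \<epsilon>) / \<epsilon>) ^ (n - 1)"
      using C1 \<epsilon> by (intro mult_mono one_le_power) auto
    then show ?thesis by simp
  qed
  define X where "X = 1 / \<alpha>\<^sup>2 * ((1 + \<epsilon>) / (4 * pi * \<alpha>)) ^ (n - 1) * fact n + C ^ n * ((1 + \<epsilon>) / \<epsilon>) ^ (n - 1)"
  have X: "1 \<le> X"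
  proof -
    have "0 \<le> 1 / \<alpha>\<^sup>2 * ((1 + \<epsilon>) / (4 * pi * \<alpha>)) ^ (n - 1) * fact n" using a0 \<epsilon> by auto
    then show ?thesis using X1 by (simp add: X_def)
  qed
  have "1 * 1 \<le> fact n * X" using X by (intro mult_mono fact_ge_1) auto
  then have "C\<^sup>2 * 1 \<le> C\<^sup>2 * (fact n * X)" by (intro mult_left_mono) auto
  then have "chaos_const n * conv_lim n ?b \<le> C\<^sup>2 * (fact n * X)" using bV VC by linarith
  then have "sqrt (chaos_const n * conv_lim n ?b) \<le> sqrt (C\<^sup>2 * (fact n * X))" by (rule real_sqrt_le_mono)
  then have "(p - 1) powr (real n / 2) * sqrt (chaos_const n * conv_lim n ?b) \<le> wick_bound C n p \<alpha> \<epsilon>"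
    using C1 unfolding wick_bound_def X_def[symmetric] real_sqrt_mult
    by (simp add: mult_left_mono mult.assoc mult.left_commute[of C])
  moreover have "LpS_norm M p (- \<alpha>) (wick_power n) \<le> (p - 1) powr (real n / 2) * sqrt (chaos_const n * conv_lim n ?b)"
    by (rule LpS_norm_le[OF sobolev_wick_power[OF p a0]]) (use p in simp)
  ultimately show ?thesis by linarith
qed

text \<open>By Bessel the squared coefficients of \<open>g\<close> are a weight of total mass at
  most the squared norm of \<open>g\<close>. The lattice bound then has rate 1, and its constant is
  free of n.\<close>

lemma Psi_norm_bound:
  assumes n: "n \<ge> 1" and p: "2 \<le> p" and \<epsilon>: "\<epsilon> > 0" and g: "g \<in> H_space"
  shows "Lp_norm M p (Psi n g) \<le> wick_pairing_bound (lat_const) n p \<epsilon> * H_norm g"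
proof -
  define C where "C = lat_const"
  have "0 \<le> (5 + 3 * pi) / pi" by (intro divide_nonneg_nonneg add_nonneg_nonneg) auto
  then have C1: "1 \<le> C" unfolding C_def by (rule one_le_exp_iff[THEN iffD2])
  then have CC: "C \<le> C\<^sup>2" using mult_left_mono[of 1 C C] by (simp add: power2_eq_square)
  note gn = H_norm_power2(2)[OF g]
  define X where "X = ((1 + \<epsilon>) / (4 * pi)) ^ (n - 1) * fact n + C ^ n * ((1 + \<epsilon>) / \<epsilon>) ^ (n - 1)"
  have "conv_lim n (wsq g) \<le> (H_norm g)\<^sup>2 * C * fact n * pi ^ (n - 1)"
    unfolding C_def by (rule conv_lim_H_bound[OF Bessel[OF g]]) auto
  then have "chaos_const n * conv_lim n (wsq g) \<le> chaos_const n * ((H_norm g)\<^sup>2 * C * fact n * pi ^ (n - 1))"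
    using chaos_const_pos[of n] by (intro mult_left_mono) auto
  also have "\<dots> = C * fact n * ((1 / (4 * pi)) ^ (n - 1) * fact n) * (H_norm g)\<^sup>2"
  proof -
    have base: "pi / (4 * pi\<^sup>2) = 1 / (4 * pi)" by (simp add: power2_eq_square)
    have key: "pi ^ (n - 1) / (4 * pi\<^sup>2) ^ (n - 1) = (1 / (4 * pi)) ^ (n - 1)"
      unfolding base[symmetric] by (rule power_divide[symmetric])
    show ?thesis unfolding chaos_const_eq[OF n] key[symmetric] by (simp add: mult_ac)
  qed
  also have "\<dots> \<le> C\<^sup>2 * fact n * X * (H_norm g)\<^sup>2"
  proof (intro mult_right_mono mult_mono CC)
    have "(1 / (4 * pi)) ^ (n - 1) \<le> ((1 + \<epsilon>) / (4 * pi)) ^ (n - 1)"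
      using \<epsilon> by (intro power_mono divide_right_mono) auto
    then have "(1 / (4 * pi)) ^ (n - 1) * fact n \<le> ((1 + \<epsilon>) / (4 * pi)) ^ (n - 1) * fact n" by (intro mult_right_mono) auto
    moreover have "0 \<le> C ^ n * ((1 + \<epsilon>) / \<epsilon>) ^ (n - 1)" using C1 \<epsilon> by auto
    ultimately show "(1 / (4 * pi)) ^ (n - 1) * fact n \<le> X" unfolding X_def by linarith
  qed auto
  finally have "sqrt (chaos_const n * conv_lim n (wsq g)) \<le> sqrt (C\<^sup>2 * fact n * X * (H_norm g)\<^sup>2)" by (rule real_sqrt_le_mono)
  also have "\<dots> = C * sqrt (fact n) * sqrt X * H_norm g"
    using C1 gn by (simp add: real_sqrt_mult)
  finally have "(p - 1) powr (real n / 2) * sqrt (chaos_const n * conv_lim n (wsq g)) \<le> (p - 1) powr (real n / 2) * (C * sqrt (fact n) * sqrt X * H_norm g)"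
    by (intro mult_left_mono) auto
  also have "\<dots> = wick_pairing_bound C n p \<epsilon> * H_norm g"
    unfolding wick_pairing_bound_def X_def by (simp add: mult_ac)
  finally have "(p - 1) powr (real n / 2) * sqrt (chaos_const n * conv_lim n (wsq g)) \<le> wick_pairing_bound C n p \<epsilon> * H_norm g" .
  moreover have "Lp_norm M p (Psi n g) \<le> (p - 1) powr (real n / 2) * sqrt (chaos_const n * conv_lim n (wsq g))"
    by (rule Lp_bounded_imp(2)[OF Psi_Lp_bounded[OF g p]]) (use p in simp)
  ultimately show ?thesis unfolding C_def by linarith
qed

section \<open>Convergence along the dilates\<close>

lemma Phi_approx_Phi:
  assumes "admissible \<Lambda>"
  shows "Phi_approx n (dilate N \<Lambda>) z = Phi n (lat_pts N \<Lambda>) z"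
  by (rule ext) (rule Phi_approx_eq[OF admissible_lattice(1)[OF assms]])

lemma LpS_Cauchy:
  assumes adm: "admissible \<Lambda>" and p: "1 \<le> p" and \<alpha>: "\<alpha> > 0" and \<eta>: "\<eta> > 0"
  shows "\<exists>N\<^sub>0. \<forall>N\<ge>N\<^sub>0. \<forall>N'\<ge>N\<^sub>0. LpS_dist M p (- \<alpha>) (\<lambda>z. fourier_coeffs (Phi_approx n (dilate N \<Lambda>) z)) (\<lambda>z. fourier_coeffs (Phi_approx n (dilate N' \<Lambda>) z)) < \<eta>"
proof -
  obtain r where r: "sob_err n (max p 2) \<alpha> r < \<eta>" and ev: "eventually (\<lambda>N. lat_box r \<subseteq> (lat_pts N \<Lambda>)) sequentially"
    by (rule sob_err_eventually[OF \<alpha> adm \<eta>])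
  obtain N0 where N0: "\<And>N. N \<ge> N0 \<Longrightarrow> lat_box r \<subseteq> (lat_pts N \<Lambda>)"
    using ev unfolding eventually_sequentially by blast
  show ?thesis
  proof (intro exI[of _ N0] allI impI)
    fix N N' assume N: "N0 \<le> N" "N0 \<le> N'"
    have "Lp_bounded M (max p 2) (\<lambda>z. sobolev_norm (- \<alpha>) (\<lambda>k. fourier_coeffs (Phi n (lat_pts N \<Lambda>) z) k - fourier_coeffs (Phi n (lat_pts N' \<Lambda>) z) k)) (sob_err n (max p 2) \<alpha> r)"
      using N by (intro sobolev_Phi_diff admissible_lattice(1)[OF adm] N0 \<alpha>) auto
    then have "LpS_norm M p (- \<alpha>) (\<lambda>z k. fourier_coeffs (Phi n (lat_pts N \<Lambda>) z) k - fourier_coeffs (Phi n (lat_pts N' \<Lambda>) z) k) \<le> sob_err n (max p 2) \<alpha> r"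
      by (rule LpS_norm_le[OF Lp_bounded_max2[OF _ p]]) (use p in simp)
    then show "LpS_dist M p (- \<alpha>) (\<lambda>z. fourier_coeffs (Phi_approx n (dilate N \<Lambda>) z)) (\<lambda>z. fourier_coeffs (Phi_approx n (dilate N' \<Lambda>) z)) < \<eta>"
      unfolding LpS_dist_def Phi_approx_Phi[OF adm] using r by linarith
  qed
qed

lemma LpS_limit:
  assumes adm: "admissible \<Lambda>" and p: "1 \<le> p" and \<alpha>: "\<alpha> > 0"
  shows "(\<lambda>N. LpS_dist M p (- \<alpha>) (\<lambda>z. fourier_coeffs (Phi_approx n (dilate N \<Lambda>) z)) (wick_power n)) \<longlonglongrightarrow> 0"
proof (rule order_tendstoI)
  have nn: "0 \<le> LpS_dist M p (- \<alpha>) F G" for F G by (simp add: LpS_dist_def LpS_norm_def Lp_norm_def)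
  fix a :: real
  show "a < 0 \<Longrightarrow> eventually (\<lambda>N. a < LpS_dist M p (- \<alpha>) (\<lambda>z. fourier_coeffs (Phi_approx n (dilate N \<Lambda>) z)) (wick_power n)) sequentially"
    using nn by (intro always_eventually) (auto intro: less_le_trans)
  assume "0 < a"
  then obtain r where r: "sob_err n (max p 2) \<alpha> r < a" and ev: "eventually (\<lambda>N. lat_box r \<subseteq> (lat_pts N \<Lambda>)) sequentially"
    by (rule sob_err_eventually[OF \<alpha> adm])
  show "eventually (\<lambda>N. LpS_dist M p (- \<alpha>) (\<lambda>z. fourier_coeffs (Phi_approx n (dilate N \<Lambda>) z)) (wick_power n) < a) sequentially"
    using ev
  proof eventually_elim
    case (elim N)
    have "Lp_bounded M (max p 2) (\<lambda>z. sobolev_norm (- \<alpha>) (\<lambda>k. fourier_coeffs (Phi n (lat_pts N \<Lambda>) z) k - wick_power n z k)) (sob_err n (max p 2) \<alpha> r)"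
      by (intro sobolev_Phi_wick_power admissible_lattice(1)[OF adm] elim \<alpha>) auto
    then have "LpS_norm M p (- \<alpha>) (\<lambda>z k. fourier_coeffs (Phi n (lat_pts N \<Lambda>) z) k - wick_power n z k) \<le> sob_err n (max p 2) \<alpha> r"
      by (rule LpS_norm_le[OF Lp_bounded_max2[OF _ p]]) (use p in simp)
    then show ?case unfolding LpS_dist_def Phi_approx_Phi[OF adm] using r by linarith
  qed
qed

lemma Lp_limit:
  assumes adm: "admissible \<Lambda>" and p: "1 \<le> p" and g: "g \<in> H_space"
  shows "(\<lambda>N. Lp_norm M p (\<lambda>z. H_inner (Phi_approx n (dilate N \<Lambda>) z) g - Psi n g z)) \<longlonglongrightarrow> 0"
proof (rule order_tendstoI)
  have nn: "0 \<le> Lp_norm M p X" for X by (simp add: Lp_norm_def)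
  fix a :: real
  show "a < 0 \<Longrightarrow> eventually (\<lambda>N. a < Lp_norm M p (\<lambda>z. H_inner (Phi_approx n (dilate N \<Lambda>) z) g - Psi n g z)) sequentially"
    using nn by (intro always_eventually) (auto intro: less_le_trans)
  assume a: "0 < a"
  let ?q = "max p 2"
  define E where "E r = tail_err ?q n (wsq g) r" for r
  have "E \<longlonglongrightarrow> 0" unfolding E_def[abs_def] by (rule err_tendsto[OF conv_bdd_H[OF g]])
  then have "eventually (\<lambda>r. E r < a) sequentially" using a by (intro order_tendstoD(2)) auto
  then obtain r where r: "E r < a" using eventually_happens' sequentially_bot by blast
  show "eventually (\<lambda>N. Lp_norm M p (\<lambda>z. H_inner (Phi_approx n (dilate N \<Lambda>) z) g - Psi n g z) < a) sequentially"
    using admissible_lattice(2)[OF adm, of r]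
  proof eventually_elim
    case (elim N)
    have "Lp_bounded M ?q (\<lambda>z. H_inner (Phi n (lat_pts N \<Lambda>) z) g - Psi n g z) (E r)"
      unfolding E_def by (intro Phi_Psi_Lp_bounded g admissible_lattice(1)[OF adm] elim) auto
    then have "Lp_norm M p (\<lambda>z. H_inner (Phi n (lat_pts N \<Lambda>) z) g - Psi n g z) \<le> E r"
      by (rule Lp_bounded_imp(2)[OF Lp_bounded_max2[OF _ p]]) (use p in simp)
    then show ?case unfolding Phi_approx_Phi[OF adm] using r by linarith
  qed
qed

lemma wick_power_LpS:
  assumes p: "1 \<le> p" and \<alpha>: "\<alpha> > 0" shows "wick_power n \<in> LpS_space M p (- \<alpha>)"
proof (rule LpS_of_bounded)
  show "Lp_bounded M p (\<lambda>z. sobolev_norm (- \<alpha>) (wick_power n z)) ((max p 2 - 1) powr (real n / 2) * sqrt (chaos_const n * conv_lim n (sobolev_wt \<alpha>)))"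
    by (rule Lp_bounded_max2[OF sobolev_wick_power[OF _ \<alpha>] p]) simp
qed (use p wick_power_sobolev[OF \<alpha>] in auto)

lemma Psi_Lp:
  assumes "1 \<le> p" "g \<in> H_space" shows "Psi n g \<in> Lp_space M p"
proof (rule Lp_bounded_imp(1))
  show "Lp_bounded M p (Psi n g) ((max p 2 - 1) powr (real n / 2) * sqrt (chaos_const n * conv_lim n (wsq g)))"
    by (rule Lp_bounded_max2[OF Psi_Lp_bounded[OF assms(2)] assms(1)]) simp
qed (use assms in auto)

lemma Phi_approx_Lp:
  assumes adm: "admissible \<Lambda>" and "1 \<le> p" "g \<in> H_space"
  shows "(\<lambda>z. H_inner (Phi_approx n (dilate N \<Lambda>) z) g) \<in> Lp_space M p"
  unfolding Phi_approx_Phi[OF adm]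
proof (rule Lp_bounded_imp(1))
  show "Lp_bounded M p (\<lambda>z. H_inner (Phi n (lat_pts N \<Lambda>) z) g) ((max p 2 - 1) powr (real n / 2) * sqrt (chaos_const n * conv_sum n (lat_pts N \<Lambda>) (wsq g)))"
    by (rule Lp_bounded_max2[OF Phi_Lp_bounded[OF admissible_lattice(1)[OF adm] assms(3)] assms(2)]) simp
qed (use assms in auto)

end

theorem proposition3p1:
  fixes \<delta> :: real and \<mu>\<^sub>0 :: "dist_coeffs measure"
  assumes "\<delta> > 0" and "free_field \<delta> \<mu>\<^sub>0"
  shows
    "(\<forall>\<Lambda> n p \<alpha>. admissible \<Lambda> \<and> p \<ge> 1 \<and> \<alpha> > 0 \<longrightarrow>
        (\<forall>N\<ge>1. (\<lambda>z. fourier_coeffs (Phi_approx n (dilate N \<Lambda>) z)) \<in> LpS_space \<mu>\<^sub>0 p (- \<alpha>)) \<and>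
        (\<forall>\<eta>>0. \<exists>N\<^sub>0. \<forall>N\<ge>N\<^sub>0. \<forall>N'\<ge>N\<^sub>0.
           LpS_dist \<mu>\<^sub>0 p (- \<alpha>) (\<lambda>z. fourier_coeffs (Phi_approx n (dilate N \<Lambda>) z))
                               (\<lambda>z. fourier_coeffs (Phi_approx n (dilate N' \<Lambda>) z)) < \<eta>)) \<and>
     (\<exists>(\<Phi> :: nat \<Rightarrow> dist_coeffs \<Rightarrow> dist_coeffs)
       (\<Psi> :: nat \<Rightarrow> (real \<times> real \<Rightarrow> real) \<Rightarrow> dist_coeffs \<Rightarrow> real).
        (\<forall>n p \<alpha>. p \<ge> 1 \<and> \<alpha> > 0 \<longrightarrow>
           \<Phi> n \<in> LpS_space \<mu>\<^sub>0 p (- \<alpha>) \<and>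
           (\<forall>\<Lambda>. admissible \<Lambda> \<longrightarrow>
              (\<lambda>N. LpS_dist \<mu>\<^sub>0 p (- \<alpha>) (\<lambda>z. fourier_coeffs (Phi_approx n (dilate N \<Lambda>) z)) (\<Phi> n))
                \<longlonglongrightarrow> 0)) \<and>
        (\<forall>n\<ge>1. \<exists>C>0. \<forall>p\<ge>2. \<forall>\<alpha>>0. \<forall>\<epsilon>>0.
           LpS_norm \<mu>\<^sub>0 p (- \<alpha>) (\<Phi> n) \<le> wick_bound C n p \<alpha> \<epsilon>) \<and>
        (\<forall>\<alpha>\<^sub>0<1. \<exists>C>0. \<forall>n\<ge>1. \<forall>p\<ge>2. \<forall>\<alpha>>0. \<forall>\<epsilon>>0. \<alpha> \<le> \<alpha>\<^sub>0 \<longrightarrow>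
           LpS_norm \<mu>\<^sub>0 p (- \<alpha>) (\<Phi> n) \<le> wick_bound C n p \<alpha> \<epsilon>) \<and>
        (\<forall>n. \<forall>g \<in> H_space.
           (\<forall>p\<ge>1.
              \<Psi> n g \<in> Lp_space \<mu>\<^sub>0 p \<and>
              (\<forall>\<Lambda>. admissible \<Lambda> \<longrightarrow>
                 (\<forall>N\<ge>1. (\<lambda>z. H_inner (Phi_approx n (dilate N \<Lambda>) z) g) \<in> Lp_space \<mu>\<^sub>0 p) \<and>
                 (\<lambda>N. Lp_norm \<mu>\<^sub>0 p (\<lambda>z. H_inner (Phi_approx n (dilate N \<Lambda>) z) g - \<Psi> n g z))
                   \<longlonglongrightarrow> 0)) \<and>
           \<Psi> n g \<in> chaos \<delta> \<mu>\<^sub>0 n) \<and>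
        (\<exists>C>0. \<forall>n\<ge>1. \<forall>p\<ge>2. \<forall>\<epsilon>>0. \<forall>g \<in> H_space.
           Lp_norm \<mu>\<^sub>0 p (\<Psi> n g) \<le> wick_pairing_bound C n p \<epsilon> * H_norm g) \<and>
        (\<forall>n. \<forall>\<alpha>>0. \<forall>g \<in> H_space. fourier_coeffs g \<in> sobolev \<alpha> \<longrightarrow>
           (AE z in \<mu>\<^sub>0. \<Psi> n g z = dual_pairing (\<Phi> n z) (fourier_coeffs g))))"
proof -
  interpret prob_space \<mu>\<^sub>0 using assms(2) by (simp add: free_field_def)
  interpret free_field_measure \<delta> \<mu>\<^sub>0 by unfold_locales (use assms in auto)
  \<comment> \<open>\<open>C\<close> is chosen before n; it grows without bound as
    \<open>\<alpha>\<^sub>0\<close> approaches 1.\<close>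
  have uniform: "\<exists>C>0. \<forall>n\<ge>1. \<forall>p\<ge>2. \<forall>\<alpha>>0. \<forall>\<epsilon>>0. \<alpha> \<le> \<alpha>\<^sub>0 \<longrightarrow> LpS_norm \<mu>\<^sub>0 p (- \<alpha>) (wick_power n) \<le> wick_bound C n p \<alpha> \<epsilon>"
    if "\<alpha>\<^sub>0 < 1" for \<alpha>\<^sub>0
  proof (intro exI[of _ "1 + 54 / (1 - \<alpha>\<^sub>0) * lat_const"] conjI allI impI)
    show "0 < 1 + 54 / (1 - \<alpha>\<^sub>0) * lat_const" using that by (intro add_pos_nonneg) auto
  qed (use that in \<open>auto intro!: wick_power_norm_small\<close>)
  \<comment> \<open>The case distinction at \<alpha> = 1/2 joins the two regimes. The constant is
    the sum of what they require, and its part \<open>V\<close> depends on n.\<close>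
  have each: "\<exists>C>0. \<forall>p\<ge>2. \<forall>\<alpha>>0. \<forall>\<epsilon>>0. LpS_norm \<mu>\<^sub>0 p (- \<alpha>) (wick_power n) \<le> wick_bound C n p \<alpha> \<epsilon>" if n: "n \<ge> 1" for n
  proof -
    define V where "V = chaos_const n * conv_lim n (sobolev_wt (1 / 2))"
    define K where "K = 54 / (1 - 1 / 2) * lat_const"
    have K0: "0 \<le> K" by (simp add: K_def)
    have "0 \<le> conv_lim n (sobolev_wt (1 / 2))"
      using conv_lim_upper[OF conv_bdd_sobolev, of "1 / 2" "{}" n] conv_sum_nonneg[of "\<lambda>k. japanese k powr (- (1 / 2))" n "{}"] by simp
    then have V0: "0 \<le> V" using chaos_const_pos[of n] by (simp add: V_def)
    show ?thesis
    proof (intro exI[of _ "1 + K + V"] conjI allI impI)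
      show "0 < 1 + K + V" using K0 V0 by simp
      fix p \<alpha> \<epsilon> :: real assume "2 \<le> p" "0 < \<alpha>" "0 < \<epsilon>"
      then show "LpS_norm \<mu>\<^sub>0 p (- \<alpha>) (wick_power n) \<le> wick_bound (1 + K + V) n p \<alpha> \<epsilon>"
      proof (cases "\<alpha> \<le> 1 / 2")
        case True
        then show ?thesis using \<open>2 \<le> p\<close> \<open>0 < \<alpha>\<close> \<open>0 < \<epsilon>\<close> V0 n
          by (intro wick_power_norm_small[where \<alpha>\<^sub>0 = "1 / 2"]) (auto simp: K_def)
      next
        case False
        then show ?thesis using \<open>2 \<le> p\<close> \<open>0 < \<epsilon>\<close> K0
          by (intro wick_power_norm_large) (auto simp: V_def)
      qed
    qed
  qed
  have pairing: "\<exists>C>0. \<forall>n\<ge>1. \<forall>p\<ge>2. \<forall>\<epsilon>>0. \<forall>g \<in> H_space. Lp_norm \<mu>\<^sub>0 p (Psi n g) \<le> wick_pairing_bound C n p \<epsilon> * H_norm g"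
    by (intro exI[of _ "lat_const"] conjI allI impI ballI Psi_norm_bound) auto
  have members: "(\<lambda>z. fourier_coeffs (Phi_approx n (dilate N \<Lambda>) z)) \<in> LpS_space \<mu>\<^sub>0 p (- \<alpha>)"
    if "admissible \<Lambda>" "1 \<le> p" "0 < \<alpha>" for \<Lambda> n p \<alpha> N
    unfolding Phi_approx_Phi[OF that(1)] by (rule Phi_LpS[OF admissible_lattice(1)[OF that(1)] that(2,3)])
  show ?thesis
  proof (intro conjI allI impI ballI exI[of _ wick_power] exI[of _ Psi])
  qed (assumption | rule members LpS_Cauchy wick_power_LpS LpS_limit each uniform Psi_Lp Phi_approx_Lp
        Lp_limit Psi_chaos pairing AE_Psi_dual_pairing | elim conjE)+
qed

end
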